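(* Let $(M,g_M)$ and $(N,g_N)$ be Riemannian manifolds and $p\in[1,\infty)$. Let $d$ be a distance on $T^*M\otimes TN$ and for $u,v\in\dot W^{1,p}(M,N)$ let $$\delta_{1,p}(u,v)=\Bigl(\int_M d(Du,Dv)^p\Bigr)^{1/p}\in[0,\infty].$$ If for almost every $x\in M$ the metric space $(\{x\}\times N,d)$ is complete and $d$ is concordant with $|\cdot|_{g_M^*\otimes g_N}$, then the Sobolev space $(\dot W^{1,p}(M,N),\delta_{1,p})$ is complete.
   Context: Manifolds are Hausdorff and have a countable basis; measure-theoretic notions on $M$ are defined via local charts. A map $u\colon M\to N$ is colocally weakly differentiable if $u$ is measurable and $f\circ u$ is weakly differentiable for every $f\in C^1_c(N,\mathbb{R})$. Its colocal weak derivative is the (existing and almost everywhere unique) measurable bundle morphism $Du\colon TM\to TN$ covering $u$ such that for every $f\in C^1_c(N,\mathbb{R})$, $D(f\circ u)=Df\circ Du$ almost everywhere in $M$. For linear $\xi\colon T_xM\to T_yN$, $|\xi|_{g_M^*\otimes g_N}^2=\sum_i g_N(\xi(e_i),\xi(e_i))$ with $(e_i)$ a $g_M$-orthonormal basis of $T_xM$. $\dot W^{1,p}(M,N)$ is the set of (almost everywhere classes of) colocally weakly differentiable $u\colon M\to N$ with $|Du|_{g_M^*\otimes g_N}\in L^p(M)$; integrals are with respect to the Riemannian measure of $M$. $E=T^*M\otimes TN$ is the vector bundle over $M\times N$, with projection $\pi_{M\times N}$, whose fiber over $(x,y)$ is $\mathcal{L}(T_xM,T_yN)$; $M\times N$ is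 identified with its zero section. A continuous distance $d$ on $E$ (one inducing the topology of $E$) is concordant with $|\cdot|_{g_M^*\otimes g_N}$ if (a) $d(\pi_{M\times N}(e_1),\pi_{M\times N}(e_2))\le d(e_1,e_2)$ for all $e_1,e_2\in E$; (b) there is $\kappa>0$ with $\kappa^{-1}|e|_{g_M^*\otimes g_N}\le d(e,\pi_{M\times N}(e))\le\kappa|e|_{g_M^*\otimes g_N}$ for all $e\in E$. Notation: $d(Du,Dv)(x)=d(Du(x),Dv(x))$. The distance $\delta_{1,p}$ may take the value $\infty$; completeness means that every Cauchy sequence converges. *)

theory Defs
  imports "HOL-Analysis.Analysis"
begin

text \<open>
  The underlying set of a manifold is a whole type, Hausdorff and second countable through its type
  classes; the dimension is the cardinality of the index type of the model space \<open>real ^ 'm\<close>.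
  A chart is a pair \<open>(U, \<phi>)\<close> of a domain and a map; only the values of \<open>\<phi>\<close> on \<open>U\<close> matter.
  The class is \<open>C\<^sup>1\<close> (with continuous Riemannian metrics), so in particular smooth
  Riemannian manifolds are covered.
\<close>

type_synonym ('a, 'm) mchart = "'a set \<times> ('a \<Rightarrow> real ^ 'm)"

abbreviation dom_of :: "('a, 'm) mchart \<Rightarrow> 'a set"
  where "dom_of c \<equiv> fst c"

abbreviation map_of_chart :: "('a, 'm) mchart \<Rightarrow> 'a \<Rightarrow> real ^ 'm"
  where "map_of_chart c \<equiv> snd c"

definition chart_image :: "('a, 'm) mchart \<Rightarrow> (real ^ 'm) set"
  where "chart_image c = map_of_chart c ` dom_of c"

definition chart_inv :: "('a, 'm) mchart \<Rightarrow> real ^ 'm \<Rightarrow> 'a"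
  where "chart_inv c = inv_into (dom_of c) (map_of_chart c)"

definition C1_on ::
    "'v::real_normed_vector set \<Rightarrow> ('v \<Rightarrow> 'w::real_normed_vector) \<Rightarrow> bool"
  where "C1_on S f \<longleftrightarrow>
    (\<exists>f'. (\<forall>x\<in>S. (f has_derivative blinfun_apply (f' x)) (at x)) \<and> continuous_on S f')"

definition manifold_atlas ::
    "('a::{t2_space,second_countable_topology}, 'm::finite) mchart set \<Rightarrow> bool"
  where "manifold_atlas A \<longleftrightarrow>
    (\<Union>c\<in>A. dom_of c) = UNIV \<and>
    (\<forall>c\<in>A. open (dom_of c) \<and> open (chart_image c) \<and>
       homeomorphism (dom_of c) (chart_image c) (map_of_chart c) (chart_inv c)) \<and>
    (\<forall>c\<in>A. \<forall>c'\<in>A.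
       C1_on (map_of_chart c ` (dom_of c \<inter> dom_of c')) (map_of_chart c' \<circ> chart_inv c))"

text \<open>
  At every point \<open>x\<close> a chart of the atlas around \<open>x\<close> is selected, and \<open>T\<^sub>x M\<close> is \<open>real ^ 'm\<close>,
  a tangent vector being given by its components in the selected chart. Since the selected chart
  need not depend continuously on \<open>x\<close>, topologies and continuity on the associated bundles are never
  those of the product types: they always go through \<open>chart_diff\<close>, the differential
  \<open>T\<^sub>x M \<rightarrow> real ^ 'm\<close> of a chart at \<open>x\<close>, and its inverse \<open>chart_frame\<close>.
\<close>

definition chart_at :: "('a, 'm) mchart set \<Rightarrow> 'a \<Rightarrow> ('a, 'm) mchart"
  where "chart_at A x = (SOME c. c \<in> A \<and> x \<in> dom_of c)"

definition transition_deriv ::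
    "('a, 'm::finite) mchart \<Rightarrow> ('a, 'm) mchart \<Rightarrow> 'a \<Rightarrow> (real ^ 'm) \<Rightarrow>\<^sub>L (real ^ 'm)"
  where "transition_deriv c c' x =
    Blinfun (frechet_derivative (map_of_chart c' \<circ> chart_inv c) (at (map_of_chart c x)))"

definition chart_diff ::
    "('a, 'm::finite) mchart set \<Rightarrow> ('a, 'm) mchart \<Rightarrow> 'a \<Rightarrow> (real ^ 'm) \<Rightarrow>\<^sub>L (real ^ 'm)"
  where "chart_diff A c x = transition_deriv (chart_at A x) c x"

definition chart_frame ::
    "('a, 'm::finite) mchart set \<Rightarrow> ('a, 'm) mchart \<Rightarrow> 'a \<Rightarrow> (real ^ 'm) \<Rightarrow>\<^sub>L (real ^ 'm)"
  where "chart_frame A c x = transition_deriv c (chart_at A x) x"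

text \<open>\<open>g x\<close> is the scalar product on \<open>T\<^sub>x M\<close>.\<close>

type_synonym ('a, 'm) mmetric = "'a \<Rightarrow> real ^ 'm \<Rightarrow> real ^ 'm \<Rightarrow> real"

definition riemannian_manifold ::
    "('a::{t2_space,second_countable_topology}, 'm::finite) mchart set
      \<Rightarrow> ('a, 'm) mmetric \<Rightarrow> bool"
  where "riemannian_manifold A g \<longleftrightarrow>
    manifold_atlas A \<and>
    (\<forall>x. bilinear (g x) \<and> (\<forall>v w. g x v w = g x w v) \<and> (\<forall>v. v \<noteq> 0 \<longrightarrow> 0 < g x v v)) \<and>
    (\<forall>c\<in>A. \<forall>v w.
       continuous_on (dom_of c) (\<lambda>x. g x (chart_frame A c x v) (chart_frame A c x w)))"

definition lebesgue_sets :: "('a, 'm::finite) mchart set \<Rightarrow> 'a set set"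
  where "lebesgue_sets A =
    {X. \<forall>c\<in>A. map_of_chart c ` (X \<inter> dom_of c) \<in> sets lebesgue}"

definition manifold_sigma :: "('a, 'm::finite) mchart set \<Rightarrow> 'a measure"
  where "manifold_sigma A = sigma UNIV (lebesgue_sets A)"

definition volume_density ::
    "('a, 'm::finite) mchart set \<Rightarrow> ('a, 'm) mmetric \<Rightarrow> ('a, 'm) mchart \<Rightarrow> 'a \<Rightarrow> real"
  where "volume_density A g c x =
    sqrt (det (\<chi> i j. g x (chart_frame A c x (axis i 1)) (chart_frame A c x (axis j 1))))"

text \<open>
  The measure is \<open>sqrt (det g) dx\<close> in every chart. To make this a global definition, the manifold is
  cut into the disjoint pieces \<open>disjointed (\<lambda>i. dom_of (C i)) i\<close> obtained from a countable family
  of charts covering it (one exists by second countability); by the change of variables formula the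
  result does not depend on that family.
\<close>

definition countable_chart_cover :: "('a, 'm) mchart set \<Rightarrow> nat \<Rightarrow> ('a, 'm) mchart"
  where "countable_chart_cover A = (SOME C. range C \<subseteq> A \<and> (\<Union>i. dom_of (C i)) = UNIV)"

definition riemannian_measure ::
    "('a, 'm::finite) mchart set \<Rightarrow> ('a, 'm) mmetric \<Rightarrow> 'a measure"
  where "riemannian_measure A g =
    (let C = countable_chart_cover A in
     measure_of UNIV (lebesgue_sets A) (\<lambda>X. \<Sum>i.
       \<integral>\<^sup>+z. ennreal (volume_density A g (C i) (chart_inv (C i) z)) *
            indicator (map_of_chart (C i) ` (X \<inter> disjointed (\<lambda>j. dom_of (C j)) i)) z
       \<partial>lebesgue))"

definition compact_support :: "('v::topological_space \<Rightarrow> real) \<Rightarrow> bool"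
  where "compact_support f \<longleftrightarrow> compact (closure {x. f x \<noteq> 0})"

definition locally_integrable_on ::
    "(real ^ 'm::finite) set \<Rightarrow> (real ^ 'm \<Rightarrow> real) \<Rightarrow> bool"
  where "locally_integrable_on V w \<longleftrightarrow>
    (\<forall>K. compact K \<and> K \<subseteq> V \<longrightarrow> set_integrable lebesgue K w)"

definition weak_derivative_on ::
    "(real ^ 'm::finite) set \<Rightarrow> (real ^ 'm \<Rightarrow> real) \<Rightarrow> (real ^ 'm \<Rightarrow> (real ^ 'm) \<Rightarrow>\<^sub>L real) \<Rightarrow> bool"
  where "weak_derivative_on V w W \<longleftrightarrow>
    locally_integrable_on V w \<and>
    (\<forall>v. locally_integrable_on V (\<lambda>z. W z v)) \<and>
    (\<forall>\<eta>. C1_on UNIV \<eta> \<and> compact_support \<eta> \<and> closure {z. \<eta> z \<noteq> 0} \<subseteq> V \<longrightarrow>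
      (\<forall>v. (LINT z:V|lebesgue. w z * frechet_derivative \<eta> (at z) v) =
           - (LINT z:V|lebesgue. W z v * \<eta> z)))"

text \<open>On a manifold the weak derivative is a section \<open>\<omega>\<close> of the cotangent bundle,
  \<open>\<omega> x\<close> being a linear form on \<open>T\<^sub>x M\<close>.\<close>

definition weak_derivative ::
    "('a, 'm::finite) mchart set \<Rightarrow> ('a \<Rightarrow> real) \<Rightarrow> ('a \<Rightarrow> (real ^ 'm) \<Rightarrow>\<^sub>L real) \<Rightarrow> bool"
  where "weak_derivative A w \<omega> \<longleftrightarrow>
    (\<forall>c\<in>A. weak_derivative_on (chart_image c) (w \<circ> chart_inv c)
      (\<lambda>z. \<omega> (chart_inv c z) o\<^sub>L chart_frame A c (chart_inv c z)))"

definition weakly_differentiable :: "('a, 'm::finite) mchart set \<Rightarrow> ('a \<Rightarrow> real) \<Rightarrow> bool"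
  where "weakly_differentiable A w \<longleftrightarrow> (\<exists>\<omega>. weak_derivative A w \<omega>)"

definition C1c :: "('b::topological_space, 'n::finite) mchart set \<Rightarrow> ('b \<Rightarrow> real) set"
  where "C1c B = {f. compact_support f \<and> (\<forall>c\<in>B. C1_on (chart_image c) (f \<circ> chart_inv c))}"

definition mdiff ::
    "('b, 'n::finite) mchart set \<Rightarrow> ('b \<Rightarrow> real) \<Rightarrow> 'b \<Rightarrow> (real ^ 'n) \<Rightarrow>\<^sub>L real"
  where "mdiff B f y = (let c = chart_at B y in
    Blinfun (frechet_derivative (f \<circ> chart_inv c) (at (map_of_chart c y))))"

definition colocally_weakly_differentiable ::
    "('a, 'm::finite) mchart set \<Rightarrow> ('b::topological_space, 'n::finite) mchart set
      \<Rightarrow> ('a \<Rightarrow> 'b) \<Rightarrow> bool"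
  where "colocally_weakly_differentiable A B u \<longleftrightarrow>
    u \<in> measurable (manifold_sigma A) borel \<and>
    (\<forall>f\<in>C1c B. weakly_differentiable A (f \<circ> u))"

text \<open>
  A point \<open>(x, y, \<xi>)\<close> of the bundle \<open>T\<^sup>*M \<otimes> TN\<close> over \<open>M \<times> N\<close> consists of its base point
  \<open>(x, y)\<close> and of \<open>\<xi> \<in> L(T\<^sub>x M, T\<^sub>y N)\<close>. The topology is the one of the vector bundle: the
  sets over a product of chart domains that are open in the local trivialization form a base.
\<close>

type_synonym ('a, 'm, 'b, 'n) hom_bundle = "'a \<times> 'b \<times> ((real ^ 'm) \<Rightarrow>\<^sub>L (real ^ 'n))"

fun hom_trivialization ::
    "('a, 'm::finite) mchart set \<Rightarrow> ('b, 'n::finite) mchart set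
      \<Rightarrow> ('a, 'm) mchart \<Rightarrow> ('b, 'n) mchart \<Rightarrow> ('a, 'm, 'b, 'n) hom_bundle
      \<Rightarrow> (real ^ 'm) \<times> (real ^ 'n) \<times> ((real ^ 'm) \<Rightarrow>\<^sub>L (real ^ 'n))"
  where "hom_trivialization A B c c' (x, y, \<xi>) =
    (map_of_chart c x, map_of_chart c' y, chart_diff B c' y o\<^sub>L \<xi> o\<^sub>L chart_frame A c x)"

definition hom_bundle_topology ::
    "('a, 'm::finite) mchart set \<Rightarrow> ('b, 'n::finite) mchart set
      \<Rightarrow> ('a, 'm, 'b, 'n) hom_bundle topology"
  where "hom_bundle_topology A B = topology_generated_by
    {{e. fst e \<in> dom_of c \<and> fst (snd e) \<in> dom_of c' \<and> hom_trivialization A B c c' e \<in> W}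
      | c c' W. c \<in> A \<and> c' \<in> B \<and> open W}"

text \<open>
  A bundle morphism \<open>TM \<rightarrow> TN\<close> covering \<open>u\<close> is given by its linear maps
  \<open>D x \<in> L(T\<^sub>x M, T\<^bsub>u x\<^esub> N)\<close>; it is measurable if \<open>x \<mapsto> (x, u x, D x)\<close> is a measurable map
  to \<open>T\<^sup>*M \<otimes> TN\<close> with its Borel sets. As weak derivatives are determined up to null sets,
  \<open>D (f \<circ> u) = D f \<circ> D u\<close> almost everywhere says that the right-hand side is a weak derivative
  of \<open>f \<circ> u\<close>.
\<close>

definition is_colocal_weak_derivative ::
    "('a, 'm::finite) mchart set \<Rightarrow> ('b::topological_space, 'n::finite) mchart set
      \<Rightarrow> ('a \<Rightarrow> 'b) \<Rightarrow> ('a \<Rightarrow> (real ^ 'm) \<Rightarrow>\<^sub>L (real ^ 'n)) \<Rightarrow> bool"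
  where "is_colocal_weak_derivative A B u D \<longleftrightarrow>
    (\<lambda>x. (x, u x, D x)) \<in>
      measurable (manifold_sigma A) (sigma UNIV {W. openin (hom_bundle_topology A B) W}) \<and>
    (\<forall>f\<in>C1c B. weak_derivative A (f \<circ> u) (\<lambda>x. mdiff B f (u x) o\<^sub>L D x))"

definition colocal_weak_derivative ::
    "('a, 'm::finite) mchart set \<Rightarrow> ('b::topological_space, 'n::finite) mchart set
      \<Rightarrow> ('a \<Rightarrow> 'b) \<Rightarrow> 'a \<Rightarrow> (real ^ 'm) \<Rightarrow>\<^sub>L (real ^ 'n)"
  where "colocal_weak_derivative A B u = (SOME D. is_colocal_weak_derivative A B u D)"

text \<open>The colocal weak derivative as a map from \<open>M\<close> to \<open>T\<^sup>*M \<otimes> TN\<close>.\<close>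

definition weak_tangent ::
    "('a, 'm::finite) mchart set \<Rightarrow> ('b::topological_space, 'n::finite) mchart set
      \<Rightarrow> ('a \<Rightarrow> 'b) \<Rightarrow> 'a \<Rightarrow> ('a, 'm, 'b, 'n) hom_bundle"
  where "weak_tangent A B u x = (x, u x, colocal_weak_derivative A B u x)"

text \<open>An orthonormal family indexed by \<open>'m\<close> is automatically a basis, and \<open>hom_norm\<close> does not
  depend on its choice.\<close>

definition orthonormal_basis :: "(real ^ 'm \<Rightarrow> real ^ 'm \<Rightarrow> real) \<Rightarrow> ('m::finite \<Rightarrow> real ^ 'm) \<Rightarrow> bool"
  where "orthonormal_basis h b \<longleftrightarrow> (\<forall>i j. h (b i) (b j) = (if i = j then 1 else 0))"

fun hom_norm ::
    "('a, 'm::finite) mmetric \<Rightarrow> ('b, 'n::finite) mmetric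
      \<Rightarrow> ('a, 'm, 'b, 'n) hom_bundle \<Rightarrow> real"
  where "hom_norm gM gN (x, y, \<xi>) =
    (let b = (SOME b. orthonormal_basis (gM x) b) in
     sqrt (\<Sum>i\<in>UNIV. gN y (\<xi> (b i)) (\<xi> (b i))))"

fun base_proj :: "('a, 'm::finite, 'b, 'n::finite) hom_bundle \<Rightarrow> ('a, 'm, 'b, 'n) hom_bundle"
  where "base_proj (x, y, \<xi>) = (x, y, 0)"

definition concordant ::
    "('a, 'm::finite) mchart set \<Rightarrow> ('a, 'm) mmetric
      \<Rightarrow> ('b, 'n::finite) mchart set \<Rightarrow> ('b, 'n) mmetric
      \<Rightarrow> (('a, 'm, 'b, 'n) hom_bundle \<Rightarrow> ('a, 'm, 'b, 'n) hom_bundle \<Rightarrow> real) \<Rightarrow> bool"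
  where "concordant A gM B gN d \<longleftrightarrow>
    Metric_space.mtopology UNIV d = hom_bundle_topology A B \<and>
    (\<forall>e1 e2. d (base_proj e1) (base_proj e2) \<le> d e1 e2) \<and>
    (\<exists>\<kappa>>0. \<forall>e. inverse \<kappa> * hom_norm gM gN e \<le> d e (base_proj e) \<and>
               d e (base_proj e) \<le> \<kappa> * hom_norm gM gN e)"

definition sobolev_maps ::
    "('a, 'm::finite) mchart set \<Rightarrow> ('a, 'm) mmetric
      \<Rightarrow> ('b::topological_space, 'n::finite) mchart set \<Rightarrow> ('b, 'n) mmetric \<Rightarrow> real
      \<Rightarrow> ('a \<Rightarrow> 'b) set"
  where "sobolev_maps A gM B gN p =
    {u. colocally_weakly_differentiable A B u \<and>
        integrable (riemannian_measure A gM) (\<lambda>x. hom_norm gM gN (weak_tangent A B u x) powr p)}"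

definition ae_eq_rel ::
    "('a, 'm::finite) mchart set \<Rightarrow> ('a, 'm) mmetric \<Rightarrow> ('a \<Rightarrow> 'b) set
      \<Rightarrow> (('a \<Rightarrow> 'b) \<times> ('a \<Rightarrow> 'b)) set"
  where "ae_eq_rel A gM S =
    {(u, v). u \<in> S \<and> v \<in> S \<and> (AE x in riemannian_measure A gM. u x = v x)}"

definition sobolev_space ::
    "('a, 'm::finite) mchart set \<Rightarrow> ('a, 'm) mmetric
      \<Rightarrow> ('b::topological_space, 'n::finite) mchart set \<Rightarrow> ('b, 'n) mmetric \<Rightarrow> real
      \<Rightarrow> ('a \<Rightarrow> 'b) set set"
  where "sobolev_space A gM B gN p =
    sobolev_maps A gM B gN p // ae_eq_rel A gM (sobolev_maps A gM B gN p)"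

definition ennreal_root :: "real \<Rightarrow> ennreal \<Rightarrow> ennreal"
  where "ennreal_root p t = (if t = \<infinity> then \<infinity> else ennreal (enn2real t powr (1 / p)))"

text \<open>The distance between two almost everywhere classes is computed on representatives; its value
  does not depend on them.\<close>

definition sobolev_dist ::
    "('a, 'm::finite) mchart set \<Rightarrow> ('a, 'm) mmetric
      \<Rightarrow> ('b::topological_space, 'n::finite) mchart set \<Rightarrow> real
      \<Rightarrow> (('a, 'm, 'b, 'n) hom_bundle \<Rightarrow> ('a, 'm, 'b, 'n) hom_bundle \<Rightarrow> real)
      \<Rightarrow> ('a \<Rightarrow> 'b) set \<Rightarrow> ('a \<Rightarrow> 'b) set \<Rightarrow> ennreal"
  where "sobolev_dist A gM B p d X Y =
    (let u = (SOME u. u \<in> X); v = (SOME v. v \<in> Y) in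
     ennreal_root p (\<integral>\<^sup>+x. ennreal (d (weak_tangent A B u x) (weak_tangent A B v x) powr p)
       \<partial>riemannian_measure A gM))"

definition complete_extended :: "'s set \<Rightarrow> ('s \<Rightarrow> 's \<Rightarrow> ennreal) \<Rightarrow> bool"
  where "complete_extended S \<delta> \<longleftrightarrow>
    (\<forall>\<sigma>. (\<forall>k::nat. \<sigma> k \<in> S) \<and> (\<forall>\<epsilon>>0. \<exists>K. \<forall>k\<ge>K. \<forall>l\<ge>K. \<delta> (\<sigma> k) (\<sigma> l) < \<epsilon>) \<longrightarrow>
      (\<exists>s\<in>S. (\<lambda>k. \<delta> (\<sigma> k) s) \<longlonglongrightarrow> 0))"

end

theory Submission
  imports Defs
begin

text \<open>
  Completeness follows the classical proof for \<open>L\<^sup>p\<close>. A Cauchy sequence has a subsequence whose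
  consecutive distances are summable; almost everywhere its tangent maps are then Cauchy for \<open>d\<close>, with distances
  to the first term dominated by an \<open>L\<^sup>p\<close> function. The base points converge because \<open>{x} \<times> N\<close> is complete
  and projecting to the base does not increase \<open>d\<close>; the fibre components then stay bounded, so by local
  compactness of the fibres the tangent maps converge in the bundle. The limit is the tangent map of a colocally
  weakly differentiable map: after composition with a test function one may pass to the limit in the definition
  of the weak derivative by dominated convergence. Fatou's lemma gives convergence in \<open>\<delta>\<^sub>1\<^sub>,\<^sub>p\<close>.

  The distance is only meaningful once the colocal weak derivative is known to exist and to be unique almost
  everywhere. Uniqueness holds because the components of charts cut off to test functions separate tangent vectors. Existence
  glues the derivatives of \<open>f \<circ> u\<close> for countably many such \<open>f\<close>; the compatibility needs the chain rule for weak
  derivatives, proved by mollification, and its consequence that weak derivatives vanish almost everywhere on level sets.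
\<close>

section \<open>Mollification\<close>

text \<open>The target has no linear structure, so a map is accessible only through real test
  functions. Chart components cut off to test functions, collected in vectors F_j, recover it on
  small open sets V_j, where every test function f equals h o F_j with h of class C^1 and of bounded
  derivative on the whole model space. The preimage of V_j under u is merely measurable, since u
  need not be continuous, so no chain rule can be localised to it. Instead h o F_j o u is
  differentiated on a whole chart image and compared with f o u: the difference vanishes on that
  preimage, and the level set property removes its derivative there. Consecutive distances are taken
  below 4^-(k+1): half of this decay pays for summability, the other half remains as a pointwise
  geometric bound. Weak derivatives ask only for local integrability, and t \<le> 1 + t^p supplies
  it from L^p bounds. Tangent vectors are components in a selected chart that may jump from point to
  point, so every continuity or convergence argument passes through the differential of a fixed
  chart.\<close>

lemma lborel_distr_diff_left:
  fixes x :: "'a::euclidean_space"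
  shows "distr lborel borel ((-) x) = lborel"
proof -
  have "(\<lambda>s. x + (-1) *\<^sub>R s) = (-) x" by auto
  then show ?thesis
    using lborel_affine[of "-1" x] by (simp add: density_1)
qed

lemma nn_integral_lborel_diff_right:
  fixes s :: "'a::euclidean_space"
  assumes "f \<in> borel_measurable borel"
  shows "(\<integral>\<^sup>+x. f (x - s) \<partial>lborel) = (\<integral>\<^sup>+x. f x \<partial>lborel)"
proof -
  have "(\<integral>\<^sup>+x. f x \<partial>lborel) = (\<integral>\<^sup>+x. f x \<partial>distr lborel borel ((+) (-s)))"
    by (simp only: lborel_distr_plus)
  also have "\<dots> = (\<integral>\<^sup>+x. f (- s + x) \<partial>lborel)"
    using assms by (subst nn_integral_distr) auto
  finally show ?thesis by (simp add: algebra_simps)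
qed

lemma integral_lborel_diff_left:
  fixes f :: "'a::euclidean_space \<Rightarrow> 'b::{banach, second_countable_topology}"
  assumes "f \<in> borel_measurable borel"
  shows "(LINT z|lborel. f (x - z)) = (LINT z|lborel. f z)"
proof -
  have "(LINT z|lborel. f z) = (LINT z|distr lborel borel ((-) x). f z)"
    by (simp only: lborel_distr_diff_left)
  also have "\<dots> = (LINT z|lborel. f (x - z))"
    using assms by (subst integral_distr) auto
  finally show ?thesis by simp
qed

lemma integrable_lborel_diff_left:
  fixes f :: "'a::euclidean_space \<Rightarrow> 'b::{banach, second_countable_topology}"
  assumes "integrable lborel f"
  shows "integrable lborel (\<lambda>z. f (x - z))"
proof -
  have "integrable (distr lborel borel ((-) x)) f"
    using assms by (simp only: lborel_distr_diff_left)
  then show ?thesis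
    by (subst (asm) integrable_distr_eq) (use borel_measurable_integrable[OF assms] in auto)
qed

lemma integral_lborel_translation:
  fixes f :: "'a::euclidean_space \<Rightarrow> 'b::{banach, second_countable_topology}"
  assumes "f \<in> borel_measurable borel"
  shows "(LINT z|lborel. f (z + s)) = (LINT z|lborel. f z)"
proof -
  have "(LINT z|lborel. f z) = (LINT z|distr lborel borel ((+) s). f z)"
    by (simp only: lborel_distr_plus)
  also have "\<dots> = (LINT z|lborel. f (s + z))"
    using assms by (subst integral_distr) auto
  finally show ?thesis by (simp add: add.commute)
qed

text \<open>Inner and outer regularity give a compact K and an open U with K \<subseteq> A
  \<subseteq> U and small gaps. If the shift is shorter than the distance from K to the complement
  of U, a point that is in A either before or after the shift but not both is in A - K or has its
  partner in U - A. Hence the four indicator terms, each of integral at most e/4.\<close>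

lemma L1_translation_continuous_indicator:
  fixes A :: "'a::euclidean_space set"
  assumes A: "A \<in> sets lborel" "emeasure lborel A < \<infinity>" and e: "0 < e"
  shows "\<exists>r>0. \<forall>s. norm s < r \<longrightarrow>
    (\<integral>\<^sup>+x. ennreal \<bar>indicator A (x - s) - indicator A x\<bar> \<partial>lborel) \<le> ennreal e"
proof -
  have Ab[measurable]: "A \<in> sets borel" using A by simp
  have AL: "A \<in> sets lebesgue" using A by auto
  obtain T where T: "closed T" "T \<subseteq> A" "emeasure lebesgue (A - T) < ennreal (e/8)"
    by (rule sets_lebesgue_inner_closed[OF AL, of "e/8"]) (use e in auto)
  obtain U where U: "open U" "A \<subseteq> U" "emeasure lebesgue (U - A) < ennreal (e/4)"
    by (rule sets_lebesgue_outer_open[OF AL, of "e/4"]) (use e in auto)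
  have Tb[measurable]: "T \<in> sets borel" and Ub[measurable]: "U \<in> sets borel" using T U by auto
  define TT where "TT n = T \<inter> cball 0 (real n)" for n
  have TTb[measurable]: "TT n \<in> sets borel" for n by (auto simp: TT_def)
  have "(\<lambda>n. emeasure lborel (T - TT n)) \<longlonglongrightarrow> emeasure lborel (\<Inter>n. T - TT n)"
  proof (rule Lim_emeasure_decseq)
    show "range (\<lambda>n. T - TT n) \<subseteq> sets lborel" by auto
    show "decseq (\<lambda>n. T - TT n)" by (auto simp: decseq_def TT_def)
    show "emeasure lborel (T - TT n) \<noteq> \<infinity>" for n
      using A(2) emeasure_mono[of "T - TT n" A lborel] T(2) Ab by (force simp: top_unique)
  qed
  moreover have "(\<Inter>n. T - TT n) = {}"
  proof -
    have "\<exists>n. norm x \<le> real n" for x :: 'a by (rule real_arch_simple)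
    then show ?thesis by (force simp: TT_def)
  qed
  ultimately have "(\<lambda>n. emeasure lborel (T - TT n)) \<longlonglongrightarrow> 0" by (simp del: INT_simps UN_simps Diff_eq_empty_iff)
  then have "eventually (\<lambda>n. emeasure lborel (T - TT n) < ennreal (e/8)) sequentially"
    using e by (intro order_tendstoD) auto
  then obtain n where n: "emeasure lborel (T - TT n) < ennreal (e/8)"
    by (auto simp: eventually_sequentially)
  define K where "K = TT n"
  have K: "compact K" "K \<subseteq> A" using T by (auto simp: K_def TT_def)
  have Kb[measurable]: "K \<in> sets borel" by (simp add: K_def)
  have "emeasure lborel (A - K) \<le> emeasure lborel ((A - T) \<union> (T - TT n))"
    by (rule emeasure_mono) (auto simp: K_def)
  also have "\<dots> \<le> emeasure lborel (A - T) + emeasure lborel (T - TT n)"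
    by (rule emeasure_subadditive) auto
  also have "\<dots> \<le> ennreal (e/8) + ennreal (e/8)"
    using T(3) n by (intro add_mono) auto
  also have "\<dots> = ennreal (e/4)" using e by (simp flip: ennreal_plus)
  finally have AK: "emeasure lborel (A - K) \<le> ennreal (e/4)" .
  have UA: "emeasure lborel (U - A) \<le> ennreal (e/4)" using U(3) by auto
  have "\<exists>r>0. \<forall>x\<in>K. \<forall>y\<in>-U. r \<le> dist x y"
    by (rule separate_compact_closed) (use K U in auto)
  then obtain r where r: "r > 0" "\<And>x y. x \<in> K \<Longrightarrow> y \<notin> U \<Longrightarrow> r \<le> dist x y" by auto
  show ?thesis
  proof (intro exI[of _ r] conjI allI impI)
    fix s :: 'a assume s: "norm s < r"
    have near: "x + s \<in> U" "x - s \<in> U" if "x \<in> K" for x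
      using r(2)[OF that, of "x + s"] r(2)[OF that, of "x - s"] s by (auto simp: dist_norm)
    have "(\<integral>\<^sup>+x. ennreal \<bar>indicator A (x - s) - indicator A x\<bar> \<partial>lborel) \<le>
      (\<integral>\<^sup>+x. (indicator (A - K) x + indicator (U - A) (x - s)) +
         (indicator (A - K) (x - s) + indicator (U - A) x) \<partial>lborel)"
    proof (rule nn_integral_mono)
      fix x
      show "ennreal \<bar>indicator A (x - s) - indicator A x\<bar> \<le>
        (indicator (A - K) x + indicator (U - A) (x - s)) +
         (indicator (A - K) (x - s) + indicator (U - A) x)"
        using near(2)[of x] near(1)[of "x - s"]
        by (cases "x \<in> A"; cases "x - s \<in> A"; cases "x \<in> K"; cases "x - s \<in> K") auto
    qed
    also have "\<dots> = (emeasure lborel (A - K) + emeasure lborel (U - A)) +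
         (emeasure lborel (A - K) + emeasure lborel (U - A))"
    proof -
      have i: "(\<integral>\<^sup>+x. indicator S (x - s) \<partial>lborel) = emeasure lborel S" if "S \<in> sets borel" for S :: "'a set"
        using nn_integral_lborel_diff_right[of "indicator S" s] that by simp
      have iU: "(\<integral>\<^sup>+x. indicator (U - A) (x - s) \<partial>lborel) = emeasure lborel (U - A)"
        and iA: "(\<integral>\<^sup>+x. indicator (A - K) (x - s) \<partial>lborel) = emeasure lborel (A - K)"
        by (rule i; measurable)+
      show ?thesis
        by (subst nn_integral_add, measurable)+ (simp add: iU iA)
    qed
    also have "\<dots> \<le> (ennreal (e/4) + ennreal (e/4)) + (ennreal (e/4) + ennreal (e/4))"
      by (intro add_mono AK UA)
    also have "\<dots> = ennreal e" using e by (simp flip: ennreal_plus)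
    finally show "(\<integral>\<^sup>+x. ennreal \<bar>indicator A (x - s) - indicator A x\<bar> \<partial>lborel) \<le> ennreal e" .
  qed (use r in auto)
qed

text \<open>Density argument: the property holds for vector multiples of indicators of sets of
  finite measure and survives sums and dominated limits.\<close>

lemma L1_translation_continuous:
  fixes f :: "'a::euclidean_space \<Rightarrow> 'b::{banach, second_countable_topology}"
  assumes "integrable lborel f" and "0 < e"
  shows "\<exists>r>0. \<forall>s. norm s < r \<longrightarrow>
    (\<integral>\<^sup>+x. ennreal (norm (f (x - s) - f x)) \<partial>lborel) \<le> ennreal e"
  using assms
proof (induction arbitrary: e rule: integrable_induct)
  case (base A c)
  \<comment> \<open>The summand 1 keeps the quotient meaningful when \<open>c\<close> is
    zero.\<close>
  let ?d = "e / (norm c + 1)"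
  have d: "?d > 0" using base by (auto intro!: divide_pos_pos add_nonneg_pos)
  have Ab[measurable]: "A \<in> sets borel" using base by simp
  obtain r where r: "r > 0" "\<And>s. norm s < r \<Longrightarrow>
     (\<integral>\<^sup>+x. ennreal \<bar>indicator A (x - s) - indicator A x\<bar> \<partial>lborel) \<le> ennreal ?d"
    using L1_translation_continuous_indicator[OF base(1) base(2) d] by blast
  show ?case
  proof (intro exI[of _ r] conjI allI impI)
    fix s :: 'a assume s: "norm s < r"
    have "(\<integral>\<^sup>+x. ennreal (norm (indicator A (x - s) *\<^sub>R c - indicator A x *\<^sub>R c)) \<partial>lborel)
       = (\<integral>\<^sup>+x. ennreal (norm c) * ennreal \<bar>indicator A (x - s) - indicator A x\<bar> \<partial>lborel)"
      by (intro nn_integral_cong) (simp flip: scaleR_left_diff_distrib ennreal_mult add: mult.commute)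
    also have "\<dots> = ennreal (norm c) *
        (\<integral>\<^sup>+x. ennreal \<bar>indicator A (x - s) - indicator A x\<bar> \<partial>lborel)"
      by (rule nn_integral_cmult) measurable
    also have "\<dots> \<le> ennreal (norm c) * ennreal ?d"
      by (intro mult_left_mono r s) auto
    also have "\<dots> = ennreal (norm c * ?d)" using d by (simp flip: ennreal_mult)
    also have "\<dots> \<le> ennreal e"
      by (intro ennreal_leI) (use base(3) norm_ge_zero[of c] in \<open>simp add: divide_le_eq algebra_simps add_nonneg_pos not_less\<close>)
    finally show "(\<integral>\<^sup>+x. ennreal (norm (indicator A (x - s) *\<^sub>R c - indicator A x *\<^sub>R c)) \<partial>lborel) \<le> ennreal e" .
  qed (rule r)
next
  case (add f g)
  have fm[measurable]: "f \<in> borel_measurable borel" "g \<in> borel_measurable borel"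
    using borel_measurable_integrable[OF add.hyps(1)] borel_measurable_integrable[OF add.hyps(2)] by simp_all
  obtain r where r: "r > 0" "\<And>s. norm s < r \<Longrightarrow>
     (\<integral>\<^sup>+x. ennreal (norm (f (x - s) - f x)) \<partial>lborel) \<le> ennreal (e/2)"
    using add.IH(1)[of "e/2"] add.prems by auto
  obtain r' where r': "r' > 0" "\<And>s. norm s < r' \<Longrightarrow>
     (\<integral>\<^sup>+x. ennreal (norm (g (x - s) - g x)) \<partial>lborel) \<le> ennreal (e/2)"
    using add.IH(2)[of "e/2"] add.prems by auto
  show ?case
  proof (intro exI[of _ "min r r'"] conjI allI impI)
    fix s :: 'a assume s: "norm s < min r r'"
    have "(\<integral>\<^sup>+x. ennreal (norm (f (x - s) + g (x - s) - (f x + g x))) \<partial>lborel)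
      \<le> (\<integral>\<^sup>+x. ennreal (norm (f (x - s) - f x)) + ennreal (norm (g (x - s) - g x)) \<partial>lborel)"
      by (intro nn_integral_mono)
        (auto simp flip: ennreal_plus intro!: ennreal_leI norm_diff_triangle_ineq)
    also have "\<dots> = (\<integral>\<^sup>+x. ennreal (norm (f (x - s) - f x)) \<partial>lborel) +
       (\<integral>\<^sup>+x. ennreal (norm (g (x - s) - g x)) \<partial>lborel)"
      by (rule nn_integral_add) measurable
    also have "\<dots> \<le> ennreal (e/2) + ennreal (e/2)"
      by (intro add_mono r r') (use s in auto)
    also have "\<dots> = ennreal e" using add.prems by (simp flip: ennreal_plus)
    finally show "(\<integral>\<^sup>+x. ennreal (norm (f (x - s) + g (x - s) - (f x + g x))) \<partial>lborel) \<le> ennreal e" .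
  qed (use r r' in auto)
next
  case (lim f S)
  have fm[measurable]: "f \<in> borel_measurable borel" "\<And>i. S i \<in> borel_measurable borel"
    using borel_measurable_integrable[OF lim.hyps(4)] borel_measurable_integrable[OF lim.hyps(1)] by simp_all
  have "(\<lambda>i. LINT x|lborel. norm (S i x - f x)) \<longlonglongrightarrow> (LINT x|(lborel::'a measure). 0)"
  \<comment> \<open>The induction provides approximants bounded by \<open>2 * norm (f x)\<close>;
    subtracting \<open>f\<close> adds one more multiple.\<close>
  proof (rule integral_dominated_convergence[where w="\<lambda>x. 3 * norm (f x)"])
    show "integrable lborel (\<lambda>x. 3 * norm (f x))" using lim.hyps(4) by auto
    show "AE x in lborel. (\<lambda>i. norm (S i x - f x)) \<longlonglongrightarrow> 0"
      using lim.hyps(2) by (auto intro!: tendsto_norm_zero LIM_zero)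
    show "AE x in lborel. norm (norm (S i x - f x)) \<le> 3 * norm (f x)" for i
    proof (intro AE_I2)
      fix x
      show "norm (norm (S i x - f x)) \<le> 3 * norm (f x)"
        using lim.hyps(3)[of x i] norm_triangle_ineq4[of "S i x" "f x"] by auto
    qed
  qed auto
  then have "(\<lambda>i. LINT x|lborel. norm (S i x - f x)) \<longlonglongrightarrow> 0" by simp
  then have "eventually (\<lambda>i. (LINT x|lborel. norm (S i x - f x)) < e/3) sequentially"
    using lim.prems by (intro order_tendstoD) auto
  then obtain i where i: "(LINT x|lborel. norm (S i x - f x)) < e/3"
    by (auto simp: eventually_sequentially)
  have ii: "(\<integral>\<^sup>+x. ennreal (norm (S i x - f x)) \<partial>lborel) \<le> ennreal (e/3)"
    using lim.hyps(1)[of i] lim.hyps(4) i by (subst nn_integral_eq_integral) (auto intro!: ennreal_leI)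
  obtain r where r: "r > 0" "\<And>s. norm s < r \<Longrightarrow>
     (\<integral>\<^sup>+x. ennreal (norm (S i (x - s) - S i x)) \<partial>lborel) \<le> ennreal (e/3)"
    using lim.IH[of "e/3" i] lim.prems by auto
  show ?case
  proof (intro exI[of _ r] conjI allI impI)
    fix s :: 'a assume s: "norm s < r"
    have ii': "(\<integral>\<^sup>+x. ennreal (norm (S i (x - s) - f (x - s))) \<partial>lborel) \<le> ennreal (e/3)"
      using ii nn_integral_lborel_diff_right[of "\<lambda>x. ennreal (norm (S i x - f x))" s] by simp
    have "(\<integral>\<^sup>+x. ennreal (norm (f (x - s) - f x)) \<partial>lborel)
      \<le> (\<integral>\<^sup>+x. (ennreal (norm (S i (x - s) - f (x - s))) + ennreal (norm (S i (x - s) - S i x)))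
           + ennreal (norm (S i x - f x)) \<partial>lborel)"
    proof (intro nn_integral_mono)
      fix x
      have "norm (f (x - s) - f x) \<le> norm (S i (x - s) - f (x - s)) + norm (S i (x - s) - S i x)
         + norm (S i x - f x)"
        using norm_triangle_ineq4[of "(S i (x - s) - S i x) + (S i x - f x)" "S i (x - s) - f (x - s)"]
          norm_triangle_ineq[of "S i (x - s) - S i x" "S i x - f x"] by simp
      then show "ennreal (norm (f (x - s) - f x)) \<le> (ennreal (norm (S i (x - s) - f (x - s))) + ennreal (norm (S i (x - s) - S i x)))
           + ennreal (norm (S i x - f x))"
        by (auto simp flip: ennreal_plus intro!: ennreal_leI)
    qed
    also have "\<dots> = ((\<integral>\<^sup>+x. ennreal (norm (S i (x - s) - f (x - s))) \<partial>lborel) +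
       (\<integral>\<^sup>+x. ennreal (norm (S i (x - s) - S i x)) \<partial>lborel)) +
       (\<integral>\<^sup>+x. ennreal (norm (S i x - f x)) \<partial>lborel)"
      by (subst nn_integral_add, measurable)+
    also have "\<dots> \<le> (ennreal (e/3) + ennreal (e/3)) + ennreal (e/3)"
      by (intro add_mono r ii ii') (use s in auto)
    also have "\<dots> = ennreal e" using lim.prems by (simp flip: ennreal_plus)
    finally show "(\<integral>\<^sup>+x. ennreal (norm (f (x - s) - f x)) \<partial>lborel) \<le> ennreal e" .
  qed (rule r)
qed

text \<open>Convolution with a real kernel. The kernel is arbitrary because the derivative of a
  mollification has the same form, with a directional derivative of the mollifier as kernel.\<close>

definition mollify :: "('a::euclidean_space \<Rightarrow> real) \<Rightarrow> ('a \<Rightarrow> 'b::{banach, second_countable_topology}) \<Rightarrow> 'a \<Rightarrow> 'b"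
  where "mollify \<rho> f x = (LINT z|lborel. \<rho> (x - z) *\<^sub>R f z)"

lemma integrable_bounded_scaleR:
  fixes f :: "'a \<Rightarrow> 'b::{banach, second_countable_topology}"
  assumes "integrable M f" and "\<rho> \<in> borel_measurable M" and "\<And>x. \<bar>\<rho> x\<bar> \<le> C"
  shows "integrable M (\<lambda>x. \<rho> x *\<^sub>R f x)"
proof (rule Bochner_Integration.integrable_bound[where f="\<lambda>x. C *\<^sub>R f x"])
  show "integrable M (\<lambda>x. C *\<^sub>R f x)" using assms by auto
  show "(\<lambda>x. \<rho> x *\<^sub>R f x) \<in> borel_measurable M"
    using assms borel_measurable_integrable by measurable
  show "AE x in M. norm (\<rho> x *\<^sub>R f x) \<le> norm (C *\<^sub>R f x)"
  proof (intro AE_I2)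
    fix x
    show "norm (\<rho> x *\<^sub>R f x) \<le> norm (C *\<^sub>R f x)"
      using assms(3)[of x] by (auto intro!: mult_right_mono)
  qed
qed

text \<open>As \<rho> has mass one, the error at x is the average of f(x - s) - f(x) against \<rho>.
  Exchanging the two integrals bounds the L^1 error by an average of translation errors, and only
  shifts shorter than r carry weight.\<close>

lemma mollify_L1:
  fixes f :: "'a::euclidean_space \<Rightarrow> 'b::{banach, second_countable_topology}"
  assumes f: "integrable lborel f"
    and \<rho>: "\<rho> \<in> borel_measurable borel" "\<And>x. 0 \<le> \<rho> x" "\<And>x. \<rho> x \<le> C" "has_bochner_integral lborel \<rho> 1"
    and r: "\<And>x. r \<le> norm x \<Longrightarrow> \<rho> x = 0"
    and tr: "\<And>s. norm s < r \<Longrightarrow> (\<integral>\<^sup>+x. ennreal (norm (f (x - s) - f x)) \<partial>lborel) \<le> ennreal e"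
  shows "(\<integral>\<^sup>+x. ennreal (norm (mollify \<rho> f x - f x)) \<partial>lborel) \<le> ennreal e"
proof -
  have [measurable]: "f \<in> borel_measurable borel" "\<rho> \<in> borel_measurable borel"
    using f \<rho> by (auto dest: borel_measurable_integrable)
  have \<rho>i: "integrable lborel \<rho>" "(LINT x|lborel. \<rho> x) = 1"
    using \<rho>(4) by (auto simp: has_bochner_integral_iff)
  have "norm (mollify \<rho> f x - f x) \<le> (\<integral>\<^sup>+s. ennreal (\<rho> s) * ennreal (norm (f (x - s) - f x)) \<partial>lborel)" for x
  proof -
    have i1: "integrable lborel (\<lambda>z. \<rho> z *\<^sub>R f (x - z))"
      by (rule integrable_bounded_scaleR[where C=C])
        (use \<rho> integrable_lborel_diff_left[OF f, of x] in auto)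
    have i2: "integrable lborel (\<lambda>z. \<rho> z *\<^sub>R f x)" using \<rho>i by auto
    have "mollify \<rho> f x = (LINT z|lborel. \<rho> z *\<^sub>R f (x - z))"
      unfolding mollify_def
      using integral_lborel_diff_left[of "\<lambda>z. \<rho> z *\<^sub>R f (x - z)" x] by simp
    then have "mollify \<rho> f x - f x = (LINT z|lborel. \<rho> z *\<^sub>R (f (x - z) - f x))"
      using i1 i2 \<rho>i by (simp add: scaleR_diff_right)
    moreover have "integrable lborel (\<lambda>z. \<rho> z *\<^sub>R (f (x - z) - f x))"
      using Bochner_Integration.integrable_diff[OF i1 i2] by (simp add: scaleR_diff_right)
    ultimately have "ennreal (norm (mollify \<rho> f x - f x)) \<le> (\<integral>\<^sup>+z. ennreal (norm (\<rho> z *\<^sub>R (f (x - z) - f x))) \<partial>lborel)"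
      by (metis integral_norm_bound_ennreal)
    also have "\<dots> = (\<integral>\<^sup>+s. ennreal (\<rho> s) * ennreal (norm (f (x - s) - f x)) \<partial>lborel)"
      using \<rho>(2) by (intro nn_integral_cong) (simp flip: ennreal_mult)
    finally show ?thesis .
  qed
  then have "(\<integral>\<^sup>+x. ennreal (norm (mollify \<rho> f x - f x)) \<partial>lborel)
    \<le> (\<integral>\<^sup>+x. (\<integral>\<^sup>+s. ennreal (\<rho> s) * ennreal (norm (f (x - s) - f x)) \<partial>lborel) \<partial>lborel)"
    by (intro nn_integral_mono)
  also have "\<dots> = (\<integral>\<^sup>+s. (\<integral>\<^sup>+x. ennreal (\<rho> s) * ennreal (norm (f (x - s) - f x)) \<partial>lborel) \<partial>lborel)"
    by (rule lborel_pair.Fubini') measurable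
  also have "\<dots> = (\<integral>\<^sup>+s. ennreal (\<rho> s) * (\<integral>\<^sup>+x. ennreal (norm (f (x - s) - f x)) \<partial>lborel) \<partial>lborel)"
    by (intro nn_integral_cong nn_integral_cmult) measurable
  also have "\<dots> \<le> (\<integral>\<^sup>+s. ennreal (\<rho> s) * ennreal e \<partial>lborel)"
  proof (intro nn_integral_mono)
    fix s
    show "ennreal (\<rho> s) * (\<integral>\<^sup>+x. ennreal (norm (f (x - s) - f x)) \<partial>lborel) \<le> ennreal (\<rho> s) * ennreal e"
      using r[of s] tr[of s] by (cases "norm s < r") (auto intro: mult_left_mono)
  qed
  also have "\<dots> = (\<integral>\<^sup>+s. ennreal (\<rho> s) \<partial>lborel) * ennreal e"
    by (rule nn_integral_multc) measurable
  also have "(\<integral>\<^sup>+s. ennreal (\<rho> s) \<partial>lborel) = 1"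
    using \<rho>i \<rho>(2) by (subst nn_integral_eq_integral) auto
  finally show ?thesis by simp
qed

text \<open>The elementary C^1 bump: test functions are only required to be C^1, so the squared
  positive part suffices, both for mollifiers and for cutoffs. At zero the difference quotient is at
  most \<bar>h\<bar>.\<close>

lemma has_derivative_max_sq:
  fixes t :: real
  shows "((\<lambda>t. (max 0 t)\<^sup>2) has_real_derivative (2 * max 0 t)) (at t)"
proof (cases "t = 0")
  case True
  have "((\<lambda>h. ((max 0 h)\<^sup>2) / h) \<longlongrightarrow> 0) (at (0::real))"
  proof (rule Lim_null_comparison[where g="\<lambda>h. \<bar>h\<bar>"])
    show "\<forall>\<^sub>F h in at (0::real). norm ((max 0 h)\<^sup>2 / h) \<le> \<bar>h\<bar>"
      by (intro always_eventually) (auto simp: max_def power2_eq_square)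
    show "((\<lambda>h::real. \<bar>h\<bar>) \<longlongrightarrow> 0) (at 0)"
      by (intro tendsto_rabs_zero) simp
  qed
  then show ?thesis using True by (simp add: DERIV_def)
next
  case False
  show ?thesis
  proof (cases "t > 0")
    case True
    have "((\<lambda>t. t\<^sup>2) has_real_derivative (2 * t)) (at t)"
      by (auto intro!: derivative_eq_intros)
    then have "((\<lambda>t. (max 0 t)\<^sup>2) has_real_derivative (2 * t)) (at t)"
      by (rule has_field_derivative_transform_within_open[where S="{0<..}"]) (use True in auto)
    then show ?thesis using True by simp
  next
    case neg: False
    have "((\<lambda>t::real. 0::real) has_real_derivative 0) (at t)" by simp
    then have "((\<lambda>t. (max 0 t)\<^sup>2) has_real_derivative 0) (at t)"
      by (rule has_field_derivative_transform_within_open[where S="{..<0}"]) (use False neg in auto)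
    then show ?thesis using neg by simp
  qed
qed

text \<open>The squared positive part of r^2 - |x|^2 is C^1, vanishes outside the open ball of
  radius r and is positive inside. It is divided by its integral, which is nonzero because an open
  ball is not negligible.\<close>

lemma mollifier_exists:
  fixes r :: real
  assumes r: "r > 0"
  obtains \<rho> :: "'a::euclidean_space \<Rightarrow> real" and \<rho>' :: "'a \<Rightarrow> 'a \<Rightarrow>\<^sub>L real"
  where "\<And>x. (\<rho> has_derivative blinfun_apply (\<rho>' x)) (at x)" "continuous_on UNIV \<rho>'"
    "\<And>x. 0 \<le> \<rho> x" "\<And>x. r \<le> norm x \<Longrightarrow> \<rho> x = 0" "has_bochner_integral lborel \<rho> 1"
proof -
  define k where "k x = (max 0 (r\<^sup>2 - x \<bullet> x))\<^sup>2" for x :: 'a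
  define k' where "k' x = (- 4 * max 0 (r\<^sup>2 - x \<bullet> x)) *\<^sub>R blinfun_inner_right x" for x :: 'a
  have dk: "(k has_derivative blinfun_apply (k' x)) (at x)" for x
  proof -
    have a: "((\<lambda>x. r\<^sup>2 - x \<bullet> x) has_derivative (\<lambda>v. - 2 * (x \<bullet> v))) (at x)"
      by (auto intro!: derivative_eq_intros simp: inner_commute)
    have "((\<lambda>x. (max 0 (r\<^sup>2 - x \<bullet> x))\<^sup>2) has_derivative
      (\<lambda>v. (2 * max 0 (r\<^sup>2 - x \<bullet> x)) * (- 2 * (x \<bullet> v)))) (at x)"
      using has_derivative_compose[OF a, of "\<lambda>t. (max 0 t)\<^sup>2" "(*) (2 * max 0 (r\<^sup>2 - x \<bullet> x))"]
        has_derivative_max_sq[of "r\<^sup>2 - x \<bullet> x"] by (simp add: has_field_derivative_def)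
    moreover have "(\<lambda>v. (2 * max 0 (r\<^sup>2 - x \<bullet> x)) * (- 2 * (x \<bullet> v))) = blinfun_apply (k' x)"
      by (rule ext) (simp add: k'_def blinfun.scaleR_left blinfun.minus_left)
    ultimately show ?thesis by (simp add: k_def[abs_def])
  qed
  have ck': "continuous_on UNIV k'"
    unfolding k'_def by (intro continuous_intros)
  have ck: "continuous_on UNIV k"
    unfolding k_def by (intro continuous_intros)
  have km[measurable]: "k \<in> borel_measurable borel"
    using ck by (rule borel_measurable_continuous_onI)
  have k0: "k x = 0" if "r \<le> norm x" for x
  proof -
    have "r\<^sup>2 \<le> (norm x)\<^sup>2" using that r by (intro power_mono) auto
    then show ?thesis by (simp add: k_def power2_norm_eq_inner)
  qed
  have kpos: "k x > 0" if "norm x < r" for x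
  proof -
    have "(norm x)\<^sup>2 < r\<^sup>2" using that r by (intro power_strict_mono) auto
    then show ?thesis by (simp add: k_def power2_norm_eq_inner)
  qed
  have ki: "integrable lborel k"
  proof -
    have "set_integrable lborel (cball 0 r) k"
      unfolding set_integrable_def
      by (rule borel_integrable_compact) (auto intro: continuous_on_subset[OF ck])
    moreover have "(\<lambda>x. indicator (cball 0 r) x *\<^sub>R k x) = k"
      using k0 by (force simp: indicator_def)
    ultimately show ?thesis by (simp add: set_integrable_def)
  qed
  define I where "I = (LINT x|lborel. k x)"
  have k_nonneg: "k x \<ge> 0" for x by (simp add: k_def)
  have Inn: "I \<ge> 0" unfolding I_def by (rule integral_nonneg_AE) (simp add: k_nonneg)
  have "I \<noteq> 0"
  proof
    assume "I = 0"
    then have "AE x in lborel. k x = 0"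
      using integral_nonneg_eq_0_iff_AE[OF ki] k_nonneg by (simp add: I_def)
    then have "AE x in lborel. x \<notin> ball (0::'a) r"
    proof eventually_elim
      case (elim x)
      then show ?case using kpos[of x] by (cases "norm x < r") auto
    qed
    then have "ball (0::'a) r \<in> null_sets lborel"
      by (subst (asm) AE_iff_null_sets[symmetric]) auto
    then have "negligible (ball (0::'a) r)"
      by (simp add: negligible_iff_null_sets null_sets_completionI)
    then show False using r by (simp add: open_not_negligible)
  qed
  then have Ipos: "I > 0" using Inn by simp
  show thesis
  proof
    show "((\<lambda>x. k x / I) has_derivative blinfun_apply (inverse I *\<^sub>R k' x)) (at x)" for x
    proof -
      have e: "(\<lambda>x. k x / I) = (\<lambda>x. inverse I * k x)" by (simp add: divide_inverse mult.commute)
      have e': "blinfun_apply (inverse I *\<^sub>R k' x) = (\<lambda>v. inverse I * blinfun_apply (k' x) v)"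
        by (simp add: fun_eq_iff blinfun.scaleR_left)
      show ?thesis unfolding e e' by (rule has_derivative_mult_right[OF dk])
    qed
    show "continuous_on UNIV (\<lambda>x. inverse I *\<^sub>R k' x)"
      by (intro continuous_intros ck')
    show "0 \<le> k x / I" for x using Ipos by (simp add: k_def)
    show "k x / I = 0" if "r \<le> norm x" for x using k0[OF that] by simp
    show "has_bochner_integral lborel (\<lambda>x. k x / I) 1"
      using ki Ipos by (auto simp: has_bochner_integral_iff I_def)
  qed
qed

section \<open>Weak directional derivatives in Euclidean space\<close>

lemma has_derivative_directional:
  fixes f :: "'v::real_normed_vector \<Rightarrow> 'w::real_normed_vector"
  assumes "(f has_derivative f') (at (x + t *\<^sub>R v))"
  shows "((\<lambda>t. f (x + t *\<^sub>R v)) has_vector_derivative f' v) (at t)"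
proof -
  have "((\<lambda>t. x + t *\<^sub>R v) has_vector_derivative v) (at t)"
    by (auto intro!: derivative_eq_intros simp: has_vector_derivative_def)
  then show ?thesis
    using vector_derivative_diff_chain_within[of "\<lambda>t. x + t *\<^sub>R v" v t UNIV f f'] assms
    by (simp add: o_def has_derivative_at_withinI)
qed

lemma has_vector_derivative_at_0I:
  fixes f :: "real \<Rightarrow> 'w::real_normed_vector"
  assumes "((\<lambda>h. (f h - f 0) /\<^sub>R h) \<longlongrightarrow> D) (at 0)"
  shows "(f has_vector_derivative D) (at 0)"
proof -
  have "((\<lambda>h. norm ((f h - f 0) /\<^sub>R h - D)) \<longlongrightarrow> 0) (at 0)"
    using assms by (intro tendsto_norm_zero LIM_zero)
  moreover have "\<forall>\<^sub>F h in at 0. norm ((f h - f 0) /\<^sub>R h - D) = norm (f h - f 0 - h *\<^sub>R D) / norm h"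
  proof (rule eventually_at_filter[THEN iffD2], rule always_eventually, intro allI impI)
    fix h :: real assume "h \<noteq> 0"
    then have "(f h - f 0) /\<^sub>R h - D = (f h - f 0 - h *\<^sub>R D) /\<^sub>R h"
      by (simp add: scaleR_diff_right)
    then show "norm ((f h - f 0) /\<^sub>R h - D) = norm (f h - f 0 - h *\<^sub>R D) / norm h"
      by (simp add: divide_inverse mult.commute)
  qed
  ultimately have "((\<lambda>h. norm (f h - f 0 - h *\<^sub>R D) / norm h) \<longlongrightarrow> 0) (at 0)"
    by (simp add: tendsto_cong)
  then show ?thesis
    by (simp add: has_vector_derivative_def has_derivative_at bounded_linear_scaleR_left)
qed

lemma bounded_derivative_Lipschitz:
  fixes f :: "'v::real_normed_vector \<Rightarrow> 'w::real_normed_vector"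
  assumes "\<And>x. (f has_derivative blinfun_apply (f' x)) (at x)" and "\<And>x. norm (f' x) \<le> L"
  shows "norm (f x - f y) \<le> L * norm (x - y)"
  by (rule differentiable_bound[where S=UNIV and f'="\<lambda>x. blinfun_apply (f' x)"])
    (use assms in \<open>auto simp: norm_blinfun.rep_eq[symmetric]\<close>)

text \<open>Integration by parts reduced to translation invariance: each difference quotient of
  \<psi> along v has integral zero, and the quotients converge boundedly on a fixed ball.
  Differentiability is asked along lines only, which is the form in which mollified maps provide
  it.\<close>

lemma integral_directional_derivative_eq_0:
  fixes \<psi> :: "'a::euclidean_space \<Rightarrow> real"
  assumes cont: "continuous_on UNIV \<psi>" and supp: "\<And>x. R \<le> norm x \<Longrightarrow> \<psi> x = 0"
    and der: "\<And>x. ((\<lambda>t. \<psi> (x + t *\<^sub>R v)) has_real_derivative \<psi>' x) (at 0)"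
    and bd: "\<And>x. \<bar>\<psi>' x\<bar> \<le> C"
  shows "(LINT x|lborel. \<psi>' x) = 0"
proof -
  have [measurable]: "\<psi> \<in> borel_measurable borel"
    using cont by (rule borel_measurable_continuous_onI)
  define q where "q n x = (\<psi> (x + (1 / real (Suc n)) *\<^sub>R v) - \<psi> x) / (1 / real (Suc n))" for n x
  have [measurable]: "q n \<in> borel_measurable borel" for n unfolding q_def by measurable
  \<comment> \<open>Derivatives at parameter 0 for all base points give those at every parameter, by
    moving the base point.\<close>
  have der_t: "((\<lambda>t. \<psi> (x + t *\<^sub>R v)) has_real_derivative \<psi>' (x + t *\<^sub>R v)) (at t)" for x t
    using der[of "x + t *\<^sub>R v"]
      DERIV_shift[of "\<lambda>t. \<psi> (x + t *\<^sub>R v)" "\<psi>' (x + t *\<^sub>R v)" 0 t]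
    by (simp add: algebra_simps)
  have lim: "(\<lambda>n. q n x) \<longlonglongrightarrow> \<psi>' x" for x
  proof -
    have "((\<lambda>h. (\<psi> (x + h *\<^sub>R v) - \<psi> x) / h) \<longlongrightarrow> \<psi>' x) (at 0)"
      using der[of x] by (simp add: DERIV_def)
    moreover have "filterlim (\<lambda>n. 1 / real (Suc n)) (at 0) sequentially"
      unfolding filterlim_at using LIMSEQ_inverse_real_of_nat by (auto simp: divide_inverse)
    ultimately show ?thesis unfolding q_def by (rule filterlim_compose)
  qed
  have [measurable]: "\<psi>' \<in> borel_measurable borel"
    by (rule borel_measurable_LIMSEQ_metric[where f=q]) (use lim in auto)
  have C0: "0 \<le> C" using bd[of 0] by linarith
  have qb: "\<bar>q n x\<bar> \<le> C" for n x
  proof -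
    \<comment> \<open>The mean value theorem makes the quotient a value of \<psi>', so the bound
      \<open>C\<close> passes to it.\<close>
    have "\<exists>z>0. z < 1 / real (Suc n) \<and> \<psi> (x + (1 / real (Suc n)) *\<^sub>R v) - \<psi> (x + 0 *\<^sub>R v) = (1 / real (Suc n) - 0) * \<psi>' (x + z *\<^sub>R v)"
      by (rule MVT2) (use der_t in auto)
    then obtain z where "\<psi> (x + (1 / real (Suc n)) *\<^sub>R v) - \<psi> x = (1 / real (Suc n)) * \<psi>' (x + z *\<^sub>R v)"
      by auto
    then have "q n x = \<psi>' (x + z *\<^sub>R v)" by (simp add: q_def)
    then show ?thesis using bd by simp
  qed
  \<comment> \<open>The steps are at most \<open>norm v\<close> long, so all quotients are supported
    in one ball.\<close>
  have q0: "q n x = 0" if "R + norm v \<le> norm x" for n x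
  proof -
    have "(1 / real (Suc n)) * norm v \<le> 1 * norm v" by (intro mult_right_mono) auto
    then have "norm ((1 / real (Suc n)) *\<^sub>R v) \<le> norm v" by simp
    moreover have "norm x \<le> norm (x + (1 / real (Suc n)) *\<^sub>R v) + norm ((1 / real (Suc n)) *\<^sub>R v)"
      using norm_triangle_ineq4[of "x + (1 / real (Suc n)) *\<^sub>R v" "(1 / real (Suc n)) *\<^sub>R v"] by simp
    ultimately have "R \<le> norm (x + (1 / real (Suc n)) *\<^sub>R v)" using that by linarith
    moreover have "R \<le> norm x" using that norm_ge_zero[of v] by linarith
    ultimately show ?thesis using supp by (simp add: q_def)
  qed
  have \<psi>i: "integrable lborel \<psi>"
  proof -
    have "integrable lborel (\<lambda>x. indicator (cball 0 R) x *\<^sub>R \<psi> x)"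
      by (rule borel_integrable_compact) (auto intro: continuous_on_subset[OF cont])
    moreover have "(\<lambda>x. indicator (cball 0 R) x *\<^sub>R \<psi> x) = \<psi>"
      using supp by (force simp: indicator_def)
    ultimately show ?thesis by simp
  qed
  have qi0: "(LINT x|lborel. q n x) = 0" for n
  proof -
    have i2: "integrable lborel (\<lambda>x. \<psi> (x + (1 / real (Suc n)) *\<^sub>R v))"
      using integrable_distr_eq[of "(+) ((1 / real (Suc n)) *\<^sub>R v)" lborel borel \<psi>] \<psi>i
      by (simp add: lborel_distr_plus add.commute)
    show ?thesis
      unfolding q_def using i2 \<psi>i
      by (simp add: integral_lborel_translation del: of_nat_Suc)
  qed
  have "(\<lambda>n. LINT x|lborel. q n x) \<longlonglongrightarrow> (LINT x|lborel. \<psi>' x)"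
  proof (rule integral_dominated_convergence[where w="\<lambda>x. C * indicator (cball 0 (R + norm v)) x"])
    show "integrable lborel (\<lambda>x::'a. C * indicator (cball 0 (R + norm v)) x)"
      using emeasure_bounded_finite[OF bounded_cball[of "0::'a" "R + norm v"]]
      by (intro integrable_mult_right integrable_real_indicator) auto
    show "AE x in lborel. (\<lambda>n. q n x) \<longlonglongrightarrow> \<psi>' x" using lim by simp
    show "AE x in lborel. norm (q n x) \<le> C * indicator (cball 0 (R + norm v)) x" for n
    proof (intro AE_I2)
      fix x
      show "norm (q n x) \<le> C * indicator (cball 0 (R + norm v)) x"
        using q0[of x n] qb[of n x] by (cases "R + norm v \<le> norm x") (auto simp: C0)
    qed
  qed auto
  then show ?thesis using qi0 by (simp add: LIMSEQ_const_iff)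
qed

lemma mollify_continuous:
  fixes f :: "'a::euclidean_space \<Rightarrow> 'b::{banach, second_countable_topology}"
  assumes f: "integrable lborel f" and \<rho>: "continuous_on UNIV \<rho>" "\<And>x. \<bar>\<rho> x\<bar> \<le> C"
  shows "continuous_on UNIV (mollify \<rho> f)"
proof -
  have [measurable]: "f \<in> borel_measurable borel" "\<rho> \<in> borel_measurable borel"
    using borel_measurable_integrable[OF f] borel_measurable_continuous_onI[OF \<rho>(1)] by simp_all
  show ?thesis
    unfolding continuous_on_sequentially
  proof (intro allI ballI impI, clarsimp)
    fix X :: "nat \<Rightarrow> 'a" and a assume X: "X \<longlonglongrightarrow> a"
    have "(\<lambda>n. mollify \<rho> f (X n)) \<longlonglongrightarrow> mollify \<rho> f a"
      unfolding mollify_def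
    proof (rule integral_dominated_convergence[where w="\<lambda>z. C * norm (f z)"])
      show "AE z in lborel. (\<lambda>n. \<rho> (X n - z) *\<^sub>R f z) \<longlonglongrightarrow> \<rho> (a - z) *\<^sub>R f z"
      proof (intro AE_I2 tendsto_scaleR tendsto_const)
        fix z
        have "isCont \<rho> (a - z)" using \<rho>(1) by (simp add: continuous_on_eq_continuous_at)
        then show "(\<lambda>n. \<rho> (X n - z)) \<longlonglongrightarrow> \<rho> (a - z)"
          by (rule isCont_tendsto_compose) (intro tendsto_intros X)
      qed
      show "AE z in lborel. norm (\<rho> (X n - z) *\<^sub>R f z) \<le> C * norm (f z)" for n
        using \<rho>(2) by (auto intro!: mult_right_mono)
    qed (use f in auto)
    then show "(mollify \<rho> f \<circ> X) \<longlonglongrightarrow> mollify \<rho> f a" by (simp add: o_def)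
  qed
qed

lemma norm_mollify_le:
  fixes f :: "'a::euclidean_space \<Rightarrow> 'b::{banach, second_countable_topology}"
  assumes f: "integrable lborel f" and \<rho>: "\<rho> \<in> borel_measurable borel" "\<And>x. \<bar>\<rho> x\<bar> \<le> C"
  shows "norm (mollify \<rho> f x) \<le> C * (LINT z|lborel. norm (f z))"
proof -
  have [measurable]: "f \<in> borel_measurable borel" "\<rho> \<in> borel_measurable borel"
    using borel_measurable_integrable[OF f] \<rho>(1) by simp_all
  have "norm (mollify \<rho> f x) \<le> (LINT z|lborel. norm (\<rho> (x - z) *\<^sub>R f z))"
    unfolding mollify_def by (rule integral_norm_bound)
  also have "\<dots> \<le> (LINT z|lborel. C * norm (f z))"
  proof (rule integral_mono)
    show "integrable lborel (\<lambda>z. norm (\<rho> (x - z) *\<^sub>R f z))"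
      by (intro integrable_norm integrable_bounded_scaleR[where C=C] f) (use \<rho> in auto)
    show "integrable lborel (\<lambda>z. C * norm (f z))" using f by auto
    show "norm (\<rho> (x - z) *\<^sub>R f z) \<le> C * norm (f z)" for z
      using \<rho>(2)[of "x - z"] by (auto intro!: mult_right_mono)
  qed
  finally show ?thesis by simp
qed

text \<open>Differentiation under the integral sign: \<rho> is Lipschitz with constant L, so its
  quotients along v are at most \<open>L * norm v\<close>, and a multiple of
  \<open>norm (f z)\<close> is the majorant.\<close>

lemma mollify_directional_derivative:
  fixes f :: "'a::euclidean_space \<Rightarrow> 'b::{banach, second_countable_topology}"
  assumes f: "integrable lborel f"
    and \<rho>: "\<And>x. (\<rho> has_derivative blinfun_apply (\<rho>' x)) (at x)" "continuous_on UNIV \<rho>'" "\<And>x. norm (\<rho>' x) \<le> L"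
      "\<And>x. \<bar>\<rho> x\<bar> \<le> C"
  shows "((\<lambda>t. mollify \<rho> f (x + t *\<^sub>R v)) has_vector_derivative mollify (\<lambda>y. \<rho>' y v) f x) (at 0)"
proof -
  have \<rho>c: "continuous_on UNIV \<rho>"
    by (intro continuous_at_imp_continuous_on ballI has_derivative_continuous[OF \<rho>(1)])
  have \<rho>v: "continuous_on UNIV (\<lambda>y. blinfun_apply (\<rho>' y) v)"
    by (intro continuous_intros \<rho>(2))
  have [measurable]: "f \<in> borel_measurable borel" "\<rho> \<in> borel_measurable borel"
    "(\<lambda>y. blinfun_apply (\<rho>' y) v) \<in> borel_measurable borel"
    using borel_measurable_integrable[OF f] borel_measurable_continuous_onI[OF \<rho>c]
      borel_measurable_continuous_onI[OF \<rho>v] by simp_all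
  have "((\<lambda>h. (mollify \<rho> f (x + h *\<^sub>R v) - mollify \<rho> f x) /\<^sub>R h) \<longlongrightarrow> mollify (\<lambda>y. \<rho>' y v) f x) (at 0)"
    unfolding tendsto_at_iff_sequentially
  proof (intro allI impI)
    fix h :: "nat \<Rightarrow> real" assume h: "\<forall>i. h i \<in> UNIV - {0}" "h \<longlonglongrightarrow> 0"
    let ?q = "\<lambda>n z. ((\<rho> (x + h n *\<^sub>R v - z) - \<rho> (x - z)) / h n) *\<^sub>R f z"
    have eq: "(mollify \<rho> f (x + h n *\<^sub>R v) - mollify \<rho> f x) /\<^sub>R h n = (LINT z|lborel. ?q n z)" for n
    proof -
      have i: "integrable lborel (\<lambda>z. \<rho> (y - z) *\<^sub>R f z)" for y
        by (rule integrable_bounded_scaleR[where C=C]) (use f \<rho>(4) in auto)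
      have "(LINT z|lborel. ?q n z) =
        (LINT z|lborel. inverse (h n) *\<^sub>R (\<rho> (x + h n *\<^sub>R v - z) *\<^sub>R f z - \<rho> (x - z) *\<^sub>R f z))"
        by (intro Bochner_Integration.integral_cong) (auto simp: algebra_simps divide_inverse)
      also have "\<dots> = inverse (h n) *\<^sub>R (mollify \<rho> f (x + h n *\<^sub>R v) - mollify \<rho> f x)"
        using i by (simp add: mollify_def)
      finally show ?thesis by simp
    qed
    have "(\<lambda>n. LINT z|lborel. ?q n z) \<longlonglongrightarrow> mollify (\<lambda>y. \<rho>' y v) f x"
      unfolding mollify_def
    proof (rule integral_dominated_convergence[where w="\<lambda>z. (L * norm v) * norm (f z)"])
      show "AE z in lborel. (\<lambda>n. ?q n z) \<longlonglongrightarrow> \<rho>' (x - z) v *\<^sub>R f z"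
      proof (intro AE_I2 tendsto_scaleR tendsto_const)
        fix z
        have "((\<lambda>t. \<rho> ((x - z) + t *\<^sub>R v)) has_vector_derivative \<rho>' (x - z) v) (at 0)"
          by (rule has_derivative_directional) (use \<rho>(1) in simp)
        then have "((\<lambda>h. (\<rho> ((x - z) + h *\<^sub>R v) - \<rho> (x - z)) / h) \<longlongrightarrow> \<rho>' (x - z) v) (at 0)"
          by (simp add: has_real_derivative_iff_has_vector_derivative[symmetric] DERIV_def)
        then show "(\<lambda>n. (\<rho> (x + h n *\<^sub>R v - z) - \<rho> (x - z)) / h n) \<longlonglongrightarrow> \<rho>' (x - z) v"
          unfolding tendsto_at_iff_sequentially using h by (auto simp: o_def algebra_simps)
      qed
      show "AE z in lborel. norm (?q n z) \<le> (L * norm v) * norm (f z)" for n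
      proof (intro AE_I2)
        fix z
        have "\<bar>\<rho> (x + h n *\<^sub>R v - z) - \<rho> (x - z)\<bar> \<le> L * norm (h n *\<^sub>R v)"
          using bounded_derivative_Lipschitz[of \<rho> \<rho>' L "x + h n *\<^sub>R v - z" "x - z"] \<rho> by simp
        then have "\<bar>(\<rho> (x + h n *\<^sub>R v - z) - \<rho> (x - z)) / h n\<bar> \<le> L * norm v"
          using h(1) by (auto simp: field_simps abs_mult)
        then show "norm (?q n z) \<le> (L * norm v) * norm (f z)"
          by (auto intro!: mult_right_mono simp del: abs_divide)
      qed
    qed (use f in auto)
    then show "((\<lambda>h. (mollify \<rho> f (x + h *\<^sub>R v) - mollify \<rho> f x) /\<^sub>R h) \<circ> h) \<longlonglongrightarrow> mollify (\<lambda>y. \<rho>' y v) f x"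
      by (simp add: o_def eq)
  qed
  then show ?thesis
    by (intro has_vector_derivative_at_0I) simp
qed


definition loc_integrable :: "'v::euclidean_space set \<Rightarrow> ('v \<Rightarrow> 'w::euclidean_space) \<Rightarrow> bool"
  where "loc_integrable V w \<longleftrightarrow> (\<forall>K. compact K \<and> K \<subseteq> V \<longrightarrow> set_integrable lebesgue K w)"

definition test_function :: "'v::euclidean_space set \<Rightarrow> ('v \<Rightarrow> real) \<Rightarrow> bool"
  where "test_function V \<eta> \<longleftrightarrow> C1_on UNIV \<eta> \<and> compact_support \<eta> \<and> closure {z. \<eta> z \<noteq> 0} \<subseteq> V"

text \<open>The weak derivative is handled in one fixed direction at a time and for vector values,
  so that all components of a cutoff chart can enter the chain rule together.\<close>

definition weak_dderiv ::
    "'v::euclidean_space set \<Rightarrow> 'v \<Rightarrow> ('v \<Rightarrow> 'w::euclidean_space) \<Rightarrow> ('v \<Rightarrow> 'w) \<Rightarrow> bool"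
  where "weak_dderiv V v w G \<longleftrightarrow> loc_integrable V w \<and> loc_integrable V G \<and>
    (\<forall>\<eta>. test_function V \<eta> \<longrightarrow>
      (LINT z:V|lebesgue. frechet_derivative \<eta> (at z) v *\<^sub>R w z) = - (LINT z:V|lebesgue. \<eta> z *\<^sub>R G z))"

lemma weak_derivative_on_iff:
  "weak_derivative_on V w W \<longleftrightarrow> (\<forall>v. weak_dderiv V v w (\<lambda>z. W z v))"
  unfolding weak_derivative_on_def weak_dderiv_def loc_integrable_def locally_integrable_on_def test_function_def
  by (auto simp: mult.commute)

section \<open>Test functions and Borel versions of integrable functions\<close>

lemma loc_integrableD: "loc_integrable V w \<Longrightarrow> compact K \<Longrightarrow> K \<subseteq> V \<Longrightarrow> integrable lebesgue (\<lambda>x. indicator K x *\<^sub>R w x)"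
  by (auto simp: loc_integrable_def set_integrable_def)

lemma continuous_compact_supp_bounded:
  fixes f :: "'v::euclidean_space \<Rightarrow> 'w::real_normed_vector"
  assumes "continuous_on UNIV f" "compact K" "\<And>x. x \<notin> K \<Longrightarrow> f x = 0"
  obtains C where "0 \<le> C" "\<And>x. norm (f x) \<le> C"
proof -
  have "bounded (f ` K)"
    using assms by (intro compact_imp_bounded compact_continuous_image) (auto intro: continuous_on_subset)
  then obtain C where C: "\<And>x. x \<in> K \<Longrightarrow> norm (f x) \<le> C" by (auto simp: bounded_iff)
  show thesis
  proof
    show "norm (f x) \<le> \<bar>C\<bar>" for x using C[of x] assms(3)[of x] by (cases "x \<in> K") auto
  qed auto
qed

lemma test_functionE:
  assumes "test_function V \<eta>"
  obtains K \<eta>' C where "compact K" "K \<subseteq> V" "\<And>z. (\<eta> has_derivative blinfun_apply (\<eta>' z)) (at z)"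
    "continuous_on UNIV \<eta>'" "\<And>z. z \<notin> K \<Longrightarrow> \<eta> z = 0" "\<And>z. z \<notin> K \<Longrightarrow> \<eta>' z = 0"
    "\<And>z. \<bar>\<eta> z\<bar> \<le> C" "\<And>z. norm (\<eta>' z) \<le> C" "\<And>z. frechet_derivative \<eta> (at z) = blinfun_apply (\<eta>' z)"
    "continuous_on UNIV \<eta>"
proof -
  define K where "K = closure {z. \<eta> z \<noteq> 0}"
  obtain \<eta>' where d: "\<And>z. (\<eta> has_derivative blinfun_apply (\<eta>' z)) (at z)" and c: "continuous_on UNIV \<eta>'"
    using assms by (auto simp: test_function_def C1_on_def)
  have K: "compact K" "K \<subseteq> V" using assms by (auto simp: test_function_def compact_support_def K_def)
  have z: "\<eta> z = 0" if "z \<notin> K" for z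
    using that closure_subset[of "{z. \<eta> z \<noteq> 0}"] by (auto simp: K_def)
  have z': "\<eta>' z = 0" if "z \<notin> K" for z
  proof -
    have "((\<lambda>_. 0) has_derivative (\<lambda>_. 0)) (at z)" by simp
    then have "(\<eta> has_derivative (\<lambda>_. 0)) (at z)"
      by (rule has_derivative_transform_within_open[where s="- K"])
        (use that z K compact_imp_closed in auto)
    then have "blinfun_apply (\<eta>' z) = (\<lambda>_. 0)"
      using d[of z] has_derivative_unique by blast
    then show ?thesis by (intro blinfun_eqI) simp
  qed
  have cont: "continuous_on UNIV \<eta>"
    by (intro continuous_at_imp_continuous_on ballI has_derivative_continuous[OF d])
  obtain C1 where C1: "0 \<le> C1" "\<And>x. norm (\<eta> x) \<le> C1"
    using continuous_compact_supp_bounded[OF cont K(1) z] by blast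
  obtain C2 where C2: "0 \<le> C2" "\<And>x. norm (\<eta>' x) \<le> C2"
    using continuous_compact_supp_bounded[OF c K(1) z'] by blast
  have C1': "\<bar>\<eta> z\<bar> \<le> C1 + C2" for z using C1(2)[of z] C2(1) by simp
  have C2': "norm (\<eta>' z) \<le> C1 + C2" for z using C2(2)[of z] C1(1) by simp
  have fr: "frechet_derivative \<eta> (at z) = blinfun_apply (\<eta>' z)" for z
    using frechet_derivative_at[OF d[of z]] by simp
  show thesis by (rule that[OF K d c z z' C1' C2' fr cont])
qed

lemma set_integral_supported:
  fixes w :: "'v::euclidean_space \<Rightarrow> 'w::euclidean_space"
  assumes "K \<subseteq> V" "\<And>z. z \<notin> K \<Longrightarrow> \<phi> z = 0"
  shows "(LINT z:V|lebesgue. \<phi> z *\<^sub>R w z) = (LINT z|lebesgue. \<phi> z *\<^sub>R (indicator K z *\<^sub>R w z))"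
  unfolding set_lebesgue_integral_def
proof (intro Bochner_Integration.integral_cong refl)
  fix z
  show "indicator V z *\<^sub>R \<phi> z *\<^sub>R w z = \<phi> z *\<^sub>R (indicator K z *\<^sub>R w z)"
    using assms by (cases "z \<in> K") auto
qed

text \<open>Translations and Fubini's theorem are applied for \<open>lborel\<close>, while the data
  are only Lebesgue measurable; they are exchanged for Borel versions component by
  component.\<close>

lemma integrable_lebesgue_lborel_version:
  fixes f :: "'v::euclidean_space \<Rightarrow> 'w::euclidean_space"
  assumes "integrable lebesgue f"
  obtains g where "integrable lborel g" "AE x in lebesgue. f x = g x"
proof -
  have fm: "f \<in> borel_measurable lebesgue" using assms by auto
  have "\<exists>g'\<in>borel_measurable lborel. (AE x in lborel. f x \<bullet> b = g' x)" for b
    by (rule completion_ex_borel_measurable_real) (use fm in measurable)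
  then obtain g' where g': "\<And>b. g' b \<in> borel_measurable lborel" "\<And>b. AE x in lborel. f x \<bullet> b = g' b x"
    by metis
  define g where "g x = (\<Sum>b\<in>Basis. g' b x *\<^sub>R b)" for x
  have gm: "g \<in> borel_measurable lborel" unfolding g_def using g'(1) by measurable
  have "AE x in lebesgue. \<forall>b\<in>Basis. f x \<bullet> b = g' b x"
    by (rule AE_finite_allI) (auto intro: AE_completion g'(2))
  then have ae: "AE x in lebesgue. f x = g x"
  proof eventually_elim
    case (elim x)
    then show ?case using euclidean_representation[of "f x"] by (simp add: g_def)
  qed
  have gl: "g \<in> borel_measurable lebesgue" using gm by (rule measurable_completion)
  have "integrable lebesgue g"
    using assms integrable_cong_AE[OF fm gl ae] by simp
  then have "integrable lborel g" using integrable_completion[OF gm] by simp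
  then show thesis using ae by (rule that)
qed

text \<open>The approximants are mollifications of w cut off to a compact neighbourhood of K. For x
  in K the kernel centred at x is a test function in V, so the weak derivative turns the derivative
  of the mollification into the mollification of G; off K nothing relates \<open>DW\<close> to G.
  The last conclusion, that an almost everywhere vanishing w has zero approximants, is there for
  uniqueness.\<close>

lemma weak_dderiv_approx:
  fixes w G :: "'v::euclidean_space \<Rightarrow> 'w::euclidean_space"
  assumes V: "open V" and wd: "weak_dderiv V v w G" and K: "compact K" "K \<subseteq> V"
  obtains W DW :: "nat \<Rightarrow> 'v \<Rightarrow> 'w" where
    "\<And>k x. ((\<lambda>t. W k (x + t *\<^sub>R v)) has_vector_derivative DW k x) (at 0)"
    "\<And>k. continuous_on UNIV (W k)" "\<And>k. continuous_on UNIV (DW k)"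
    "\<And>k. \<exists>C. \<forall>x. norm (W k x) \<le> C \<and> norm (DW k x) \<le> C"
    "AE x in lebesgue. x \<in> K \<longrightarrow> (\<lambda>k. W k x) \<longlonglongrightarrow> w x"
    "(\<lambda>k. \<integral>\<^sup>+x\<in>K. ennreal (norm (W k x - w x)) \<partial>lebesgue) \<longlonglongrightarrow> 0"
    "(\<lambda>k. \<integral>\<^sup>+x\<in>K. ennreal (norm (DW k x - G x)) \<partial>lebesgue) \<longlonglongrightarrow> 0"
    "(AE x in lebesgue. x \<in> V \<longrightarrow> w x = 0) \<longrightarrow> (\<forall>k x. W k x = 0)"
proof -
  have "\<exists>\<delta>>0. \<forall>x\<in>K. \<forall>y\<in>-V. \<delta> \<le> dist x y"
    by (rule separate_compact_closed) (use K V in auto)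
  then obtain \<delta> where \<delta>: "\<delta> > 0" "\<And>x y. x \<in> K \<Longrightarrow> y \<notin> V \<Longrightarrow> \<delta> \<le> dist x y" by auto
  \<comment> \<open>The closed \<delta>/2-neighbourhood of K: it stays inside V and contains the
    support of every kernel of radius below \<delta>/2 centred in K.\<close>
  define K' where "K' = {x + y |x y. x \<in> K \<and> y \<in> cball 0 (\<delta>/2)}"
  have K': "compact K'" unfolding K'_def by (intro compact_sums K) simp
  have K'V: "K' \<subseteq> V"
  proof
    fix z assume "z \<in> K'"
    then obtain x y where xy: "z = x + y" "x \<in> K" "norm y \<le> \<delta>/2" by (auto simp: K'_def)
    then show "z \<in> V" using \<delta>(2)[of x z] \<delta>(1) by (auto simp: dist_norm)
  qed
  have KK': "K \<subseteq> K'" unfolding K'_def using \<delta>(1) by force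
  have K'm: "x - s \<in> K'" if "x \<in> K" "norm s \<le> \<delta>/2" for x s
    unfolding K'_def using that by (intro CollectI exI[of _ x] exI[of _ "-s"]) auto
  have li: "loc_integrable V w" "loc_integrable V G" using wd by (auto simp: weak_dderiv_def)
  obtain w0 where w0: "integrable lborel w0" "AE x in lebesgue. indicator K' x *\<^sub>R w x = w0 x"
    using integrable_lebesgue_lborel_version[OF loc_integrableD[OF li(1) K' K'V]] by blast
  obtain G0 where G0: "integrable lborel G0" "AE x in lebesgue. indicator K' x *\<^sub>R G x = G0 x"
    using integrable_lebesgue_lborel_version[OF loc_integrableD[OF li(2) K' K'V]] by blast
  have [measurable]: "w0 \<in> borel_measurable borel" "G0 \<in> borel_measurable borel"
    using borel_measurable_integrable[OF w0(1)] borel_measurable_integrable[OF G0(1)] by simp_all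
  have Kb[measurable]: "K \<in> sets borel" using K(1) by (simp add: compact_imp_closed)
  \<comment> \<open>One radius serves w and G at once, with translation errors at most
    1/(k+1).\<close>
  define P where "P k \<rho> \<rho>' r \<longleftrightarrow> r > 0 \<and> r < \<delta>/2 \<and>
     (\<forall>s. norm s < r \<longrightarrow> (\<integral>\<^sup>+x. ennreal (norm (w0 (x - s) - w0 x)) \<partial>lborel) \<le> ennreal (1 / real (Suc k))) \<and>
     (\<forall>s. norm s < r \<longrightarrow> (\<integral>\<^sup>+x. ennreal (norm (G0 (x - s) - G0 x)) \<partial>lborel) \<le> ennreal (1 / real (Suc k))) \<and>
     (\<forall>x. (\<rho> has_derivative blinfun_apply (\<rho>' x)) (at x)) \<and> continuous_on UNIV \<rho>' \<and>
     (\<forall>x. 0 \<le> \<rho> x) \<and> (\<forall>x. r \<le> norm x \<longrightarrow> \<rho> x = 0) \<and> has_bochner_integral lborel \<rho> 1"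
    for k and \<rho> :: "'v \<Rightarrow> real" and \<rho>' :: "'v \<Rightarrow> 'v \<Rightarrow>\<^sub>L real" and r
  have "\<exists>\<rho> \<rho>' r. P k \<rho> \<rho>' r" for k
  proof -
    have k: "1 / real (Suc k) > 0" by simp
    obtain r1 where r1: "r1 > 0" "\<And>s. norm s < r1 \<Longrightarrow> (\<integral>\<^sup>+x. ennreal (norm (w0 (x - s) - w0 x)) \<partial>lborel) \<le> ennreal (1 / real (Suc k))"
      using L1_translation_continuous[OF w0(1) k] by blast
    obtain r2 where r2: "r2 > 0" "\<And>s. norm s < r2 \<Longrightarrow> (\<integral>\<^sup>+x. ennreal (norm (G0 (x - s) - G0 x)) \<partial>lborel) \<le> ennreal (1 / real (Suc k))"
      using L1_translation_continuous[OF G0(1) k] by blast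
    define r where "r = min (min r1 r2) (\<delta>/4)"
    have r: "r > 0" "r < \<delta>/2" "r \<le> r1" "r \<le> r2" using r1 r2 \<delta>(1) by (auto simp: r_def)
    obtain \<rho> :: "'v \<Rightarrow> real" and \<rho>' where "\<And>x. (\<rho> has_derivative blinfun_apply (\<rho>' x)) (at x)" "continuous_on UNIV \<rho>'"
      "\<And>x. 0 \<le> \<rho> x" "\<And>x. r \<le> norm x \<Longrightarrow> \<rho> x = 0" "has_bochner_integral lborel \<rho> 1"
      using mollifier_exists[OF r(1)] by metis
    then have "P k \<rho> \<rho>' r" unfolding P_def using r r1 r2 by auto
    then show ?thesis by blast
  qed
  then obtain \<rho> \<rho>' r where P: "\<And>k. P k (\<rho> k) (\<rho>' k) (r k)" by metis
  have r: "r k > 0" "r k < \<delta>/2" for k using P by (auto simp: P_def)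
  have d: "(\<rho> k has_derivative blinfun_apply (\<rho>' k x)) (at x)" for k x using P by (auto simp: P_def)
  have c': "continuous_on UNIV (\<rho>' k)" for k using P by (auto simp: P_def)
  have \<rho>0: "\<rho> k x = 0" if "r k \<le> norm x" for k x using P that unfolding P_def by blast
  have \<rho>p: "0 \<le> \<rho> k x" for k x using P unfolding P_def by blast
  have c: "continuous_on UNIV (\<rho> k)" for k
    by (intro continuous_at_imp_continuous_on ballI has_derivative_continuous[OF d])
  have testf: "test_function V (\<lambda>z. \<rho> k (x - z)) \<and> (\<forall>z. z \<notin> K' \<longrightarrow> \<rho> k (x - z) = 0 \<and> \<rho>' k (x - z) = 0)
     \<and> (\<forall>z. frechet_derivative (\<lambda>z. \<rho> k (x - z)) (at z) v = - \<rho>' k (x - z) v)" if "x \<in> K" for k x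
  proof -
    have dd: "((\<lambda>z. \<rho> k (x - z)) has_derivative blinfun_apply (- \<rho>' k (x - z))) (at z)" for z
    proof -
      have "((\<lambda>z. x - z) has_derivative (\<lambda>v. - v)) (at z)" by (auto intro!: derivative_eq_intros)
      from has_derivative_compose[OF this d]
      have "((\<lambda>z. \<rho> k (x - z)) has_derivative (\<lambda>v. \<rho>' k (x - z) (- v))) (at z)" .
      moreover have "blinfun_apply (- \<rho>' k (x - z)) = (\<lambda>v. \<rho>' k (x - z) (- v))"
        by (simp add: fun_eq_iff blinfun.minus_left blinfun.minus_right)
      ultimately show ?thesis by simp
    qed
    have cc: "continuous_on UNIV (\<lambda>z. - \<rho>' k (x - z))"
      by (intro continuous_intros continuous_on_compose2[OF c']) auto
    have sub: "closure {z. \<rho> k (x - z) \<noteq> 0} \<subseteq> cball x (r k)"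
    proof (rule closure_minimal)
      show "{z. \<rho> k (x - z) \<noteq> 0} \<subseteq> cball x (r k)"
        using \<rho>0[of k "x - z" for z] by (force simp: dist_norm)
    qed simp
    have "cball x (r k) \<subseteq> K'"
    proof
      fix z assume "z \<in> cball x (r k)"
      then show "z \<in> K'" using K'm[OF that, of "x - z"] r(2)[of k] by (auto simp: dist_norm)
    qed
    with sub have sub': "closure {z. \<rho> k (x - z) \<noteq> 0} \<subseteq> K'" by blast
    have tf: "test_function V (\<lambda>z. \<rho> k (x - z))"
      unfolding test_function_def C1_on_def compact_support_def
    proof (intro conjI exI[of _ "\<lambda>z. - \<rho>' k (x - z)"] ballI dd cc)
      show "compact (closure {z. \<rho> k (x - z) \<noteq> 0})"
        using sub by (meson bounded_cball bounded_subset closed_closure compact_eq_bounded_closed)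
      show "closure {z. \<rho> k (x - z) \<noteq> 0} \<subseteq> V" using sub' K'V by blast
    qed
    moreover have "\<rho> k (x - z) = 0 \<and> \<rho>' k (x - z) = 0" if "z \<notin> K'" for z
    proof
      show "\<rho> k (x - z) = 0"
        using that sub' closure_subset[of "{z. \<rho> k (x - z) \<noteq> 0}"] by auto
      have "((\<lambda>_. 0) has_derivative (\<lambda>_. 0)) (at z)" by simp
      then have "((\<lambda>z. \<rho> k (x - z)) has_derivative (\<lambda>_. 0)) (at z)"
      proof (rule has_derivative_transform_within_open[where s="- K'"])
        show "open (- K')" using K' compact_imp_closed by auto
        show "z \<in> - K'" using that by simp
        show "0 = \<rho> k (x - y)" if "y \<in> - K'" for y
          using that sub' closure_subset[of "{z. \<rho> k (x - z) \<noteq> 0}"] by auto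
      qed
      then have "blinfun_apply (- \<rho>' k (x - z)) = (\<lambda>_. 0)"
        using dd[of z] has_derivative_unique by blast
      then have "- \<rho>' k (x - z) = 0" by (intro blinfun_eqI) simp
      then show "\<rho>' k (x - z) = 0" by simp
    qed
    moreover have "frechet_derivative (\<lambda>z. \<rho> k (x - z)) (at z) v = - \<rho>' k (x - z) v" for z
      using frechet_derivative_at[OF dd[of z], symmetric] by (simp add: blinfun.minus_left)
    ultimately show ?thesis by blast
  qed
  have \<rho>'0: "\<rho>' k x = 0" if "x \<notin> cball 0 (r k)" for k x
  proof -
    have "((\<lambda>_. 0) has_derivative (\<lambda>_. 0)) (at x)" by simp
    then have "(\<rho> k has_derivative (\<lambda>_. 0)) (at x)"
      by (rule has_derivative_transform_within_open[where s="- cball 0 (r k)"]) (use that \<rho>0 in auto)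
    then have "blinfun_apply (\<rho>' k x) = (\<lambda>_. 0)" using d has_derivative_unique by blast
    then show ?thesis by (intro blinfun_eqI) simp
  qed
  have "\<exists>C. \<forall>x. \<bar>\<rho> k x\<bar> \<le> C \<and> norm (\<rho>' k x) \<le> C" for k
  proof -
    have a: "\<rho> k x = 0" if "x \<notin> cball 0 (r k)" for x using \<rho>0[of k x] that by simp
    obtain C1 where C1: "0 \<le> C1" "\<And>x. norm (\<rho> k x) \<le> C1"
      using continuous_compact_supp_bounded[OF c compact_cball a] by blast
    obtain C2 where C2: "0 \<le> C2" "\<And>x. norm (\<rho>' k x) \<le> C2"
      using continuous_compact_supp_bounded[OF c' compact_cball \<rho>'0] by blast
    show ?thesis
    proof (intro exI[of _ "C1 + C2"] allI conjI)
      fix x show "\<bar>\<rho> k x\<bar> \<le> C1 + C2" using C1(2)[of x] C2(1) by simp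
      show "norm (\<rho>' k x) \<le> C1 + C2" using C2(2)[of x] C1(1) by simp
    qed
  qed
  then obtain C where C: "\<And>k x. \<bar>\<rho> k x\<bar> \<le> C k" "\<And>k x. norm (\<rho>' k x) \<le> C k" by metis
  have C'': "\<bar>\<rho>' k y v\<bar> \<le> C k * norm v" for k y
    using norm_blinfun[of "\<rho>' k y" v] C(2)[of k y] mult_right_mono[OF C(2)[of k y] norm_ge_zero[of v]] by simp
  have \<rho>m[measurable]: "\<rho> k \<in> borel_measurable borel" for k by (rule borel_measurable_continuous_onI[OF c])
  have c'v: "continuous_on UNIV (\<lambda>y. \<rho>' k y v)" for k by (intro continuous_intros c')
  have \<rho>'m[measurable]: "(\<lambda>y. \<rho>' k y v) \<in> borel_measurable borel" for k by (rule borel_measurable_continuous_onI[OF c'v])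
  define W where "W k = mollify (\<rho> k) w0" for k
  define DW where "DW k = mollify (\<lambda>y. \<rho>' k y v) w0" for k
  have der: "((\<lambda>t. W k (x + t *\<^sub>R v)) has_vector_derivative DW k x) (at 0)" for k x
    unfolding W_def DW_def by (rule mollify_directional_derivative[OF w0(1) d c' C(2) C(1)])
  have cW: "continuous_on UNIV (W k)" for k unfolding W_def by (rule mollify_continuous[OF w0(1) c C(1)])
  have cDW: "continuous_on UNIV (DW k)" for k unfolding DW_def by (rule mollify_continuous[OF w0(1) c'v C''])
  have [measurable]: "W k \<in> borel_measurable borel" "DW k \<in> borel_measurable borel" for k
    using borel_measurable_continuous_onI[OF cW] borel_measurable_continuous_onI[OF cDW] by simp_all
  have bW: "\<exists>C. \<forall>x. norm (W k x) \<le> C \<and> norm (DW k x) \<le> C" for k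
  proof -
    have "norm (W k x) \<le> C k * (LINT z|lborel. norm (w0 z))" for x
      unfolding W_def by (rule norm_mollify_le[OF w0(1) \<rho>m C(1)])
    moreover have "norm (DW k x) \<le> (C k * norm v) * (LINT z|lborel. norm (w0 z))" for x
      unfolding DW_def by (rule norm_mollify_le[OF w0(1) \<rho>'m C''])
    ultimately show ?thesis
      by (intro exI[of _ "max (C k * (LINT z|lborel. norm (w0 z))) ((C k * norm v) * (LINT z|lborel. norm (w0 z)))"])
        (auto simp: le_max_iff_disj)
  qed
  have to_leb: "(LINT z:V|lebesgue. \<phi> z *\<^sub>R f z) = (LINT z|lborel. \<phi> z *\<^sub>R f0 z)"
    if "\<And>z. z \<notin> K' \<Longrightarrow> \<phi> z = 0" "\<phi> \<in> borel_measurable borel" "AE x in lebesgue. indicator K' x *\<^sub>R f x = f0 x"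
      "f0 \<in> borel_measurable borel" "loc_integrable V f" for \<phi> and f f0 :: "'v \<Rightarrow> 'w"
  proof -
    have [measurable]: "\<phi> \<in> borel_measurable borel" "f0 \<in> borel_measurable borel" by fact+
    have "(LINT z:V|lebesgue. \<phi> z *\<^sub>R f z) = (LINT z|lebesgue. \<phi> z *\<^sub>R (indicator K' z *\<^sub>R f z))"
      by (rule set_integral_supported) (use K'V that in auto)
    also have "\<dots> = (LINT z|lebesgue. \<phi> z *\<^sub>R f0 z)"
    proof (rule integral_cong_AE)
      have "\<phi> \<in> borel_measurable lebesgue" "f0 \<in> borel_measurable lebesgue"
        using that by (auto intro: measurable_completion)
      with borel_measurable_integrable[OF loc_integrableD[OF that(5) K' K'V]]
      show "(\<lambda>z. \<phi> z *\<^sub>R f0 z) \<in> borel_measurable lebesgue" 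
        "(\<lambda>z. \<phi> z *\<^sub>R indicator K' z *\<^sub>R f z) \<in> borel_measurable lebesgue"
        by - (rule borel_measurable_scaleR; assumption)+
      show "AE z in lebesgue. \<phi> z *\<^sub>R indicator K' z *\<^sub>R f z = \<phi> z *\<^sub>R f0 z"
        using that(3) by eventually_elim simp
    qed
    also have "\<dots> = (LINT z|lborel. \<phi> z *\<^sub>R f0 z)"
      by (rule integral_completion) measurable
    finally show ?thesis .
  qed
  \<comment> \<open>The weak derivative is tested with the kernel centred at x. Differentiating the
    kernel in the integration variable produces a sign that cancels the one in the
    definition.\<close>
  have DWG: "DW k x = mollify (\<rho> k) G0 x" if "x \<in> K" for k x
  proof -
    note t = testf[OF that, of k]
    have t1: "\<rho> k (x - z) = 0" "\<rho>' k (x - z) = 0" if "z \<notin> K'" for z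
      using t that by blast+
    have t2: "frechet_derivative (\<lambda>z. \<rho> k (x - z)) (at z) v = - \<rho>' k (x - z) v" for z
      using t by blast
    have "(LINT z:V|lebesgue. frechet_derivative (\<lambda>z. \<rho> k (x - z)) (at z) v *\<^sub>R w z)
      = - (LINT z:V|lebesgue. \<rho> k (x - z) *\<^sub>R G z)"
      using wd t unfolding weak_dderiv_def by blast
    also have "(LINT z:V|lebesgue. \<rho> k (x - z) *\<^sub>R G z) = mollify (\<rho> k) G0 x"
      unfolding mollify_def by (rule to_leb) (use t1 G0 li in auto)
    also have "(LINT z:V|lebesgue. frechet_derivative (\<lambda>z. \<rho> k (x - z)) (at z) v *\<^sub>R w z)
       = (LINT z:V|lebesgue. (- \<rho>' k (x - z) v) *\<^sub>R w z)"
      by (simp only: t2)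
    also have "\<dots> = (LINT z|lborel. (- \<rho>' k (x - z) v) *\<^sub>R w0 z)"
      by (rule to_leb) (use t1 w0 li in auto)
    also have "\<dots> = - DW k x"
      by (simp add: DW_def mollify_def)
    finally show ?thesis by simp
  qed
  have L1W: "(\<integral>\<^sup>+x. ennreal (norm (W k x - w0 x)) \<partial>lborel) \<le> ennreal (1 / real (Suc k))" for k
    unfolding W_def
    by (rule mollify_L1[where r="r k" and C="C k", OF w0(1)]) (use P[of k] C(1)[of k] \<rho>m in \<open>auto simp: P_def abs_le_iff\<close>)
  have L1G: "(\<integral>\<^sup>+x. ennreal (norm (mollify (\<rho> k) G0 x - G0 x)) \<partial>lborel) \<le> ennreal (1 / real (Suc k))" for k
    by (rule mollify_L1[where r="r k" and C="C k", OF G0(1)]) (use P[of k] C(1)[of k] \<rho>m in \<open>auto simp: P_def abs_le_iff\<close>)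
  have L1WK: "(\<integral>\<^sup>+x\<in>K. ennreal (norm (W k x - w x)) \<partial>lebesgue) \<le> ennreal (1 / real (Suc k))" for k
  proof -
    have "(\<integral>\<^sup>+x\<in>K. ennreal (norm (W k x - w x)) \<partial>lebesgue) = (\<integral>\<^sup>+x\<in>K. ennreal (norm (W k x - w0 x)) \<partial>lebesgue)"
    proof (rule nn_integral_cong_AE)
      show "AE x in lebesgue. ennreal (norm (W k x - w x)) * indicator K x = ennreal (norm (W k x - w0 x)) * indicator K x"
        using w0(2)
      proof eventually_elim
        case (elim x)
        then show ?case using KK' by (auto simp: indicator_def split: if_splits)
      qed
    qed
    also have "\<dots> = (\<integral>\<^sup>+x\<in>K. ennreal (norm (W k x - w0 x)) \<partial>lborel)" by (simp add: nn_integral_completion)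
    also have "\<dots> \<le> (\<integral>\<^sup>+x. ennreal (norm (W k x - w0 x)) \<partial>lborel)"
      by (intro nn_integral_mono) (auto simp: indicator_def)
    finally show ?thesis using L1W[of k] by simp
  qed
  have L1GK: "(\<integral>\<^sup>+x\<in>K. ennreal (norm (DW k x - G x)) \<partial>lebesgue) \<le> ennreal (1 / real (Suc k))" for k
  proof -
    have "(\<integral>\<^sup>+x\<in>K. ennreal (norm (DW k x - G x)) \<partial>lebesgue) = (\<integral>\<^sup>+x\<in>K. ennreal (norm (mollify (\<rho> k) G0 x - G0 x)) \<partial>lebesgue)"
    proof (rule nn_integral_cong_AE)
      show "AE x in lebesgue. ennreal (norm (DW k x - G x)) * indicator K x = ennreal (norm (mollify (\<rho> k) G0 x - G0 x)) * indicator K x"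
        using G0(2)
      proof eventually_elim
        case (elim x)
        then show ?case using KK' DWG[of x k] by (auto simp: indicator_def split: if_splits)
      qed
    qed
    also have "\<dots> = (\<integral>\<^sup>+x\<in>K. ennreal (norm (mollify (\<rho> k) G0 x - G0 x)) \<partial>lborel)" by (simp add: nn_integral_completion)
    also have "\<dots> \<le> (\<integral>\<^sup>+x. ennreal (norm (mollify (\<rho> k) G0 x - G0 x)) \<partial>lborel)"
      by (intro nn_integral_mono) (auto simp: indicator_def)
    finally show ?thesis using L1G[of k] by simp
  qed
  have lim0: "(\<lambda>k. ennreal (1 / real (Suc k))) \<longlonglongrightarrow> 0"
    using LIMSEQ_inverse_real_of_nat by (subst ennreal_0[symmetric], intro tendsto_ennrealI) (simp add: divide_inverse)
  have Wi: "integrable lborel (\<lambda>x. W k x - w0 x)" for k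
    using L1W[of k] by (intro integrableI_bounded) (auto intro: order.strict_trans1)
  have "(\<lambda>k. LINT x|lborel. norm (W k x - w0 x)) \<longlonglongrightarrow> 0"
  proof (rule tendsto_sandwich[OF _ _ tendsto_const])
    show "\<forall>\<^sub>F k in sequentially. 0 \<le> (LINT x|lborel. norm (W k x - w0 x))" by simp
    show "\<forall>\<^sub>F k in sequentially. (LINT x|lborel. norm (W k x - w0 x)) \<le> 1 / real (Suc k)"
    proof (rule always_eventually, rule allI)
      fix k
      have "ennreal (LINT x|lborel. norm (W k x - w0 x)) \<le> ennreal (1 / real (Suc k))"
        using L1W[of k] Wi[of k] by (subst (asm) nn_integral_eq_integral) auto
      then show "(LINT x|lborel. norm (W k x - w0 x)) \<le> 1 / real (Suc k)"
        by (simp add: ennreal_le_iff del: of_nat_Suc)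
    qed
    show "(\<lambda>k. 1 / real (Suc k)) \<longlonglongrightarrow> 0"
      using LIMSEQ_inverse_real_of_nat by (simp add: divide_inverse)
  qed
  \<comment> \<open>L^1 convergence gives almost everywhere convergence along a subsequence only, so
    every conclusion is stated for that subsequence.\<close>
  from tendsto_L1_AE_subseq[OF Wi this] obtain s where
    s: "strict_mono (s::nat \<Rightarrow> nat)" "AE x in lborel. (\<lambda>k. W (s k) x - w0 x) \<longlonglongrightarrow> 0" by blast
  show thesis
  proof (rule that[of "\<lambda>k. W (s k)" "\<lambda>k. DW (s k)"])
    show "((\<lambda>t. W (s k) (x + t *\<^sub>R v)) has_vector_derivative DW (s k) x) (at 0)" for k x by (rule der)
    show "continuous_on UNIV (W (s k))" "continuous_on UNIV (DW (s k))" for k by (rule cW cDW)+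
    show "\<exists>C. \<forall>x. norm (W (s k) x) \<le> C \<and> norm (DW (s k) x) \<le> C" for k by (rule bW)
    have "AE x in lebesgue. (\<lambda>k. W (s k) x - w0 x) \<longlonglongrightarrow> 0" using s(2) by (rule AE_completion)
    then show "AE x in lebesgue. x \<in> K \<longrightarrow> (\<lambda>k. W (s k) x) \<longlonglongrightarrow> w x"
      using w0(2)
    proof eventually_elim
      case (elim x)
      then show ?case using KK' by (auto simp: LIM_zero_iff)
    qed
    show "(\<lambda>k. \<integral>\<^sup>+x\<in>K. ennreal (norm (W (s k) x - w x)) \<partial>lebesgue) \<longlonglongrightarrow> 0"
    proof (rule tendsto_sandwich[OF _ _ tendsto_const LIMSEQ_subseq_LIMSEQ[OF lim0 s(1)]])
      show "\<forall>\<^sub>F k in sequentially. (\<integral>\<^sup>+x\<in>K. ennreal (norm (W (s k) x - w x)) \<partial>lebesgue) \<le> ((\<lambda>k. ennreal (1 / real (Suc k))) \<circ> s) k"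
        unfolding o_def by (intro always_eventually allI L1WK)
    qed simp
    show "(\<lambda>k. \<integral>\<^sup>+x\<in>K. ennreal (norm (DW (s k) x - G x)) \<partial>lebesgue) \<longlonglongrightarrow> 0"
    proof (rule tendsto_sandwich[OF _ _ tendsto_const LIMSEQ_subseq_LIMSEQ[OF lim0 s(1)]])
      show "\<forall>\<^sub>F k in sequentially. (\<integral>\<^sup>+x\<in>K. ennreal (norm (DW (s k) x - G x)) \<partial>lebesgue) \<le> ((\<lambda>k. ennreal (1 / real (Suc k))) \<circ> s) k"
        unfolding o_def by (intro always_eventually allI L1GK)
    qed simp
    show "(AE x in lebesgue. x \<in> V \<longrightarrow> w x = 0) \<longrightarrow> (\<forall>k x. W (s k) x = 0)"
    proof (intro impI allI)
      fix k x assume w: "AE x in lebesgue. x \<in> V \<longrightarrow> w x = 0"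
      have "AE z in lebesgue. w0 z = 0"
        using w w0(2)
      proof eventually_elim
        case (elim z)
        then show ?case using K'V by (cases "z \<in> K'") auto
      qed
      then have "AE z in lborel. w0 z = 0" by (simp add: AE_completion_iff)
      then have "AE z in lborel. \<rho> (s k) (x - z) *\<^sub>R w0 z = 0" by eventually_elim simp
      then show "W (s k) x = 0" unfolding W_def mollify_def by (rule integral_eq_zero_AE)
    qed
  qed
qed

text \<open>An open set is a countable union of compact sets, so countably many exceptional null
  sets are united.\<close>

lemma AE_on_openI:
  fixes V :: "'v::euclidean_space set"
  assumes "open V" "\<And>K. compact K \<Longrightarrow> K \<subseteq> V \<Longrightarrow> AE x in lebesgue. x \<in> K \<longrightarrow> P x"
  shows "AE x in lebesgue. x \<in> V \<longrightarrow> P x"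
proof -
  obtain C where C: "\<And>n::nat. compact (C n)" "\<And>n. C n \<subseteq> V" "(\<Union>n. C n) = V"
    using open_Union_compact_subsets[OF assms(1)] by metis
  have "AE x in lebesgue. \<forall>n. x \<in> C n \<longrightarrow> P x"
    unfolding AE_all_countable using C assms(2) by blast
  then show ?thesis by eventually_elim (use C(3) in blast)
qed

lemma loc_integrable_measurable:
  "loc_integrable V w \<Longrightarrow> compact K \<Longrightarrow> K \<subseteq> V \<Longrightarrow> (\<lambda>x. indicator K x *\<^sub>R w x) \<in> borel_measurable lebesgue"
  using loc_integrableD borel_measurable_integrable by blast

text \<open>By completeness of Lebesgue measure both the sequence and the limit may be altered on
  the exceptional null set.\<close>

lemma lebesgue_measurable_AE_limit:
  fixes f :: "nat \<Rightarrow> 'v::euclidean_space \<Rightarrow> 'w::euclidean_space"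
  assumes f: "\<And>k. f k \<in> borel_measurable lebesgue" and lim: "AE x in lebesgue. (\<lambda>k. f k x) \<longlonglongrightarrow> g x"
  shows "g \<in> borel_measurable lebesgue"
proof -
  obtain N where N: "N \<in> null_sets lebesgue" "\<And>x. x \<notin> N \<Longrightarrow> (\<lambda>k. f k x) \<longlonglongrightarrow> g x"
    using lim unfolding completion.AE_iff_null_sets by auto
  have Ns[measurable]: "N \<in> sets lebesgue" using N(1) by auto
  have [measurable]: "f k \<in> borel_measurable lebesgue" for k by (rule f)
  have "(\<lambda>x. if x \<in> N then 0 else g x) \<in> borel_measurable lebesgue"
  proof (rule borel_measurable_LIMSEQ_metric)
    show "(\<lambda>x. if x \<in> N then 0 else f k x) \<in> borel_measurable lebesgue" for k by measurable
    show "(\<lambda>k. if x \<in> N then 0 else f k x) \<longlonglongrightarrow> (if x \<in> N then 0 else g x)" for x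
      using N(2) by auto
  qed
  then show ?thesis
    by (rule borel_measurable_AE) (rule AE_I'[OF N(1)], auto)
qed

section \<open>Stability of local integrability\<close>

lemma loc_integrable_bound:
  fixes w :: "'v::euclidean_space \<Rightarrow> 'w::euclidean_space" and P :: "'v \<Rightarrow> real"
  assumes P: "loc_integrable V P" and w: "\<And>K. compact K \<Longrightarrow> K \<subseteq> V \<Longrightarrow> (\<lambda>x. indicator K x *\<^sub>R w x) \<in> borel_measurable lebesgue"
    and le: "AE x in lebesgue. x \<in> V \<longrightarrow> norm (w x) \<le> P x"
  shows "loc_integrable V w"
  unfolding loc_integrable_def set_integrable_def
proof (intro allI impI, elim conjE)
  fix K :: "'v set" assume K: "compact K" "K \<subseteq> V"
  show "integrable lebesgue (\<lambda>x. indicator K x *\<^sub>R w x)"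
  proof (rule Bochner_Integration.integrable_bound[OF loc_integrableD[OF P K] w[OF K]])
    show "AE x in lebesgue. norm (indicator K x *\<^sub>R w x) \<le> norm (indicator K x *\<^sub>R P x)"
      using le by eventually_elim (use K in \<open>auto simp: indicator_def\<close>)
  qed
qed

lemma loc_integrable_cong_AE:
  fixes w :: "'v::euclidean_space \<Rightarrow> 'w::euclidean_space"
  assumes w: "loc_integrable V w" and eq: "AE x in lebesgue. x \<in> V \<longrightarrow> w x = w' x"
  shows "loc_integrable V w'"
  unfolding loc_integrable_def set_integrable_def
proof (intro allI impI, elim conjE)
  fix K :: "'v set" assume K: "compact K" "K \<subseteq> V"
  have ae: "AE x in lebesgue. indicator K x *\<^sub>R w x = indicator K x *\<^sub>R w' x"
    using eq by eventually_elim (use K in \<open>auto simp: indicator_def\<close>)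
  have m: "(\<lambda>x. indicator K x *\<^sub>R w' x) \<in> borel_measurable lebesgue"
    by (rule borel_measurable_AE[OF loc_integrable_measurable[OF w K] ae])
  show "integrable lebesgue (\<lambda>x. indicator K x *\<^sub>R w' x)"
    using integrable_cong_AE[OF loc_integrable_measurable[OF w K] m ae] loc_integrableD[OF w K] by simp
qed

lemma loc_integrable_const: "loc_integrable V (\<lambda>_. c)"
  unfolding loc_integrable_def set_integrable_def
proof (intro allI impI, elim conjE)
  fix K :: "'a set" assume K: "compact K"
  then have "emeasure lebesgue K < \<infinity>"
    using lmeasurable_compact fmeasurableD2 by (metis infinity_ennreal_def top.not_eq_extremum)
  then show "integrable lebesgue (\<lambda>x. indicator K x *\<^sub>R c)"
    using K lmeasurable_compact[OF K] by (intro integrable_scaleR_left integrable_real_indicator) auto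
qed

lemma loc_integrable_add: "loc_integrable V f \<Longrightarrow> loc_integrable V g \<Longrightarrow> loc_integrable V (\<lambda>x. f x + g x)"
  unfolding loc_integrable_def by (auto intro: set_integral_add)

lemma loc_integrable_bounded_linear:
  assumes "bounded_linear L" "loc_integrable V f" shows "loc_integrable V (\<lambda>x. L (f x))"
  unfolding loc_integrable_def set_integrable_def
proof (intro allI impI, elim conjE)
  interpret bounded_linear L by fact
  fix K assume "compact K" "K \<subseteq> V"
  from integrable_bounded_linear[OF assms(1) loc_integrableD[OF assms(2) this]]
  show "integrable lebesgue (\<lambda>x. indicator K x *\<^sub>R L (f x))" by (simp add: scaleR)
qed

lemma loc_integrable_norm: "loc_integrable V f \<Longrightarrow> loc_integrable V (\<lambda>x. norm (f x))"
  unfolding loc_integrable_def set_integrable_def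
proof (intro allI impI, elim conjE)
  fix K assume "\<forall>K. compact K \<and> K \<subseteq> V \<longrightarrow> integrable lebesgue (\<lambda>x. indicator K x *\<^sub>R f x)" "compact K" "K \<subseteq> V"
  then have "integrable lebesgue (\<lambda>x. norm (indicator K x *\<^sub>R f x))" by (intro integrable_norm) auto
  then show "integrable lebesgue (\<lambda>x. indicator K x *\<^sub>R norm (f x))" by simp
qed

lemma integrable_test_supported:
  fixes w :: "'v::euclidean_space \<Rightarrow> 'w::euclidean_space"
  assumes w: "loc_integrable V w" and K: "compact K" "K \<subseteq> V" and \<phi>: "continuous_on UNIV \<phi>" "\<And>z. \<bar>\<phi> z\<bar> \<le> C"
  shows "integrable lebesgue (\<lambda>z. \<phi> z *\<^sub>R (indicator K z *\<^sub>R w z))"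
  by (rule integrable_bounded_scaleR[where C=C, OF loc_integrableD[OF w K]])
    (use \<phi> borel_measurable_continuous_onI[OF \<phi>(1)] in \<open>auto intro: measurable_completion\<close>)

lemma integrable_test:
  fixes w :: "'v::euclidean_space \<Rightarrow> 'w::euclidean_space"
  assumes \<eta>: "test_function V \<eta>" and w: "loc_integrable V w"
  shows "set_integrable lebesgue V (\<lambda>z. \<eta> z *\<^sub>R w z)"
    and "set_integrable lebesgue V (\<lambda>z. frechet_derivative \<eta> (at z) v *\<^sub>R w z)"
proof -
  obtain K \<eta>' C where K: "compact K" "K \<subseteq> V" and d: "\<And>z. (\<eta> has_derivative blinfun_apply (\<eta>' z)) (at z)"
    and c': "continuous_on UNIV \<eta>'" and z: "\<And>z. z \<notin> K \<Longrightarrow> \<eta> z = 0" "\<And>z. z \<notin> K \<Longrightarrow> \<eta>' z = 0"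
    and C: "\<And>z. \<bar>\<eta> z\<bar> \<le> C" "\<And>z. norm (\<eta>' z) \<le> C"
    and fr: "\<And>z. frechet_derivative \<eta> (at z) = blinfun_apply (\<eta>' z)" and c: "continuous_on UNIV \<eta>"
    by (rule test_functionE[OF \<eta>]) blast
  have "(\<lambda>z. indicator V z *\<^sub>R \<eta> z *\<^sub>R w z) = (\<lambda>z. \<eta> z *\<^sub>R (indicator K z *\<^sub>R w z))"
    using K z by (auto simp: fun_eq_iff indicator_def)
  then show "set_integrable lebesgue V (\<lambda>z. \<eta> z *\<^sub>R w z)"
    unfolding set_integrable_def using integrable_test_supported[OF w K c C(1)] by simp
  have b: "\<bar>\<eta>' z v\<bar> \<le> C * norm v" for z
    using norm_blinfun[of "\<eta>' z" v] mult_right_mono[OF C(2)[of z] norm_ge_zero[of v]] by simp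
  have c'v: "continuous_on UNIV (\<lambda>z. \<eta>' z v)" by (intro continuous_intros c')
  have "(\<lambda>z. indicator V z *\<^sub>R frechet_derivative \<eta> (at z) v *\<^sub>R w z) = (\<lambda>z. \<eta>' z v *\<^sub>R (indicator K z *\<^sub>R w z))"
    using K z by (auto simp: fun_eq_iff indicator_def fr)
  then show "set_integrable lebesgue V (\<lambda>z. frechet_derivative \<eta> (at z) v *\<^sub>R w z)"
    unfolding set_integrable_def using integrable_test_supported[OF w K c'v b] by simp
qed

section \<open>Algebra and uniqueness of weak directional derivatives\<close>

lemma weak_dderiv_add:
  assumes "weak_dderiv V v w G" "weak_dderiv V v w' G'"
  shows "weak_dderiv V v (\<lambda>z. w z + w' z) (\<lambda>z. G z + G' z)"
proof -
  have li: "loc_integrable V w" "loc_integrable V G" "loc_integrable V w'" "loc_integrable V G'"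
    using assms by (auto simp: weak_dderiv_def)
  show ?thesis
    unfolding weak_dderiv_def
  proof (intro conjI loc_integrable_add li allI impI)
    fix \<eta> assume \<eta>: "test_function V \<eta>"
    show "(LINT z:V|lebesgue. frechet_derivative \<eta> (at z) v *\<^sub>R (w z + w' z)) = - (LINT z:V|lebesgue. \<eta> z *\<^sub>R (G z + G' z))"
      using assms \<eta>
      by (simp add: weak_dderiv_def scaleR_add_right set_integral_add(2)[OF integrable_test(1)[OF \<eta> li(2)] integrable_test(1)[OF \<eta> li(4)]]
          set_integral_add(2)[OF integrable_test(2)[OF \<eta> li(1)] integrable_test(2)[OF \<eta> li(3)]])
  qed
qed

lemma weak_dderiv_zero: "weak_dderiv V v (\<lambda>_. 0) (\<lambda>_. 0)"
  by (auto simp: weak_dderiv_def loc_integrable_const)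

lemma weak_dderiv_bounded_linear:
  assumes L: "bounded_linear L" and w: "weak_dderiv V v w G"
  shows "weak_dderiv V v (\<lambda>z. L (w z)) (\<lambda>z. L (G z))"
proof -
  interpret bounded_linear L by fact
  have *: "(LINT z:V|lebesgue. \<phi> z *\<^sub>R L (f z)) = L (LINT z:V|lebesgue. \<phi> z *\<^sub>R f z)"
    if "set_integrable lebesgue V (\<lambda>z. \<phi> z *\<^sub>R f z)" for \<phi> f
    using integral_bounded_linear[OF L that[unfolded set_integrable_def]]
    by (simp add: set_lebesgue_integral_def scaleR)
  show ?thesis
    unfolding weak_dderiv_def
  proof (intro conjI allI impI)
    have li: "loc_integrable V w" "loc_integrable V G" using w by (auto simp: weak_dderiv_def)
    then show "loc_integrable V (\<lambda>z. L (w z))" "loc_integrable V (\<lambda>z. L (G z))"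
      by (auto intro: loc_integrable_bounded_linear[OF L])
    fix \<eta> assume \<eta>: "test_function V \<eta>"
    show "(LINT z:V|lebesgue. frechet_derivative \<eta> (at z) v *\<^sub>R L (w z)) = - (LINT z:V|lebesgue. \<eta> z *\<^sub>R L (G z))"
      using w \<eta> unfolding *[OF integrable_test(2)[OF \<eta> li(1)]] *[OF integrable_test(1)[OF \<eta> li(2)]]
      by (simp add: weak_dderiv_def neg)
  qed
qed

lemma weak_dderiv_sum:
  assumes "finite I" "\<And>i. i \<in> I \<Longrightarrow> weak_dderiv V v (w i) (G i)"
  shows "weak_dderiv V v (\<lambda>z. \<Sum>i\<in>I. w i z) (\<lambda>z. \<Sum>i\<in>I. G i z)"
  using assms by (induction I) (auto intro: weak_dderiv_zero weak_dderiv_add)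

lemma weak_dderiv_diff:
  assumes "weak_dderiv V v w G" "weak_dderiv V v w' G'"
  shows "weak_dderiv V v (\<lambda>z. w z - w' z) (\<lambda>z. G z - G' z)"
  using weak_dderiv_add[OF assms(1) weak_dderiv_bounded_linear[OF bounded_linear_minus[OF bounded_linear_ident] assms(2)]]
  by simp

text \<open>The approximants of w are identically zero, hence so are their classical derivatives,
  and these converge to G in L^1 on compact sets.\<close>

lemma weak_dderiv_unique_0:
  assumes V: "open V" and wd: "weak_dderiv V v w G" and w: "AE x in lebesgue. x \<in> V \<longrightarrow> w x = 0"
  shows "AE x in lebesgue. x \<in> V \<longrightarrow> G x = 0"
proof (rule AE_on_openI[OF V])
  fix K assume K: "compact K" "K \<subseteq> V"
  have li: "loc_integrable V G" using wd by (simp add: weak_dderiv_def)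
  obtain W DW where der: "\<And>k x. ((\<lambda>t. W k (x + t *\<^sub>R v)) has_vector_derivative DW k x) (at 0)"
    and "\<And>k. continuous_on UNIV (W k)" "\<And>k. continuous_on UNIV (DW k)"
    and "\<And>k. \<exists>C. \<forall>x. norm (W k x) \<le> C \<and> norm (DW k x) \<le> C"
    and "AE x in lebesgue. x \<in> K \<longrightarrow> (\<lambda>k. W k x) \<longlonglongrightarrow> w x"
    and "(\<lambda>k. \<integral>\<^sup>+x\<in>K. ennreal (norm (W k x - w x)) \<partial>lebesgue) \<longlonglongrightarrow> 0"
    and lim: "(\<lambda>k. \<integral>\<^sup>+x\<in>K. ennreal (norm (DW k x - G x)) \<partial>lebesgue) \<longlonglongrightarrow> 0"
    and "(AE x in lebesgue. x \<in> V \<longrightarrow> w x = 0) \<longrightarrow> (\<forall>k x. W k x = 0)"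
    by (rule weak_dderiv_approx[OF V wd K], rule that; assumption)
  then have W0: "W k x = 0" for k x using w by blast
  have DW0: "DW k x = 0" for k x
  proof -
    have "((\<lambda>t. 0) has_vector_derivative DW k x) (at 0)" using der[of k x] W0 by simp
    then show ?thesis using vector_derivative_unique_at[OF _ has_vector_derivative_const] by blast
  qed
  have "(\<integral>\<^sup>+x\<in>K. ennreal (norm (G x)) \<partial>lebesgue) = 0"
    using lim by (simp add: DW0 LIMSEQ_const_iff)
  moreover have "(\<integral>\<^sup>+x\<in>K. ennreal (norm (G x)) \<partial>lebesgue) = (\<integral>\<^sup>+x. ennreal (norm (indicator K x *\<^sub>R G x)) \<partial>lebesgue)"
    by (intro nn_integral_cong) (auto simp: indicator_def)
  ultimately have "AE x in lebesgue. ennreal (norm (indicator K x *\<^sub>R G x)) = 0"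
    by (subst nn_integral_0_iff_AE[symmetric])
      (simp_all only: measurable_compose[OF measurable_compose[OF loc_integrable_measurable[OF li K] borel_measurable_norm] measurable_ennreal])
  then show "AE x in lebesgue. x \<in> K \<longrightarrow> G x = 0" by eventually_elim auto
qed

lemma weak_dderiv_unique:
  assumes V: "open V" and "weak_dderiv V v w G" "weak_dderiv V v w' G'" "AE x in lebesgue. x \<in> V \<longrightarrow> w x = w' x"
  shows "AE x in lebesgue. x \<in> V \<longrightarrow> G x = G' x"
  using weak_dderiv_unique_0[OF V weak_dderiv_diff[OF assms(2,3)]] assms(4) by simp

lemma set_integral_test_cong_AE:
  fixes w w' :: "'v::euclidean_space \<Rightarrow> 'w::euclidean_space"
  assumes "set_integrable lebesgue V (\<lambda>z. \<phi> z *\<^sub>R w z)" "set_integrable lebesgue V (\<lambda>z. \<phi> z *\<^sub>R w' z)"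
    "AE x in lebesgue. x \<in> V \<longrightarrow> w x = w' x"
  shows "(LINT z:V|lebesgue. \<phi> z *\<^sub>R w z) = (LINT z:V|lebesgue. \<phi> z *\<^sub>R w' z)"
  unfolding set_lebesgue_integral_def
proof (rule integral_cong_AE)
  show "AE z in lebesgue. indicat_real V z *\<^sub>R \<phi> z *\<^sub>R w z = indicat_real V z *\<^sub>R \<phi> z *\<^sub>R w' z"
    using assms(3) by eventually_elim (auto simp: indicator_def)
qed (use assms(1,2) in \<open>auto simp: set_integrable_def\<close>)

lemma weak_dderiv_cong_AE:
  assumes wd: "weak_dderiv V v w G" and "AE x in lebesgue. x \<in> V \<longrightarrow> w x = w' x"
    "AE x in lebesgue. x \<in> V \<longrightarrow> G x = G' x"
  shows "weak_dderiv V v w' G'"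
proof -
  have li: "loc_integrable V w" "loc_integrable V G" using wd by (auto simp: weak_dderiv_def)
  have li': "loc_integrable V w'" "loc_integrable V G'"
    using loc_integrable_cong_AE li assms(2,3) by blast+
  show ?thesis
    unfolding weak_dderiv_def
  proof (intro conjI li' allI impI)
    fix \<eta> assume \<eta>: "test_function V \<eta>"
    have "(LINT z:V|lebesgue. frechet_derivative \<eta> (at z) v *\<^sub>R w' z) = (LINT z:V|lebesgue. frechet_derivative \<eta> (at z) v *\<^sub>R w z)"
      by (rule set_integral_test_cong_AE[symmetric]) (use integrable_test[OF \<eta>] li li' assms in auto)
    also have "\<dots> = - (LINT z:V|lebesgue. \<eta> z *\<^sub>R G z)" using wd \<eta> by (simp add: weak_dderiv_def)
    also have "(LINT z:V|lebesgue. \<eta> z *\<^sub>R G z) = (LINT z:V|lebesgue. \<eta> z *\<^sub>R G' z)"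
      by (rule set_integral_test_cong_AE) (use integrable_test[OF \<eta>] li li' assms in auto)
    finally show "(LINT z:V|lebesgue. frechet_derivative \<eta> (at z) v *\<^sub>R w' z) = - (LINT z:V|lebesgue. \<eta> z *\<^sub>R G' z)" .
  qed
qed

section \<open>Limits of weak directional derivatives\<close>

lemma loc_integrable_limit:
  fixes w :: "nat \<Rightarrow> 'v::euclidean_space \<Rightarrow> 'w::euclidean_space"
  assumes w: "\<And>k. loc_integrable V (w k)" and P: "loc_integrable V P"
    and lim: "AE x in lebesgue. x \<in> V \<longrightarrow> (\<lambda>k. w k x) \<longlonglongrightarrow> w' x"
    and le: "\<And>k. AE x in lebesgue. x \<in> V \<longrightarrow> norm (w k x) \<le> P x"
  shows "loc_integrable V w'"
proof (rule loc_integrable_bound[OF P])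
  fix K assume K: "compact K" "K \<subseteq> V"
  show "(\<lambda>x. indicator K x *\<^sub>R w' x) \<in> borel_measurable lebesgue"
  proof (rule lebesgue_measurable_AE_limit)
    show "(\<lambda>x. indicator K x *\<^sub>R w k x) \<in> borel_measurable lebesgue" for k
      using loc_integrable_measurable[OF w K] .
    show "AE x in lebesgue. (\<lambda>k. indicator K x *\<^sub>R w k x) \<longlonglongrightarrow> indicator K x *\<^sub>R w' x"
      using lim by eventually_elim (use K in \<open>auto simp: indicator_def\<close>)
  qed
next
  have "AE x in lebesgue. \<forall>k. x \<in> V \<longrightarrow> norm (w k x) \<le> P x"
    unfolding AE_all_countable using le by blast
  with lim show "AE x in lebesgue. x \<in> V \<longrightarrow> norm (w' x) \<le> P x"
  proof eventually_elim
    case (elim x)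
    then show ?case by (metis Lim_bounded tendsto_norm)
  qed
qed

lemma set_integral_test_limit:
  fixes w :: "nat \<Rightarrow> 'v::euclidean_space \<Rightarrow> 'w::euclidean_space"
  assumes w: "\<And>k. set_integrable lebesgue V (\<lambda>z. \<phi> z *\<^sub>R w k z)" "set_integrable lebesgue V (\<lambda>z. \<phi> z *\<^sub>R w' z)"
    and P: "set_integrable lebesgue V (\<lambda>z. \<phi> z *\<^sub>R (P z :: real))"
    and lim: "AE x in lebesgue. x \<in> V \<longrightarrow> (\<lambda>k. w k x) \<longlonglongrightarrow> w' x"
    and le: "\<And>k. AE x in lebesgue. x \<in> V \<longrightarrow> norm (w k x) \<le> P x"
  shows "(\<lambda>k. LINT z:V|lebesgue. \<phi> z *\<^sub>R w k z) \<longlonglongrightarrow> (LINT z:V|lebesgue. \<phi> z *\<^sub>R w' z)"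
  unfolding set_lebesgue_integral_def
proof (rule integral_dominated_convergence)
  show "integrable lebesgue (\<lambda>z. norm (indicat_real V z *\<^sub>R \<phi> z *\<^sub>R P z))"
    using P unfolding set_integrable_def by (rule integrable_norm)
  show "AE z in lebesgue. (\<lambda>k. indicat_real V z *\<^sub>R \<phi> z *\<^sub>R w k z) \<longlonglongrightarrow> indicat_real V z *\<^sub>R \<phi> z *\<^sub>R w' z"
    using lim by eventually_elim (auto simp: indicator_def intro!: tendsto_scaleR)
  show "AE z in lebesgue. norm (indicat_real V z *\<^sub>R \<phi> z *\<^sub>R w k z) \<le> norm (indicat_real V z *\<^sub>R \<phi> z *\<^sub>R P z)" for k
    using le[of k] by eventually_elim (auto simp: indicator_def abs_mult intro!: mult_left_mono)
qed (use w in \<open>auto simp: set_integrable_def\<close>)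

text \<open>Both sides of the defining identity pass to the limit by dominated convergence, the
  majorants being P and Q weighted by the test function or its derivative. It serves twice: for
  level sets, and for the limit of a Cauchy sequence of maps.\<close>

lemma weak_dderiv_limit:
  fixes w G :: "nat \<Rightarrow> 'v::euclidean_space \<Rightarrow> 'w::euclidean_space"
  assumes wd: "\<And>k. weak_dderiv V v (w k) (G k)" and P: "loc_integrable V P" and Q: "loc_integrable V Q"
    and lim: "AE x in lebesgue. x \<in> V \<longrightarrow> (\<lambda>k. w k x) \<longlonglongrightarrow> w' x" "AE x in lebesgue. x \<in> V \<longrightarrow> (\<lambda>k. G k x) \<longlonglongrightarrow> G' x"
    and le: "\<And>k. AE x in lebesgue. x \<in> V \<longrightarrow> norm (w k x) \<le> P x" "\<And>k. AE x in lebesgue. x \<in> V \<longrightarrow> norm (G k x) \<le> Q x"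
  shows "weak_dderiv V v w' G'"
proof -
  have li: "loc_integrable V (w k)" "loc_integrable V (G k)" for k using wd by (auto simp: weak_dderiv_def)
  have li': "loc_integrable V w'" "loc_integrable V G'"
    by (rule loc_integrable_limit[OF li(1) P lim(1) le(1)], rule loc_integrable_limit[OF li(2) Q lim(2) le(2)])
  show ?thesis
    unfolding weak_dderiv_def
  proof (intro conjI li' allI impI)
    fix \<eta> assume \<eta>: "test_function V \<eta>"
    have "(\<lambda>k. LINT z:V|lebesgue. frechet_derivative \<eta> (at z) v *\<^sub>R w k z) \<longlonglongrightarrow> (LINT z:V|lebesgue. frechet_derivative \<eta> (at z) v *\<^sub>R w' z)"
      by (rule set_integral_test_limit[where P=P]) (use integrable_test[OF \<eta>] integrable_test(2)[OF \<eta> P, of v] li li' P lim le in auto)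
    moreover have "(\<lambda>k. LINT z:V|lebesgue. \<eta> z *\<^sub>R G k z) \<longlonglongrightarrow> (LINT z:V|lebesgue. \<eta> z *\<^sub>R G' z)"
      by (rule set_integral_test_limit[where P=Q]) (use integrable_test(1)[OF \<eta>] integrable_test(1)[OF \<eta> Q] li li' Q lim le in auto)
    then have "(\<lambda>k. - (LINT z:V|lebesgue. \<eta> z *\<^sub>R G k z)) \<longlonglongrightarrow> - (LINT z:V|lebesgue. \<eta> z *\<^sub>R G' z)"
      by (rule tendsto_minus)
    moreover have "(\<lambda>k. LINT z:V|lebesgue. frechet_derivative \<eta> (at z) v *\<^sub>R w k z) = (\<lambda>k. - (LINT z:V|lebesgue. \<eta> z *\<^sub>R G k z))"
      using wd \<eta> by (auto simp: weak_dderiv_def)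
    ultimately show "(LINT z:V|lebesgue. frechet_derivative \<eta> (at z) v *\<^sub>R w' z) = - (LINT z:V|lebesgue. \<eta> z *\<^sub>R G' z)"
      by (simp only: LIMSEQ_unique)
  qed
qed

section \<open>Chain rule and derivatives on level sets\<close>

lemma ennreal_norm_integral_diff_le:
  fixes f g :: "'a \<Rightarrow> 'b::{banach, second_countable_topology}"
  assumes "integrable M f" "integrable M g"
  shows "ennreal (norm ((LINT x|M. f x) - (LINT x|M. g x))) \<le> (\<integral>\<^sup>+x. ennreal (norm (f x - g x)) \<partial>M)"
proof -
  have "(LINT x|M. f x) - (LINT x|M. g x) = (LINT x|M. f x - g x)" using assms by simp
  then show ?thesis using integral_norm_bound_ennreal[of M "\<lambda>x. f x - g x"] assms by simp
qed

lemma tendsto_ennreal_norm_diff: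
  fixes f g :: "nat \<Rightarrow> 'b::real_normed_vector"
  assumes "\<And>k. ennreal (norm (f k - g k)) \<le> e k" "e \<longlonglongrightarrow> 0" "g \<longlonglongrightarrow> l"
  shows "f \<longlonglongrightarrow> l"
proof -
  have "(\<lambda>k. ennreal (norm (f k - g k))) \<longlonglongrightarrow> 0"
    by (rule tendsto_sandwich[OF _ _ tendsto_const assms(2)]) (use assms(1) in auto)
  then have "(\<lambda>k. norm (f k - g k)) \<longlonglongrightarrow> 0"
    using tendsto_ennreal_iff[of "\<lambda>k. norm (f k - g k)" sequentially 0] by simp
  then have "(\<lambda>k. f k - g k) \<longlonglongrightarrow> 0" by (rule tendsto_norm_zero_cancel)
  from tendsto_add[OF this assms(3)] show ?thesis by simp
qed

text \<open>For a mollified W_k the product \<eta> h(W_k) is compactly supported and differentiable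
  along v, so the integral of its derivative vanishes. The two terms of the product rule,
  \<open>a\<close> and \<open>b\<close>, converge separately to the integrals in the identity for w.
  The bound on h' makes h Lipschitz and supplies all majorants.\<close>

theorem weak_dderiv_chain:
  fixes w G :: "'v::euclidean_space \<Rightarrow> 'w::euclidean_space" and h :: "'w \<Rightarrow> real"
  assumes V: "open V" and wd: "weak_dderiv V v w G"
    and h: "\<And>y. (h has_derivative blinfun_apply (h' y)) (at y)" "continuous_on UNIV h'" "\<And>y. norm (h' y) \<le> L"
  shows "weak_dderiv V v (\<lambda>z. h (w z)) (\<lambda>z. h' (w z) (G z))"
proof -
  have li: "loc_integrable V w" "loc_integrable V G" using wd by (auto simp: weak_dderiv_def)
  have L0: "0 \<le> L" using h(3)[of 0] norm_ge_zero order.trans by blast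
  have hc: "continuous_on UNIV h"
    by (intro continuous_at_imp_continuous_on ballI has_derivative_continuous[OF h(1)])
  have hm[measurable]: "h \<in> borel_measurable borel" by (rule borel_measurable_continuous_onI[OF hc])
  have hlip: "\<bar>h x - h y\<bar> \<le> L * norm (x - y)" for x y
    using bounded_derivative_Lipschitz[of h h' L x y] h by simp
  have h'c: "continuous_on UNIV (\<lambda>p. blinfun_apply (h' (fst p)) (snd p))"
    by (intro continuous_intros continuous_on_compose2[OF h(2)]) auto
  have h'm[measurable]: "(\<lambda>p. blinfun_apply (h' (fst p)) (snd p)) \<in> borel_measurable borel"
    by (rule borel_measurable_continuous_onI[OF h'c])
  have h'b: "\<bar>h' y g\<bar> \<le> L * norm g" for y g
    using norm_blinfun[of "h' y" g] mult_right_mono[OF h(3)[of y] norm_ge_zero[of g]] by simp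
  have h'meas: "(\<lambda>x. h' (f x) (g x)) \<in> borel_measurable lebesgue"
    if "f \<in> borel_measurable lebesgue" "g \<in> borel_measurable lebesgue" for f g :: "'v \<Rightarrow> 'w"
    using measurable_compose[OF borel_measurable_Pair[OF that] h'm] by simp
  have L1: "loc_integrable V (\<lambda>z. h (w z))"
  proof (rule loc_integrable_bound[where P="\<lambda>z. \<bar>h 0\<bar> + L * norm (w z)"])
    show "loc_integrable V (\<lambda>z. \<bar>h 0\<bar> + L * norm (w z))"
      by (intro loc_integrable_add loc_integrable_const loc_integrable_bounded_linear[OF bounded_linear_mult_right]
          loc_integrable_norm li)
    fix K assume K: "compact K" "K \<subseteq> V"
    have [measurable]: "K \<in> sets lebesgue" using K(1) lmeasurable_compact by auto
    have [measurable]: "(\<lambda>x. indicator K x *\<^sub>R w x) \<in> borel_measurable lebesgue" 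
      by (rule loc_integrable_measurable[OF li(1) K])
    \<comment> \<open>Only the product of w with the indicator is known to be measurable, so h is
      applied to that product; the outer indicator removes the value \<open>h 0\<close> off
      K.\<close>
    have "(\<lambda>x. indicator K x *\<^sub>R h (indicator K x *\<^sub>R w x)) \<in> borel_measurable lebesgue" by measurable
    moreover have "(\<lambda>x. indicator K x *\<^sub>R h (indicator K x *\<^sub>R w x)) = (\<lambda>x. indicator K x *\<^sub>R h (w x))"
      by (auto simp: fun_eq_iff indicator_def)
    ultimately show "(\<lambda>x. indicator K x *\<^sub>R h (w x)) \<in> borel_measurable lebesgue" by (simp only:)
  next
    show "AE x in lebesgue. x \<in> V \<longrightarrow> norm (h (w x)) \<le> \<bar>h 0\<bar> + L * norm (w x)"
    proof (intro AE_I2 impI)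
      fix x show "norm (h (w x)) \<le> \<bar>h 0\<bar> + L * norm (w x)" using hlip[of "w x" 0] by simp
    qed
  qed
  have mK: "(\<lambda>x. indicator K x *\<^sub>R h' (f x) (G x)) \<in> borel_measurable lebesgue"
    if K: "compact K" "K \<subseteq> V" and f: "(\<lambda>x. indicator K x *\<^sub>R f x) \<in> borel_measurable lebesgue" for K f
  proof -
    have "(\<lambda>x. h' (indicator K x *\<^sub>R f x) (indicator K x *\<^sub>R G x)) \<in> borel_measurable lebesgue"
      by (rule h'meas[OF f loc_integrable_measurable[OF li(2) K]])
    moreover have "(\<lambda>x. h' (indicator K x *\<^sub>R f x) (indicator K x *\<^sub>R G x)) = (\<lambda>x. indicator K x *\<^sub>R h' (f x) (G x))"
      by (auto simp: fun_eq_iff indicator_def)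
    ultimately show ?thesis by (simp only:)
  qed
  have Qli: "loc_integrable V (\<lambda>z. L * norm (G z))"
    by (intro loc_integrable_bounded_linear[OF bounded_linear_mult_right] loc_integrable_norm li)
  have L2: "loc_integrable V (\<lambda>z. h' (w z) (G z))"
    by (rule loc_integrable_bound[OF Qli]) (use mK loc_integrable_measurable[OF li(1)] h'b in auto)
  show ?thesis
    unfolding weak_dderiv_def
  proof (intro conjI L1 L2 allI impI)
    fix \<eta> assume \<eta>: "test_function V \<eta>"
    obtain K \<eta>' C where K: "compact K" "K \<subseteq> V" and d: "\<And>z. (\<eta> has_derivative blinfun_apply (\<eta>' z)) (at z)"
      and c': "continuous_on UNIV \<eta>'" and z: "\<And>z. z \<notin> K \<Longrightarrow> \<eta> z = 0" "\<And>z. z \<notin> K \<Longrightarrow> \<eta>' z = 0"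
      and C: "\<And>z. \<bar>\<eta> z\<bar> \<le> C" "\<And>z. norm (\<eta>' z) \<le> C"
      and fr: "\<And>z. frechet_derivative \<eta> (at z) = blinfun_apply (\<eta>' z)" and c: "continuous_on UNIV \<eta>"
      by (rule test_functionE[OF \<eta>]) blast
    have C0: "0 \<le> C" using C(1)[of 0] by linarith
    have \<eta>'b: "\<bar>\<eta>' z v\<bar> \<le> C * norm v" for z
      using norm_blinfun[of "\<eta>' z" v] mult_right_mono[OF C(2)[of z] norm_ge_zero[of v]] by simp
    have c'v: "continuous_on UNIV (\<lambda>z. \<eta>' z v)" by (intro continuous_intros c')
    obtain W DW :: "nat \<Rightarrow> 'v \<Rightarrow> 'w" where W: "\<And>k x. ((\<lambda>t. W k (x + t *\<^sub>R v)) has_vector_derivative DW k x) (at 0)"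
      "\<And>k. continuous_on UNIV (W k)" "\<And>k. continuous_on UNIV (DW k)"
      "\<And>k. \<exists>C. \<forall>x. norm (W k x) \<le> C \<and> norm (DW k x) \<le> C"
      "AE x in lebesgue. x \<in> K \<longrightarrow> (\<lambda>k. W k x) \<longlonglongrightarrow> w x"
      "(\<lambda>k. \<integral>\<^sup>+x\<in>K. ennreal (norm (W k x - w x)) \<partial>lebesgue) \<longlonglongrightarrow> 0"
      "(\<lambda>k. \<integral>\<^sup>+x\<in>K. ennreal (norm (DW k x - G x)) \<partial>lebesgue) \<longlonglongrightarrow> 0"
      by (rule weak_dderiv_approx[OF V wd K]) blast
    obtain R where R: "\<And>x. x \<in> K \<Longrightarrow> norm x < R"
      using compact_imp_bounded[OF K(1)] by (auto simp: bounded_pos_less)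
    define a where "a k x = \<eta> x * h' (W k x) (DW k x)" for k x
    define b where "b k x = \<eta>' x v * h (W k x)" for k x
    have ac: "continuous_on UNIV (a k)" for k
      unfolding a_def by (intro continuous_intros c continuous_on_compose2[OF h(2)] W) auto
    have bc: "continuous_on UNIV (b k)" for k
      unfolding b_def by (intro continuous_intros c'v continuous_on_compose2[OF hc] W) auto
    have int: "integrable lborel f" if "continuous_on UNIV f" "\<And>x. x \<notin> K \<Longrightarrow> f x = 0" for f :: "'v \<Rightarrow> real"
    proof -
      have "integrable lborel (\<lambda>x. indicator K x *\<^sub>R f x)"
        by (rule borel_integrable_compact[OF K(1)]) (rule continuous_on_subset[OF that(1)], simp)
      moreover have "(\<lambda>x. indicator K x *\<^sub>R f x) = f" using that(2) by (auto simp: fun_eq_iff indicator_def)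
      ultimately show ?thesis by simp
    qed
    have ai: "integrable lborel (a k)" for k by (rule int[OF ac]) (simp add: a_def z)
    have bi: "integrable lborel (b k)" for k by (rule int[OF bc]) (simp add: b_def z)
    have sum0: "(LINT x|lborel. a k x) + (LINT x|lborel. b k x) = 0" for k
    proof -
      obtain Ck where Ck: "\<And>x. norm (W k x) \<le> Ck" "\<And>x. norm (DW k x) \<le> Ck" using W(4)[of k] by auto
      have Ck0: "0 \<le> Ck" using Ck(1)[of 0] norm_ge_zero order.trans by blast
      have "(LINT x|lborel. a k x + b k x) = 0"
      proof (rule integral_directional_derivative_eq_0[where \<psi>="\<lambda>x. \<eta> x * h (W k x)" and v=v and R=R
            and C="C * (L * Ck) + C * norm v * (\<bar>h 0\<bar> + L * Ck)"])
        show "continuous_on UNIV (\<lambda>x. \<eta> x * h (W k x))"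
          by (intro continuous_intros c continuous_on_compose2[OF hc] W) auto
        show "\<eta> x * h (W k x) = 0" if "R \<le> norm x" for x using R[of x] z(1)[of x] that by force
        show "((\<lambda>t. \<eta> (x + t *\<^sub>R v) * h (W k (x + t *\<^sub>R v))) has_real_derivative a k x + b k x) (at 0)" for x
        proof -
          have 1: "((\<lambda>t. \<eta> (x + t *\<^sub>R v)) has_real_derivative \<eta>' x v) (at 0)"
            using has_derivative_directional[of \<eta> "\<eta>' x" x 0 v] d[of x]
            by (simp add: has_real_derivative_iff_has_vector_derivative)
          have 2: "((\<lambda>t. h (W k (x + t *\<^sub>R v))) has_real_derivative h' (W k x) (DW k x)) (at 0)"
            using vector_derivative_diff_chain_within[of "\<lambda>t. W k (x + t *\<^sub>R v)" "DW k x" 0 UNIV h "h' (W k x)"]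
              W(1)[of k x] h(1)[of "W k x"]
            by (simp add: has_real_derivative_iff_has_vector_derivative o_def has_derivative_at_withinI)
          show ?thesis using DERIV_mult[OF 1 2] by (simp add: a_def b_def algebra_simps)
        qed
        show "\<bar>a k x + b k x\<bar> \<le> C * (L * Ck) + C * norm v * (\<bar>h 0\<bar> + L * Ck)" for x
        proof -
          have "\<bar>h' (W k x) (DW k x)\<bar> \<le> L * Ck"
            using h'b[of "W k x" "DW k x"] mult_left_mono[OF Ck(2)[of x] L0] by linarith
          then have 1: "\<bar>a k x\<bar> \<le> C * (L * Ck)"
            unfolding a_def abs_mult using C(1)[of x] C0 by (intro mult_mono) auto
          have "\<bar>h (W k x)\<bar> \<le> \<bar>h 0\<bar> + L * Ck"
            using hlip[of "W k x" 0] mult_left_mono[OF Ck(1)[of x] L0] by simp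
          then have 2: "\<bar>b k x\<bar> \<le> C * norm v * (\<bar>h 0\<bar> + L * Ck)"
            unfolding b_def abs_mult using \<eta>'b[of x] C0 by (intro mult_mono) auto
          show ?thesis using 1 2 by linarith
        qed
      qed
      then show ?thesis using ai bi by simp
    qed
    have Al: "(LINT x|lborel. a k x) = (LINT x|lebesgue. a k x)" "(LINT x|lborel. b k x) = (LINT x|lebesgue. b k x)" for k
      using borel_measurable_continuous_onI[OF ac] borel_measurable_continuous_onI[OF bc] by (simp_all add: integral_completion)
    have ail: "integrable lebesgue (a k)" and bil: "integrable lebesgue (b k)" for k
      using ai bi borel_measurable_continuous_onI[OF ac] borel_measurable_continuous_onI[OF bc] by (simp_all add: integrable_completion)
    define A where "A = (LINT z|lebesgue. \<eta> z *\<^sub>R (indicator K z *\<^sub>R h' (w z) (G z)))"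
    define B where "B = (LINT z|lebesgue. \<eta>' z v *\<^sub>R (indicator K z *\<^sub>R h (w z)))"
    have Kl[measurable]: "K \<in> sets lebesgue" using K(1) lmeasurable_compact by auto
    have Wm: "W k \<in> borel_measurable lebesgue" for k
      by (rule measurable_completion) (simp add: borel_measurable_continuous_onI[OF W(2)])
    have WKm: "(\<lambda>x. indicator K x *\<^sub>R W k x) \<in> borel_measurable lebesgue" for k
      using Wm by measurable
    have wm: "(\<lambda>x. norm (W k x - w x) * indicator K x) \<in> borel_measurable lebesgue" for k
    proof -
      have "(\<lambda>x. norm (indicator K x *\<^sub>R W k x - indicator K x *\<^sub>R w x)) \<in> borel_measurable lebesgue"
        using WKm[of k] loc_integrable_measurable[OF li(1) K] by measurable
      moreover have "(\<lambda>x. norm (indicator K x *\<^sub>R W k x - indicator K x *\<^sub>R w x)) = (\<lambda>x. norm (W k x - w x) * indicator K x)"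
        by (auto simp: fun_eq_iff indicator_def)
      ultimately show ?thesis by simp
    qed
    have wm': "(\<lambda>x. norm (DW k x - G x) * indicator K x) \<in> borel_measurable lebesgue" for k
    proof -
      have "DW k \<in> borel_measurable lebesgue"
        by (rule measurable_completion) (simp add: borel_measurable_continuous_onI[OF W(3)])
      then have "(\<lambda>x. norm (indicator K x *\<^sub>R DW k x - indicator K x *\<^sub>R G x)) \<in> borel_measurable lebesgue"
        using loc_integrable_measurable[OF li(2) K] by measurable
      moreover have "(\<lambda>x. norm (indicator K x *\<^sub>R DW k x - indicator K x *\<^sub>R G x)) = (\<lambda>x. norm (DW k x - G x) * indicator K x)"
        by (auto simp: fun_eq_iff indicator_def)
      ultimately show ?thesis by simp
    qed
    have enK: "(\<integral>\<^sup>+x. ennreal M * ennreal (f x * indicator K x) \<partial>lebesgue) = ennreal M * (\<integral>\<^sup>+x\<in>K. ennreal (f x) \<partial>lebesgue)"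
      if "(\<lambda>x. f x * indicator K x) \<in> borel_measurable lebesgue" for f and M :: real
    proof -
      have "(\<integral>\<^sup>+x. ennreal M * ennreal (f x * indicator K x) \<partial>lebesgue) = ennreal M * (\<integral>\<^sup>+x. ennreal (f x * indicator K x) \<partial>lebesgue)"
        by (rule nn_integral_cmult) (use that in measurable)
      also have "(\<integral>\<^sup>+x. ennreal (f x * indicator K x) \<partial>lebesgue) = (\<integral>\<^sup>+x\<in>K. ennreal (f x) \<partial>lebesgue)"
        by (intro nn_integral_cong) (auto simp: indicator_def)
      finally show ?thesis .
    qed
    have "(\<lambda>k. LINT x|lebesgue. b k x) \<longlonglongrightarrow> B"
    proof (rule tendsto_ennreal_norm_diff[OF _ _ tendsto_const])
      fix k
      have "ennreal (norm ((LINT x|lebesgue. b k x) - B)) \<le> (\<integral>\<^sup>+x. ennreal (norm (b k x - \<eta>' x v *\<^sub>R (indicator K x *\<^sub>R h (w x)))) \<partial>lebesgue)"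
        unfolding B_def
        by (rule ennreal_norm_integral_diff_le[OF bil]) (rule integrable_test_supported[OF L1 K c'v \<eta>'b])
      also have "\<dots> \<le> (\<integral>\<^sup>+x. ennreal (C * norm v * L) * ennreal (norm (W k x - w x) * indicator K x) \<partial>lebesgue)"
      proof (intro nn_integral_mono)
        fix x
        have "norm (b k x - \<eta>' x v *\<^sub>R (indicator K x *\<^sub>R h (w x))) \<le> (C * norm v * L) * (norm (W k x - w x) * indicator K x)"
        proof (cases "x \<in> K")
          case True
          have "norm (b k x - \<eta>' x v *\<^sub>R (indicator K x *\<^sub>R h (w x))) = \<bar>\<eta>' x v\<bar> * \<bar>h (W k x) - h (w x)\<bar>"
            using True by (simp add: b_def abs_mult[symmetric] algebra_simps)
          also have "\<dots> \<le> (C * norm v) * (L * norm (W k x - w x))"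
            using \<eta>'b[of x] hlip[of "W k x" "w x"] C0 by (intro mult_mono) auto
          finally show ?thesis using True by (simp add: mult_ac)
        qed (simp add: b_def z)
        then show "ennreal (norm (b k x - \<eta>' x v *\<^sub>R (indicator K x *\<^sub>R h (w x)))) \<le> ennreal (C * norm v * L) * ennreal (norm (W k x - w x) * indicator K x)"
          using C0 L0 by (auto simp flip: ennreal_mult intro!: ennreal_leI)
      qed
      also have "\<dots> = ennreal (C * norm v * L) * (\<integral>\<^sup>+x\<in>K. ennreal (norm (W k x - w x)) \<partial>lebesgue)"
        by (rule enK[OF wm])
      finally show "ennreal (norm ((LINT x|lebesgue. b k x) - B)) \<le> ennreal (C * norm v * L) * (\<integral>\<^sup>+x\<in>K. ennreal (norm (W k x - w x)) \<partial>lebesgue)" .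
    next
      show "(\<lambda>k. ennreal (C * norm v * L) * (\<integral>\<^sup>+x\<in>K. ennreal (norm (W k x - w x)) \<partial>lebesgue)) \<longlonglongrightarrow> 0"
        using tendsto_mult_ennreal[OF tendsto_const W(6), of "ennreal (C * norm v * L)"] by simp
    qed
    moreover have "(\<lambda>k. LINT x|lebesgue. a k x) \<longlonglongrightarrow> A"
    proof (rule tendsto_ennreal_norm_diff)
      fix k
      \<comment> \<open>The intermediate term still has W_k inside h' but already G as derivative.
        As h' is merely continuous, the derivative is replaced first, in L^1, and the argument of h'
        afterwards, by pointwise convergence under a fixed majorant.\<close>
      let ?m = "\<lambda>x. \<eta> x *\<^sub>R (indicator K x *\<^sub>R h' (W k x) (G x))"
      have liW: "set_integrable lebesgue K (\<lambda>x. h' (W k x) (G x))"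
        unfolding set_integrable_def
        by (rule Bochner_Integration.integrable_bound[OF loc_integrableD[OF Qli K] mK[OF K WKm]])
          (use h'b L0 in \<open>auto simp: indicator_def\<close>)
      have mi: "integrable lebesgue ?m"
        by (rule integrable_bounded_scaleR[where C=C, OF liW[unfolded set_integrable_def]])
          (use C borel_measurable_continuous_onI[OF c] in \<open>auto intro: measurable_completion\<close>)
      have "ennreal (norm ((LINT x|lebesgue. a k x) - (LINT x|lebesgue. ?m x))) \<le> (\<integral>\<^sup>+x. ennreal (norm (a k x - ?m x)) \<partial>lebesgue)"
        by (rule ennreal_norm_integral_diff_le[OF ail mi])
      also have "\<dots> \<le> (\<integral>\<^sup>+x. ennreal (C * L) * ennreal (norm (DW k x - G x) * indicator K x) \<partial>lebesgue)"
      proof (intro nn_integral_mono)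
        fix x
        have "norm (a k x - ?m x) \<le> (C * L) * (norm (DW k x - G x) * indicator K x)"
        proof (cases "x \<in> K")
          case True
          have "norm (a k x - ?m x) = \<bar>\<eta> x\<bar> * \<bar>h' (W k x) (DW k x - G x)\<bar>"
            using True by (simp add: a_def abs_mult[symmetric] algebra_simps blinfun.diff_right)
          also have "\<dots> \<le> C * (L * norm (DW k x - G x))"
            using C(1)[of x] h'b[of "W k x" "DW k x - G x"] C0 by (intro mult_mono) auto
          finally show ?thesis using True by (simp add: mult_ac)
        qed (simp add: a_def z)
        then show "ennreal (norm (a k x - ?m x)) \<le> ennreal (C * L) * ennreal (norm (DW k x - G x) * indicator K x)"
          using C0 L0 by (auto simp flip: ennreal_mult intro!: ennreal_leI)
      qed
      also have "\<dots> = ennreal (C * L) * (\<integral>\<^sup>+x\<in>K. ennreal (norm (DW k x - G x)) \<partial>lebesgue)"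
        by (rule enK[OF wm'])
      finally show "ennreal (norm ((LINT x|lebesgue. a k x) - (LINT x|lebesgue. ?m x))) \<le> ennreal (C * L) * (\<integral>\<^sup>+x\<in>K. ennreal (norm (DW k x - G x)) \<partial>lebesgue)" .
    next
      show "(\<lambda>k. ennreal (C * L) * (\<integral>\<^sup>+x\<in>K. ennreal (norm (DW k x - G x)) \<partial>lebesgue)) \<longlonglongrightarrow> 0"
        using tendsto_mult_ennreal[OF tendsto_const W(7), of "ennreal (C * L)"] by simp
    next
      show "(\<lambda>k. LINT x|lebesgue. \<eta> x *\<^sub>R (indicator K x *\<^sub>R h' (W k x) (G x))) \<longlonglongrightarrow> A"
        unfolding A_def
      proof (rule integral_dominated_convergence[where w="\<lambda>x. C * (indicator K x *\<^sub>R (L * norm (G x)))"])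
        have \<eta>m: "\<eta> \<in> borel_measurable lebesgue"
          using borel_measurable_continuous_onI[OF c] by (auto intro: measurable_completion)
        show "(\<lambda>x. \<eta> x *\<^sub>R indicator K x *\<^sub>R h' (w x) (G x)) \<in> borel_measurable lebesgue"
          by (rule borel_measurable_scaleR[OF \<eta>m mK[OF K loc_integrable_measurable[OF li(1) K]]])
        show "(\<lambda>x. \<eta> x *\<^sub>R indicator K x *\<^sub>R h' (W k x) (G x)) \<in> borel_measurable lebesgue" for k
          by (rule borel_measurable_scaleR[OF \<eta>m mK[OF K WKm]])
        show "integrable lebesgue (\<lambda>x. C * (indicator K x *\<^sub>R (L * norm (G x))))"
          using loc_integrableD[OF Qli K] by simp
        show "AE x in lebesgue. (\<lambda>k. \<eta> x *\<^sub>R indicator K x *\<^sub>R h' (W k x) (G x)) \<longlonglongrightarrow> \<eta> x *\<^sub>R indicator K x *\<^sub>R h' (w x) (G x)"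
          using W(5)
        proof eventually_elim
          case (elim x)
          show ?case
          proof (cases "x \<in> K")
            case True
            have "isCont h' (w x)" using h(2) by (simp add: continuous_on_eq_continuous_at)
            then have "(\<lambda>k. h' (W k x)) \<longlonglongrightarrow> h' (w x)"
              by (rule isCont_tendsto_compose) (use elim True in simp)
            then show ?thesis by (intro tendsto_intros)
          qed simp
        qed
        show "AE x in lebesgue. norm (\<eta> x *\<^sub>R indicator K x *\<^sub>R h' (W k x) (G x)) \<le> C * (indicator K x *\<^sub>R (L * norm (G x)))" for k
        proof (intro AE_I2)
          fix x show "norm (\<eta> x *\<^sub>R indicator K x *\<^sub>R h' (W k x) (G x)) \<le> C * (indicator K x *\<^sub>R (L * norm (G x)))"
            using mult_mono[OF C(1)[of x] h'b[of "W k x" "G x"]] C0 by (auto simp: indicator_def abs_mult)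
        qed
      qed
    qed
    ultimately have "(\<lambda>k. (LINT x|lebesgue. a k x) + (LINT x|lebesgue. b k x)) \<longlonglongrightarrow> A + B"
      by (intro tendsto_add)
    then have "A + B = 0" using sum0 by (simp add: Al[symmetric] LIMSEQ_const_iff)
    moreover have "(LINT z:V|lebesgue. \<eta> z *\<^sub>R h' (w z) (G z)) = A"
      unfolding A_def by (rule set_integral_supported[OF K(2) z(1)])
    moreover have "(LINT z:V|lebesgue. frechet_derivative \<eta> (at z) v *\<^sub>R h (w z)) = B"
      unfolding B_def fr by (rule set_integral_supported[OF K(2)]) (simp add: z)
    ultimately show "(LINT z:V|lebesgue. frechet_derivative \<eta> (at z) v *\<^sub>R h (w z)) = - (LINT z:V|lebesgue. \<eta> z *\<^sub>R h' (w z) (G z))"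
      by simp
  qed
qed

text \<open>Compose w with arctan((n+1) t)/(n+1). These functions tend to zero, while their
  derivatives 1/(1 + ((n+1) t)^2) are at most one and tend to the indicator of t = 0. In the limit
  the zero function has a weak derivative equal to G where w = 0 and to zero elsewhere, and
  uniqueness applies.\<close>

theorem weak_dderiv_zero_set:
  fixes w :: "'v::euclidean_space \<Rightarrow> real"
  assumes V: "open V" and wd: "weak_dderiv V v w G"
  shows "AE x in lebesgue. x \<in> V \<longrightarrow> w x = 0 \<longrightarrow> G x = 0"
proof -
  define h where "h n t = arctan (real (Suc n) * t) / real (Suc n)" for n t
  define h' where "h' n t = (1 / (1 + (real (Suc n) * t)\<^sup>2)) *\<^sub>R (id_blinfun :: real \<Rightarrow>\<^sub>L real)" for n t
  have pos: "1 + (real (Suc n) * t)\<^sup>2 > 0" for n t by (rule add_pos_nonneg) auto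
  have wn: "weak_dderiv V v (\<lambda>z. h n (w z)) (\<lambda>z. h' n (w z) (G z))" for n
  proof (rule weak_dderiv_chain[OF V wd, where L=1])
    show "(h n has_derivative blinfun_apply (h' n y)) (at y)" for y
    proof -
      have "(h n has_real_derivative (inverse (1 + (real (Suc n) * y)\<^sup>2) * (real (Suc n))) / real (Suc n)) (at y)"
        unfolding h_def by (intro derivative_eq_intros refl | simp del: of_nat_Suc)+
      moreover have "(*) ((inverse (1 + (real (Suc n) * y)\<^sup>2) * (real (Suc n))) / real (Suc n)) = blinfun_apply (h' n y)"
        by (auto simp: fun_eq_iff h'_def blinfun.scaleR_left divide_inverse)
      ultimately show ?thesis by (simp add: has_field_derivative_def)
    qed
    show "continuous_on UNIV (h' n)"
      unfolding h'_def using pos[of n] by (intro continuous_intros ballI) (metis less_irrefl)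
    show "norm (h' n y) \<le> 1" for y
      unfolding h'_def using pos[of n y] by (simp add: norm_blinfun_id)
  qed
  have li: "loc_integrable V (\<lambda>z. norm (G z))" using wd unfolding weak_dderiv_def using loc_integrable_norm by blast
  have lim1: "(\<lambda>n. h n t) \<longlonglongrightarrow> 0" for t
  proof (rule Lim_null_comparison[where g="\<lambda>n. 2 * inverse (real (Suc n))"])
    show "\<forall>\<^sub>F n in sequentially. norm (h n t) \<le> 2 * inverse (real (Suc n))"
    proof (intro always_eventually allI)
      fix n
      have "\<bar>arctan (real (Suc n) * t)\<bar> \<le> 2"
        using arctan_bounded[of "real (Suc n) * t"] pi_less_4 by linarith
      then show "norm (h n t) \<le> 2 * inverse (real (Suc n))"
        by (simp add: h_def divide_inverse abs_mult mult_right_mono del: of_nat_Suc)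
    qed
    show "(\<lambda>n. 2 * inverse (real (Suc n))) \<longlonglongrightarrow> 0"
      using tendsto_mult[OF tendsto_const LIMSEQ_inverse_real_of_nat, of 2] by simp
  qed
  have lim2: "(\<lambda>n. h' n t g) \<longlonglongrightarrow> (if t = 0 then g else 0)" for t g
  proof (cases "t = 0")
    case False
    have "filterlim (\<lambda>n. real (Suc n)) at_top sequentially"
      using filterlim_compose[OF filterlim_real_sequentially filterlim_Suc] by simp
    then have "filterlim (\<lambda>n. (real (Suc n))\<^sup>2) at_top sequentially"
      by (intro filterlim_pow_at_top) auto
    then have "filterlim (\<lambda>n. t\<^sup>2 * (real (Suc n))\<^sup>2) at_top sequentially"
      by (intro filterlim_tendsto_pos_mult_at_top[OF tendsto_const]) (use False in auto)
    then have "filterlim (\<lambda>n. 1 + t\<^sup>2 * (real (Suc n))\<^sup>2) at_top sequentially"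
      by (intro filterlim_tendsto_add_at_top[OF tendsto_const])
    then have "(\<lambda>n. inverse (1 + t\<^sup>2 * (real (Suc n))\<^sup>2)) \<longlonglongrightarrow> 0"
      by (rule tendsto_inverse_0_at_top)
    from tendsto_mult[OF this tendsto_const[of g]] show ?thesis
      using False by (simp add: h'_def blinfun.scaleR_left divide_inverse power_mult_distrib mult_ac del: of_nat_Suc)
  qed (simp add: h'_def blinfun.scaleR_left)
  have "weak_dderiv V v (\<lambda>z. 0) (\<lambda>z. if w z = 0 then G z else 0)"
  proof (rule weak_dderiv_limit[OF wn loc_integrable_const[of V 2] li])
    show "AE x in lebesgue. x \<in> V \<longrightarrow> (\<lambda>n. h n (w x)) \<longlonglongrightarrow> 0" using lim1 by simp
    show "AE x in lebesgue. x \<in> V \<longrightarrow> (\<lambda>n. h' n (w x) (G x)) \<longlonglongrightarrow> (if w x = 0 then G x else 0)" using lim2 by blast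
    show "AE x in lebesgue. x \<in> V \<longrightarrow> norm (h n (w x)) \<le> 2" for n
    proof (intro AE_I2 impI)
      fix x
      have "\<bar>arctan (real (Suc n) * w x)\<bar> \<le> 2"
        using arctan_bounded[of "real (Suc n) * w x"] pi_less_4 by linarith
      then show "norm (h n (w x)) \<le> 2"
        by (simp add: h_def divide_le_eq abs_mult)
    qed
    show "AE x in lebesgue. x \<in> V \<longrightarrow> norm (h' n (w x) (G x)) \<le> norm (G x)" for n
    proof (intro AE_I2 impI)
      fix x
      show "norm (h' n (w x) (G x)) \<le> norm (G x)"
        using pos[of n "w x"] by (simp add: h'_def blinfun.scaleR_left divide_le_eq mult_left_mono abs_mult mult_le_cancel_left1 del: of_nat_Suc)
    qed
  qed
  then have "AE x in lebesgue. x \<in> V \<longrightarrow> (if w x = 0 then G x else 0) = 0"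
    by (rule weak_dderiv_unique_0[OF V]) simp
  then show ?thesis by eventually_elim auto
qed

section \<open>Change of variables over an arbitrary finite index type\<close>

text \<open>The change of variables theorem of the library needs a well-ordered index type. The type
  \<open>'m ranked\<close> has as many elements as \<open>'m\<close> and is well-ordered; the theorem is transported along a
  bijection between the two.\<close>

typedef (overloaded) ('m::finite) ranked = "{..<CARD('m)}"
  morphisms rank_of Ranked
  by (rule exI[of _ 0]) simp

instantiation ranked :: (finite) linorder
begin
definition less_eq_ranked :: "'a ranked \<Rightarrow> 'a ranked \<Rightarrow> bool"
  where "less_eq_ranked x y \<longleftrightarrow> rank_of x \<le> rank_of y"
definition less_ranked :: "'a ranked \<Rightarrow> 'a ranked \<Rightarrow> bool"
  where "less_ranked x y \<longleftrightarrow> rank_of x < rank_of y"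
instance
  by standard (auto simp: less_eq_ranked_def less_ranked_def rank_of_inject)
end

instance ranked :: (finite) wellorder
proof
  fix P :: "'a ranked \<Rightarrow> bool" and a
  assume *: "\<And>x. (\<And>y. y < x \<Longrightarrow> P y) \<Longrightarrow> P x"
  show "P a"
    by (induction a rule: measure_induct_rule[where f=rank_of]) (use * in \<open>auto simp: less_ranked_def\<close>)
qed

lemma bij_betw_rank_of: "bij_betw (rank_of :: 'm::finite ranked \<Rightarrow> nat) UNIV {..<CARD('m)}"
  unfolding bij_betw_def using type_definition.Rep_range[OF type_definition_ranked]
  by (auto simp: inj_on_def rank_of_inject)

instance ranked :: (finite) finite
proof
  show "finite (UNIV :: 'a ranked set)"
    using bij_betw_finite[OF bij_betw_rank_of] by simp
qed

lemma CARD_ranked: "CARD('m::finite ranked) = CARD('m)"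
  using bij_betw_same_card[OF bij_betw_rank_of[where 'm='m]] by simp

lemma ranked_bij_exists: "\<exists>e :: 'm::finite ranked \<Rightarrow> 'm. bij e"
  by (rule finite_same_card_bij) (auto simp: CARD_ranked)

section \<open>Renaming coordinates along a bijection\<close>

lemma sign_conj:
  fixes e :: "'i::finite \<Rightarrow> 'j::finite"
  assumes e: "bij e" and p: "p permutes UNIV"
  shows "sign (e \<circ> p \<circ> inv e) = sign p"
proof -
  have "map_permutation UNIV e p = e \<circ> p \<circ> inv e"
    using bij_is_surj[OF e] by (auto simp: map_permutation_def fun_eq_iff)
  then show ?thesis
    using sign_map_permutation[OF _ p, of e] bij_is_inj[OF e] by simp
qed

text \<open>Conjugation by e carries the permutations of one index type to those of the other and
  keeps signs, so the Leibniz sums agree term by term.\<close>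

lemma det_reindex:
  fixes A :: "real^'j::finite^'j" and e :: "'i::finite \<Rightarrow> 'j"
  assumes e: "bij e"
  shows "det (\<chi> i j. A $ e i $ e j) = det A"
proof -
  let ?c = "\<lambda>p. e \<circ> p \<circ> inv e"
  have inv: "inv e (e x) = x" "e (inv e y) = y" for x y
    using e by (simp_all add: bij_is_inj bij_is_surj surj_f_inv_f)
  have bij: "bij_betw ?c {p. p permutes UNIV} {p. p permutes UNIV}"
  proof (rule bij_betwI[where g="\<lambda>p. inv e \<circ> p \<circ> e"])
    show "?c \<in> {p. p permutes UNIV} \<rightarrow> {p. p permutes UNIV}"
      using e by (auto simp: permutes_univ bij_iff[symmetric] bij_comp bij_imp_bij_inv)
    show "(\<lambda>p. inv e \<circ> p \<circ> e) \<in> {p. p permutes UNIV} \<rightarrow> {p. p permutes UNIV}"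
      using e by (auto simp: permutes_univ bij_iff[symmetric] bij_comp bij_imp_bij_inv)
  qed (simp_all add: fun_eq_iff inv)
  have "det A = (\<Sum>p\<in>{p. p permutes UNIV}. of_int (sign (?c p)) * (\<Prod>i\<in>UNIV. A $ i $ ?c p i))"
    unfolding det_def by (rule sum.reindex_bij_betw[OF bij, symmetric])
  also have "\<dots> = (\<Sum>p\<in>{p. p permutes UNIV}. of_int (sign p) * (\<Prod>i\<in>UNIV. A $ e i $ e (p i)))"
  proof (rule sum.cong[OF refl])
    fix p :: "'i \<Rightarrow> 'i" assume "p \<in> {p. p permutes UNIV}"
    then have s: "sign (?c p) = sign p" using sign_conj[OF e] by auto
    have "(\<Prod>i\<in>UNIV. A $ i $ ?c p i) = (\<Prod>i\<in>UNIV. A $ e i $ ?c p (e i))"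
      by (rule prod.reindex_bij_betw[OF e, symmetric])
    then show "of_int (sign (?c p)) * (\<Prod>i\<in>UNIV. A $ i $ ?c p i) = of_int (sign p) * (\<Prod>i\<in>UNIV. A $ e i $ e (p i))"
      by (simp add: s inv)
  qed
  finally show ?thesis by (simp add: det_def)
qed

definition reindex :: "('i \<Rightarrow> 'j) \<Rightarrow> real^'j \<Rightarrow> real^'i"
  where "reindex e x = (\<chi> i. x $ e i)"

lemma reindex_reindex: "bij e \<Longrightarrow> reindex (inv e) (reindex e x) = x"
  by (simp add: reindex_def vec_eq_iff bij_is_surj surj_f_inv_f)

lemma reindex_reindex': "bij e \<Longrightarrow> reindex e (reindex (inv e) x) = x"
  by (simp add: reindex_def vec_eq_iff bij_is_inj)

lemma bounded_linear_reindex: "bounded_linear (reindex e :: real^'j::finite \<Rightarrow> real^'i::finite)"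
  by (rule linear_conv_bounded_linear[THEN iffD1]) (auto intro!: linearI simp: reindex_def vec_eq_iff)

lemma reindex_measurable[measurable]: "(reindex e :: real^'j::finite \<Rightarrow> real^'i::finite) \<in> borel_measurable borel"
  by (intro borel_measurable_continuous_onI linear_continuous_on bounded_linear_reindex)

text \<open>Preimages of boxes are boxes with the same edge lengths in another order, and the
  measures of boxes determine Lebesgue measure.\<close>

lemma lborel_distr_reindex:
  fixes e :: "'i::finite \<Rightarrow> 'j::finite"
  assumes e: "bij e"
  shows "distr lborel borel (reindex e) = lborel"
proof (rule lborel_eqI[symmetric])
  fix l u :: "real^'i" assume lu: "\<And>b. b \<in> Basis \<Longrightarrow> l \<bullet> b \<le> u \<bullet> b"
  then have lu': "l $ i \<le> u $ i" for i using lu[of "axis i 1"] by (simp add: axis_in_Basis_iff cart_eq_inner_axis)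
  have inv: "inv e (e x) = x" "e (inv e y) = y" for x y
    using e by (simp_all add: bij_is_inj bij_is_surj surj_f_inv_f)
  have ax: "axis i (1::real) = axis j 1 \<longleftrightarrow> i = j" for i j :: "'k::finite" by (simp add: axis_eq_axis)
  have BI: "(\<Prod>b\<in>Basis. v \<bullet> b) = (\<Prod>i\<in>UNIV. v $ i)" for v :: "real^'k::finite"
  proof -
    have "bij_betw (\<lambda>i::'k. axis i (1::real)) UNIV Basis"
      by (auto simp: bij_betw_def inj_on_def ax Basis_vec_def)
    from prod.reindex_bij_betw[OF this, of "\<lambda>b. v \<bullet> b"] show ?thesis
      by (simp add: cart_eq_inner_axis)
  qed
  have vim: "reindex e -` box l u = box (reindex (inv e) l) (reindex (inv e) u)"
  proof (rule set_eqI)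
    fix x
    have "(\<forall>i. l $ i < x $ e i \<and> x $ e i < u $ i) \<longleftrightarrow> (\<forall>j. l $ inv e j < x $ j \<and> x $ j < u $ inv e j)"
      using inv by metis
    then show "x \<in> reindex e -` box l u \<longleftrightarrow> x \<in> box (reindex (inv e) l) (reindex (inv e) u)"
      by (simp add: mem_box_cart reindex_def)
  qed
  have "emeasure (distr lborel borel (reindex e)) (box l u) = emeasure lborel (box (reindex (inv e) l) (reindex (inv e) u))"
    by (subst emeasure_distr) (simp_all add: vim)
  also have "\<dots> = ennreal (\<Prod>b\<in>Basis. (reindex (inv e) u - reindex (inv e) l) \<bullet> b)"
  proof (rule emeasure_lborel_box)
    fix b :: "real^'j" assume "b \<in> Basis"
    then obtain j where "b = axis j 1" by (auto simp: Basis_vec_def)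
    then show "reindex (inv e) l \<bullet> b \<le> reindex (inv e) u \<bullet> b"
      using lu' by (simp add: cart_eq_inner_axis[symmetric] reindex_def)
  qed
  also have "(\<Prod>b\<in>Basis. (reindex (inv e) u - reindex (inv e) l) \<bullet> b) = (\<Prod>j\<in>UNIV. (u - l) $ inv e j)"
    unfolding BI by (simp add: reindex_def)
  also have "\<dots> = (\<Prod>i\<in>UNIV. (u - l) $ i)"
    by (rule prod.reindex_bij_betw) (use e bij_imp_bij_inv in auto)
  also have "\<dots> = (\<Prod>b\<in>Basis. (u - l) \<bullet> b)" unfolding BI ..
  finally show "emeasure (distr lborel borel (reindex e)) (box l u) = ennreal (\<Prod>b\<in>Basis. (u - l) \<bullet> b)" .
qed simp

lemma AE_lebesgue_reindex:
  fixes e :: "'i::finite \<Rightarrow> 'j::finite"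
  assumes e: "bij e" and P: "AE y in lebesgue. P y"
  shows "AE x in lebesgue. P (reindex e x)"
proof -
  have "AE y in lborel. P y" using P by (simp add: AE_completion_iff)
  then have "AE y in distr lborel borel (reindex e). P y" by (simp only: lborel_distr_reindex[OF e])
  then have "AE x in lborel. P (reindex e x)" by (rule AE_distrD[rotated]) simp
  then show ?thesis by (rule AE_completion)
qed

text \<open>A Borel version is composed with the renaming; invariance of the measure keeps the set
  where the two versions differ null.\<close>

lemma integrable_lebesgue_reindex:
  fixes e :: "'i::finite \<Rightarrow> 'j::finite" and f :: "real^'i \<Rightarrow> 'w::euclidean_space"
  assumes e: "bij e" and f: "integrable lebesgue f"
  shows "integrable lebesgue (\<lambda>x. f (reindex e x))"
proof -
  obtain g where g: "integrable lborel g" "AE x in lebesgue. f x = g x"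
    using integrable_lebesgue_lborel_version[OF f] .
  have gm[measurable]: "g \<in> borel_measurable borel" using borel_measurable_integrable[OF g(1)] by simp
  have "integrable (distr lborel borel (reindex e)) g" using g(1) by (simp only: lborel_distr_reindex[OF e])
  then have "integrable lborel (\<lambda>x. g (reindex e x))" by (subst (asm) integrable_distr_eq) auto
  then have gi: "integrable lebesgue (\<lambda>x. g (reindex e x))" by (subst integrable_completion) measurable
  have ae: "AE x in lebesgue. g (reindex e x) = f (reindex e x)"
    using AE_lebesgue_reindex[OF e g(2)] by eventually_elim simp
  have fm: "(\<lambda>x. f (reindex e x)) \<in> borel_measurable lebesgue"
    by (rule borel_measurable_AE[OF borel_measurable_integrable[OF gi] ae])
  show ?thesis using integrable_cong_AE[OF borel_measurable_integrable[OF gi] fm ae] gi by simp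
qed

text \<open>The map, its derivative and the integrand are conjugated with the renaming of
  coordinates. Conjugation leaves the determinant alone, so the Jacobian factor returns
  unchanged.\<close>

theorem set_integrable_change_of_variables:
  fixes f :: "real^'m::finite \<Rightarrow> real" and g :: "real^'m \<Rightarrow> real^'m"
  assumes S: "S \<in> sets lebesgue"
    and der: "\<And>x. x \<in> S \<Longrightarrow> (g has_derivative g' x) (at x within S)"
    and inj: "inj_on g S"
    and f: "set_integrable lebesgue (g ` S) f"
  shows "set_integrable lebesgue S (\<lambda>x. \<bar>det (matrix (g' x))\<bar> * f (g x))"
proof -
  obtain e :: "'m ranked \<Rightarrow> 'm" where e: "bij e" using ranked_bij_exists by blast
  have e': "bij (inv e)" using e by (rule bij_imp_bij_inv)
  have inv: "inv e (e x) = x" "e (inv e y) = y" for x y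
    using e by (simp_all add: bij_is_inj bij_is_surj surj_f_inv_f)
  let ?R = "reindex e" and ?Q = "reindex (inv e)"
  have QR: "?Q (?R x) = x" "?R (?Q y) = y" for x :: "real^'m" and y :: "real^'m ranked"
    using reindex_reindex[OF e] reindex_reindex'[OF e] by auto
  define T where "T = ?R ` S"
  have T_iff: "y \<in> T \<longleftrightarrow> ?Q y \<in> S" for y
    unfolding T_def by (auto simp: QR image_iff intro!: bexI[of _ "?Q y"])
  define G where "G y = ?R (g (?Q y))" for y
  define G' where "G' y v = ?R (g' (?Q y) (?Q v))" for y v
  \<comment> \<open>The theorem to be applied is about vector values, so the scalar integrand
    becomes a vector with a single entry.\<close>
  define F where "F y = (\<chi> i::1. f (?Q y))" for y
  have QT: "?Q ` T = S" unfolding T_def using QR by (force simp: image_image)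
  have T: "T \<in> sets lebesgue"
  proof -
    have "reindex e ` S \<in> sets lebesgue"
      by (rule differentiable_image_in_sets_lebesgue[OF S])
        (auto simp: CARD_ranked intro!: linear_imp_differentiable_on bounded_linear.linear bounded_linear_reindex)
    then show ?thesis by (simp add: T_def)
  qed
  have der': "(G has_derivative G' y) (at y within T)" if "y \<in> T" for y
  proof -
    have 1: "(?Q has_derivative ?Q) (at y within T)"
      by (rule bounded_linear.has_derivative[OF bounded_linear_reindex has_derivative_ident])
    have 2: "(g has_derivative g' (?Q y)) (at (?Q y) within ?Q ` T)"
      using der[of "?Q y"] that by (simp add: QT T_iff)
    have "((g \<circ> ?Q) has_derivative (g' (?Q y) \<circ> ?Q)) (at y within T)"
      by (rule diff_chain_within[OF 1 2])
    from bounded_linear.has_derivative[OF bounded_linear_reindex[of e] this]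
    show ?thesis by (simp add: G_def[abs_def] G'_def[abs_def] o_def)
  qed
  have inj': "inj_on G T"
  proof (rule inj_onI)
    fix x y assume xy: "x \<in> T" "y \<in> T" "G x = G y"
    then have "g (?Q x) = g (?Q y)" unfolding G_def by (metis QR(1))
    then have "?Q x = ?Q y" using inj xy by (auto simp: T_iff inj_on_def)
    then show "x = y" by (metis QR(2))
  qed
  have GT: "y \<in> G ` T \<longleftrightarrow> ?Q y \<in> g ` S" for y
    unfolding G_def T_def by (auto simp: image_iff QR) (metis QR)+
  have "integrable lebesgue (\<lambda>x. indicator (g ` S) x *\<^sub>R f x)" using f by (simp add: set_integrable_def)
  from integrable_lebesgue_reindex[OF e' this]
  have "integrable lebesgue (\<lambda>y. indicator (g ` S) (?Q y) *\<^sub>R f (?Q y))" .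
  moreover have "bounded_linear (\<lambda>t::real. \<chi> i::1. t)"
    by (rule linear_conv_bounded_linear[THEN iffD1]) (auto intro!: linearI simp: vec_eq_iff)
  ultimately have "integrable lebesgue (\<lambda>y. (\<chi> i::1. indicator (g ` S) (?Q y) *\<^sub>R f (?Q y)))"
    by (rule integrable_bounded_linear[rotated])
  moreover have "(\<lambda>y. (\<chi> i::1. indicator (g ` S) (?Q y) *\<^sub>R f (?Q y))) = (\<lambda>y. indicator (G ` T) y *\<^sub>R F y)"
    by (auto simp: fun_eq_iff vec_eq_iff F_def indicator_def GT)
  ultimately have "F absolutely_integrable_on (G ` T)" by (simp add: set_integrable_def)
  then have "(\<lambda>y. \<bar>det (matrix (G' y))\<bar> *\<^sub>R F (G y)) absolutely_integrable_on T"
    by (simp only: absolutely_integrable_change_of_variables[OF T der' inj', of F])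
  then have "integrable lebesgue (\<lambda>y. indicator T y *\<^sub>R \<bar>det (matrix (G' y))\<bar> *\<^sub>R F (G y))"
    by (simp add: set_integrable_def)
  from integrable_lebesgue_reindex[OF e this]
  have "integrable lebesgue (\<lambda>x. indicator T (?R x) *\<^sub>R \<bar>det (matrix (G' (?R x)))\<bar> *\<^sub>R F (G (?R x)))" .
  from integrable_bounded_linear[OF bounded_linear_vec_nth[of 1] this]
  have "integrable lebesgue (\<lambda>x. indicator T (?R x) * (\<bar>det (matrix (G' (?R x)))\<bar> * f (g x)))"
    by (simp add: F_def G_def QR mult.assoc)
  moreover have "det (matrix (G' (?R x))) = det (matrix (g' x))" for x
  proof -
    have "?Q (axis j 1) = axis (e j) 1" for j
      by (auto simp: reindex_def vec_eq_iff axis_def inv)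
    then have "matrix (G' (?R x)) = (\<chi> i j. matrix (g' x) $ e i $ e j)"
      by (simp add: matrix_def G'_def QR vec_eq_iff) (simp add: reindex_def)
    then show ?thesis using det_reindex[OF e] by simp
  qed
  moreover have "indicator T (?R x) = (indicator S x :: real)" for x
    by (simp add: indicator_def T_iff QR)
  ultimately show ?thesis by (simp add: set_integrable_def)
qed

section \<open>Charts and null sets\<close>

locale manifold =
  fixes A :: "('a::{t2_space,second_countable_topology}, 'm::finite) mchart set"
  assumes atlas: "manifold_atlas A"
begin

lemma ex_chart: "\<exists>c. c \<in> A \<and> x \<in> dom_of c"
proof -
  have "x \<in> (\<Union>c\<in>A. dom_of c)" using atlas by (simp add: manifold_atlas_def)
  then show ?thesis by blast
qed

lemma chart_at: "chart_at A x \<in> A" "x \<in> dom_of (chart_at A x)"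
  unfolding chart_at_def using someI_ex[OF ex_chart[of x]] by auto

lemma open_dom: "c \<in> A \<Longrightarrow> open (dom_of c)"
  and open_chart_image: "c \<in> A \<Longrightarrow> open (chart_image c)"
  and chart_homeomorphism: "c \<in> A \<Longrightarrow> homeomorphism (dom_of c) (chart_image c) (map_of_chart c) (chart_inv c)"
  using atlas by (auto simp: manifold_atlas_def)

lemma chart_inv_map: "c \<in> A \<Longrightarrow> x \<in> dom_of c \<Longrightarrow> chart_inv c (map_of_chart c x) = x"
  and map_chart_inv: "c \<in> A \<Longrightarrow> z \<in> chart_image c \<Longrightarrow> map_of_chart c (chart_inv c z) = z"
  and map_in_image: "c \<in> A \<Longrightarrow> x \<in> dom_of c \<Longrightarrow> map_of_chart c x \<in> chart_image c"
  and chart_inv_in_dom: "c \<in> A \<Longrightarrow> z \<in> chart_image c \<Longrightarrow> chart_inv c z \<in> dom_of c"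
  and continuous_on_map: "c \<in> A \<Longrightarrow> continuous_on (dom_of c) (map_of_chart c)"
  and continuous_on_inv: "c \<in> A \<Longrightarrow> continuous_on (chart_image c) (chart_inv c)"
proof -
  assume c: "c \<in> A"
  note h = chart_homeomorphism[OF c, unfolded homeomorphism_def]
  show "continuous_on (dom_of c) (map_of_chart c)" "continuous_on (chart_image c) (chart_inv c)" using h by blast+
  show "chart_inv c (map_of_chart c x) = x" "map_of_chart c x \<in> chart_image c" if "x \<in> dom_of c" using h that by blast+
  show "map_of_chart c (chart_inv c z) = z" "chart_inv c z \<in> dom_of c" if "z \<in> chart_image c" using h that by blast+
qed

lemma inj_on_chart: "c \<in> A \<Longrightarrow> inj_on (map_of_chart c) (dom_of c)"
  by (metis chart_inv_map inj_on_inverseI)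

lemma open_map_image:
  assumes "c \<in> A" "open U" shows "open (map_of_chart c ` (U \<inter> dom_of c))"
proof -
  have "openin (top_of_set (dom_of c)) (U \<inter> dom_of c)"
    using assms by (metis Int_commute openin_open_Int)
  then have "openin (top_of_set (chart_image c)) (map_of_chart c ` (U \<inter> dom_of c))"
    by (rule homeomorphism_imp_open_map[OF chart_homeomorphism[OF assms(1)]])
  then show ?thesis using open_chart_image[OF assms(1)] openin_open_eq by blast
qed

lemma map_image_eq: "c \<in> A \<Longrightarrow> map_of_chart c ` (X \<inter> dom_of c) = {z \<in> chart_image c. chart_inv c z \<in> X}"
  by (force simp: chart_image_def chart_inv_map)

section \<open>Transition derivatives, frames and differentials of charts\<close>

lemma transition_has_derivative:
  assumes c: "c \<in> A" "c' \<in> A" and x: "x \<in> dom_of c" "x \<in> dom_of c'"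
  shows "((map_of_chart c' \<circ> chart_inv c) has_derivative blinfun_apply (transition_deriv c c' x)) (at (map_of_chart c x))"
proof -
  have "C1_on (map_of_chart c ` (dom_of c \<inter> dom_of c')) (map_of_chart c' \<circ> chart_inv c)"
    using atlas c by (auto simp: manifold_atlas_def)
  then obtain f' where f': "\<And>z. z \<in> map_of_chart c ` (dom_of c \<inter> dom_of c') \<Longrightarrow>
      ((map_of_chart c' \<circ> chart_inv c) has_derivative blinfun_apply (f' z)) (at z)"
    unfolding C1_on_def by blast
  have d: "((map_of_chart c' \<circ> chart_inv c) has_derivative blinfun_apply (f' (map_of_chart c x))) (at (map_of_chart c x))"
    using f' x by blast
  have "transition_deriv c c' x = f' (map_of_chart c x)"
    unfolding transition_deriv_def frechet_derivative_at[OF d, symmetric] by (rule blinfun_apply_inverse)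
  with d show ?thesis by simp
qed

lemma continuous_on_transition_deriv:
  assumes c: "c \<in> A" "c' \<in> A"
  shows "continuous_on (dom_of c \<inter> dom_of c') (transition_deriv c c')"
proof -
  have "C1_on (map_of_chart c ` (dom_of c \<inter> dom_of c')) (map_of_chart c' \<circ> chart_inv c)"
    using atlas c by (auto simp: manifold_atlas_def)
  then obtain f' where f': "\<And>z. z \<in> map_of_chart c ` (dom_of c \<inter> dom_of c') \<Longrightarrow>
      ((map_of_chart c' \<circ> chart_inv c) has_derivative blinfun_apply (f' z)) (at z)"
    and cont: "continuous_on (map_of_chart c ` (dom_of c \<inter> dom_of c')) f'"
    unfolding C1_on_def by blast
  have eq: "transition_deriv c c' x = f' (map_of_chart c x)" if "x \<in> dom_of c \<inter> dom_of c'" for x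
  proof -
    have "blinfun_apply (f' (map_of_chart c x)) = blinfun_apply (transition_deriv c c' x)"
      using has_derivative_unique[OF f'[of "map_of_chart c x"] transition_has_derivative[OF c]] that by blast
    then show ?thesis by (simp add: blinfun_apply_inject)
  qed
  have "continuous_on (dom_of c \<inter> dom_of c') (\<lambda>x. f' (map_of_chart c x))"
    by (rule continuous_on_compose2[OF cont]) (auto intro: continuous_on_subset[OF continuous_on_map[OF c(1)]])
  then show ?thesis by (rule continuous_on_eq) (simp add: eq)
qed

text \<open>The chain rule for transition maps. This cocycle identity, with the selected chart as
  one of the three, yields the inverse relation between \<open>chart_diff\<close> and
  \<open>chart_frame\<close> and their behaviour under a change of chart.\<close>

lemma transition_deriv_comp:
  assumes c: "c \<in> A" "c' \<in> A" "c'' \<in> A" and x: "x \<in> dom_of c" "x \<in> dom_of c'" "x \<in> dom_of c''"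
  shows "transition_deriv c' c'' x o\<^sub>L transition_deriv c c' x = transition_deriv c c'' x"
proof -
  have "((map_of_chart c'' \<circ> chart_inv c') has_derivative blinfun_apply (transition_deriv c' c'' x))
     (at ((map_of_chart c' \<circ> chart_inv c) (map_of_chart c x)))"
    using transition_has_derivative[OF c(2,3) x(2,3)] by (simp add: chart_inv_map c x)
  then have "((map_of_chart c'' \<circ> chart_inv c') \<circ> (map_of_chart c' \<circ> chart_inv c) has_derivative
      blinfun_apply (transition_deriv c' c'' x) \<circ> blinfun_apply (transition_deriv c c' x)) (at (map_of_chart c x))"
    using transition_has_derivative[OF c(1,2) x(1,2)] by (intro diff_chain_at)
  then have "((map_of_chart c'' \<circ> chart_inv c) has_derivative
      blinfun_apply (transition_deriv c' c'' x) \<circ> blinfun_apply (transition_deriv c c' x)) (at (map_of_chart c x))"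
  proof (rule has_derivative_transform_within_open[where s="map_of_chart c ` (dom_of c' \<inter> dom_of c)"])
    show "open (map_of_chart c ` (dom_of c' \<inter> dom_of c))" by (rule open_map_image[OF c(1) open_dom[OF c(2)]])
    show "((map_of_chart c'' \<circ> chart_inv c') \<circ> (map_of_chart c' \<circ> chart_inv c)) z = (map_of_chart c'' \<circ> chart_inv c) z"
      if "z \<in> map_of_chart c ` (dom_of c' \<inter> dom_of c)" for z
      using that by (auto simp: chart_inv_map c)
  qed (use x in auto)
  from has_derivative_unique[OF this transition_has_derivative[OF c(1,3) x(1,3)]]
  show ?thesis by (intro blinfun_eqI) (metis blinfun_apply_blinfun_compose comp_apply)
qed

lemma transition_deriv_self:
  assumes c: "c \<in> A" and x: "x \<in> dom_of c"
  shows "transition_deriv c c x = id_blinfun"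
proof -
  have "((\<lambda>z. z) has_derivative (\<lambda>z. z)) (at (map_of_chart c x))" by (rule has_derivative_ident)
  then have "((map_of_chart c \<circ> chart_inv c) has_derivative (\<lambda>z. z)) (at (map_of_chart c x))"
    by (rule has_derivative_transform_within_open[OF _ open_chart_image[OF c]])
      (use map_in_image[OF c x] map_chart_inv[OF c] in auto)
  from has_derivative_unique[OF this transition_has_derivative[OF c c x x]]
  show ?thesis by (intro blinfun_eqI) (metis id_blinfun.rep_eq)
qed

lemma chart_diff_frame:
  assumes c: "c \<in> A" and x: "x \<in> dom_of c"
  shows "chart_diff A c x o\<^sub>L chart_frame A c x = id_blinfun" "chart_frame A c x o\<^sub>L chart_diff A c x = id_blinfun"
  unfolding chart_diff_def chart_frame_def
  using transition_deriv_comp[OF c chart_at(1) c x chart_at(2) x]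
    transition_deriv_comp[OF chart_at(1) c chart_at(1) chart_at(2) x chart_at(2)]
  by (simp_all add: transition_deriv_self c x chart_at)

lemma chart_diff_frame_apply:
  assumes c: "c \<in> A" and x: "x \<in> dom_of c"
  shows "chart_diff A c x (chart_frame A c x v) = v" "chart_frame A c x (chart_diff A c x v) = v"
  using chart_diff_frame[OF assms] by (metis blinfun_apply_blinfun_compose id_blinfun.rep_eq)+

lemma chart_frame_change:
  assumes c: "c \<in> A" "c' \<in> A" and x: "x \<in> dom_of c" "x \<in> dom_of c'"
  shows "chart_frame A c' x = chart_frame A c x o\<^sub>L transition_deriv c' c x"
  unfolding chart_frame_def using transition_deriv_comp[OF c(2,1) chart_at(1) x(2,1) chart_at(2)] by simp

lemma chart_diff_change:
  assumes c: "c \<in> A" "c' \<in> A" and x: "x \<in> dom_of c" "x \<in> dom_of c'"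
  shows "chart_diff A c' x = transition_deriv c c' x o\<^sub>L chart_diff A c x"
  unfolding chart_diff_def using transition_deriv_comp[OF chart_at(1) c chart_at(2) x] by simp

section \<open>Measurable sets and null sets in charts\<close>

lemma transition_differentiable_on:
  assumes c: "c \<in> A" "c' \<in> A" and S: "S \<subseteq> map_of_chart c ` (dom_of c \<inter> dom_of c')"
  shows "(map_of_chart c' \<circ> chart_inv c) differentiable_on S"
  unfolding differentiable_on_def
proof
  fix z assume "z \<in> S"
  then obtain x where "z = map_of_chart c x" "x \<in> dom_of c" "x \<in> dom_of c'" using S by blast
  then show "(map_of_chart c' \<circ> chart_inv c) differentiable (at z within S)"
    using transition_has_derivative[OF c] differentiableI differentiable_at_withinI by blast
qed

lemma transition_image:
  assumes c: "c \<in> A" "c' \<in> A" and Y: "Y \<subseteq> dom_of c"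
  shows "(map_of_chart c' \<circ> chart_inv c) ` (map_of_chart c ` Y) = map_of_chart c' ` Y"
  using Y by (force simp: image_image chart_inv_map c subset_iff)

text \<open>One chart suffices: transition maps are differentiable between spaces of equal
  dimension, and such maps send Lebesgue sets to Lebesgue sets.\<close>

lemma lebesgue_sets_chart:
  assumes c: "c \<in> A" and Y: "Y \<subseteq> dom_of c" "map_of_chart c ` Y \<in> sets lebesgue"
  shows "Y \<in> lebesgue_sets A"
  unfolding lebesgue_sets_def
proof (intro CollectI ballI)
  fix c' assume c': "c' \<in> A"
  have "map_of_chart c ` (Y \<inter> dom_of c') = map_of_chart c ` Y \<inter> map_of_chart c ` (dom_of c' \<inter> dom_of c)"
    using Y inj_on_chart[OF c] by (auto simp: inj_on_def)
  moreover have "open (map_of_chart c ` (dom_of c' \<inter> dom_of c))" by (rule open_map_image[OF c open_dom[OF c']])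
  ultimately have m: "map_of_chart c ` (Y \<inter> dom_of c') \<in> sets lebesgue" using Y(2) by (auto simp: sets.Int)
  have "(map_of_chart c' \<circ> chart_inv c) ` (map_of_chart c ` (Y \<inter> dom_of c')) \<in> sets lebesgue"
    by (rule differentiable_image_in_sets_lebesgue[OF m order_refl transition_differentiable_on[OF c c']]) (use Y in auto)
  then show "map_of_chart c' ` (Y \<inter> dom_of c') \<in> sets lebesgue"
    by (subst (asm) transition_image[OF c c']) (use Y in auto)
qed

lemma sigma_algebra_lebesgue_sets: "sigma_algebra UNIV (lebesgue_sets A)"
  unfolding sigma_algebra_iff2
proof (intro conjI ballI allI impI)
  show "{} \<in> lebesgue_sets A" by (simp add: lebesgue_sets_def)
next
  fix X assume X: "X \<in> lebesgue_sets A"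
  show "UNIV - X \<in> lebesgue_sets A"
    unfolding lebesgue_sets_def
  proof (intro CollectI ballI)
    fix c assume c: "c \<in> A"
    have "map_of_chart c ` ((UNIV - X) \<inter> dom_of c) = chart_image c - map_of_chart c ` (X \<inter> dom_of c)"
      unfolding map_image_eq[OF c] by auto
    then show "map_of_chart c ` ((UNIV - X) \<inter> dom_of c) \<in> sets lebesgue"
      using X c open_chart_image[OF c] by (auto simp: lebesgue_sets_def)
  qed
next
  fix F :: "nat \<Rightarrow> 'a set" assume F: "range F \<subseteq> lebesgue_sets A"
  show "(\<Union>i. F i) \<in> lebesgue_sets A"
    unfolding lebesgue_sets_def
  proof (intro CollectI ballI)
    fix c assume c: "c \<in> A"
    have "map_of_chart c ` ((\<Union>i. F i) \<inter> dom_of c) = (\<Union>i. map_of_chart c ` (F i \<inter> dom_of c))" by auto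
    then show "map_of_chart c ` ((\<Union>i. F i) \<inter> dom_of c) \<in> sets lebesgue"
      using F c by (auto simp: lebesgue_sets_def subset_iff)
  qed
qed auto

lemma sets_manifold_sigma[simp]: "sets (manifold_sigma A) = lebesgue_sets A"
  and space_manifold_sigma[simp]: "space (manifold_sigma A) = UNIV"
  unfolding manifold_sigma_def
  by (simp_all add: sigma_algebra.sets_measure_of_eq[OF sigma_algebra_lebesgue_sets] space_measure_of_conv)

lemma open_in_lebesgue_sets: "open U \<Longrightarrow> U \<in> lebesgue_sets A"
  by (auto simp: lebesgue_sets_def open_map_image)

lemma lebesgue_sets_map: "X \<in> lebesgue_sets A \<Longrightarrow> c \<in> A \<Longrightarrow> map_of_chart c ` (X \<inter> dom_of c) \<in> sets lebesgue"
  by (auto simp: lebesgue_sets_def)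

lemma lebesgue_sets_Int: "X \<in> lebesgue_sets A \<Longrightarrow> Y \<in> lebesgue_sets A \<Longrightarrow> X \<inter> Y \<in> lebesgue_sets A"
  using sets.Int[of X "manifold_sigma A" Y] by simp

lemma lebesgue_sets_Diff: "X \<in> lebesgue_sets A \<Longrightarrow> Y \<in> lebesgue_sets A \<Longrightarrow> X - Y \<in> lebesgue_sets A"
  using sets.Diff[of X "manifold_sigma A" Y] by simp

lemma lebesgue_sets_countable_UN: "countable I \<Longrightarrow> (\<And>i. i \<in> I \<Longrightarrow> X i \<in> lebesgue_sets A) \<Longrightarrow> (\<Union>i\<in>I. X i) \<in> lebesgue_sets A"
  using sets.countable_UN'[of I X "manifold_sigma A"] by (simp add: image_subset_iff)

definition chart_null :: "'a set \<Rightarrow> bool"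
  where "chart_null X \<longleftrightarrow> (\<forall>c\<in>A. negligible (map_of_chart c ` (X \<inter> dom_of c)))"

text \<open>A notion of almost everywhere that involves no metric. Weak derivatives are treated in
  charts, and the notion is later identified with that of the Riemannian measure.\<close>

definition chart_AE :: "('a \<Rightarrow> bool) \<Rightarrow> bool"
  where "chart_AE P \<longleftrightarrow> (\<forall>c\<in>A. AE z in lebesgue. z \<in> chart_image c \<longrightarrow> P (chart_inv c z))"

lemma chart_AE_iff_null: "chart_AE P \<longleftrightarrow> chart_null {x. \<not> P x}"
proof -
  have "(AE z in lebesgue. z \<in> chart_image c \<longrightarrow> P (chart_inv c z)) \<longleftrightarrow>
    negligible (map_of_chart c ` ({x. \<not> P x} \<inter> dom_of c))" if c: "c \<in> A" for c
  proof -
    have "{z. \<not> (z \<in> chart_image c \<longrightarrow> P (chart_inv c z))} = map_of_chart c ` ({x. \<not> P x} \<inter> dom_of c)"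
      unfolding map_image_eq[OF c] by auto
    then show ?thesis by (simp add: negligible_iff_null_sets completion.AE_iff_null_sets)
  qed
  then show ?thesis by (simp add: chart_AE_def chart_null_def)
qed

lemma chart_AE_mono: "chart_AE P \<Longrightarrow> (\<And>x. P x \<Longrightarrow> Q x) \<Longrightarrow> chart_AE Q"
  unfolding chart_AE_def by (auto elim!: AE_mp)

lemma chart_AE_conj: "chart_AE P \<Longrightarrow> chart_AE Q \<Longrightarrow> chart_AE (\<lambda>x. P x \<and> Q x)"
  unfolding chart_AE_def
proof
  fix c assume "\<forall>c\<in>A. AE z in lebesgue. z \<in> chart_image c \<longrightarrow> P (chart_inv c z)"
    "\<forall>c\<in>A. AE z in lebesgue. z \<in> chart_image c \<longrightarrow> Q (chart_inv c z)" "c \<in> A"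
  then have "AE z in lebesgue. z \<in> chart_image c \<longrightarrow> P (chart_inv c z)" "AE z in lebesgue. z \<in> chart_image c \<longrightarrow> Q (chart_inv c z)"
    by auto
  then show "AE z in lebesgue. z \<in> chart_image c \<longrightarrow> P (chart_inv c z) \<and> Q (chart_inv c z)"
    by eventually_elim auto
qed

lemma chart_AE_all_countable: "(\<And>i::'i::countable. chart_AE (P i)) \<Longrightarrow> chart_AE (\<lambda>x. \<forall>i. P i x)"
  unfolding chart_AE_def
proof
  fix c assume *: "\<And>i. \<forall>c\<in>A. AE z in lebesgue. z \<in> chart_image c \<longrightarrow> P i (chart_inv c z)" and c: "c \<in> A"
  have "AE z in lebesgue. \<forall>i. z \<in> chart_image c \<longrightarrow> P i (chart_inv c z)"
    unfolding AE_all_countable using * c by blast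
  then show "AE z in lebesgue. z \<in> chart_image c \<longrightarrow> (\<forall>i. P i (chart_inv c z))" by eventually_elim auto
qed

lemma chart_null_subset: "chart_null X \<Longrightarrow> Y \<subseteq> X \<Longrightarrow> chart_null Y"
  unfolding chart_null_def by (meson Int_mono image_mono negligible_subset order_refl)

lemma chart_null_lebesgue_sets: "chart_null X \<Longrightarrow> X \<in> lebesgue_sets A"
  unfolding chart_null_def lebesgue_sets_def
  using negligible_iff_null_sets by blast

text \<open>Differentiable transition maps send null sets to null sets, so each piece need only be
  checked in its own chart.\<close>

lemma chart_null_cover:
  assumes C: "\<And>i::nat. C i \<in> A" and P: "\<And>i. P i \<subseteq> dom_of (C i)" "(\<Union>i. P i) = UNIV"
    and null: "\<And>i. negligible (map_of_chart (C i) ` (X \<inter> P i))"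
  shows "chart_null X"
  unfolding chart_null_def
proof
  fix c assume c: "c \<in> A"
  have "negligible (map_of_chart c ` (X \<inter> P i \<inter> dom_of c))" for i
  proof -
    have "negligible (map_of_chart (C i) ` (X \<inter> P i \<inter> dom_of c))"
      by (rule negligible_subset[OF null[of i]]) auto
    then have "negligible ((map_of_chart c \<circ> chart_inv (C i)) ` (map_of_chart (C i) ` (X \<inter> P i \<inter> dom_of c)))"
      by (rule negligible_differentiable_image_negligible[OF order_refl _ transition_differentiable_on[OF C c]]) (use P in auto)
    then show ?thesis by (subst (asm) transition_image[OF C c]) (use P in auto)
  qed
  then have "negligible (\<Union>i. map_of_chart c ` (X \<inter> P i \<inter> dom_of c))" by (rule negligible_Union_nat)
  moreover have "map_of_chart c ` (X \<inter> dom_of c) \<subseteq> (\<Union>i. map_of_chart c ` (X \<inter> P i \<inter> dom_of c))" using P(2) by blast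
  ultimately show "negligible (map_of_chart c ` (X \<inter> dom_of c))" by (rule negligible_subset)
qed

text \<open>Lindelof's theorem applied to the chart domains; it makes the choice in the definition a
  genuine one.\<close>

lemma countable_chart_cover_works:
  "range (countable_chart_cover A) \<subseteq> A" "(\<Union>i. dom_of (countable_chart_cover A i)) = UNIV"
proof -
  have "\<exists>C::nat \<Rightarrow> ('a, 'm) mchart. range C \<subseteq> A \<and> (\<Union>i. dom_of (C i)) = UNIV"
  proof -
    obtain F where F: "F \<subseteq> dom_of ` A" "countable F" "\<Union>F = \<Union>(dom_of ` A)"
      by (rule Lindelof[of "dom_of ` A"]) (use open_dom in auto)
    have U: "\<Union>F = UNIV" using F(3) atlas by (simp add: manifold_atlas_def)
    then have "F \<noteq> {}" by auto
    then have D: "range (from_nat_into F) = F" using F(2) by (rule range_from_nat_into)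
    let ?D = "from_nat_into F"
    have "\<exists>c. c \<in> A \<and> dom_of c = ?D i" for i
    proof -
      have "?D i \<in> dom_of ` A" using D F(1) by (metis rangeI subsetD)
      then show ?thesis by (auto simp: image_iff)
    qed
    then obtain C where C: "\<And>i. C i \<in> A \<and> dom_of (C i) = ?D i" by metis
    have "(\<Union>i. dom_of (C i)) = \<Union>(range ?D)" using C by simp
    then have "(\<Union>i. dom_of (C i)) = UNIV" using D U by simp
    moreover have "range C \<subseteq> A" using C by blast
    ultimately show ?thesis by blast
  qed
  from someI_ex[OF this] show "range (countable_chart_cover A) \<subseteq> A" "(\<Union>i. dom_of (countable_chart_cover A i)) = UNIV"
    unfolding countable_chart_cover_def by auto
qed

text \<open>Nothing controls \<open>chart_inv\<close> off the chart image; a constant value there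
  makes the map measurable on the whole model space.\<close>

definition chart_inv_ext :: "('a, 'm) mchart \<Rightarrow> real ^ 'm \<Rightarrow> 'a"
  where "chart_inv_ext c z = (if z \<in> chart_image c then chart_inv c z else undefined)"

lemma chart_inv_ext_measurable:
  assumes c: "c \<in> A" shows "chart_inv_ext c \<in> measurable lebesgue (manifold_sigma A)"
proof (rule measurableI)
  fix X assume X: "X \<in> sets (manifold_sigma A)"
  have "chart_inv_ext c -` X \<inter> space lebesgue = map_of_chart c ` (X \<inter> dom_of c) \<union> (if undefined \<in> X then - chart_image c else {})"
    unfolding map_image_eq[OF c] by (auto simp: chart_inv_ext_def split: if_splits)
  also have "\<dots> \<in> sets lebesgue"
    using lebesgue_sets_map[OF _ c, of X] X open_chart_image[OF c] by (auto intro!: sets.Un simp: borel_closed)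
  finally show "chart_inv_ext c -` X \<inter> space lebesgue \<in> sets lebesgue" .
qed simp

lemma measurable_in_chart:
  fixes f :: "'a \<Rightarrow> 'w::euclidean_space"
  assumes c: "c \<in> A" and f: "f \<in> borel_measurable (manifold_sigma A)"
  shows "(\<lambda>z. indicator (chart_image c) z *\<^sub>R f (chart_inv c z)) \<in> borel_measurable lebesgue"
proof -
  have "(\<lambda>z. f (chart_inv_ext c z)) \<in> borel_measurable lebesgue"
    by (rule measurable_compose[OF chart_inv_ext_measurable[OF c] f])
  moreover have "chart_image c \<in> sets lebesgue" using open_chart_image[OF c] by auto
  ultimately have "(\<lambda>z. indicator (chart_image c) z *\<^sub>R f (chart_inv_ext c z)) \<in> borel_measurable lebesgue" by measurable
  moreover have "(\<lambda>z. indicator (chart_image c) z *\<^sub>R f (chart_inv_ext c z)) = (\<lambda>z. indicator (chart_image c) z *\<^sub>R f (chart_inv c z))"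
    by (auto simp: chart_inv_ext_def fun_eq_iff indicator_def)
  ultimately show ?thesis by (simp only:)
qed

text \<open>The \<sigma>-algebra contains all null sets, so altering a map on one of them changes
  preimages by measurable sets only.\<close>

lemma chart_AE_measurable:
  assumes f: "f \<in> measurable (manifold_sigma A) N" and eq: "chart_AE (\<lambda>x. f x = g x)"
    and g: "\<And>x. g x \<in> space N"
  shows "g \<in> measurable (manifold_sigma A) N"
proof (rule measurableI)
  let ?Z = "{x. f x \<noteq> g x}"
  have Z: "chart_null ?Z" using eq by (simp add: chart_AE_iff_null)
  fix S assume S: "S \<in> sets N"
  have "f -` S \<in> lebesgue_sets A" using measurable_sets[OF f S] by simp
  then have "f -` S - ?Z \<in> lebesgue_sets A" using chart_null_lebesgue_sets[OF Z] by (rule lebesgue_sets_Diff)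
  moreover have "g -` S \<inter> ?Z \<in> lebesgue_sets A"
    by (rule chart_null_lebesgue_sets[OF chart_null_subset[OF Z]]) auto
  ultimately have "(f -` S - ?Z) \<union> (g -` S \<inter> ?Z) \<in> sets (manifold_sigma A)" by (intro sets.Un) simp_all
  moreover have "g -` S \<inter> space (manifold_sigma A) = (f -` S - ?Z) \<union> (g -` S \<inter> ?Z)" by auto
  ultimately show "g -` S \<inter> space (manifold_sigma A) \<in> sets (manifold_sigma A)" by simp
qed (use g in simp)

end

section \<open>Scalar products and the Riemannian measure\<close>

locale scalar_product =
  fixes h :: "real ^ 'm::finite \<Rightarrow> real ^ 'm \<Rightarrow> real"
  assumes bilinear: "bilinear h" and sym: "h v w = h w v" and pos: "v \<noteq> 0 \<Longrightarrow> 0 < h v v"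
begin

lemma linear_left: "linear (\<lambda>v. h v w)" and linear_right: "linear (h v)"
  using bilinear by (auto simp: bilinear_def)

lemma h_0[simp]: "h 0 w = 0" "h v 0 = 0"
  using linear_0[OF linear_left] linear_0[OF linear_right] by auto

lemma h_nonneg: "0 \<le> h v v"
  using pos[of v] by (cases "v = 0") (auto simp: less_imp_le)


lemma h_diff: "h (v - v') w = h v w - h v' w" "h v (w - w') = h v w - h v w'"
  using linear_diff[OF linear_left] linear_diff[OF linear_right] by auto

lemma h_scaleR: "h (r *\<^sub>R v) w = r * h v w" "h v (r *\<^sub>R w) = r * h v w"
  using linear_scale[OF linear_left] linear_scale[OF linear_right] by auto

lemma h_sum: "h (\<Sum>i\<in>I. f i) w = (\<Sum>i\<in>I. h (f i) w)" "h v (\<Sum>i\<in>I. f i) = (\<Sum>i\<in>I. h v (f i))"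
  using linear_sum[OF linear_left] linear_sum[OF linear_right] by auto

text \<open>Gram-Schmidt, by induction on the number of vectors: from a vector outside the span the
  components along the span are subtracted and the rest is normalised.\<close>

lemma orthonormal_set_exists:
  "k \<le> CARD('m) \<Longrightarrow> \<exists>S. finite S \<and> card S = k \<and> (\<forall>v\<in>S. \<forall>w\<in>S. h v w = (if v = w then 1 else 0))"
proof (induction k)
  case 0
  show ?case by (rule exI[of _ "{}"]) simp
next
  case (Suc k)
  then obtain S where S: "finite S" "card S = k" and on: "\<forall>v\<in>S. \<forall>w\<in>S. h v w = (if v = w then 1 else 0)" by auto
  \<comment> \<open>Fewer vectors than the dimension cannot span, so a new direction exists.\<close>
  have "dim (span S) \<le> card S" using S dim_le_card'[OF S(1)] by simp
  then have "span S \<noteq> UNIV" using Suc.prems S by (metis Suc_n_not_le_n dim_UNIV DIM_cart DIM_real mult_1_right order_trans)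
  then obtain v where v: "v \<notin> span S" by auto
  define u where "u = v - (\<Sum>s\<in>S. h v s *\<^sub>R s)"
  have "u \<noteq> 0"
  proof
    assume "u = 0"
    then have "v = (\<Sum>s\<in>S. h v s *\<^sub>R s)" by (simp add: u_def)
    also have "\<dots> \<in> span S" by (intro span_sum span_scale span_base)
    finally show False using v by simp
  qed
  then have up: "h u u > 0" by (rule pos)
  have us: "h u s = 0" if "s \<in> S" for s
  proof -
    have "h u s = h v s - (\<Sum>t\<in>S. h v t * h t s)" by (simp add: u_def h_diff h_sum h_scaleR)
    also have "(\<Sum>t\<in>S. h v t * h t s) = (\<Sum>t\<in>S. if t = s then h v s else 0)"
      using on that by (intro sum.cong) auto
    also have "\<dots> = h v s" using S(1) that by simp
    finally show ?thesis by simp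
  qed
  define w where "w = (1 / sqrt (h u u)) *\<^sub>R u"
  have ww: "h w w = 1" using up by (simp add: w_def h_scaleR field_simps)
  have ws: "h w s = 0" "h s w = 0" if "s \<in> S" for s using us[OF that] sym[of s w] by (auto simp: w_def h_scaleR)
  have wS: "w \<notin> S" using ww ws by fastforce
  show ?case
  proof (intro exI[of _ "insert w S"] conjI)
    show "card (insert w S) = Suc k" using S wS by simp
    show "\<forall>v\<in>insert w S. \<forall>y\<in>insert w S. h v y = (if v = y then 1 else 0)"
      using on ww ws wS by auto
  qed (use S in simp)
qed

lemma orthonormal_basis_exists: "\<exists>b. orthonormal_basis h b"
proof -
  obtain S where S: "finite S" "card S = CARD('m)" and on: "\<forall>v\<in>S. \<forall>w\<in>S. h v w = (if v = w then 1 else 0)"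
    using orthonormal_set_exists[of "CARD('m)"] by auto
  obtain b where b: "bij_betw b (UNIV :: 'm set) S"
    using finite_same_card_bij[of "UNIV :: 'm set" S] S by auto
  have "b i \<in> S" "b i = b j \<longleftrightarrow> i = j" for i j
    using b by (auto simp: bij_betw_def inj_on_def)
  then have "orthonormal_basis h b" using on by (simp add: orthonormal_basis_def)
  then show ?thesis by blast
qed

text \<open>Orthonormal vectors are independent; being as many as the dimension, they span, and
  pairing with them reads off the coefficients.\<close>

lemma orthonormal_expansion:
  assumes b: "orthonormal_basis h b"
  shows "v = (\<Sum>i\<in>UNIV. h v (b i) *\<^sub>R b i)"
proof -
  have hb: "h (b i) (b j) = (if i = j then 1 else 0)" for i j using b by (simp add: orthonormal_basis_def)
  have inj: "inj b"
  proof (rule injI)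
    fix i j assume "b i = b j"
    then show "i = j" using hb[of i j] hb[of i i] by (auto split: if_splits)
  qed
  have hsum: "h (\<Sum>i\<in>UNIV. c i *\<^sub>R b i) (b j) = c j" for c j
    by (simp add: h_sum h_scaleR hb if_distrib[of "\<lambda>t. _ * t"] sum.delta cong: if_cong)
  have "independent (range b)"
  proof (rule independent_if_scalars_zero)
    fix f x assume s: "(\<Sum>x\<in>range b. f x *\<^sub>R x) = 0" and "x \<in> range b"
    then obtain j where j: "x = b j" by auto
    have "(\<Sum>i\<in>UNIV. f (b i) *\<^sub>R b i) = 0" using s by (simp add: sum.reindex[OF inj])
    then show "f x = 0" using hsum[of "\<lambda>i. f (b i)" j] j by simp
  qed simp
  then have "UNIV \<subseteq> span (range b)"
    by (rule card_ge_dim_independent[rotated]) (auto simp: card_image[OF inj])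
  then have "v \<in> span (range b)" by auto
  then obtain f where "v = (\<Sum>x\<in>range b. f x *\<^sub>R x)" by (auto simp: span_finite)
  then have v: "v = (\<Sum>i\<in>UNIV. f (b i) *\<^sub>R b i)" by (simp add: sum.reindex[OF inj])
  have "h v (b j) = f (b j)" for j unfolding v by (rule hsum)
  then have "(\<Sum>i\<in>UNIV. h v (b i) *\<^sub>R b i) = (\<Sum>i\<in>UNIV. f (b i) *\<^sub>R b i)" by simp
  with v show ?thesis by (simp only:)
qed

lemma parseval:
  assumes b: "orthonormal_basis h b"
  shows "h v w = (\<Sum>i\<in>UNIV. h v (b i) * h w (b i))"
proof -
  have "h v w = h (\<Sum>i\<in>UNIV. h v (b i) *\<^sub>R b i) w" by (rule arg_cong[OF orthonormal_expansion[OF b], where f="\<lambda>u. h u w"])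
  also have "\<dots> = (\<Sum>i\<in>UNIV. h v (b i) * h w (b i))" by (simp add: h_sum h_scaleR sym[of "b i" w for i])
  finally show ?thesis .
qed

text \<open>One term of the Parseval sum for h v v.\<close>

lemma basis_coefficient_le:
  assumes b: "orthonormal_basis h b" shows "\<bar>h v (b i)\<bar> \<le> sqrt (h v v)"
proof -
  have "(h v (b i))\<^sup>2 \<le> (\<Sum>i\<in>UNIV. (h v (b i))\<^sup>2)" by (rule member_le_sum) auto
  also have "\<dots> = h v v" using parseval[OF b, of v v] by (simp add: power2_eq_square)
  finally show ?thesis by (rule real_le_rsqrt[of "\<bar>h v (b i)\<bar>", simplified])
qed

definition gram :: "('m \<Rightarrow> real ^ 'm) \<Rightarrow> real ^ 'm ^ 'm"
  where "gram f = (\<chi> i j. h (f i) (f j))"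

text \<open>The hypothesis is linear independence. In an orthonormal basis the Gram matrix is P P^T,
  so its determinant is the square of det P, and independence makes the transpose of P
  injective.\<close>

lemma det_gram_pos:
  assumes f: "\<And>c. (\<Sum>i\<in>UNIV. c i *\<^sub>R f i) = 0 \<Longrightarrow> (\<And>i. c i = 0)"
  shows "0 < det (gram f)"
proof -
  obtain b where b: "orthonormal_basis h b" using orthonormal_basis_exists by blast
  define P :: "real ^ 'm ^ 'm" where "P = (\<chi> i j. h (f i) (b j))"
  have "gram f = P ** transpose P"
    by (simp add: gram_def P_def matrix_matrix_mult_def transpose_def vec_eq_iff parseval[OF b, of "f i" "f j" for i j])
  then have d: "det (gram f) = (det P)\<^sup>2" by (simp add: det_mul det_transpose power2_eq_square)
  have "\<forall>x. transpose P *v x = 0 \<longrightarrow> x = 0"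
  proof (intro allI impI)
    fix x assume x: "transpose P *v x = 0"
    have "h (\<Sum>i\<in>UNIV. x $ i *\<^sub>R f i) (b j) = 0" for j
    proof -
      have "h (\<Sum>i\<in>UNIV. x $ i *\<^sub>R f i) (b j) = (transpose P *v x) $ j"
        by (simp add: h_sum h_scaleR matrix_vector_mult_def transpose_def P_def mult.commute)
      then show ?thesis using x by simp
    qed
    then have s0: "(\<Sum>j\<in>UNIV. h (\<Sum>i\<in>UNIV. x $ i *\<^sub>R f i) (b j) *\<^sub>R b j) = 0" by (simp only: scaleR_zero_left sum.neutral_const)
    have "(\<Sum>i\<in>UNIV. x $ i *\<^sub>R f i) = 0" by (rule trans[OF orthonormal_expansion[OF b] s0])
    then have "x $ i = 0" for i by (rule f)
    then show "x = 0" by (simp add: vec_eq_iff)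
  qed
  then obtain B where "B ** transpose P = mat 1" using matrix_left_invertible_ker by blast
  then have "det B * det (transpose P) = 1" by (metis det_I det_mul)
  then have "det P \<noteq> 0" by (auto simp: det_transpose)
  then show ?thesis by (simp add: d)
qed

end

section \<open>The volume density of a Riemannian metric\<close>

locale riemannian =
  fixes A :: "('a::{t2_space,second_countable_topology}, 'm::finite) mchart set"
    and g :: "('a, 'm) mmetric"
  assumes riemannian: "riemannian_manifold A g"
begin

sublocale manifold A
  using riemannian by unfold_locales (simp add: riemannian_manifold_def)

lemma scalar_product: "scalar_product (g x)"
  using riemannian by unfold_locales (auto simp: riemannian_manifold_def)

lemma continuous_on_metric:
  "c \<in> A \<Longrightarrow> continuous_on (dom_of c) (\<lambda>x. g x (chart_frame A c x v) (chart_frame A c x w))"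
  using riemannian by (simp add: riemannian_manifold_def)

definition chart_gram :: "('a, 'm) mchart \<Rightarrow> 'a \<Rightarrow> real ^ 'm ^ 'm"
  where "chart_gram c x = (\<chi> i j. g x (chart_frame A c x (axis i 1)) (chart_frame A c x (axis j 1)))"

lemma volume_density_eq: "volume_density A g c x = sqrt (det (chart_gram c x))"
  by (simp add: volume_density_def chart_gram_def)

lemma axis_sum: "v = (\<Sum>i\<in>UNIV. v $ i *\<^sub>R axis i (1::real))"
  by (simp add: vec_eq_iff axis_def if_distrib[of "\<lambda>t. _ * t"] sum.delta cong: if_cong)

lemma frame_sum: "chart_frame A c x v = (\<Sum>i\<in>UNIV. v $ i *\<^sub>R chart_frame A c x (axis i 1))"
  by (subst axis_sum[of v]) (simp only: blinfun.sum_right blinfun.scaleR_right)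

lemma metric_frame: "g x (chart_frame A c x v) (chart_frame A c x w) = (\<Sum>i\<in>UNIV. \<Sum>j\<in>UNIV. v $ i * w $ j * chart_gram c x $ i $ j)"
proof -
  interpret scalar_product "g x" by (rule scalar_product)
  show ?thesis
    unfolding frame_sum[of c x v] frame_sum[of c x w]
    by (simp add: h_sum h_scaleR chart_gram_def sum_distrib_left mult.assoc)
      (subst sum.swap, simp add: mult.left_commute)
qed

lemma det_chart_gram_pos:
  assumes c: "c \<in> A" and x: "x \<in> dom_of c"
  shows "0 < det (chart_gram c x)"
proof -
  interpret scalar_product "g x" by (rule scalar_product)
  have "0 < det (gram (\<lambda>i. chart_frame A c x (axis i 1)))"
  proof (rule det_gram_pos)
    fix f i assume "(\<Sum>i\<in>UNIV. f i *\<^sub>R chart_frame A c x (axis i 1)) = 0"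
    then have "chart_frame A c x (\<chi> i. f i) = 0" using frame_sum[of c x "\<chi> i. f i"] by simp
    then have "(\<chi> i. f i) = 0" using chart_diff_frame_apply(1)[OF c x] by (metis blinfun.zero_right)
    then show "f i = 0" by (simp add: vec_eq_iff)
  qed
  then show ?thesis by (simp add: gram_def chart_gram_def)
qed

lemma volume_density_pos: "c \<in> A \<Longrightarrow> x \<in> dom_of c \<Longrightarrow> 0 < volume_density A g c x"
  by (simp add: volume_density_eq det_chart_gram_pos)

lemma continuous_on_det:
  fixes F :: "'z::topological_space \<Rightarrow> real ^ 'k::finite ^ 'k"
  assumes "\<And>i j. continuous_on S (\<lambda>x. F x $ i $ j)"
  shows "continuous_on S (\<lambda>x. det (F x))"
  unfolding det_def by (intro continuous_intros assms)

lemma continuous_on_volume_density: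
  assumes c: "c \<in> A" shows "continuous_on (dom_of c) (volume_density A g c)"
  unfolding volume_density_eq[abs_def]
  by (intro continuous_on_real_sqrt continuous_on_det) (simp add: chart_gram_def continuous_on_metric[OF c])

text \<open>The Gram matrix transforms as J^T G J with J the matrix of the transition derivative, so
  the root of its determinant gains the factor |det J|. This matches the Jacobian in the change of
  variables.\<close>

lemma volume_density_change:
  assumes c: "c \<in> A" "c' \<in> A" and x: "x \<in> dom_of c" "x \<in> dom_of c'"
  shows "volume_density A g c' x = \<bar>det (matrix (transition_deriv c' c x))\<bar> * volume_density A g c x"
proof -
  define J where "J = matrix (blinfun_apply (transition_deriv c' c x))"
  have fr: "chart_frame A c' x (axis i 1) = chart_frame A c x (transition_deriv c' c x (axis i 1))" for i
    by (simp add: chart_frame_change[OF c x])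
  have "chart_gram c' x = transpose J ** chart_gram c x ** J"
  proof -
    have "chart_gram c' x $ i $ j = (transpose J ** chart_gram c x ** J) $ i $ j" for i j
    proof -
      have "chart_gram c' x $ i $ j = (\<Sum>a\<in>UNIV. \<Sum>b\<in>UNIV. J $ a $ i * J $ b $ j * chart_gram c x $ a $ b)"
      proof -
        have "chart_gram c' x $ i $ j = g x (chart_frame A c x (transition_deriv c' c x (axis i 1))) (chart_frame A c x (transition_deriv c' c x (axis j 1)))"
          by (simp add: chart_gram_def[of c'] fr)
        then show ?thesis by (simp only: metric_frame J_def matrix_def vec_lambda_beta)
      qed
      also have "\<dots> = (transpose J ** chart_gram c x ** J) $ i $ j"
        by (simp add: matrix_matrix_mult_def transpose_def sum_distrib_left sum_distrib_right mult_ac)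
          (subst sum.swap, simp add: mult_ac)
      finally show ?thesis .
    qed
    then show ?thesis by (simp add: vec_eq_iff)
  qed
  then have "det (chart_gram c' x) = (det J)\<^sup>2 * det (chart_gram c x)"
    by (simp add: det_mul det_transpose power2_eq_square)
  then show ?thesis by (simp add: volume_density_eq real_sqrt_mult J_def)
qed

section \<open>The Riemannian measure as a sum of chart measures\<close>

abbreviation cover :: "nat \<Rightarrow> ('a, 'm) mchart"
  where "cover \<equiv> countable_chart_cover A"

definition piece :: "nat \<Rightarrow> 'a set"
  where "piece i = disjointed (\<lambda>j. dom_of (cover j)) i"

lemma cover_in: "cover i \<in> A" using countable_chart_cover_works(1) by auto

lemma piece_sub: "piece i \<subseteq> dom_of (cover i)" unfolding piece_def by (rule disjointed_subset)

lemma UN_piece: "(\<Union>i. piece i) = UNIV"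
  unfolding piece_def UN_disjointed_eq by (rule countable_chart_cover_works(2))


lemma piece_in: "piece i \<in> lebesgue_sets A"
  unfolding piece_def disjointed_def
  by (intro lebesgue_sets_Diff lebesgue_sets_countable_UN open_in_lebesgue_sets open_dom cover_in) auto

definition piece_density :: "nat \<Rightarrow> real ^ 'm \<Rightarrow> real"
  where "piece_density i z = volume_density A g (cover i) (chart_inv (cover i) z) * indicator (map_of_chart (cover i) ` piece i) z"

lemma map_piece_sets: "map_of_chart (cover i) ` piece i \<in> sets lebesgue"
  using lebesgue_sets_map[OF piece_in cover_in, of i i] piece_sub[of i] by (simp add: Int_absorb2)

lemma map_piece_sub: "map_of_chart (cover i) ` piece i \<subseteq> chart_image (cover i)"
  using piece_sub[of i] by (auto simp: chart_image_def)

lemma density_chart_continuous: "c \<in> A \<Longrightarrow> continuous_on (chart_image c) (\<lambda>z. volume_density A g c (chart_inv c z))"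
  by (rule continuous_on_compose2[OF continuous_on_volume_density continuous_on_inv]) (auto simp: chart_inv_in_dom)

lemma piece_density_measurable[measurable]: "piece_density i \<in> borel_measurable lebesgue"
proof -
  have o: "chart_image (cover i) \<in> sets borel" using open_chart_image[OF cover_in] by simp
  have "(\<lambda>z. indicator (chart_image (cover i)) z *\<^sub>R volume_density A g (cover i) (chart_inv (cover i) z)) \<in> borel_measurable borel"
    by (rule borel_measurable_continuous_on_indicator[OF o density_chart_continuous[OF cover_in]])
  then have m[measurable]: "(\<lambda>z. indicator (chart_image (cover i)) z *\<^sub>R volume_density A g (cover i) (chart_inv (cover i) z)) \<in> borel_measurable lebesgue"
    by (intro measurable_completion) simp
  have [measurable]: "map_of_chart (cover i) ` piece i \<in> sets lebesgue" by (rule map_piece_sets)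
  have "(\<lambda>z. (indicator (chart_image (cover i)) z *\<^sub>R volume_density A g (cover i) (chart_inv (cover i) z)) *
      indicator (map_of_chart (cover i) ` piece i) z) \<in> borel_measurable lebesgue" by measurable
  moreover have "(\<lambda>z. (indicator (chart_image (cover i)) z *\<^sub>R volume_density A g (cover i) (chart_inv (cover i) z)) *
      indicator (map_of_chart (cover i) ` piece i) z) = piece_density i"
    using map_piece_sub[of i] by (auto simp: piece_density_def fun_eq_iff indicator_def)
  ultimately show ?thesis by (simp only:)
qed

lemma piece_density_pos: "z \<in> map_of_chart (cover i) ` piece i \<Longrightarrow> 0 < piece_density i z"
  using volume_density_pos[OF cover_in chart_inv_in_dom[OF cover_in, of z]] map_piece_sub[of i]
  by (simp add: piece_density_def subset_iff)

text \<open>The share of the Riemannian measure carried by one piece, written as a push-forward so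
  that integrals against it are Lebesgue integrals in a chart.\<close>

definition piece_measure :: "nat \<Rightarrow> 'a measure"
  where "piece_measure i = distr (density lebesgue (\<lambda>z. ennreal (piece_density i z))) (manifold_sigma A) (chart_inv_ext (cover i))"

lemma sets_piece_measure[simp]: "sets (piece_measure i) = lebesgue_sets A"
  and space_piece_measure[simp]: "space (piece_measure i) = UNIV"
  by (simp_all add: piece_measure_def)

lemma nn_integral_piece_measure:
  assumes f: "f \<in> borel_measurable (manifold_sigma A)"
  shows "(\<integral>\<^sup>+x. f x \<partial>piece_measure i) = (\<integral>\<^sup>+z. ennreal (piece_density i z) * f (chart_inv (cover i) z) \<partial>lebesgue)"
proof -
  have m[measurable]: "chart_inv_ext (cover i) \<in> measurable lebesgue (manifold_sigma A)"
    by (rule chart_inv_ext_measurable[OF cover_in])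
  have m': "chart_inv_ext (cover i) \<in> measurable (density lebesgue (\<lambda>z. ennreal (piece_density i z))) (manifold_sigma A)"
    by simp
  have mf: "(\<lambda>z. f (chart_inv_ext (cover i) z)) \<in> borel_measurable lebesgue" by (rule measurable_compose[OF m f])
  have "(\<integral>\<^sup>+x. f x \<partial>piece_measure i) = (\<integral>\<^sup>+z. ennreal (piece_density i z) * f (chart_inv_ext (cover i) z) \<partial>lebesgue)"
    unfolding piece_measure_def
    by (subst nn_integral_distr[OF m']) (use f mf in \<open>simp_all add: nn_integral_density\<close>)
  also have "\<dots> = (\<integral>\<^sup>+z. ennreal (piece_density i z) * f (chart_inv (cover i) z) \<partial>lebesgue)"
  proof (intro nn_integral_cong)
    fix z
    show "ennreal (piece_density i z) * f (chart_inv_ext (cover i) z) = ennreal (piece_density i z) * f (chart_inv (cover i) z)"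
      using map_piece_sub[of i] by (auto simp: piece_density_def chart_inv_ext_def indicator_def)
  qed
  finally show ?thesis .
qed

lemma emeasure_piece_measure:
  assumes X: "X \<in> lebesgue_sets A"
  shows "emeasure (piece_measure i) X = (\<integral>\<^sup>+z. ennreal (volume_density A g (cover i) (chart_inv (cover i) z)) *
            indicator (map_of_chart (cover i) ` (X \<inter> piece i)) z \<partial>lebesgue)"
proof -
  have "emeasure (piece_measure i) X = (\<integral>\<^sup>+x. indicator X x \<partial>piece_measure i)" using X by simp
  also have "\<dots> = (\<integral>\<^sup>+z. ennreal (piece_density i z) * indicator X (chart_inv (cover i) z) \<partial>lebesgue)"
    by (rule nn_integral_piece_measure, rule borel_measurable_indicator) (use X in simp)
  also have "\<dots> = (\<integral>\<^sup>+z. ennreal (volume_density A g (cover i) (chart_inv (cover i) z)) *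
            indicator (map_of_chart (cover i) ` (X \<inter> piece i)) z \<partial>lebesgue)"
  proof (intro nn_integral_cong)
    fix z
    have "z \<in> map_of_chart (cover i) ` (X \<inter> piece i) \<longleftrightarrow> z \<in> map_of_chart (cover i) ` piece i \<and> chart_inv (cover i) z \<in> X"
      using piece_sub[of i] by (auto simp: chart_inv_map[OF cover_in] subset_iff)
    then show "ennreal (piece_density i z) * indicator X (chart_inv (cover i) z) =
      ennreal (volume_density A g (cover i) (chart_inv (cover i) z)) * indicator (map_of_chart (cover i) ` (X \<inter> piece i)) z"
      by (auto simp: piece_density_def indicator_def)
  qed
  finally show ?thesis .
qed

lemma riemannian_measure_eq:
  "riemannian_measure A g = measure_of UNIV (lebesgue_sets A) (\<lambda>X. \<Sum>i. \<integral>\<^sup>+z. ennreal (volume_density A g (cover i) (chart_inv (cover i) z)) *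
            indicator (map_of_chart (cover i) ` (X \<inter> piece i)) z \<partial>lebesgue)"
  by (simp add: riemannian_measure_def piece_def Let_def)

lemma sets_riemannian_measure[simp]: "sets (riemannian_measure A g) = lebesgue_sets A"
  and space_riemannian_measure[simp]: "space (riemannian_measure A g) = UNIV"
  unfolding riemannian_measure_eq
  by (simp_all add: sigma_algebra.sets_measure_of_eq[OF sigma_algebra_lebesgue_sets] space_measure_of_conv)

text \<open>Every summand is a measure, so countable additivity of the sum is an exchange of two
  nonnegative series, done as an integral over the counting measure.\<close>

lemma emeasure_riemannian_measure:
  assumes X: "X \<in> lebesgue_sets A"
  shows "emeasure (riemannian_measure A g) X = (\<Sum>i. emeasure (piece_measure i) X)"
proof -
  have "emeasure (riemannian_measure A g) X = (\<Sum>i. \<integral>\<^sup>+z. ennreal (volume_density A g (cover i) (chart_inv (cover i) z)) *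
            indicator (map_of_chart (cover i) ` (X \<inter> piece i)) z \<partial>lebesgue)"
    unfolding riemannian_measure_eq
  proof (rule emeasure_measure_of_sigma[OF sigma_algebra_lebesgue_sets _ _ X])
    let ?\<mu> = "\<lambda>X. \<Sum>i. \<integral>\<^sup>+z. ennreal (volume_density A g (cover i) (chart_inv (cover i) z)) *
            indicator (map_of_chart (cover i) ` (X \<inter> piece i)) z \<partial>lebesgue"
    show "positive (lebesgue_sets A) ?\<mu>" by (simp add: positive_def)
    show "countably_additive (lebesgue_sets A) ?\<mu>"
      unfolding countably_additive_def
    proof (intro allI impI)
      fix F :: "nat \<Rightarrow> 'a set"
      assume F: "range F \<subseteq> lebesgue_sets A" "disjoint_family F" "(\<Union>i. F i) \<in> lebesgue_sets A"
      have "(\<Sum>n. ?\<mu> (F n)) = (\<Sum>n. \<Sum>i. emeasure (piece_measure i) (F n))"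
        using F by (simp add: emeasure_piece_measure image_subset_iff)
      also have "\<dots> = (\<Sum>n. \<integral>\<^sup>+i. emeasure (piece_measure i) (F n) \<partial>count_space UNIV)"
        by (simp add: nn_integral_count_space_nat)
      also have "\<dots> = (\<integral>\<^sup>+i. (\<Sum>n. emeasure (piece_measure i) (F n)) \<partial>count_space UNIV)"
        by (rule nn_integral_suminf[symmetric]) simp
      also have "\<dots> = (\<Sum>i. \<Sum>n. emeasure (piece_measure i) (F n))"
        by (simp add: nn_integral_count_space_nat)
      also have "\<dots> = (\<Sum>i. emeasure (piece_measure i) (\<Union>n. F n))"
        using F by (intro suminf_cong suminf_emeasure) auto
      also have "\<dots> = ?\<mu> (\<Union>n. F n)" using F(3) by (simp only: emeasure_piece_measure)
      finally show "(\<Sum>n. ?\<mu> (F n)) = ?\<mu> (\<Union>n. F n)" .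
    qed
  qed
  then show ?thesis using X by (simp add: emeasure_piece_measure)
qed

lemma piece_measure_le: "piece_measure i \<le> riemannian_measure A g"
proof -
  have "emeasure (piece_measure i) \<le> emeasure (riemannian_measure A g)"
  proof (rule le_funI)
    fix X
    show "emeasure (piece_measure i) X \<le> emeasure (riemannian_measure A g) X"
    proof (cases "X \<in> lebesgue_sets A")
      case True
      have "sum (\<lambda>i. emeasure (piece_measure i) X) {i} \<le> (\<Sum>i. emeasure (piece_measure i) X)"
        by (rule sum_le_suminf) auto
      then show ?thesis using True by (simp add: emeasure_riemannian_measure)
    qed (simp add: emeasure_notin_sets)
  qed
  then show ?thesis by (simp add: le_measure le_fun_def)
qed

text \<open>The density is positive on each piece, so a set of measure zero has negligible pieces in
  the charts of the cover, and transition maps carry this to every chart. The converse holds because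
  a density does not charge negligible sets.\<close>

lemma null_sets_riemannian_measure: "X \<in> null_sets (riemannian_measure A g) \<longleftrightarrow> chart_null X"
proof
  assume "X \<in> null_sets (riemannian_measure A g)"
  then have X: "X \<in> lebesgue_sets A" and "(\<Sum>i. emeasure (piece_measure i) X) = 0"
    by (auto simp: null_sets_def emeasure_riemannian_measure)
  then have 0: "emeasure (piece_measure i) X = 0" for i by (simp add: suminf_eq_zero_iff)
  show "chart_null X"
  proof (rule chart_null_cover[OF cover_in piece_sub UN_piece])
    fix i
    have "(\<integral>\<^sup>+x. indicator X x \<partial>piece_measure i) = 0" using 0[of i] X by simp
    then have z: "(\<integral>\<^sup>+z. ennreal (piece_density i z) * indicator X (chart_inv (cover i) z) \<partial>lebesgue) = 0"
      by (subst (asm) nn_integral_piece_measure) (use X in \<open>simp_all add: borel_measurable_indicator\<close>)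
    have eq: "ennreal (piece_density i z) * indicator X (chart_inv (cover i) z) =
       ennreal (piece_density i z * indicator (map_of_chart (cover i) ` (X \<inter> dom_of (cover i))) z)" for z
      unfolding map_image_eq[OF cover_in] using map_piece_sub[of i] by (auto simp: piece_density_def indicator_def)
    have Xm: "map_of_chart (cover i) ` (X \<inter> dom_of (cover i)) \<in> sets lebesgue" by (rule lebesgue_sets_map[OF X cover_in])
    have m: "(\<lambda>z. ennreal (piece_density i z * indicator (map_of_chart (cover i) ` (X \<inter> dom_of (cover i))) z)) \<in> borel_measurable lebesgue"
      using Xm by measurable
    have "AE z in lebesgue. ennreal (piece_density i z * indicator (map_of_chart (cover i) ` (X \<inter> dom_of (cover i))) z) = 0"
      using z unfolding eq nn_integral_0_iff_AE[OF m] .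
    then have "AE z in lebesgue. z \<notin> map_of_chart (cover i) ` (X \<inter> piece i)"
    proof eventually_elim
      case (elim z)
      show ?case
      proof
        assume zz: "z \<in> map_of_chart (cover i) ` (X \<inter> piece i)"
        then have "0 < piece_density i z" using piece_density_pos[of z i] by blast
        moreover have "z \<in> map_of_chart (cover i) ` (X \<inter> dom_of (cover i))" using zz piece_sub by blast
        ultimately show False using elim by (simp add: ennreal_eq_0_iff)
      qed
    qed
    then show "negligible (map_of_chart (cover i) ` (X \<inter> piece i))"
      by (simp add: negligible_iff_null_sets completion.AE_iff_null_sets)
  qed
next
  assume X: "chart_null X"
  then have Xl: "X \<in> lebesgue_sets A" by (rule chart_null_lebesgue_sets)
  have "emeasure (piece_measure i) X = 0" for i
  proof -
    have "negligible (map_of_chart (cover i) ` (X \<inter> dom_of (cover i)))" using X cover_in by (auto simp: chart_null_def)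
    then have "negligible (map_of_chart (cover i) ` (X \<inter> piece i))"
      by (rule negligible_subset) (use piece_sub in blast)
    then have "AE z in lebesgue. z \<notin> map_of_chart (cover i) ` (X \<inter> piece i)"
      by (simp add: negligible_iff_null_sets completion.AE_iff_null_sets)
    then have "AE z in lebesgue. ennreal (volume_density A g (cover i) (chart_inv (cover i) z)) *
            indicator (map_of_chart (cover i) ` (X \<inter> piece i)) z = 0"
      by eventually_elim simp
    then show ?thesis unfolding emeasure_piece_measure[OF Xl] by (subst nn_integral_cong_AE[where v="\<lambda>_. 0"]) auto
  qed
  then show "X \<in> null_sets (riemannian_measure A g)"
    using Xl by (simp add: null_sets_def emeasure_riemannian_measure)
qed

lemma AE_riemannian_measure: "(AE x in riemannian_measure A g. P x) \<longleftrightarrow> chart_AE P"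
proof
  assume "AE x in riemannian_measure A g. P x"
  then obtain N where "{x. \<not> P x} \<subseteq> N" "N \<in> null_sets (riemannian_measure A g)"
    by (auto simp: eventually_ae_filter)
  then show "chart_AE P" unfolding chart_AE_iff_null null_sets_riemannian_measure by (blast intro: chart_null_subset)
next
  assume "chart_AE P"
  then have "{x. \<not> P x} \<in> null_sets (riemannian_measure A g)"
    by (simp add: chart_AE_iff_null null_sets_riemannian_measure)
  then show "AE x in riemannian_measure A g. P x" by (rule AE_I') simp
qed

lemma measurable_riemannian_measure: "measurable (riemannian_measure A g) N = measurable (manifold_sigma A) N"
  by (rule measurable_cong_sets) simp_all

section \<open>From integrals over the manifold to local integrability in charts\<close>

lemma set_integrable_piece:
  fixes F :: "'a \<Rightarrow> real"
  assumes F: "F \<in> borel_measurable (manifold_sigma A)" "\<And>x. 0 \<le> F x" "(\<integral>\<^sup>+x. ennreal (F x) \<partial>riemannian_measure A g) < \<infinity>"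
  shows "set_integrable lebesgue (map_of_chart (cover i) ` piece i)
      (\<lambda>z. volume_density A g (cover i) (chart_inv (cover i) z) * F (chart_inv (cover i) z))"
  unfolding set_integrable_def
proof (rule integrableI_bounded)
  let ?f = "\<lambda>z. piece_density i z * (indicator (chart_image (cover i)) z *\<^sub>R F (chart_inv (cover i) z))"
  have eq: "indicator (map_of_chart (cover i) ` piece i) z *\<^sub>R (volume_density A g (cover i) (chart_inv (cover i) z) * F (chart_inv (cover i) z)) = ?f z" for z
    using map_piece_sub[of i] by (auto simp: piece_density_def indicator_def)
  have "?f \<in> borel_measurable lebesgue"
    using measurable_in_chart[OF cover_in F(1), of i] by measurable
  then show "(\<lambda>z. indicator (map_of_chart (cover i) ` piece i) z *\<^sub>R (volume_density A g (cover i) (chart_inv (cover i) z) * F (chart_inv (cover i) z))) \<in> borel_measurable lebesgue"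
    by (simp only: eq)
  have nn: "0 \<le> piece_density i z" for z
    using piece_density_pos[of z i] by (cases "z \<in> map_of_chart (cover i) ` piece i") (auto simp: piece_density_def)
  have "(\<integral>\<^sup>+z. ennreal (norm (?f z)) \<partial>lebesgue) = (\<integral>\<^sup>+z. ennreal (piece_density i z) * ennreal (F (chart_inv (cover i) z)) \<partial>lebesgue)"
  proof (intro nn_integral_cong)
    fix z
    show "ennreal (norm (?f z)) = ennreal (piece_density i z) * ennreal (F (chart_inv (cover i) z))"
    proof (cases "z \<in> map_of_chart (cover i) ` piece i")
      case True
      then have e: "?f z = piece_density i z * F (chart_inv (cover i) z)" using map_piece_sub[of i] by (auto simp: subset_iff)
      show ?thesis unfolding e using nn[of z] F(2)[of "chart_inv (cover i) z"] by (simp add: ennreal_mult)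
    qed (simp add: piece_density_def)
  qed
  also have "\<dots> = (\<integral>\<^sup>+x. ennreal (F x) \<partial>piece_measure i)"
    by (rule nn_integral_piece_measure[symmetric]) (use F(1) in measurable)
  also have "\<dots> \<le> (\<integral>\<^sup>+x. ennreal (F x) \<partial>riemannian_measure A g)"
    by (rule nn_integral_mono_measure[OF _ piece_measure_le]) simp
  also have "\<dots> < \<infinity>" by (rule F(3))
  finally show "(\<integral>\<^sup>+z. ennreal (norm (indicator (map_of_chart (cover i) ` piece i) z *\<^sub>R (volume_density A g (cover i) (chart_inv (cover i) z) * F (chart_inv (cover i) z)))) \<partial>lebesgue) < \<infinity>"
    by (simp only: eq)
qed

text \<open>Integrability is known in the chart of the cover to which the piece belongs. The
  transition map carries it to the chart c, the Jacobian turning one density into the other.\<close>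

lemma set_integrable_piece_chart:
  fixes F :: "'a \<Rightarrow> real"
  assumes c: "c \<in> A" and F: "F \<in> borel_measurable (manifold_sigma A)" "\<And>x. 0 \<le> F x" "(\<integral>\<^sup>+x. ennreal (F x) \<partial>riemannian_measure A g) < \<infinity>"
  shows "set_integrable lebesgue (map_of_chart c ` (piece i \<inter> dom_of c))
      (\<lambda>z. volume_density A g c (chart_inv c z) * F (chart_inv c z))"
proof -
  let ?i = "cover i"
  define \<tau> where "\<tau> = map_of_chart ?i \<circ> chart_inv c"
  define S where "S = map_of_chart c ` (piece i \<inter> dom_of c)"
  have S: "S \<in> sets lebesgue" unfolding S_def by (rule lebesgue_sets_map[OF piece_in c])
  have Si: "map_of_chart ?i ` (piece i \<inter> dom_of c) \<in> sets lebesgue"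
  proof -
    have "map_of_chart ?i ` ((piece i \<inter> dom_of c) \<inter> dom_of ?i) \<in> sets lebesgue"
      by (rule lebesgue_sets_map[OF lebesgue_sets_Int[OF piece_in open_in_lebesgue_sets[OF open_dom[OF c]]] cover_in])
    moreover have "(piece i \<inter> dom_of c) \<inter> dom_of ?i = piece i \<inter> dom_of c" using piece_sub[of i] by blast
    ultimately show ?thesis by simp
  qed
  have \<tau>S: "\<tau> ` S = map_of_chart ?i ` (piece i \<inter> dom_of c)"
    unfolding \<tau>_def S_def by (rule transition_image[OF c cover_in]) auto
  define T where "T z = transition_deriv c ?i (chart_inv c z)" for z
  have der: "(\<tau> has_derivative blinfun_apply (T z)) (at z within S)" if "z \<in> S" for z
  proof -
    obtain x where x: "x \<in> piece i" "x \<in> dom_of c" "z = map_of_chart c x" using \<open>z \<in> S\<close> by (auto simp: S_def)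
    then have "x \<in> dom_of ?i" using piece_sub by blast
    from transition_has_derivative[OF c cover_in x(2) this]
    show ?thesis unfolding \<tau>_def T_def by (simp add: x chart_inv_map[OF c] has_derivative_at_withinI)
  qed
  have inj: "inj_on \<tau> S"
  proof (rule inj_onI)
    fix z z' assume zz: "z \<in> S" "z' \<in> S" and eq: "\<tau> z = \<tau> z'"
    obtain x where x: "x \<in> piece i" "x \<in> dom_of c" "z = map_of_chart c x" using zz by (auto simp: S_def)
    obtain x' where x': "x' \<in> piece i" "x' \<in> dom_of c" "z' = map_of_chart c x'" using zz by (auto simp: S_def)
    have "map_of_chart ?i x = map_of_chart ?i x'" using eq by (simp add: \<tau>_def x x' chart_inv_map[OF c])
    then have "x = x'" using inj_on_chart[OF cover_in[of i]] x x' piece_sub[of i] by (auto simp: inj_on_def subset_iff)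
    then show "z = z'" using x x' by simp
  qed
  have "set_integrable lebesgue (\<tau> ` S) (\<lambda>z. volume_density A g ?i (chart_inv ?i z) * F (chart_inv ?i z))"
    unfolding \<tau>S by (rule set_integrable_subset[OF set_integrable_piece[OF F, of i] Si]) auto
  from set_integrable_change_of_variables[OF S der inj this]
  have "set_integrable lebesgue S (\<lambda>z. \<bar>det (matrix (T z))\<bar> * (volume_density A g ?i (chart_inv ?i (\<tau> z)) * F (chart_inv ?i (\<tau> z))))" .
  moreover have "\<bar>det (matrix (T z))\<bar> * (volume_density A g ?i (chart_inv ?i (\<tau> z)) * F (chart_inv ?i (\<tau> z))) =
      volume_density A g c (chart_inv c z) * F (chart_inv c z)" if "z \<in> S" for z
  proof -
    obtain x where x: "x \<in> piece i" "x \<in> dom_of c" "z = map_of_chart c x" using \<open>z \<in> S\<close> by (auto simp: S_def)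
    then have xi: "x \<in> dom_of ?i" using piece_sub by blast
    have "chart_inv ?i (\<tau> z) = x" "chart_inv c z = x" by (simp_all add: \<tau>_def x chart_inv_map[OF c] chart_inv_map[OF cover_in xi])
    then show ?thesis using volume_density_change[OF cover_in c xi x(2)] by (simp add: T_def)
  qed
  ultimately show ?thesis unfolding S_def[symmetric] by (simp cong: set_integrable_cong)
qed

lemma compact_finitely_many_pieces:
  assumes "compact L" obtains n where "L \<subseteq> (\<Union>i<n. piece i)"
proof -
  have "L \<subseteq> (\<Union>i. dom_of (cover i))" by (simp add: countable_chart_cover_works)
  then obtain I where I: "finite I" "L \<subseteq> (\<Union>i\<in>I. dom_of (cover i))"
    using compactE_image[OF assms, of UNIV "\<lambda>i. dom_of (cover i)"] open_dom[OF cover_in] by metis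
  obtain n where n: "I \<subseteq> {0..<n}" using finite_nat_bounded[OF I(1)] by (auto simp: atLeast0LessThan)
  have "L \<subseteq> (\<Union>i\<in>{0..<n}. dom_of (cover i))" using I n by blast
  also have "\<dots> = (\<Union>i\<in>{0..<n}. piece i)" unfolding piece_def by (rule finite_UN_disjointed_eq[symmetric])
  finally show thesis by (intro that[of n]) (simp add: atLeast0LessThan)
qed

text \<open>A compact set in a chart is covered by finitely many pieces, and the volume density has
  a positive lower bound on it. Dividing by this bound and summing over the pieces gives an
  integrable majorant of F.\<close>

theorem loc_integrable_chart:
  fixes F :: "'a \<Rightarrow> real"
  assumes c: "c \<in> A" and F: "F \<in> borel_measurable (manifold_sigma A)" "\<And>x. 0 \<le> F x" "(\<integral>\<^sup>+x. ennreal (F x) \<partial>riemannian_measure A g) < \<infinity>"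
  shows "loc_integrable (chart_image c) (\<lambda>z. F (chart_inv c z))"
  unfolding loc_integrable_def set_integrable_def
proof (intro allI impI, elim conjE)
  fix K assume K: "compact K" "K \<subseteq> chart_image c"
  let ?V = "\<lambda>z. volume_density A g c (chart_inv c z)"
  have "compact (chart_inv c ` K)"
    by (rule compact_continuous_image[OF continuous_on_subset[OF continuous_on_inv[OF c] K(2)] K(1)])
  then obtain n where n: "chart_inv c ` K \<subseteq> (\<Union>i<n. piece i)" by (rule compact_finitely_many_pieces)
  let ?S = "\<lambda>i. map_of_chart c ` (piece i \<inter> dom_of c)"
  have Sin: "z \<in> ?S i \<longleftrightarrow> chart_inv c z \<in> piece i" if "z \<in> K" for z i
    using that K(2) unfolding map_image_eq[OF c] by auto
  have "\<exists>m>0. \<forall>z\<in>K. m \<le> ?V z"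
  proof (cases "K = {}")
    case False
    obtain z0 where "z0 \<in> K" "\<And>z. z \<in> K \<Longrightarrow> ?V z0 \<le> ?V z"
      using continuous_attains_inf[OF K(1) False continuous_on_subset[OF density_chart_continuous[OF c] K(2)]] by blast
    then show ?thesis using volume_density_pos[OF c chart_inv_in_dom[OF c]] K(2) by (meson subsetD)
  qed (auto intro: exI[of _ 1])
  then obtain m where m: "m > 0" "\<And>z. z \<in> K \<Longrightarrow> m \<le> ?V z" by blast
  have Kl: "K \<in> sets lebesgue" using lmeasurable_compact[OF K(1)] by auto
  have Fm: "(\<lambda>z. indicator K z *\<^sub>R F (chart_inv c z)) \<in> borel_measurable lebesgue"
  proof -
    have "(\<lambda>z. indicator K z *\<^sub>R (indicator (chart_image c) z *\<^sub>R F (chart_inv c z))) \<in> borel_measurable lebesgue"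
      using measurable_in_chart[OF c F(1)] Kl by measurable
    moreover have "(\<lambda>z. indicator K z *\<^sub>R (indicator (chart_image c) z *\<^sub>R F (chart_inv c z))) = (\<lambda>z. indicator K z *\<^sub>R F (chart_inv c z))"
      using K(2) by (auto simp: fun_eq_iff indicator_def)
    ultimately show ?thesis by (simp only:)
  qed
  have int: "integrable lebesgue (\<lambda>z. \<Sum>i<n. inverse m * (indicator (?S i) z *\<^sub>R (?V z * F (chart_inv c z))))"
    using set_integrable_piece_chart[OF c F] unfolding set_integrable_def
    by (intro Bochner_Integration.integrable_sum integrable_mult_right) blast
  show "integrable lebesgue (\<lambda>z. indicator K z *\<^sub>R F (chart_inv c z))"
  proof (rule Bochner_Integration.integrable_bound[OF int Fm], intro AE_I2)
    fix z
    have nn: "0 \<le> inverse m * (indicator (?S i) z *\<^sub>R (?V z * F (chart_inv c z)))" for i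
    proof (cases "z \<in> ?S i")
      case True
      then have "chart_inv c z \<in> dom_of c" using chart_inv_map[OF c] by auto
      then have "0 < ?V z" by (rule volume_density_pos[OF c])
      then show ?thesis using F(2) m(1) by simp
    qed simp
    show "norm (indicator K z *\<^sub>R F (chart_inv c z)) \<le> norm (\<Sum>i<n. inverse m * (indicator (?S i) z *\<^sub>R (?V z * F (chart_inv c z))))"
    proof (cases "z \<in> K")
      case True
      then obtain i where i: "i < n" "chart_inv c z \<in> piece i" using n by auto
      then have zi: "z \<in> ?S i" using Sin[OF True] by simp
      have "m * F (chart_inv c z) \<le> ?V z * F (chart_inv c z)" using m(2)[OF True] F(2) by (rule mult_right_mono)
      then have "F (chart_inv c z) \<le> inverse m * (?V z * F (chart_inv c z))" using m(1) by (simp add: field_simps)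
      also have "\<dots> = inverse m * (indicator (?S i) z *\<^sub>R (?V z * F (chart_inv c z)))" using zi by simp
      also have "\<dots> \<le> (\<Sum>i<n. inverse m * (indicator (?S i) z *\<^sub>R (?V z * F (chart_inv c z))))"
        by (rule member_le_sum) (use i nn in auto)
      finally show ?thesis using True F(2)[of "chart_inv c z"] by simp
    qed simp
  qed
qed

text \<open>The quadratic form is continuous and positive on the compact product of K with the unit
  sphere; by homogeneity its extrema there bound it on all vectors.\<close>

lemma metric_frame_bounds:
  assumes c: "c \<in> A" and K: "compact K" "K \<subseteq> dom_of c"
  obtains l u where "0 < l" "0 < u"
    "\<And>x v. x \<in> K \<Longrightarrow> l * (norm v)\<^sup>2 \<le> g x (chart_frame A c x v) (chart_frame A c x v)"
    "\<And>x v. x \<in> K \<Longrightarrow> g x (chart_frame A c x v) (chart_frame A c x v) \<le> u * (norm v)\<^sup>2"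
proof (cases "K = {}")
  case True
  then show ?thesis by (intro that[of 1 1]) auto
next
  case False
  let ?q = "\<lambda>x v. g x (chart_frame A c x v) (chart_frame A c x v)"
  let ?Q = "\<lambda>p. \<Sum>i\<in>UNIV. \<Sum>j\<in>UNIV. snd p $ i * snd p $ j * chart_gram c (fst p) $ i $ j"
  have Q: "?q x v = ?Q (x, v)" for x v by (simp add: metric_frame)
  let ?C = "K \<times> sphere (0::real^'m) 1"
  have C: "compact ?C" using K(1) by (intro compact_Times) auto
  have "axis undefined 1 \<in> sphere (0::real^'m) 1" by simp
  then have Cne: "?C \<noteq> {}" using False by blast
  have gc: "continuous_on ?C (\<lambda>p. chart_gram c (fst p) $ i $ j)" for i j
    unfolding chart_gram_def
    by (simp, rule continuous_on_compose2[OF continuous_on_metric[OF c] continuous_on_fst[OF continuous_on_id]]) (use K in auto)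
  have cont: "continuous_on ?C ?Q"
    by (intro continuous_on_sum continuous_on_mult continuous_on_component continuous_on_snd continuous_on_id gc) 
  obtain p0 where p0: "p0 \<in> ?C" "\<And>p. p \<in> ?C \<Longrightarrow> ?Q p0 \<le> ?Q p" using continuous_attains_inf[OF C Cne cont] by blast
  obtain p1 where p1: "p1 \<in> ?C" "\<And>p. p \<in> ?C \<Longrightarrow> ?Q p \<le> ?Q p1" using continuous_attains_sup[OF C Cne cont] by blast
  have pos: "0 < ?q x v" if "x \<in> K" "v \<noteq> 0" for x v
  proof -
    interpret scalar_product "g x" by (rule scalar_product)
    have "chart_frame A c x v \<noteq> 0"
      using chart_diff_frame_apply(1)[OF c, of x v] that K(2) by (metis blinfun.zero_right subsetD)
    then show ?thesis by (rule pos)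
  qed
  have l0: "0 < ?Q p0"
  proof -
    have "fst p0 \<in> K" "snd p0 \<noteq> 0" using p0(1) by (auto simp: mem_Times_iff)
    from pos[OF this] show ?thesis using Q[of "fst p0" "snd p0"] by simp
  qed
  have u0: "0 < ?Q p1" using l0 p1(2)[OF p0(1)] by linarith
  have scal: "?q x v = (norm v)\<^sup>2 * ?Q (x, v /\<^sub>R norm v)" if "v \<noteq> 0" for x v
  proof -
    interpret scalar_product "g x" by (rule scalar_product)
    have hom: "?q x (r *\<^sub>R w) = r\<^sup>2 * ?q x w" for r w
      by (simp only: blinfun.scaleR_right h_scaleR power2_eq_square mult.assoc)
    have "?q x v = ?q x (norm v *\<^sub>R (v /\<^sub>R norm v))" using that by simp
    also have "\<dots> = (norm v)\<^sup>2 * ?q x (v /\<^sub>R norm v)" by (rule hom)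
    finally show ?thesis by (simp only: Q)
  qed
  show ?thesis
  proof (rule that[OF l0 u0])
    fix x v assume x: "x \<in> K"
    have z: "?q x 0 = 0" using metric_frame[of x c 0 0] by simp
    have inC: "(x, v /\<^sub>R norm v) \<in> ?C" if "v \<noteq> 0" using x that by simp
    show "?Q p0 * (norm v)\<^sup>2 \<le> ?q x v"
    proof (cases "v = 0")
      case False
      show ?thesis unfolding scal[OF False] using mult_left_mono[OF p0(2)[OF inC[OF False]], of "(norm v)\<^sup>2"] by (simp only: mult.commute zero_le_power2)
    qed (use z in simp)
    show "?q x v \<le> ?Q p1 * (norm v)\<^sup>2"
    proof (cases "v = 0")
      case False
      show ?thesis unfolding scal[OF False] using mult_left_mono[OF p1(2)[OF inC[OF False]], of "(norm v)\<^sup>2"] by (simp only: mult.commute zero_le_power2)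
    qed (use z in simp)
  qed
qed

text \<open>The entries g^{kl} of the inverse Gram matrix, in the form of Cramer's rule, so that
  their continuity is that of determinants.\<close>

definition gram_inverse :: "('a, 'm) mchart \<Rightarrow> 'a \<Rightarrow> 'm \<Rightarrow> 'm \<Rightarrow> real"
  where "gram_inverse c x k l =
    det (\<chi> i j. if j = k then axis l 1 $ i else chart_gram c x $ i $ j) / det (chart_gram c x)"

lemma continuous_on_gram_inverse:
  assumes c: "c \<in> A" shows "continuous_on (dom_of c) (\<lambda>x. gram_inverse c x k l)"
  unfolding gram_inverse_def
proof (intro continuous_on_divide continuous_on_det ballI)
  have gc: "continuous_on (dom_of c) (\<lambda>x. chart_gram c x $ i $ j)" for i j
    by (simp add: chart_gram_def continuous_on_metric[OF c])
  show "continuous_on (dom_of c) (\<lambda>x. chart_gram c x $ i $ j)" for i j by (rule gc)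
  show "continuous_on (dom_of c) (\<lambda>x. (\<chi> i j. if j = k then axis l 1 $ i else chart_gram c x $ i $ j) $ i $ j)" for i j
    using gc[of i j] by (cases "j = k") auto
  show "det (chart_gram c x) \<noteq> 0" if "x \<in> dom_of c" for x using det_chart_gram_pos[OF c that] by simp
qed

text \<open>If the rows of \<beta> are the coordinates of an orthonormal basis, then \<beta>^T
  \<beta> inverts the Gram matrix. The sum is therefore independent of the basis, which is chosen at
  each x without any continuity.\<close>

lemma gram_inverse_basis:
  assumes c: "c \<in> A" and x: "x \<in> dom_of c" and b: "orthonormal_basis (g x) b"
  shows "(\<Sum>i\<in>UNIV. chart_diff A c x (b i) $ k * chart_diff A c x (b i) $ l) = gram_inverse c x k l"
proof -
  interpret scalar_product "g x" by (rule scalar_product)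
  let ?f = "\<lambda>a. chart_frame A c x (axis a 1)"
  define P :: "real^'m^'m" where "P = (\<chi> a i. g x (?f a) (b i))"
  define \<beta> :: "real^'m^'m" where "\<beta> = (\<chi> i a. chart_diff A c x (b i) $ a)"
  have G: "chart_gram c x = P ** transpose P"
    by (simp add: chart_gram_def P_def matrix_matrix_mult_def transpose_def vec_eq_iff parseval[OF b, of "?f i" "?f j" for i j])
  \<comment> \<open>Expanding a frame vector in the basis and reading the result in the chart gives
    back a unit vector.\<close>
  have "P ** \<beta> = mat 1"
  proof -
    have "(P ** \<beta>) $ a $ l = mat 1 $ a $ l" for a l
    proof -
      have "(\<Sum>i\<in>UNIV. g x (?f a) (b i) *\<^sub>R b i) = ?f a" by (rule orthonormal_expansion[OF b, symmetric])
      then have "chart_diff A c x (\<Sum>i\<in>UNIV. g x (?f a) (b i) *\<^sub>R b i) = axis a 1"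
        by (simp add: chart_diff_frame_apply(1)[OF c x])
      then have "(\<Sum>i\<in>UNIV. g x (?f a) (b i) *\<^sub>R chart_diff A c x (b i)) = axis a 1"
        by (simp add: blinfun.sum_right blinfun.scaleR_right)
      then have "(\<Sum>i\<in>UNIV. g x (?f a) (b i) *\<^sub>R chart_diff A c x (b i)) $ l = axis a 1 $ l" by simp
      then show ?thesis by (simp add: matrix_matrix_mult_def P_def \<beta>_def mat_def axis_def eq_commute)
    qed
    then show ?thesis by (simp add: vec_eq_iff)
  qed
  then have \<beta>P: "\<beta> ** P = mat 1" by (rule matrix_left_right_inverse1)
  have "chart_gram c x ** (transpose \<beta> ** \<beta>) = P ** (transpose P ** transpose \<beta>) ** \<beta>"
    by (simp add: G matrix_mul_assoc)
  also have "transpose P ** transpose \<beta> = mat 1" by (simp add: \<beta>P transpose_mat flip: matrix_transpose_mul)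
  finally have I: "chart_gram c x ** (transpose \<beta> ** \<beta>) = mat 1" using \<open>P ** \<beta> = mat 1\<close> by simp
  define H where "H = transpose \<beta> ** \<beta>"
  have "chart_gram c x *v (\<chi> k. H $ k $ l) = axis l 1"
  proof -
    have "(chart_gram c x *v (\<chi> k. H $ k $ l)) $ i = (chart_gram c x ** H) $ i $ l" for i
      by (simp add: matrix_vector_mult_def matrix_matrix_mult_def)
    then show ?thesis using I by (simp add: vec_eq_iff H_def mat_def axis_def)
  qed
  moreover have "det (chart_gram c x) \<noteq> 0" using det_chart_gram_pos[OF c x] by simp
  ultimately have "(\<chi> k. H $ k $ l) = (\<chi> k. det (\<chi> i j. if j = k then axis l 1 $ i else chart_gram c x $ i $ j) / det (chart_gram c x))"
    using cramer by blast
  then have "H $ k $ l = gram_inverse c x k l" by (simp add: vec_eq_iff gram_inverse_def)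
  moreover have "H $ k $ l = (\<Sum>i\<in>UNIV. chart_diff A c x (b i) $ k * chart_diff A c x (b i) $ l)"
    by (simp add: H_def matrix_matrix_mult_def transpose_def \<beta>_def)
  ultimately show ?thesis by simp
qed

end

section \<open>Compactly supported test functions on a manifold\<close>

text \<open>With b the squared positive part and R = r^2, the quotient b(4R - t) / (b(4R - t) + b(t
  - R)) at t = |z - z0|^2 is one for t \<le> R and zero for t \<ge> 4R. The denominator is positive
  because the half-lines t < 4R and t > R cover the line.\<close>

lemma C1_cutoff_exists:
  fixes z0 :: "'v::euclidean_space"
  assumes r: "0 < r"
  obtains \<theta> :: "'v \<Rightarrow> real" and \<theta>' :: "'v \<Rightarrow> 'v \<Rightarrow>\<^sub>L real"
  where "\<And>z. (\<theta> has_derivative blinfun_apply (\<theta>' z)) (at z)" "continuous_on UNIV \<theta>'"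
    "\<And>z. dist z0 z \<le> r \<Longrightarrow> \<theta> z = 1" "\<And>z. 2 * r \<le> dist z0 z \<Longrightarrow> \<theta> z = 0"
proof -
  define b where "b t = (max 0 t)\<^sup>2" for t :: real
  define b' where "b' t = 2 * max 0 t" for t :: real
  have db: "(b has_real_derivative b' t) (at t)" for t unfolding b_def[abs_def] b'_def by (rule has_derivative_max_sq)
  have cb: "continuous_on UNIV b" "continuous_on UNIV b'" unfolding b_def b'_def by (intro continuous_intros)+
  define R where "R = r\<^sup>2"
  have R: "R > 0" using r by (simp add: R_def)
  define q where "q t = b (4 * R - t) + b (t - R)" for t
  have qpos: "q t > 0" for t
  proof (cases "t < 4 * R")
    case True
    then have "b (4 * R - t) > 0" by (simp add: b_def)
    then show ?thesis by (simp add: q_def b_def add_pos_nonneg)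
  next
    case False
    then have "b (t - R) > 0" using R by (simp add: b_def)
    then show ?thesis by (simp add: q_def b_def add_nonneg_pos)
  qed
  define s where "s t = b (4 * R - t) / q t" for t
  define s' where "s' t = ((b' (4 * R - t) * (0 - 1)) * q t - b (4 * R - t) * (b' (4 * R - t) * (0 - 1) + b' (t - R) * (1 - 0))) / (q t * q t)" for t
  have ds: "(s has_real_derivative s' t) (at t)" for t
  proof -
    have 1: "((\<lambda>t. b (4 * R - t)) has_real_derivative b' (4 * R - t) * (0 - 1)) (at t)"
      by (rule DERIV_chain2[OF db]) (intro DERIV_diff DERIV_const DERIV_ident)
    have 2: "((\<lambda>t. b (t - R)) has_real_derivative b' (t - R) * (1 - 0)) (at t)"
      by (rule DERIV_chain2[OF db]) (intro DERIV_diff DERIV_const DERIV_ident)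
    show ?thesis
      unfolding s_def[abs_def] s'_def
      by (rule DERIV_divide[OF 1]) (use DERIV_add[OF 1 2] qpos[of t] in \<open>simp_all add: q_def[abs_def]\<close>)
  qed
  have cs': "continuous_on UNIV s'"
    unfolding s'_def q_def
    by (intro continuous_intros continuous_on_compose2[OF cb(1)] continuous_on_compose2[OF cb(2)])
      (use qpos in \<open>auto simp: q_def less_imp_neq[symmetric]\<close>)
  define \<theta> where "\<theta> z = s ((z - z0) \<bullet> (z - z0))" for z
  define \<theta>' where "\<theta>' z = (s' ((z - z0) \<bullet> (z - z0)) * 2) *\<^sub>R blinfun_inner_right (z - z0)" for z
  show thesis
  proof
    show "(\<theta> has_derivative blinfun_apply (\<theta>' z)) (at z)" for z
    proof -
      have 1: "((\<lambda>z. (z - z0) \<bullet> (z - z0)) has_derivative (\<lambda>v. 2 * ((z - z0) \<bullet> v))) (at z)"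
        by (auto intro!: derivative_eq_intros simp: inner_commute)
      have "(\<theta> has_derivative (\<lambda>v. s' ((z - z0) \<bullet> (z - z0)) * (2 * ((z - z0) \<bullet> v)))) (at z)"
        unfolding \<theta>_def[abs_def]
        by (rule has_derivative_compose[OF 1]) (use ds[of "(z - z0) \<bullet> (z - z0)"] in \<open>simp add: has_field_derivative_def\<close>)
      moreover have "(\<lambda>v. s' ((z - z0) \<bullet> (z - z0)) * (2 * ((z - z0) \<bullet> v))) = blinfun_apply (\<theta>' z)"
        by (simp add: fun_eq_iff \<theta>'_def blinfun.scaleR_left)
      ultimately show ?thesis by simp
    qed
    show "continuous_on UNIV \<theta>'"
      unfolding \<theta>'_def by (intro continuous_intros continuous_on_compose2[OF cs']) auto
    show "\<theta> z = 1" if "dist z0 z \<le> r" for z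
    proof -
      have "(z - z0) \<bullet> (z - z0) = (dist z0 z)\<^sup>2" by (simp add: dist_norm norm_minus_commute[of z0 z] power2_norm_eq_inner)
      then have "(z - z0) \<bullet> (z - z0) \<le> R"
        using that power_mono[of "dist z0 z" r 2] by (simp add: R_def)
      then have "q ((z - z0) \<bullet> (z - z0)) = b (4 * R - (z - z0) \<bullet> (z - z0))" by (simp add: q_def b_def)
      then show ?thesis using qpos[of "(z - z0) \<bullet> (z - z0)"] by (simp add: \<theta>_def s_def)
    qed
    show "\<theta> z = 0" if "2 * r \<le> dist z0 z" for z
    proof -
      have "(2 * r)\<^sup>2 \<le> (norm (z - z0))\<^sup>2"
        using that r by (intro power_mono) (auto simp: dist_norm norm_minus_commute)
      then have "4 * R \<le> (z - z0) \<bullet> (z - z0)" by (simp add: R_def power2_norm_eq_inner power_mult_distrib)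
      then show ?thesis by (simp add: \<theta>_def s_def b_def)
    qed
  qed
qed

text \<open>S and the complement of K are open, cover the space, and the extension is explicit on
  each of them.\<close>

lemma C1_extend_by_zero:
  fixes \<psi> :: "'v::euclidean_space \<Rightarrow> real"
  assumes S: "open S" and K: "closed K" "K \<subseteq> S"
    and d: "\<And>z. z \<in> S \<Longrightarrow> (\<psi> has_derivative blinfun_apply (\<psi>' z)) (at z)" and c: "continuous_on S \<psi>'"
    and z: "\<And>z. z \<in> S \<Longrightarrow> z \<notin> K \<Longrightarrow> \<psi> z = 0"
  obtains h' where "\<And>z. ((\<lambda>z. if z \<in> S then \<psi> z else 0) has_derivative blinfun_apply (h' z)) (at z)"
    "continuous_on UNIV h'" "\<And>z. z \<notin> K \<Longrightarrow> h' z = 0" "\<And>z. z \<in> S \<Longrightarrow> h' z = \<psi>' z"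
proof -
  let ?h = "\<lambda>z. if z \<in> S then \<psi> z else 0"
  have d1: "(?h has_derivative blinfun_apply (\<psi>' z)) (at z)" if "z \<in> S" for z
    by (rule has_derivative_transform_within_open[OF d[OF that] S that]) simp
  have d0: "(?h has_derivative (\<lambda>_. 0)) (at z)" if "z \<notin> K" for z
  proof -
    have "((\<lambda>_. 0) has_derivative (\<lambda>_. 0)) (at z)" by simp
    then show ?thesis
      by (rule has_derivative_transform_within_open[where s="-K"]) (use K that z in \<open>auto simp: open_Compl\<close>)
  qed
  have z': "\<psi>' y = 0" if "y \<in> S" "y \<notin> K" for y
    using has_derivative_unique[OF d1[OF that(1)] d0[OF that(2)]] by (intro blinfun_eqI) simp
  define h' where "h' y = (if y \<in> S then \<psi>' y else 0)" for y
  have h'0: "h' y = 0" if "y \<notin> K" for y using z'[of y] that by (simp add: h'_def)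
  show thesis
  proof (rule that[of h'])
    show "(?h has_derivative blinfun_apply (h' y)) (at y)" for y
    proof (cases "y \<in> S")
      case True then show ?thesis using d1[OF True] by (simp add: h'_def)
    next
      case False
      then have "y \<notin> K" using K by blast
      from d0[OF this] h'0[OF this] show ?thesis by (simp add: zero_blinfun.rep_eq)
    qed
    have "continuous_on S h'" using c by (rule continuous_on_eq) (simp add: h'_def)
    moreover have "continuous_on (- K) h'" by (rule continuous_on_eq[OF continuous_on_const[of _ 0]]) (simp add: h'0)
    ultimately have "continuous_on (S \<union> - K) h'"
      using S K by (intro continuous_on_open_Un) (auto simp: open_Compl)
    moreover have "S \<union> - K = UNIV" using K by blast
    ultimately show "continuous_on UNIV h'" by simp
  qed (use h'0 in \<open>auto simp: h'_def\<close>)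
qed

section \<open>Test functions on a manifold and their differentials\<close>

context manifold
begin

text \<open>\<open>mdiff\<close> is computed in the chart selected at y. Composed with the frame it
  becomes the derivative in a fixed chart, which is the form that depends continuously on y.\<close>

lemma C1c_chart_derivative:
  assumes f: "f \<in> C1c A" and c: "c \<in> A" and y: "y \<in> dom_of c"
  shows "((f \<circ> chart_inv c) has_derivative blinfun_apply (mdiff A f y o\<^sub>L chart_frame A c y)) (at (map_of_chart c y))"
proof -
  let ?k = "chart_at A y"
  have "C1_on (chart_image ?k) (f \<circ> chart_inv ?k)" using f chart_at by (auto simp: C1c_def)
  then obtain f' where d: "((f \<circ> chart_inv ?k) has_derivative blinfun_apply (f' (map_of_chart ?k y))) (at (map_of_chart ?k y))"
    unfolding C1_on_def using map_in_image[OF chart_at, of y] by blast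
  have m: "mdiff A f y = f' (map_of_chart ?k y)"
    unfolding mdiff_def Let_def frechet_derivative_at[OF d, symmetric] by (rule blinfun_apply_inverse)
  have "((f \<circ> chart_inv ?k) has_derivative blinfun_apply (mdiff A f y)) (at ((map_of_chart ?k \<circ> chart_inv c) (map_of_chart c y)))"
    using d by (simp add: m chart_inv_map[OF c y])
  from diff_chain_at[OF transition_has_derivative[OF c chart_at(1) y chart_at(2)] this]
  have "((f \<circ> chart_inv ?k) \<circ> (map_of_chart ?k \<circ> chart_inv c) has_derivative blinfun_apply (mdiff A f y o\<^sub>L chart_frame A c y)) (at (map_of_chart c y))"
    by (simp add: chart_frame_def o_def blinfun_compose.rep_eq)
  then show ?thesis
  proof (rule has_derivative_transform_within_open[where s="map_of_chart c ` (dom_of ?k \<inter> dom_of c)"])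
    show "open (map_of_chart c ` (dom_of ?k \<inter> dom_of c))" by (rule open_map_image[OF c open_dom[OF chart_at(1)]])
    show "map_of_chart c y \<in> map_of_chart c ` (dom_of ?k \<inter> dom_of c)" using y chart_at by blast
    show "((f \<circ> chart_inv ?k) \<circ> (map_of_chart ?k \<circ> chart_inv c)) z = (f \<circ> chart_inv c) z"
      if "z \<in> map_of_chart c ` (dom_of ?k \<inter> dom_of c)" for z
      using that by (auto simp: chart_inv_map[OF c] chart_inv_map[OF chart_at(1)])
  qed
qed

lemma continuous_on_mdiff_frame:
  assumes f: "f \<in> C1c A" and c: "c \<in> A"
  shows "continuous_on (dom_of c) (\<lambda>y. mdiff A f y o\<^sub>L chart_frame A c y)"
proof -
  have "C1_on (chart_image c) (f \<circ> chart_inv c)" using f c by (auto simp: C1c_def)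
  then obtain f' where d: "\<And>z. z \<in> chart_image c \<Longrightarrow> ((f \<circ> chart_inv c) has_derivative blinfun_apply (f' z)) (at z)"
    and cont: "continuous_on (chart_image c) f'"
    unfolding C1_on_def by blast
  have "continuous_on (dom_of c) (\<lambda>y. f' (map_of_chart c y))"
    by (rule continuous_on_compose2[OF cont continuous_on_map[OF c]]) (auto simp: map_in_image[OF c])
  then show ?thesis
  proof (rule continuous_on_eq)
    fix y assume y: "y \<in> dom_of c"
    have "blinfun_apply (f' (map_of_chart c y)) = blinfun_apply (mdiff A f y o\<^sub>L chart_frame A c y)"
      using has_derivative_unique[OF d[OF map_in_image[OF c y]] C1c_chart_derivative[OF f c y]] .
    then show "f' (map_of_chart c y) = mdiff A f y o\<^sub>L chart_frame A c y" by (simp add: blinfun_apply_inject)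
  qed
qed

lemma C1c_continuous:
  assumes f: "f \<in> C1c A" shows "continuous_on UNIV f"
proof -
  have "continuous_on (dom_of c) f" if c: "c \<in> A" for c
  proof -
    have "continuous_on (chart_image c) (f \<circ> chart_inv c)"
    proof (intro continuous_at_imp_continuous_on ballI)
      fix z assume z: "z \<in> chart_image c"
      show "isCont (f \<circ> chart_inv c) z"
        using has_derivative_continuous[OF C1c_chart_derivative[OF f c chart_inv_in_dom[OF c z]]]
        by (simp add: map_chart_inv[OF c z])
    qed
    then have "continuous_on (dom_of c) (\<lambda>y. (f \<circ> chart_inv c) (map_of_chart c y))"
      by (rule continuous_on_compose2[OF _ continuous_on_map[OF c]]) (auto simp: map_in_image[OF c])
    then show ?thesis by (rule continuous_on_eq) (simp add: chart_inv_map[OF c])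
  qed
  then have "continuous_on (\<Union>c\<in>A. dom_of c) f" by (intro continuous_on_open_UN) (auto simp: open_dom)
  then show ?thesis using atlas by (simp add: manifold_atlas_def)
qed

lemma C1c_bounded:
  assumes f: "f \<in> C1c A" obtains C where "\<And>y. \<bar>f y\<bar> \<le> C"
proof -
  let ?S = "closure {y. f y \<noteq> 0}"
  have "compact ?S" using f by (simp add: C1c_def compact_support_def)
  then have "bounded (f ` ?S)"
    by (intro compact_imp_bounded compact_continuous_image continuous_on_subset[OF C1c_continuous[OF f]]) auto
  then obtain C where C: "\<And>y. y \<in> ?S \<Longrightarrow> \<bar>f y\<bar> \<le> C" by (auto simp: bounded_iff)
  show thesis
  proof (rule that[of "\<bar>C\<bar>"])
    fix y show "\<bar>f y\<bar> \<le> \<bar>C\<bar>" using C[of y] closure_subset[of "{y. f y \<noteq> 0}"] by (cases "f y = 0") auto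
  qed
qed

lemma mdiff_eq_0:
  assumes f: "f \<in> C1c A" and y: "y \<notin> closure {y. f y \<noteq> 0}"
  shows "mdiff A f y = 0"
proof -
  let ?c = "chart_at A y"
  note c = chart_at[of y]
  have "((\<lambda>_. 0) has_derivative (\<lambda>_. 0)) (at (map_of_chart ?c y))" by simp
  then have "((f \<circ> chart_inv ?c) has_derivative (\<lambda>_. 0)) (at (map_of_chart ?c y))"
  proof (rule has_derivative_transform_within_open[where s="map_of_chart ?c ` (- closure {y. f y \<noteq> 0} \<inter> dom_of ?c)"])
    show "open (map_of_chart ?c ` (- closure {y. f y \<noteq> 0} \<inter> dom_of ?c))" by (rule open_map_image[OF c(1)]) (simp add: open_Compl)
    show "map_of_chart ?c y \<in> map_of_chart ?c ` (- closure {y. f y \<noteq> 0} \<inter> dom_of ?c)" using y c by blast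
    show "0 = (f \<circ> chart_inv ?c) z" if z: "z \<in> map_of_chart ?c ` (- closure {y. f y \<noteq> 0} \<inter> dom_of ?c)" for z
    proof -
      obtain x where x: "x \<notin> closure {y. f y \<noteq> 0}" "x \<in> dom_of ?c" "z = map_of_chart ?c x" using z by blast
      have "f x = 0" using x(1) closure_subset[of "{y. f y \<noteq> 0}"] by auto
      then show ?thesis using x by (simp add: chart_inv_map[OF c(1)])
    qed
  qed
  from has_derivative_unique[OF C1c_chart_derivative[OF f c] this]
  have 0: "mdiff A f y o\<^sub>L chart_frame A ?c y = 0" by (intro blinfun_eqI) simp
  show ?thesis
  proof (intro blinfun_eqI)
    fix v
    have "mdiff A f y v = (mdiff A f y o\<^sub>L chart_frame A ?c y) (chart_diff A ?c y v)"
      by (simp add: chart_diff_frame_apply[OF c])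
    then show "mdiff A f y v = blinfun_apply 0 v" by (simp add: 0)
  qed
qed

text \<open>In another chart the image is the union of two open sets: on one the function is \<phi>
  after a transition map, on the other it is zero. The second is open because the compact set
  carrying the support is closed in a Hausdorff space.\<close>

lemma chart_extension_C1c:
  assumes c: "c \<in> A" and K: "compact K" "K \<subseteq> chart_image c"
    and d: "\<And>z. (\<phi> has_derivative blinfun_apply (\<phi>' z)) (at z)" and cont: "continuous_on UNIV \<phi>'"
    and 0: "\<And>z. z \<notin> K \<Longrightarrow> \<phi> z = 0"
  shows "(\<lambda>y. if y \<in> dom_of c then \<phi> (map_of_chart c y) else 0) \<in> C1c A" (is "?f \<in> _")
proof -
  let ?L = "chart_inv c ` K"
  have L: "compact ?L" by (rule compact_continuous_image[OF continuous_on_subset[OF continuous_on_inv[OF c] K(2)] K(1)])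
  have Lc: "closed ?L" using L by (rule compact_imp_closed)
  have fL: "?f y = 0" if "y \<notin> ?L" for y
    using 0[of "map_of_chart c y"] that by (auto simp: image_iff) (metis chart_inv_map[OF c])
  have sub: "closure {y. ?f y \<noteq> 0} \<subseteq> ?L" by (rule closure_minimal[OF _ Lc]) (use fL in blast)
  have LD: "?L \<subseteq> dom_of c" using K(2) chart_inv_in_dom[OF c] by blast
  have "compact_support ?f"
    unfolding compact_support_def using compact_Int_closed[OF L closed_closure, of "{y. ?f y \<noteq> 0}"] sub by (simp add: Int_absorb1)
  moreover have "C1_on (chart_image k) (?f \<circ> chart_inv k)" if k: "k \<in> A" for k
  proof -
    define S where "S = map_of_chart k ` (dom_of c \<inter> dom_of k)"
    define T where "T = map_of_chart k ` (- ?L \<inter> dom_of k)"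
    have S: "open S" unfolding S_def by (rule open_map_image[OF k open_dom[OF c]])
    have T: "open T" unfolding T_def by (rule open_map_image[OF k]) (simp add: Lc open_Compl)
    have U: "chart_image k = S \<union> T" unfolding S_def T_def chart_image_def using LD by blast
    define f' where "f' z = (if z \<in> S then \<phi>' (map_of_chart c (chart_inv k z)) o\<^sub>L transition_deriv k c (chart_inv k z) else 0)" for z
    have dS: "((?f \<circ> chart_inv k) has_derivative blinfun_apply (\<phi>' (map_of_chart c (chart_inv k z)) o\<^sub>L transition_deriv k c (chart_inv k z))) (at z)"
      if z: "z \<in> S" for z
    proof -
      obtain x where x: "x \<in> dom_of c" "x \<in> dom_of k" "z = map_of_chart k x" using z by (auto simp: S_def)
      have "(\<phi> \<circ> (map_of_chart c \<circ> chart_inv k) has_derivative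
         blinfun_apply (\<phi>' (map_of_chart c (chart_inv k z))) \<circ> blinfun_apply (transition_deriv k c (chart_inv k z))) (at z)"
        using diff_chain_at[OF transition_has_derivative[OF k c x(2,1)] d] by (simp add: x chart_inv_map[OF k])
      then have "((?f \<circ> chart_inv k) has_derivative
         blinfun_apply (\<phi>' (map_of_chart c (chart_inv k z))) \<circ> blinfun_apply (transition_deriv k c (chart_inv k z))) (at z)"
        by (rule has_derivative_transform_within_open[OF _ S z]) (auto simp: S_def chart_inv_map[OF k])
      then show ?thesis by (simp add: blinfun_compose.rep_eq o_def)
    qed
    have dT: "((?f \<circ> chart_inv k) has_derivative (\<lambda>_. 0)) (at z)" if z: "z \<in> T" for z
    proof -
      have "((\<lambda>_. 0) has_derivative (\<lambda>_. 0)) (at z)" by simp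
      then show ?thesis
      proof (rule has_derivative_transform_within_open[OF _ T z])
        fix w assume "w \<in> T"
        then obtain x where "x \<notin> ?L" "x \<in> dom_of k" "w = map_of_chart k x" by (auto simp: T_def)
        then show "0 = (?f \<circ> chart_inv k) w" using fL[of x] by (auto simp: chart_inv_map[OF k] split: if_splits)
      qed
    qed
    have f'T: "f' z = 0" if "z \<in> T" for z
    proof (cases "z \<in> S")
      case True
      from has_derivative_unique[OF dS[OF True] dT[OF that]] show ?thesis
        by (intro blinfun_eqI) (simp add: f'_def True)
    qed (simp add: f'_def)
    have "continuous_on S (\<lambda>z. \<phi>' (map_of_chart c (chart_inv k z)) o\<^sub>L transition_deriv k c (chart_inv k z))"
    proof -
      have iS: "continuous_on S (chart_inv k)" by (rule continuous_on_subset[OF continuous_on_inv[OF k]]) (use U in auto)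
      have mS: "chart_inv k ` S \<subseteq> dom_of k \<inter> dom_of c" by (auto simp: S_def chart_inv_map[OF k])
      have "continuous_on S (\<lambda>z. map_of_chart c (chart_inv k z))"
        by (rule continuous_on_compose2[OF continuous_on_map[OF c] iS]) (use mS in auto)
      then have "continuous_on S (\<lambda>z. \<phi>' (map_of_chart c (chart_inv k z)))"
        by (rule continuous_on_compose2[OF cont]) auto
      moreover have "continuous_on S (\<lambda>z. transition_deriv k c (chart_inv k z))"
        by (rule continuous_on_compose2[OF continuous_on_transition_deriv[OF k c] iS mS])
      ultimately show ?thesis by (intro continuous_intros)
    qed
    then have "continuous_on S f'" by (rule continuous_on_eq) (simp add: f'_def)
    moreover have "continuous_on T f'" by (rule continuous_on_eq[OF continuous_on_const[of _ 0]]) (simp add: f'T)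
    ultimately have "continuous_on (chart_image k) f'" unfolding U by (intro continuous_on_open_Un S T)
    moreover have "((?f \<circ> chart_inv k) has_derivative blinfun_apply (f' z)) (at z)" if "z \<in> chart_image k" for z
    proof (cases "z \<in> S")
      case True then show ?thesis using dS[OF True] by (simp add: f'_def)
    next
      case False
      then have "z \<in> T" using that U by blast
      from dT[OF this] f'T[OF this] show ?thesis by (simp add: zero_blinfun.rep_eq)
    qed
    ultimately show ?thesis unfolding C1_on_def by blast
  qed
  ultimately show ?thesis by (simp add: C1c_def)
qed

text \<open>A chart made out of test functions, valid on V. The last clause provides what the weak
  chain rule consumes: on V every test function is a function of F whose derivative is continuous
  and bounded on the whole model space.\<close>

definition cutoff_chart :: "('a, 'm) mchart \<Rightarrow> 'a set \<Rightarrow> ('a \<Rightarrow> real ^ 'm) \<Rightarrow> bool"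
  where "cutoff_chart c V F \<longleftrightarrow> c \<in> A \<and> open V \<and> V \<subseteq> dom_of c \<and> (\<forall>i. (\<lambda>y. F y $ i) \<in> C1c A) \<and>
    (\<forall>y\<in>V. F y = map_of_chart c y) \<and>
    (\<forall>f\<in>C1c A. \<exists>h h' L. (\<forall>z. (h has_derivative blinfun_apply (h' z)) (at z)) \<and> continuous_on UNIV h' \<and>
       (\<forall>z. norm (h' z) \<le> L) \<and> (\<forall>y\<in>V. h (F y) = f y))"

text \<open>F is the chart times a cutoff equal to one on the ball that defines V. The factor h of a
  test function f is the same cutoff times f read in the chart; it has compact support, so its
  continuous derivative is bounded.\<close>

lemma cutoff_chart_exists: "\<exists>c V F. cutoff_chart c V F \<and> y \<in> V"
proof -
  define c where "c = chart_at A y"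
  have c: "c \<in> A" "y \<in> dom_of c" unfolding c_def by (rule chart_at)+
  define z0 where "z0 = map_of_chart c y"
  have z0: "z0 \<in> chart_image c" unfolding z0_def by (rule map_in_image[OF c])
  obtain r0 where r0: "r0 > 0" "cball z0 r0 \<subseteq> chart_image c"
    using open_chart_image[OF c(1)] z0 open_contains_cball by blast
  \<comment> \<open>The cutoff is supported in the ball of radius 2r, which has to fit into the
    chart image.\<close>
  define r where "r = r0 / 2"
  have r: "r > 0" "cball z0 (2 * r) \<subseteq> chart_image c" using r0 by (auto simp: r_def)
  obtain \<theta> :: "real^'m \<Rightarrow> real" and \<theta>' where \<theta>: "\<And>z. (\<theta> has_derivative blinfun_apply (\<theta>' z)) (at z)" "continuous_on UNIV \<theta>'"
    "\<And>z. dist z0 z \<le> r \<Longrightarrow> \<theta> z = 1" "\<And>z. 2 * r \<le> dist z0 z \<Longrightarrow> \<theta> z = 0"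
    by (rule C1_cutoff_exists[OF r(1), of z0], rule that; assumption)
  have \<theta>c: "continuous_on UNIV \<theta>" by (intro continuous_at_imp_continuous_on ballI has_derivative_continuous[OF \<theta>(1)])
  let ?K = "cball z0 (2 * r)"
  have \<theta>0: "\<theta> z = 0" if "z \<notin> ?K" for z using \<theta>(4)[of z] that by simp
  define F where "F y = (\<chi> i. if y \<in> dom_of c then \<theta> (map_of_chart c y) * map_of_chart c y $ i else 0)" for y
  define V where "V = dom_of c \<inter> map_of_chart c -` ball z0 r"
  have V: "open V" unfolding V_def by (rule continuous_open_preimage[OF continuous_on_map[OF c(1)] open_dom[OF c(1)]]) simp
  have yV: "y \<in> V" using c r by (simp add: V_def z0_def)
  have FV: "F y = map_of_chart c y" if "y \<in> V" for y
    using that \<theta>(3)[of "map_of_chart c y"] by (simp add: F_def V_def vec_eq_iff)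
  have "(\<lambda>y. F y $ i) \<in> C1c A" for i
  proof -
    let ?\<phi>' = "\<lambda>z. \<theta> z *\<^sub>R Blinfun (\<lambda>v. v $ i) + (z $ i) *\<^sub>R \<theta>' z"
    have bl: "bounded_linear (\<lambda>v::real^'m. v $ i)" by (rule bounded_linear_vec_nth)
    have "(\<lambda>y. if y \<in> dom_of c then (\<lambda>z. \<theta> z * z $ i) (map_of_chart c y) else 0) \<in> C1c A"
    proof (rule chart_extension_C1c[OF c(1) compact_cball r(2), where \<phi>'="?\<phi>'"])
      show "((\<lambda>z. \<theta> z * z $ i) has_derivative blinfun_apply (?\<phi>' z)) (at z)" for z
      proof -
        have "((\<lambda>z. \<theta> z * z $ i) has_derivative (\<lambda>v. \<theta> z * v $ i + \<theta>' z v * z $ i)) (at z)"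
          by (rule has_derivative_mult[OF \<theta>(1) bounded_linear_imp_has_derivative[OF bl]])
        moreover have "(\<lambda>v. \<theta> z * v $ i + \<theta>' z v * z $ i) = blinfun_apply (?\<phi>' z)"
          by (auto simp: fun_eq_iff blinfun.add_left blinfun.scaleR_left bounded_linear_Blinfun_apply[OF bl])
        ultimately show ?thesis by simp
      qed
      show "continuous_on UNIV ?\<phi>'" by (intro continuous_intros \<theta>c \<theta>)
    qed (use \<theta>0 in auto)
    then show ?thesis by (simp add: F_def)
  qed
  moreover have "\<exists>h h' L. (\<forall>z. (h has_derivative blinfun_apply (h' z)) (at z)) \<and> continuous_on UNIV h' \<and>
       (\<forall>z. norm (h' z) \<le> L) \<and> (\<forall>y\<in>V. h (F y) = f y)" if f: "f \<in> C1c A" for f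
  proof -
    have "C1_on (chart_image c) (f \<circ> chart_inv c)" using f c by (auto simp: C1c_def)
    then obtain f' where d: "\<And>z. z \<in> chart_image c \<Longrightarrow> ((f \<circ> chart_inv c) has_derivative blinfun_apply (f' z)) (at z)"
      and cont: "continuous_on (chart_image c) f'"
      unfolding C1_on_def by blast
    have fc: "continuous_on (chart_image c) (f \<circ> chart_inv c)"
      by (intro continuous_at_imp_continuous_on ballI has_derivative_continuous[OF d])
    let ?\<psi> = "\<lambda>z. \<theta> z * (f \<circ> chart_inv c) z"
    let ?\<psi>' = "\<lambda>z. \<theta> z *\<^sub>R f' z + (f \<circ> chart_inv c) z *\<^sub>R \<theta>' z"
    have d\<psi>: "(?\<psi> has_derivative blinfun_apply (?\<psi>' z)) (at z)" if "z \<in> chart_image c" for z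
    proof -
      have "(?\<psi> has_derivative (\<lambda>v. \<theta> z * f' z v + \<theta>' z v * (f \<circ> chart_inv c) z)) (at z)"
        by (rule has_derivative_mult[OF \<theta>(1) d[OF that]])
      moreover have "(\<lambda>v. \<theta> z * f' z v + \<theta>' z v * (f \<circ> chart_inv c) z) = blinfun_apply (?\<psi>' z)"
        by (auto simp: fun_eq_iff blinfun.add_left blinfun.scaleR_left)
      ultimately show ?thesis by simp
    qed
    have c\<psi>: "continuous_on (chart_image c) ?\<psi>'"
      by (intro continuous_intros cont fc continuous_on_subset[OF \<theta>c] continuous_on_subset[OF \<theta>(2)]) auto
    have z\<psi>: "?\<psi> z = 0" if "z \<in> chart_image c" "z \<notin> ?K" for z using \<theta>0[OF that(2)] by simp
    let ?h = "\<lambda>z. if z \<in> chart_image c then ?\<psi> z else 0"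
    obtain h' where h': "\<And>z. (?h has_derivative blinfun_apply (h' z)) (at z)" "continuous_on UNIV h'" "\<And>z. z \<notin> ?K \<Longrightarrow> h' z = 0"
      by (rule C1_extend_by_zero[OF open_chart_image[OF c(1)] closed_cball r(2) d\<psi> c\<psi> z\<psi>])
        (assumption | rule that)+
    obtain L where L: "\<And>z. norm (h' z) \<le> L"
      by (rule continuous_compact_supp_bounded[OF h'(2) compact_cball h'(3)]) blast+
    have "?h (F y) = f y" if "y \<in> V" for y
      using that \<theta>(3)[of "map_of_chart c y"] map_in_image[OF c(1), of y] chart_inv_map[OF c(1), of y]
      by (auto simp: FV V_def)
    then show ?thesis using h'(1,2) L by (intro exI[of _ ?h] exI[of _ h'] exI[of _ L] conjI allI ballI)
  qed
  ultimately have "cutoff_chart c V F" unfolding cutoff_chart_def using c V FV by (auto simp: V_def)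
  then show ?thesis using yV by blast
qed

lemma countable_cutoff_cover:
  obtains c :: "nat \<Rightarrow> ('a, 'm) mchart" and V F where "\<And>j. cutoff_chart (c j) (V j) (F j)" "(\<Union>j. V j) = UNIV"
proof -
  let ?\<V> = "{V. \<exists>c F. cutoff_chart c V F}"
  obtain \<G> where \<G>: "\<G> \<subseteq> ?\<V>" "countable \<G>" "\<Union>\<G> = \<Union>?\<V>"
    by (rule Lindelof[of ?\<V>]) (auto simp: cutoff_chart_def)
  have U: "\<Union>\<G> = UNIV" unfolding \<G>(3) using cutoff_chart_exists by blast
  then have ne: "\<G> \<noteq> {}" by auto
  define V where "V = from_nat_into \<G>"
  have rV: "range V = \<G>" unfolding V_def by (rule range_from_nat_into[OF ne \<G>(2)])
  have "\<exists>c F. cutoff_chart c (V j) F" for j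
  proof -
    have "V j \<in> ?\<V>" using rV \<G>(1) by (metis rangeI subsetD)
    then show ?thesis by blast
  qed
  then obtain c F where "\<And>j. cutoff_chart (c j) (V j) (F j)" by metis
  moreover have "(\<Union>j. V j) = UNIV" using U rV by simp
  ultimately show thesis by (rule that)
qed

text \<open>On V the components of F are those of the chart, so their differentials are the
  components of \<open>chart_diff\<close>; together they separate tangent vectors.\<close>

lemma mdiff_cutoff:
  assumes cV: "cutoff_chart c V F" and y: "y \<in> V"
  shows "mdiff A (\<lambda>y. F y $ i) y \<eta> = chart_diff A c y \<eta> $ i"
proof -
  have c: "c \<in> A" "y \<in> dom_of c" and V: "open V" "V \<subseteq> dom_of c" and F: "(\<lambda>y. F y $ i) \<in> C1c A" "\<And>y. y \<in> V \<Longrightarrow> F y = map_of_chart c y"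
    using cV y by (auto simp: cutoff_chart_def)
  have bl: "bounded_linear (\<lambda>v::real^'m. v $ i)" by (rule bounded_linear_vec_nth)
  have "(((\<lambda>y. F y $ i) \<circ> chart_inv c) has_derivative (\<lambda>v. v $ i)) (at (map_of_chart c y))"
  proof (rule has_derivative_transform_within_open[OF bounded_linear_imp_has_derivative[OF bl]])
    show "open (map_of_chart c ` (V \<inter> dom_of c))" by (rule open_map_image[OF c(1) V(1)])
  qed (use y c F(2) in \<open>auto simp: chart_inv_map[OF c(1)]\<close>)
  from has_derivative_unique[OF C1c_chart_derivative[OF F(1) c] this]
  have "(mdiff A (\<lambda>y. F y $ i) y o\<^sub>L chart_frame A c y) (chart_diff A c y \<eta>) = chart_diff A c y \<eta> $ i" by simp
  then show ?thesis by (simp add: chart_diff_frame_apply[OF c])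
qed

lemma compact_neighbourhood:
  assumes c: "c \<in> A" and y: "y \<in> dom_of c"
  obtains U K where "open U" "y \<in> U" "U \<subseteq> K" "compact K" "K \<subseteq> dom_of c"
proof -
  obtain r where r: "r > 0" "cball (map_of_chart c y) r \<subseteq> chart_image c"
    using open_chart_image[OF c] map_in_image[OF c y] open_contains_cball by blast
  let ?K = "chart_inv c ` cball (map_of_chart c y) r"
  let ?U = "dom_of c \<inter> map_of_chart c -` ball (map_of_chart c y) r"
  show thesis
  proof (rule that[of ?U ?K])
    show "open ?U" by (rule continuous_open_preimage[OF continuous_on_map[OF c] open_dom[OF c]]) simp
    show "y \<in> ?U" using y r by simp
    show "?U \<subseteq> ?K"
    proof
      fix x assume "x \<in> ?U"
      then show "x \<in> ?K" by (intro image_eqI[of _ _ "map_of_chart c x"]) (auto simp: chart_inv_map[OF c])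
    qed
    show "compact ?K" by (rule compact_continuous_image[OF continuous_on_subset[OF continuous_on_inv[OF c] r(2)] compact_cball])
    show "?K \<subseteq> dom_of c" using r(2) chart_inv_in_dom[OF c] by blast
  qed
qed

end

section \<open>Coordinates and differentials bounded by the metric\<close>

context riemannian
begin

lemma norm_chart_diff_le:
  assumes c: "c \<in> A" and K: "compact K" "K \<subseteq> dom_of c"
  obtains C where "0 < C" "\<And>y \<eta>. y \<in> K \<Longrightarrow> norm (chart_diff A c y \<eta>) \<le> C * sqrt (g y \<eta> \<eta>)"
proof -
  obtain l u where l: "0 < l" "\<And>x v. x \<in> K \<Longrightarrow> l * (norm v)\<^sup>2 \<le> g x (chart_frame A c x v) (chart_frame A c x v)"
    by (rule metric_frame_bounds[OF c K]) blast
  show thesis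
  proof (rule that[of "1 / sqrt l"])
    show "0 < 1 / sqrt l" using l by simp
    fix y \<eta> assume y: "y \<in> K"
    have "l * (norm (chart_diff A c y \<eta>))\<^sup>2 \<le> g y \<eta> \<eta>"
      using l(2)[OF y, of "chart_diff A c y \<eta>"] K(2) y by (simp add: chart_diff_frame_apply(2)[OF c] subset_iff)
    then have "sqrt l * norm (chart_diff A c y \<eta>) \<le> sqrt (g y \<eta> \<eta>)"
      using real_sqrt_le_mono by (fastforce simp: real_sqrt_mult)
    then show "norm (chart_diff A c y \<eta>) \<le> 1 / sqrt l * sqrt (g y \<eta> \<eta>)"
      using l(1) by (simp add: field_simps)
  qed
qed

text \<open>Near each point the differential is bounded in a frame and the metric controls
  coordinates. Finitely many such neighbourhoods cover the support, and the sum of their constants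
  works everywhere. This bounds the derivative of f o u by a multiple of |Du|.\<close>

lemma mdiff_bound:
  assumes f: "f \<in> C1c A"
  obtains C where "0 \<le> C" "\<And>y \<eta>. \<bar>mdiff A f y \<eta>\<bar> \<le> C * sqrt (g y \<eta> \<eta>)"
proof -
  have "\<exists>U C. open U \<and> y \<in> U \<and> 0 \<le> C \<and> (\<forall>x\<in>U. \<forall>\<eta>. \<bar>mdiff A f x \<eta>\<bar> \<le> C * sqrt (g x \<eta> \<eta>))" for y
  proof -
    define c where "c = chart_at A y"
    have c: "c \<in> A" "y \<in> dom_of c" unfolding c_def by (rule chart_at)+
    obtain U K where U: "open U" "y \<in> U" "U \<subseteq> K" "compact K" "K \<subseteq> dom_of c" by (rule compact_neighbourhood[OF c])
    obtain C where C: "0 < C" "\<And>y \<eta>. y \<in> K \<Longrightarrow> norm (chart_diff A c y \<eta>) \<le> C * sqrt (g y \<eta> \<eta>)"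
      by (rule norm_chart_diff_le[OF c(1) U(4,5)]) blast
    have "bounded ((\<lambda>y. mdiff A f y o\<^sub>L chart_frame A c y) ` K)"
      by (intro compact_imp_bounded compact_continuous_image continuous_on_subset[OF continuous_on_mdiff_frame[OF f c(1)]] U)
    then obtain M where M: "\<And>x. x \<in> K \<Longrightarrow> norm (mdiff A f x o\<^sub>L chart_frame A c x) \<le> M" by (auto simp: bounded_iff)
    have M0: "0 \<le> M" using M[of y] U norm_ge_zero order_trans by blast
    have "\<bar>mdiff A f x \<eta>\<bar> \<le> (M * C) * sqrt (g x \<eta> \<eta>)" if "x \<in> U" for x \<eta>
    proof -
      have x: "x \<in> K" "x \<in> dom_of c" using that U by auto
      have "\<bar>mdiff A f x \<eta>\<bar> = norm ((mdiff A f x o\<^sub>L chart_frame A c x) (chart_diff A c x \<eta>))"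
        by (simp add: chart_diff_frame_apply(2)[OF c(1) x(2)])
      also have "\<dots> \<le> norm (mdiff A f x o\<^sub>L chart_frame A c x) * norm (chart_diff A c x \<eta>)" by (rule norm_blinfun)
      also have "\<dots> \<le> M * (C * sqrt (g x \<eta> \<eta>))" by (rule mult_mono[OF M[OF x(1)] C(2)[OF x(1)] M0]) simp
      finally show ?thesis by (simp add: mult.assoc)
    qed
    then show ?thesis using U C M0 by (intro exI[of _ U] exI[of _ "M * C"]) auto
  qed
  then obtain U C where UC: "\<And>y. open (U y)" "\<And>y. y \<in> U y" "\<And>y. 0 \<le> C y"
    "\<And>y x \<eta>. x \<in> U y \<Longrightarrow> \<bar>mdiff A f x \<eta>\<bar> \<le> C y * sqrt (g x \<eta> \<eta>)" by metis
  let ?S = "closure {y. f y \<noteq> 0}"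
  have S: "compact ?S" using f by (simp add: C1c_def compact_support_def)
  have "?S \<subseteq> (\<Union>y\<in>UNIV. U y)" using UC(2) by blast
  then obtain I where I: "finite I" "?S \<subseteq> (\<Union>y\<in>I. U y)" using compactE_image[OF S, of UNIV U] UC(1) by metis
  show thesis
  proof (rule that[of "\<Sum>y\<in>I. C y"])
    show "0 \<le> (\<Sum>y\<in>I. C y)" by (intro sum_nonneg UC)
    fix y \<eta>
    interpret scalar_product "g y" by (rule scalar_product)
    show "\<bar>mdiff A f y \<eta>\<bar> \<le> (\<Sum>y\<in>I. C y) * sqrt (g y \<eta> \<eta>)"
    proof (cases "y \<in> ?S")
      case True
      then obtain y0 where y0: "y0 \<in> I" "y \<in> U y0" using I by blast
      have "\<bar>mdiff A f y \<eta>\<bar> \<le> C y0 * sqrt (g y \<eta> \<eta>)" by (rule UC(4)[OF y0(2)])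
      also have "\<dots> \<le> (\<Sum>y\<in>I. C y) * sqrt (g y \<eta> \<eta>)"
        by (intro mult_right_mono member_le_sum) (use y0 I UC h_nonneg in auto)
      finally show ?thesis .
    next
      case False
      then show ?thesis using mdiff_eq_0[OF f False] h_nonneg[of \<eta>] UC(3) by (simp add: sum_nonneg)
    qed
  qed
qed

end

section \<open>The bundle of linear maps between tangent spaces\<close>

lemma blinfun_compose_assoc: "(f o\<^sub>L g) o\<^sub>L h = f o\<^sub>L (g o\<^sub>L h)"
  by (intro blinfun_eqI) simp

locale riemannian_pair =
  M: riemannian A gM + N: riemannian B gN
  for A :: "('a::{t2_space,second_countable_topology}, 'm::finite) mchart set"
    and gM :: "('a, 'm) mmetric"
    and B :: "('b::{t2_space,second_countable_topology}, 'n::finite) mchart set"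
    and gN :: "('b, 'n) mmetric"
begin

abbreviation bundle_topology :: "('a, 'm, 'b, 'n) hom_bundle topology"
  where "bundle_topology \<equiv> hom_bundle_topology A B"

abbreviation triv :: "('a, 'm) mchart \<Rightarrow> ('b, 'n) mchart \<Rightarrow> ('a, 'm, 'b, 'n) hom_bundle
      \<Rightarrow> (real ^ 'm) \<times> (real ^ 'n) \<times> ((real ^ 'm) \<Rightarrow>\<^sub>L (real ^ 'n))"
  where "triv \<equiv> hom_trivialization A B"

definition over :: "('a, 'm) mchart \<Rightarrow> ('b, 'n) mchart \<Rightarrow> ('a, 'm, 'b, 'n) hom_bundle set"
  where "over c c' = {e. fst e \<in> dom_of c \<and> fst (snd e) \<in> dom_of c'}"

lemma over_iff[simp]: "(x, y, \<xi>) \<in> over c c' \<longleftrightarrow> x \<in> dom_of c \<and> y \<in> dom_of c'"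
  by (simp add: over_def)

text \<open>The coordinate change between two trivialisations: a linear map is multiplied by
  transition derivatives on both sides, forward on the target and backward on the source.\<close>

definition triv_change ::
    "('a, 'm) mchart \<Rightarrow> ('b, 'n) mchart \<Rightarrow> ('a, 'm) mchart \<Rightarrow> ('b, 'n) mchart \<Rightarrow>
      (real ^ 'm) \<times> (real ^ 'n) \<times> ((real ^ 'm) \<Rightarrow>\<^sub>L (real ^ 'n)) \<Rightarrow> (real ^ 'm) \<times> (real ^ 'n) \<times> ((real ^ 'm) \<Rightarrow>\<^sub>L (real ^ 'n))"
  where "triv_change c c' k k' p =
    (map_of_chart k (chart_inv c (fst p)), map_of_chart k' (chart_inv c' (fst (snd p))),
     transition_deriv c' k' (chart_inv c' (fst (snd p))) o\<^sub>L snd (snd p) o\<^sub>L transition_deriv k c (chart_inv c (fst p)))"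

lemma triv_change:
  assumes "c \<in> A" "k \<in> A" "c' \<in> B" "k' \<in> B" "e \<in> over c c'" "e \<in> over k k'"
  shows "triv k k' e = triv_change c c' k k' (triv c c' e)"
proof -
  obtain x y \<xi> where e: "e = (x, y, \<xi>)" by (cases e)
  have "chart_diff B k' y = transition_deriv c' k' y o\<^sub>L chart_diff B c' y"
    using N.chart_diff_change[of c' k' y] assms by (simp add: e)
  moreover have "chart_frame A k x = chart_frame A c x o\<^sub>L transition_deriv k c x"
    using M.chart_frame_change[of c k x] assms by (simp add: e)
  ultimately show ?thesis
    using assms by (simp add: e triv_change_def M.chart_inv_map N.chart_inv_map blinfun_compose_assoc)
qed

lemma continuous_on_triv_change:
  assumes c: "c \<in> A" "k \<in> A" "c' \<in> B" "k' \<in> B"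
  shows "continuous_on (map_of_chart c ` (dom_of k \<inter> dom_of c) \<times> map_of_chart c' ` (dom_of k' \<inter> dom_of c') \<times> UNIV) (triv_change c c' k k')"
proof -
  let ?S = "map_of_chart c ` (dom_of k \<inter> dom_of c)" and ?T = "map_of_chart c' ` (dom_of k' \<inter> dom_of c')"
  let ?D = "?S \<times> ?T \<times> (UNIV :: ((real ^ 'm) \<Rightarrow>\<^sub>L (real ^ 'n)) set)"
  have i1: "continuous_on ?D (\<lambda>p. chart_inv c (fst p))"
    by (rule continuous_on_compose2[OF M.continuous_on_inv[OF c(1)] continuous_on_fst[OF continuous_on_id]])
      (auto simp: chart_image_def)
  have i2: "continuous_on ?D (\<lambda>p. chart_inv c' (fst (snd p)))"
    by (rule continuous_on_compose2[OF N.continuous_on_inv[OF c(3)] continuous_on_fst[OF continuous_on_snd[OF continuous_on_id]]])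
      (auto simp: chart_image_def)
  have m1: "(\<lambda>p. chart_inv c (fst p)) ` ?D \<subseteq> dom_of k \<inter> dom_of c" by (auto simp: M.chart_inv_map c)
  have m2: "(\<lambda>p. chart_inv c' (fst (snd p))) ` ?D \<subseteq> dom_of c' \<inter> dom_of k'" by (auto simp: N.chart_inv_map c)
  have 1: "continuous_on ?D (\<lambda>p. map_of_chart k (chart_inv c (fst p)))"
    by (rule continuous_on_compose2[OF M.continuous_on_map[OF c(2)] i1]) (use m1 in blast)
  have 2: "continuous_on ?D (\<lambda>p. map_of_chart k' (chart_inv c' (fst (snd p))))"
    by (rule continuous_on_compose2[OF N.continuous_on_map[OF c(4)] i2]) (use m2 in blast)
  have 3: "continuous_on ?D (\<lambda>p. transition_deriv k c (chart_inv c (fst p)))"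
    by (rule continuous_on_compose2[OF M.continuous_on_transition_deriv[OF c(2,1)] i1 m1])
  have 4: "continuous_on ?D (\<lambda>p. transition_deriv c' k' (chart_inv c' (fst (snd p))))"
    by (rule continuous_on_compose2[OF N.continuous_on_transition_deriv[OF c(3,4)] i2 m2])
  show ?thesis
    unfolding triv_change_def by (intro continuous_intros 1 2 3 4)
qed

section \<open>The topology of the bundle in trivialisations\<close>

lemma triv_in_image: "c \<in> A \<Longrightarrow> c' \<in> B \<Longrightarrow> e \<in> over c c' \<Longrightarrow> triv c c' e \<in> chart_image c \<times> chart_image c' \<times> UNIV"
  by (cases e) (auto simp: M.map_in_image N.map_in_image)

lemma openin_bundle_basic: "c \<in> A \<Longrightarrow> c' \<in> B \<Longrightarrow> open W \<Longrightarrow> openin bundle_topology {e \<in> over c c'. triv c c' e \<in> W}"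
  unfolding hom_bundle_topology_def over_def
  by (rule topology_generated_by_Basis) blast

lemma topspace_bundle[simp]: "topspace bundle_topology = UNIV"
proof -
  have "e \<in> topspace bundle_topology" for e
  proof -
    have "openin bundle_topology {e' \<in> over (chart_at A (fst e)) (chart_at B (fst (snd e))). triv (chart_at A (fst e)) (chart_at B (fst (snd e))) e' \<in> UNIV}"
      by (rule openin_bundle_basic) (auto simp: M.chart_at N.chart_at)
    moreover have "e \<in> {e' \<in> over (chart_at A (fst e)) (chart_at B (fst (snd e))). triv (chart_at A (fst e)) (chart_at B (fst (snd e))) e' \<in> UNIV}"
      by (simp add: over_def M.chart_at N.chart_at)
    ultimately show ?thesis using openin_subset by blast
  qed
  then show ?thesis by blast
qed

text \<open>Induction over the generation of the topology. For a generating set the required open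
  set is its preimage under the change of trivialisation, restricted to the overlap. With the
  converse below, openness can be tested in trivialisations.\<close>

lemma openin_bundle_local:
  assumes "openin bundle_topology V"
  shows "\<forall>c\<in>A. \<forall>c'\<in>B. \<exists>W. open W \<and> (\<forall>e\<in>over c c'. e \<in> V \<longleftrightarrow> triv c c' e \<in> W)"
proof -
  let ?S = "{{e. fst e \<in> dom_of c \<and> fst (snd e) \<in> dom_of c' \<and> triv c c' e \<in> W} | c c' W. c \<in> A \<and> c' \<in> B \<and> open W}"
  have "generate_topology_on ?S V"
    using assms unfolding hom_bundle_topology_def openin_topology_generated_by_iff .
  then show ?thesis
  proof induction
    case Empty
    show ?case by (intro ballI exI[of _ "{}"]) auto
  next
    case (Int a b)
    show ?case
    proof (intro ballI)
      fix c c' assume c: "c \<in> A" "c' \<in> B"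
      obtain W1 where W1: "open W1" "\<forall>e\<in>over c c'. e \<in> a \<longleftrightarrow> triv c c' e \<in> W1" using Int.IH(1) c by blast
      obtain W2 where W2: "open W2" "\<forall>e\<in>over c c'. e \<in> b \<longleftrightarrow> triv c c' e \<in> W2" using Int.IH(2) c by blast
      show "\<exists>W. open W \<and> (\<forall>e\<in>over c c'. e \<in> a \<inter> b \<longleftrightarrow> triv c c' e \<in> W)"
        using W1 W2 by (intro exI[of _ "W1 \<inter> W2"]) auto
    qed
  next
    case (UN K)
    show ?case
    proof (intro ballI)
      fix c c' assume c: "c \<in> A" "c' \<in> B"
      have "\<forall>k\<in>K. \<exists>W. open W \<and> (\<forall>e\<in>over c c'. e \<in> k \<longleftrightarrow> triv c c' e \<in> W)" using UN c by blast
      then obtain W where W: "\<And>k. k \<in> K \<Longrightarrow> open (W k)" "\<And>k e. k \<in> K \<Longrightarrow> e \<in> over c c' \<Longrightarrow> e \<in> k \<longleftrightarrow> triv c c' e \<in> W k"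
        by metis
      show "\<exists>W. open W \<and> (\<forall>e\<in>over c c'. e \<in> \<Union>K \<longleftrightarrow> triv c c' e \<in> W)"
        using W by (intro exI[of _ "\<Union>k\<in>K. W k"]) auto
    qed
  next
    case (Basis s)
    then obtain k k' W where k: "k \<in> A" "k' \<in> B" "open W" and s: "s = {e \<in> over k k'. triv k k' e \<in> W}"
      unfolding over_def by auto
    show ?case
    proof (intro ballI)
      fix c c' assume c: "c \<in> A" "c' \<in> B"
      let ?D = "map_of_chart c ` (dom_of k \<inter> dom_of c) \<times> map_of_chart c' ` (dom_of k' \<inter> dom_of c') \<times> UNIV"
      let ?W = "?D \<inter> triv_change c c' k k' -` W"
      have D: "open ?D"
        by (intro open_Times M.open_map_image N.open_map_image M.open_dom N.open_dom open_UNIV c k)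
      have "open ?W" by (rule continuous_open_preimage[OF continuous_on_triv_change[OF c(1) k(1) c(2) k(2)] D k(3)])
      moreover have "e \<in> s \<longleftrightarrow> triv c c' e \<in> ?W" if e: "e \<in> over c c'" for e
      proof -
        obtain x y \<xi> where xy: "e = (x, y, \<xi>)" by (cases e)
        \<comment> \<open>Charts are injective, so coordinates lie in the image of the overlap only
          for points of the overlap.\<close>
        have "triv c c' e \<in> ?D \<longleftrightarrow> e \<in> over k k'"
          using e inj_onD[OF M.inj_on_chart[OF c(1)]] inj_onD[OF N.inj_on_chart[OF c(2)]]
          by (auto simp: xy)
        then show ?thesis using triv_change[OF c(1) k(1) c(2) k(2) e] by (auto simp: s)
      qed
      ultimately show "\<exists>W. open W \<and> (\<forall>e\<in>over c c'. e \<in> s \<longleftrightarrow> triv c c' e \<in> W)"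
        by (intro exI[of _ ?W] conjI ballI)
    qed
  qed
qed

lemma openin_bundleI:
  assumes "\<And>c c'. c \<in> A \<Longrightarrow> c' \<in> B \<Longrightarrow> \<exists>W. open W \<and> (\<forall>e\<in>over c c'. e \<in> V \<longleftrightarrow> triv c c' e \<in> W)"
  shows "openin bundle_topology V"
proof (subst openin_subopen, intro ballI)
  fix e assume e: "e \<in> V"
  define c where "c = chart_at A (fst e)"
  define c' where "c' = chart_at B (fst (snd e))"
  have c: "c \<in> A" "c' \<in> B" and ov: "e \<in> over c c'"
    by (simp_all add: c_def c'_def M.chart_at N.chart_at over_def)
  obtain W where W: "open W" "\<And>e. e \<in> over c c' \<Longrightarrow> e \<in> V \<longleftrightarrow> triv c c' e \<in> W" using assms[OF c] by blast
  show "\<exists>T. openin bundle_topology T \<and> e \<in> T \<and> T \<subseteq> V"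
    using openin_bundle_basic[OF c W(1)] W(2) ov e by (intro exI[of _ "{e \<in> over c c'. triv c c' e \<in> W}"]) auto
qed

lemma openin_bundle_base: 
  assumes "open V" shows "openin bundle_topology {e. fst (snd e) \<in> V}"
proof (rule openin_bundleI)
  fix c c' assume c: "c \<in> A" "c' \<in> B"
  let ?W = "UNIV \<times> map_of_chart c' ` (V \<inter> dom_of c') \<times> UNIV"
  have "open ?W" by (intro open_Times open_UNIV N.open_map_image c assms)
  moreover have "e \<in> {e. fst (snd e) \<in> V} \<longleftrightarrow> triv c c' e \<in> ?W" if "e \<in> over c c'" for e
    using that inj_onD[OF N.inj_on_chart[OF c(2)]] by (cases e) auto
  ultimately show "\<exists>W. open W \<and> (\<forall>e\<in>over c c'. e \<in> {e. fst (snd e) \<in> V} \<longleftrightarrow> triv c c' e \<in> W)"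
    by (intro exI[of _ ?W] conjI ballI)
qed

text \<open>Superlevel sets decide the measurability of \<phi> along a section, and continuity in
  every trivialisation makes them open.\<close>

lemma openin_bundle_greater:
  fixes \<phi> :: "('a, 'm, 'b, 'n) hom_bundle \<Rightarrow> real"
  assumes "\<And>c c'. c \<in> A \<Longrightarrow> c' \<in> B \<Longrightarrow> \<exists>\<Phi>. continuous_on (chart_image c \<times> chart_image c' \<times> UNIV) \<Phi> \<and> (\<forall>e\<in>over c c'. \<phi> e = \<Phi> (triv c c' e))"
  shows "openin bundle_topology {e. r < \<phi> e}"
proof (rule openin_bundleI)
  fix c c' assume c: "c \<in> A" "c' \<in> B"
  obtain \<Phi> where \<Phi>: "continuous_on (chart_image c \<times> chart_image c' \<times> UNIV) \<Phi>" "\<And>e. e \<in> over c c' \<Longrightarrow> \<phi> e = \<Phi> (triv c c' e)"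
    using assms[OF c] by blast
  let ?D = "chart_image c \<times> chart_image c' \<times> (UNIV :: ((real ^ 'm) \<Rightarrow>\<^sub>L (real ^ 'n)) set)"
  have D: "open ?D" by (intro open_Times open_UNIV M.open_chart_image N.open_chart_image c)
  have "open (?D \<inter> \<Phi> -` {r<..})" by (rule continuous_open_preimage[OF \<Phi>(1) D]) simp
  then show "\<exists>W. open W \<and> (\<forall>e\<in>over c c'. e \<in> {e. r < \<phi> e} \<longleftrightarrow> triv c c' e \<in> W)"
    using triv_in_image[OF c] \<Phi>(2) by (intro exI[of _ "?D \<inter> \<Phi> -` {r<..}"] conjI) auto
qed

lemma limitin_bundle_iff:
  assumes c: "c \<in> A" "c' \<in> B" and e: "e \<in> over c c'"
  shows "limitin bundle_topology s e F \<longleftrightarrow> (\<forall>\<^sub>F k in F. s k \<in> over c c') \<and> ((\<lambda>k. triv c c' (s k)) \<longlongrightarrow> triv c c' e) F"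
proof
  assume L: "limitin bundle_topology s e F"
  have ev: "\<forall>\<^sub>F k in F. s k \<in> {e \<in> over c c'. triv c c' e \<in> W}" if "open W" "triv c c' e \<in> W" for W
    using L openin_bundle_basic[OF c that(1)] e that(2) unfolding limitin_def by blast
  show "(\<forall>\<^sub>F k in F. s k \<in> over c c') \<and> ((\<lambda>k. triv c c' (s k)) \<longlongrightarrow> triv c c' e) F"
  proof
    show "\<forall>\<^sub>F k in F. s k \<in> over c c'" using ev[of UNIV] by simp
    show "((\<lambda>k. triv c c' (s k)) \<longlongrightarrow> triv c c' e) F"
    proof (rule topological_tendstoI)
      fix W assume "open W" "triv c c' e \<in> W"
      from ev[OF this] show "\<forall>\<^sub>F k in F. triv c c' (s k) \<in> W" by eventually_elim simp
    qed
  qed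
next
  assume R: "(\<forall>\<^sub>F k in F. s k \<in> over c c') \<and> ((\<lambda>k. triv c c' (s k)) \<longlongrightarrow> triv c c' e) F"
  show "limitin bundle_topology s e F"
    unfolding limitin_def
  proof (intro conjI allI impI)
    fix V assume V: "openin bundle_topology V \<and> e \<in> V"
    obtain W where W: "open W" "\<And>e. e \<in> over c c' \<Longrightarrow> e \<in> V \<longleftrightarrow> triv c c' e \<in> W"
      using bspec[OF bspec[OF openin_bundle_local[OF conjunct1[OF V]] c(1)] c(2)] by blast
    have "\<forall>\<^sub>F k in F. triv c c' (s k) \<in> W" using R W V e by (auto dest: topological_tendstoD)
    with R show "\<forall>\<^sub>F k in F. s k \<in> V" by (auto elim: eventually_elim2 simp: W(2))
  qed simp
qed

section \<open>Measurable sections\<close>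

abbreviation bundle_borel :: "('a, 'm, 'b, 'n) hom_bundle measure"
  where "bundle_borel \<equiv> sigma UNIV {W. openin bundle_topology W}"

text \<open>Countable chart covers of M and N split the preimage of an open set into countably many
  parts, each living in one trivialisation, where the hypothesis applies.\<close>

lemma measurable_bundleI:
  assumes fst: "\<And>x. fst (s x) = x"
    and m: "\<And>c c' W. c \<in> A \<Longrightarrow> c' \<in> B \<Longrightarrow> open W \<Longrightarrow>
      {z \<in> chart_image c. s (chart_inv c z) \<in> over c c' \<and> triv c c' (s (chart_inv c z)) \<in> W} \<in> sets lebesgue"
  shows "s \<in> measurable (manifold_sigma A) bundle_borel"
proof (rule measurable_measure_of)
  fix V assume "V \<in> {W. openin bundle_topology W}"
  then have o: "openin bundle_topology V" by simp
  have "\<forall>i j. \<exists>W. open W \<and> (\<forall>e\<in>over (M.cover i) (N.cover j). e \<in> V \<longleftrightarrow> triv (M.cover i) (N.cover j) e \<in> W)"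
    by (intro allI bspec[OF bspec[OF openin_bundle_local[OF o] M.cover_in] N.cover_in])
  then obtain W where W: "\<And>i j. open (W i j)"
    "\<And>i j e. e \<in> over (M.cover i) (N.cover j) \<Longrightarrow> e \<in> V \<longleftrightarrow> triv (M.cover i) (N.cover j) e \<in> W i j" by metis
  define X where "X p = {x \<in> dom_of (M.cover (fst p)). s x \<in> over (M.cover (fst p)) (N.cover (snd p)) \<and> triv (M.cover (fst p)) (N.cover (snd p)) (s x) \<in> W (fst p) (snd p)}" for p
  have X: "X p \<in> lebesgue_sets A" for p
  proof (rule M.lebesgue_sets_chart[OF M.cover_in])
    show "X p \<subseteq> dom_of (M.cover (fst p))" by (auto simp: X_def)
    then have "map_of_chart (M.cover (fst p)) ` X p = map_of_chart (M.cover (fst p)) ` (X p \<inter> dom_of (M.cover (fst p)))" by (simp add: Int_absorb2)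
    also have "\<dots> = {z \<in> chart_image (M.cover (fst p)). s (chart_inv (M.cover (fst p)) z) \<in> over (M.cover (fst p)) (N.cover (snd p)) \<and>
        triv (M.cover (fst p)) (N.cover (snd p)) (s (chart_inv (M.cover (fst p)) z)) \<in> W (fst p) (snd p)}"
      unfolding M.map_image_eq[OF M.cover_in] by (auto simp: X_def M.chart_inv_in_dom[OF M.cover_in])
    finally show "map_of_chart (M.cover (fst p)) ` X p \<in> sets lebesgue"
      using m[OF M.cover_in N.cover_in W(1)] by simp
  qed
  have "s -` V = (\<Union>p. X p)"
  proof (intro set_eqI iffI)
    fix x assume x: "x \<in> s -` V"
    obtain i where i: "x \<in> dom_of (M.cover i)" using M.countable_chart_cover_works(2) by blast
    obtain j where j: "fst (snd (s x)) \<in> dom_of (N.cover j)" using N.countable_chart_cover_works(2) by blast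
    have "s x \<in> over (M.cover i) (N.cover j)" using i j fst by (simp add: over_def)
    then have "x \<in> X (i, j)" using x i W(2) by (auto simp: X_def)
    then show "x \<in> (\<Union>p. X p)" by blast
  qed (auto simp: X_def W(2))
  also have "(\<Union>p. X p) \<in> lebesgue_sets A" by (rule M.lebesgue_sets_countable_UN) (use X in auto)
  finally show "s -` V \<inter> space (manifold_sigma A) \<in> sets (manifold_sigma A)" by simp
qed auto

lemma measurable_bundleD:
  assumes "s \<in> measurable (manifold_sigma A) bundle_borel" "openin bundle_topology V"
  shows "s -` V \<in> lebesgue_sets A"
  using measurable_sets[OF assms(1), of V] assms(2) by (simp add: sets_measure_of)

lemma measurable_bundle_greater:
  fixes \<phi> :: "('a, 'm, 'b, 'n) hom_bundle \<Rightarrow> real"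
  assumes s: "s \<in> measurable (manifold_sigma A) bundle_borel" and \<phi>: "\<And>r. openin bundle_topology {e. r < \<phi> e}"
  shows "(\<lambda>x. \<phi> (s x)) \<in> borel_measurable (manifold_sigma A)"
  unfolding borel_measurable_iff_greater
  using measurable_bundleD[OF s \<phi>] by (simp add: vimage_def)

section \<open>The norm on the fibres\<close>

lemma hom_norm_basis:
  obtains b where "orthonormal_basis (gM x) b" "\<And>y \<xi>. hom_norm gM gN (x, y, \<xi>) = sqrt (\<Sum>i\<in>UNIV. gN y (blinfun_apply \<xi> (b i)) (blinfun_apply \<xi> (b i)))"
proof -
  interpret scalar_product "gM x" by (rule M.scalar_product)
  show thesis
    by (rule that[of "SOME b. orthonormal_basis (gM x) b"])
      (use someI_ex[OF orthonormal_basis_exists] in \<open>auto simp: Let_def\<close>)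
qed

lemma hom_norm_nonneg: "0 \<le> hom_norm gM gN e"
proof -
  obtain x y \<xi> where e: "e = (x, y, \<xi>)" by (cases e)
  interpret scalar_product "gN y" by (rule N.scalar_product)
  show ?thesis by (simp add: e Let_def sum_nonneg h_nonneg)
qed

text \<open>Expand v in the orthonormal basis: each coefficient is at most |v| and each basis vector
  has an image bounded by the norm of \<xi>. The dimension factor counts the terms. T will be the
  differential of a test function or of a chart.\<close>

lemma hom_norm_apply_le:
  fixes T :: "real ^ 'n \<Rightarrow> 'c::real_normed_vector"
  assumes T: "linear T" and C: "0 \<le> C" "\<And>\<eta>. norm (T \<eta>) \<le> C * sqrt (gN y \<eta> \<eta>)"
  shows "norm (T (blinfun_apply \<xi> v)) \<le> C * real CARD('m) * sqrt (gM x v v) * hom_norm gM gN (x, y, \<xi>)"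
proof -
  obtain b where b: "orthonormal_basis (gM x) b" and n: "\<And>y \<xi>. hom_norm gM gN (x, y, \<xi>) = sqrt (\<Sum>i\<in>UNIV. gN y (blinfun_apply \<xi> (b i)) (blinfun_apply \<xi> (b i)))"
    by (rule hom_norm_basis[of x], rule that; assumption)
  interpret m: scalar_product "gM x" by (rule M.scalar_product)
  interpret n: scalar_product "gN y" by (rule N.scalar_product)
  have "\<xi> v = \<xi> (\<Sum>i\<in>UNIV. gM x v (b i) *\<^sub>R b i)" by (rule arg_cong[OF m.orthonormal_expansion[OF b], where f="blinfun_apply \<xi>"])
  then have "T (\<xi> v) = (\<Sum>i\<in>UNIV. gM x v (b i) *\<^sub>R T (\<xi> (b i)))"
    by (simp add: blinfun.sum_right blinfun.scaleR_right linear_sum[OF T] linear_scale[OF T])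
  then have "norm (T (\<xi> v)) \<le> (\<Sum>i\<in>UNIV. \<bar>gM x v (b i)\<bar> * norm (T (\<xi> (b i))))"
    by (simp add: sum_norm_le)
  also have "\<dots> \<le> (\<Sum>i\<in>(UNIV::'m set). sqrt (gM x v v) * (C * hom_norm gM gN (x, y, \<xi>)))"
  proof (rule sum_mono)
    fix i
    have "gN y (blinfun_apply \<xi> (b i)) (blinfun_apply \<xi> (b i)) \<le> (\<Sum>i\<in>UNIV. gN y (blinfun_apply \<xi> (b i)) (blinfun_apply \<xi> (b i)))"
      by (rule member_le_sum) (auto intro: n.h_nonneg)
    then have "sqrt (gN y (blinfun_apply \<xi> (b i)) (blinfun_apply \<xi> (b i))) \<le> hom_norm gM gN (x, y, \<xi>)" unfolding n by (rule real_sqrt_le_mono)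
    then have "norm (T (\<xi> (b i))) \<le> C * hom_norm gM gN (x, y, \<xi>)"
      using C(2)[of "\<xi> (b i)"] mult_left_mono[OF _ C(1)] by (meson order_trans)
    then show "\<bar>gM x v (b i)\<bar> * norm (T (\<xi> (b i))) \<le> sqrt (gM x v v) * (C * hom_norm gM gN (x, y, \<xi>))"
      by (intro mult_mono m.basis_coefficient_le[OF b]) (auto simp: m.h_nonneg)
  qed
  also have "\<dots> = C * real CARD('m) * sqrt (gM x v v) * hom_norm gM gN (x, y, \<xi>)" by simp
  finally show ?thesis .
qed

text \<open>\<open>hom_norm\<close> uses an arbitrary basis at each x, so its continuity is hidden.
  In coordinates its square is the sum over k and l of g^{kl} times the scalar product of the images
  of the k-th and l-th frame vectors, an expression that is continuous in the
  trivialisation.\<close>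

lemma openin_hom_norm_greater: "openin bundle_topology {e. r < hom_norm gM gN e}"
proof (rule openin_bundle_greater)
  fix c c' assume c: "c \<in> A" "c' \<in> B"
  let ?D = "chart_image c \<times> chart_image c' \<times> (UNIV :: ((real ^ 'm) \<Rightarrow>\<^sub>L (real ^ 'n)) set)"
  define \<Phi> where "\<Phi> p = sqrt (\<Sum>k\<in>UNIV. \<Sum>l\<in>UNIV. M.gram_inverse c (chart_inv c (fst p)) k l *
     (\<Sum>i\<in>UNIV. \<Sum>j\<in>UNIV. snd (snd p) (axis k 1) $ i * snd (snd p) (axis l 1) $ j * N.chart_gram c' (chart_inv c' (fst (snd p))) $ i $ j))"
    for p :: "(real ^ 'm) \<times> (real ^ 'n) \<times> ((real ^ 'm) \<Rightarrow>\<^sub>L (real ^ 'n))"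
  have i1: "continuous_on ?D (\<lambda>p. chart_inv c (fst p))"
    by (rule continuous_on_compose2[OF M.continuous_on_inv[OF c(1)] continuous_on_fst[OF continuous_on_id]]) auto
  have i2: "continuous_on ?D (\<lambda>p. chart_inv c' (fst (snd p)))"
    by (rule continuous_on_compose2[OF N.continuous_on_inv[OF c(2)] continuous_on_fst[OF continuous_on_snd[OF continuous_on_id]]]) auto
  have g1: "continuous_on ?D (\<lambda>p. M.gram_inverse c (chart_inv c (fst p)) k l)" for k l
    by (rule continuous_on_compose2[OF M.continuous_on_gram_inverse[OF c(1)] i1]) (auto simp: M.chart_inv_in_dom[OF c(1)])
  have "continuous_on (dom_of c') (\<lambda>y. N.chart_gram c' y $ i $ j)" for i j
    by (simp add: N.chart_gram_def N.continuous_on_metric[OF c(2)])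
  then have g2: "continuous_on ?D (\<lambda>p. N.chart_gram c' (chart_inv c' (fst (snd p))) $ i $ j)" for i j
    by (rule continuous_on_compose2[OF _ i2]) (auto simp: N.chart_inv_in_dom[OF c(2)])
  have "continuous_on ?D \<Phi>"
    unfolding \<Phi>_def
    by (intro continuous_on_real_sqrt continuous_on_sum continuous_on_mult continuous_on_component g1 g2
        blinfun.continuous_on continuous_on_snd continuous_on_id continuous_on_const)
  moreover have "hom_norm gM gN e = \<Phi> (triv c c' e)" if "e \<in> over c c'" for e
  proof -
    obtain x y \<xi> where e: "e = (x, y, \<xi>)" by (cases e)
    have xy: "x \<in> dom_of c" "y \<in> dom_of c'" using that by (auto simp: e)
    obtain b where b: "orthonormal_basis (gM x) b" and n: "\<And>y \<xi>. hom_norm gM gN (x, y, \<xi>) = sqrt (\<Sum>i\<in>UNIV. gN y (blinfun_apply \<xi> (b i)) (blinfun_apply \<xi> (b i)))"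
      by (rule hom_norm_basis[of x], rule that; assumption)
    interpret n: scalar_product "gN y" by (rule N.scalar_product)
    let ?f = "\<lambda>k. \<xi> (chart_frame A c x (axis k 1))"
    let ?\<beta> = "\<lambda>i k. chart_diff A c x (b i) $ k"
    let ?\<Xi> = "chart_diff B c' y o\<^sub>L \<xi> o\<^sub>L chart_frame A c x"
    have \<xi>b: "\<xi> (b i) = (\<Sum>k\<in>UNIV. ?\<beta> i k *\<^sub>R ?f k)" for i
    proof -
      have "\<xi> (b i) = \<xi> (chart_frame A c x (chart_diff A c x (b i)))" by (simp add: M.chart_diff_frame_apply(2)[OF c(1) xy(1)])
      also have "\<dots> = \<xi> (\<Sum>k\<in>UNIV. ?\<beta> i k *\<^sub>R chart_frame A c x (axis k 1))"
        by (rule arg_cong[OF M.frame_sum, where f="blinfun_apply \<xi>"])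
      finally show ?thesis by (simp add: blinfun.sum_right blinfun.scaleR_right)
    qed
    have ff: "gN y (?f k) (?f l) = (\<Sum>i\<in>UNIV. \<Sum>j\<in>UNIV. ?\<Xi> (axis k 1) $ i * ?\<Xi> (axis l 1) $ j * N.chart_gram c' y $ i $ j)" for k l
    proof -
      have "gN y (?f k) (?f l) = gN y (chart_frame B c' y (?\<Xi> (axis k 1))) (chart_frame B c' y (?\<Xi> (axis l 1)))"
        by (simp add: N.chart_diff_frame_apply(2)[OF c(2) xy(2)])
      then show ?thesis by (simp only: N.metric_frame)
    qed
    have "(\<Sum>i\<in>UNIV. gN y (blinfun_apply \<xi> (b i)) (blinfun_apply \<xi> (b i))) = (\<Sum>i\<in>UNIV. \<Sum>k\<in>UNIV. \<Sum>l\<in>UNIV. ?\<beta> i k * (?\<beta> i l * gN y (?f l) (?f k)))"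
      by (simp only: \<xi>b n.h_sum n.h_scaleR sum_distrib_left mult.assoc)
    also have "\<dots> = (\<Sum>i\<in>UNIV. \<Sum>k\<in>UNIV. \<Sum>l\<in>UNIV. ?\<beta> i k * ?\<beta> i l * gN y (?f k) (?f l))"
      by (intro sum.cong refl) (simp add: n.sym)
    also have "\<dots> = (\<Sum>k\<in>UNIV. \<Sum>i\<in>UNIV. \<Sum>l\<in>UNIV. ?\<beta> i k * ?\<beta> i l * gN y (?f k) (?f l))"
      by (rule sum.swap)
    also have "\<dots> = (\<Sum>k\<in>UNIV. \<Sum>l\<in>UNIV. \<Sum>i\<in>UNIV. ?\<beta> i k * ?\<beta> i l * gN y (?f k) (?f l))"
      by (rule sum.cong[OF refl], rule sum.swap)
    also have "\<dots> = (\<Sum>k\<in>UNIV. \<Sum>l\<in>UNIV. (\<Sum>i\<in>UNIV. ?\<beta> i k * ?\<beta> i l) * gN y (?f k) (?f l))"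
      by (simp only: sum_distrib_right)
    also have "\<dots> = (\<Sum>k\<in>UNIV. \<Sum>l\<in>UNIV. M.gram_inverse c x k l * gN y (?f k) (?f l))"
      by (simp only: M.gram_inverse_basis[OF c(1) xy(1) b])
    finally have "hom_norm gM gN e = sqrt (\<Sum>k\<in>UNIV. \<Sum>l\<in>UNIV. M.gram_inverse c x k l * gN y (?f k) (?f l))" by (simp only: e n)
    then show ?thesis by (simp add: \<Phi>_def e ff M.chart_inv_map[OF c(1) xy(1)] N.chart_inv_map[OF c(2) xy(2)])
  qed
  ultimately show "\<exists>\<Phi>. continuous_on ?D \<Phi> \<and> (\<forall>e\<in>over c c'. hom_norm gM gN e = \<Phi> (triv c c' e))" by blast
qed

lemma limitin_bundle_base:
  assumes "limitin bundle_topology (\<lambda>k. (x k, y k, \<xi> k)) (x', y', \<xi>') F"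
  shows "(y \<longlongrightarrow> y') F"
proof (rule topological_tendstoI)
  fix V assume "open V" "y' \<in> V"
  then have "openin bundle_topology {e. fst (snd e) \<in> V}" "(x', y', \<xi>') \<in> {e. fst (snd e) \<in> V}"
    by (simp_all add: openin_bundle_base)
  then show "\<forall>\<^sub>F k in F. y k \<in> V" using assms unfolding limitin_def by fastforce
qed

text \<open>Inserting the frame and the differential of a fixed chart around y' splits the value
  into a continuous covector field at \<open>y k\<close> and the convergent trivialised linear
  map.\<close>

lemma limitin_bundle_fibre:
  assumes L: "limitin bundle_topology (\<lambda>k. (x, y k, \<xi> k)) (x, y', \<xi>') F" and f: "f \<in> C1c B"
  shows "((\<lambda>k. mdiff B f (y k) (\<xi> k v)) \<longlongrightarrow> mdiff B f y' (\<xi>' v)) F"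
proof -
  define c where "c = chart_at A x"
  define c' where "c' = chart_at B y'"
  have c: "c \<in> A" "x \<in> dom_of c" and c': "c' \<in> B" "y' \<in> dom_of c'"
    unfolding c_def c'_def by (rule M.chart_at N.chart_at)+
  have ov: "(x, y', \<xi>') \<in> over c c'" using c c' by simp
  have LL: "(\<forall>\<^sub>F k in F. (x, y k, \<xi> k) \<in> over c c')" "((\<lambda>k. triv c c' (x, y k, \<xi> k)) \<longlongrightarrow> triv c c' (x, y', \<xi>')) F"
    using L unfolding limitin_bundle_iff[OF c(1) c'(1) ov] by blast+
  let ?\<Xi> = "\<lambda>y \<xi>. chart_diff B c' y o\<^sub>L \<xi> o\<^sub>L chart_frame A c x"
  let ?w = "chart_diff A c x v"
  have \<Xi>: "((\<lambda>k. ?\<Xi> (y k) (\<xi> k)) \<longlongrightarrow> ?\<Xi> y' \<xi>') F"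
    using tendsto_snd[OF tendsto_snd[OF LL(2)]] by simp
  have "continuous_on (dom_of c') (\<lambda>y. mdiff B f y o\<^sub>L chart_frame B c' y)" by (rule N.continuous_on_mdiff_frame[OF f c'(1)])
  then have "isCont (\<lambda>y. mdiff B f y o\<^sub>L chart_frame B c' y) y'"
    using c' N.open_dom continuous_on_eq_continuous_at by blast
  then have "((\<lambda>k. mdiff B f (y k) o\<^sub>L chart_frame B c' (y k)) \<longlongrightarrow> mdiff B f y' o\<^sub>L chart_frame B c' y') F"
    by (rule isCont_tendsto_compose[OF _ limitin_bundle_base[OF L]])
  then have "((\<lambda>k. (mdiff B f (y k) o\<^sub>L chart_frame B c' (y k)) (?\<Xi> (y k) (\<xi> k) ?w)) \<longlongrightarrow> (mdiff B f y' o\<^sub>L chart_frame B c' y') (?\<Xi> y' \<xi>' ?w)) F"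
    by (rule blinfun.tendsto[OF _ blinfun.tendsto[OF \<Xi> tendsto_const]])
  moreover have "\<forall>\<^sub>F k in F. (mdiff B f (y k) o\<^sub>L chart_frame B c' (y k)) (?\<Xi> (y k) (\<xi> k) ?w) = mdiff B f (y k) (\<xi> k v)"
    using LL(1) by eventually_elim (simp add: M.chart_diff_frame_apply(2)[OF c] N.chart_diff_frame_apply(2)[OF c'(1)])
  ultimately show ?thesis
    by (simp add: tendsto_cong M.chart_diff_frame_apply(2)[OF c] N.chart_diff_frame_apply(2)[OF c'] del: blinfun_apply_blinfun_compose)
      (simp add: M.chart_diff_frame_apply(2)[OF c] N.chart_diff_frame_apply(2)[OF c'])
qed

text \<open>Near y' the metrics are comparable to the Euclidean ones, so the norm bound becomes a
  bound on the trivialised maps, and Bolzano-Weierstrass gives a convergent subsequence.\<close>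

lemma bundle_fibre_compactness:
  fixes y :: "nat \<Rightarrow> 'b"
  assumes y: "y \<longlonglongrightarrow> y'" and R: "\<And>k. hom_norm gM gN (x, y k, \<xi> k) \<le> R"
  obtains r \<xi>' where "strict_mono r" "limitin bundle_topology (\<lambda>k. (x, y (r k), \<xi> (r k))) (x, y', \<xi>') sequentially"
proof -
  define c where "c = chart_at A x"
  define c' where "c' = chart_at B y'"
  have c: "c \<in> A" "x \<in> dom_of c" and c': "c' \<in> B" "y' \<in> dom_of c'"
    unfolding c_def c'_def by (rule M.chart_at N.chart_at)+
  obtain U K where U: "open U" "y' \<in> U" "U \<subseteq> K" "compact K" "K \<subseteq> dom_of c'" by (rule N.compact_neighbourhood[OF c'])
  obtain C where C: "0 < C" "\<And>y \<eta>. y \<in> K \<Longrightarrow> norm (chart_diff B c' y \<eta>) \<le> C * sqrt (gN y \<eta> \<eta>)"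
    by (rule N.norm_chart_diff_le[OF c'(1) U(4,5)]) blast
  obtain l u where u: "0 < u" "\<And>v. gM x (chart_frame A c x v) (chart_frame A c x v) \<le> u * (norm v)\<^sup>2"
    by (rule M.metric_frame_bounds[OF c(1), of "{x}"]) (use c in auto)
  have "\<forall>\<^sub>F k in sequentially. y k \<in> U" using y U(1,2) by (rule topological_tendstoD)
  then obtain k0 where k0: "\<And>k. k0 \<le> k \<Longrightarrow> y k \<in> U" by (auto simp: eventually_sequentially)
  let ?\<Xi> = "\<lambda>y \<xi>. chart_diff B c' y o\<^sub>L \<xi> o\<^sub>L chart_frame A c x"
  \<comment> \<open>The shift by \<open>k0\<close> discards the terms whose base point is not yet in
    the compact neighbourhood.\<close>
  define X where "X k = ?\<Xi> (y (k + k0)) (\<xi> (k + k0))" for k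
  have R0: "0 \<le> R" using R[of 0] hom_norm_nonneg order_trans by blast
  have "norm (X k) \<le> C * real CARD('m) * sqrt u * R" for k
  proof (rule norm_blinfun_bound)
    show "0 \<le> C * real CARD('m) * sqrt u * R" using C u R0 by simp
    fix v
    have yK: "y (k + k0) \<in> K" using k0[of "k + k0"] U by auto
    have "norm (chart_diff B c' (y (k + k0)) (\<xi> (k + k0) (chart_frame A c x v))) \<le>
      C * real CARD('m) * sqrt (gM x (chart_frame A c x v) (chart_frame A c x v)) * hom_norm gM gN (x, y (k + k0), \<xi> (k + k0))"
      by (rule hom_norm_apply_le) (use C yK in \<open>auto intro: bounded_linear.linear blinfun.bounded_linear_right\<close>)
    also have "\<dots> \<le> C * real CARD('m) * (sqrt u * norm v) * R"
    proof (rule mult_mono[OF mult_left_mono R])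
      have "sqrt (gM x (chart_frame A c x v) (chart_frame A c x v)) \<le> sqrt (u * (norm v)\<^sup>2)" by (rule real_sqrt_le_mono[OF u(2)])
      then show "sqrt (gM x (chart_frame A c x v) (chart_frame A c x v)) \<le> sqrt u * norm v" by (simp add: real_sqrt_mult)
      show "0 \<le> C * real CARD('m)" "0 \<le> C * real CARD('m) * (sqrt u * norm v)" using C u by simp_all
      show "0 \<le> hom_norm gM gN (x, y (k + k0), \<xi> (k + k0))" by (rule hom_norm_nonneg)
    qed
    finally show "norm (X k v) \<le> C * real CARD('m) * sqrt u * R * norm v" by (simp add: X_def mult_ac)
  qed
  then have "bounded (range X)" by (auto simp: bounded_iff)
  then obtain \<Xi> q where q: "strict_mono (q :: nat \<Rightarrow> nat)" "(X \<circ> q) \<longlonglongrightarrow> \<Xi>"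
    using bounded_imp_convergent_subsequence by blast
  define r where "r k = q k + k0" for k
  define \<xi>' where "\<xi>' = chart_frame B c' y' o\<^sub>L \<Xi> o\<^sub>L chart_diff A c x"
  have r: "strict_mono r" using q(1) by (auto simp: strict_mono_def r_def)
  have \<xi>'\<Xi>: "?\<Xi> y' \<xi>' = \<Xi>"
    by (intro blinfun_eqI) (simp add: \<xi>'_def M.chart_diff_frame_apply[OF c] N.chart_diff_frame_apply[OF c'])
  have ov: "(x, y', \<xi>') \<in> over c c'" using c c' by simp
  have "limitin bundle_topology (\<lambda>k. (x, y (r k), \<xi> (r k))) (x, y', \<xi>') sequentially"
    unfolding limitin_bundle_iff[OF c(1) c'(1) ov] hom_trivialization.simps
  proof
    have "y (r k) \<in> dom_of c'" for k using k0[of "r k"] U by (auto simp: r_def)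
    then show "\<forall>\<^sub>F k in sequentially. (x, y (r k), \<xi> (r k)) \<in> over c c'"
      using c(2) by simp
    have yr: "(\<lambda>k. y (r k)) \<longlonglongrightarrow> y'" using LIMSEQ_subseq_LIMSEQ[OF y r] by (simp add: o_def)
    have "isCont (map_of_chart c') y'" using N.continuous_on_map[OF c'(1)] N.open_dom[OF c'(1)] c'(2) continuous_on_eq_continuous_at by blast
    then have "(\<lambda>k. map_of_chart c' (y (r k))) \<longlonglongrightarrow> map_of_chart c' y'" by (rule isCont_tendsto_compose[OF _ yr])
    moreover have "(\<lambda>k. ?\<Xi> (y (r k)) (\<xi> (r k))) \<longlonglongrightarrow> ?\<Xi> y' \<xi>'" using q(2) by (simp add: \<xi>'\<Xi> o_def X_def r_def)
    ultimately show "(\<lambda>k. (map_of_chart c x, map_of_chart c' (y (r k)), ?\<Xi> (y (r k)) (\<xi> (r k)))) \<longlonglongrightarrow> (map_of_chart c x, map_of_chart c' y', ?\<Xi> y' \<xi>')"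
      by (intro tendsto_Pair tendsto_const)
  qed
  then show thesis by (rule that[OF r])
qed

end

section \<open>Existence and uniqueness of the colocal weak derivative\<close>

text \<open>Exhausting V by compact sets exhibits the function as a pointwise limit of measurable
  ones.\<close>

lemma loc_integrable_measurable_open:
  fixes w :: "'v::euclidean_space \<Rightarrow> 'w::euclidean_space"
  assumes V: "open V" and w: "loc_integrable V w"
  shows "(\<lambda>z. indicator V z *\<^sub>R w z) \<in> borel_measurable lebesgue"
proof -
  obtain C :: "nat \<Rightarrow> 'v set" where C: "\<And>n. compact (C n)" "\<And>n. C n \<subseteq> V" "\<And>K. compact K \<Longrightarrow> K \<subseteq> V \<Longrightarrow> \<exists>N. \<forall>n\<ge>N. K \<subseteq> C n"
    by (rule open_Union_compact_subsets[OF V], rule that; assumption)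
  show ?thesis
  proof (rule borel_measurable_LIMSEQ_metric)
    show "(\<lambda>z. indicator (C n) z *\<^sub>R w z) \<in> borel_measurable lebesgue" for n
      by (rule loc_integrable_measurable[OF w C(1,2)])
    fix z
    show "(\<lambda>n. indicator (C n) z *\<^sub>R w z) \<longlonglongrightarrow> indicator V z *\<^sub>R w z"
    proof (cases "z \<in> V")
      case True
      then obtain N where "\<And>n. n \<ge> N \<Longrightarrow> z \<in> C n" using C(3)[of "{z}"] by auto
      then have "\<forall>\<^sub>F n in sequentially. indicator (C n) z *\<^sub>R w z = indicator V z *\<^sub>R w z"
        using True by (auto simp: eventually_sequentially intro!: exI[of _ N])
      then show ?thesis by (rule tendsto_eventually)
    next
      case False
      then have "z \<notin> C n" for n using C(2) by blast
      then show ?thesis using False by simp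
    qed
  qed
qed

text \<open>Measurability is checked on the entries of a matrix and then carried to linear maps by
  continuity of this linear bijection.\<close>

definition blinfun_of_mat :: "real ^ 'm::finite ^ 'n::finite \<Rightarrow> (real ^ 'm) \<Rightarrow>\<^sub>L (real ^ 'n)"
  where "blinfun_of_mat M = Blinfun ((*v) M)"

lemma blinfun_of_mat_apply: "blinfun_of_mat M v = M *v v"
  unfolding blinfun_of_mat_def by (simp add: bounded_linear_Blinfun_apply)

lemma blinfun_of_mat_matrix: "blinfun_of_mat (matrix (blinfun_apply f)) = f"
  by (intro blinfun_eqI) (simp add: blinfun_of_mat_apply blinfun.bounded_linear_right matrix_vector_mul)

lemma continuous_on_blinfun_of_mat: "continuous_on S blinfun_of_mat"
proof -
  have "linear blinfun_of_mat"
    by (intro linearI blinfun_eqI)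
      (simp_all add: blinfun_of_mat_apply blinfun.add_left blinfun.scaleR_left matrix_vector_mult_add_rdistrib scaleR_matrix_vector_assoc)
  then have "bounded_linear blinfun_of_mat" by (simp add: linear_conv_bounded_linear)
  then show ?thesis by (rule linear_continuous_on)
qed

context manifold
begin

lemma weak_derivative_iff:
  "weak_derivative A w \<omega> \<longleftrightarrow> (\<forall>c\<in>A. \<forall>v. weak_dderiv (chart_image c) v (\<lambda>z. w (chart_inv c z))
      (\<lambda>z. \<omega> (chart_inv c z) (chart_frame A c (chart_inv c z) v)))"
  unfolding weak_derivative_def weak_derivative_on_iff by (simp add: o_def)

lemma frame_axis_eqI:
  assumes c: "c \<in> A" and x: "x \<in> dom_of c"
    and eq: "\<And>i. blinfun_apply \<alpha> (chart_frame A c x (axis i 1)) = blinfun_apply \<beta> (chart_frame A c x (axis i 1))"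
  shows "\<alpha> = \<beta>"
proof (intro blinfun_eqI)
  fix v
  let ?w = "chart_diff A c x v"
  have w: "chart_frame A c x ?w = (\<Sum>i\<in>UNIV. ?w $ i *\<^sub>R chart_frame A c x (axis i 1))"
  proof -
    have "?w = (\<Sum>i\<in>UNIV. ?w $ i *\<^sub>R axis i (1::real))"
      by (simp add: vec_eq_iff axis_def if_distrib[of "\<lambda>t. _ * t"] sum.delta cong: if_cong)
    from arg_cong[OF this, of "blinfun_apply (chart_frame A c x)"] show ?thesis
      by (simp only: blinfun.sum_right blinfun.scaleR_right)
  qed
  have "blinfun_apply \<alpha> (chart_frame A c x ?w) = blinfun_apply \<beta> (chart_frame A c x ?w)"
    unfolding w by (simp only: blinfun.sum_right blinfun.scaleR_right eq)
  then show "blinfun_apply \<alpha> v = blinfun_apply \<beta> v" by (simp add: chart_diff_frame_apply(2)[OF c x])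
qed

text \<open>The finitely many frame vectors determine a covector, so the null sets from directional
  uniqueness can be united.\<close>

lemma weak_derivative_unique:
  assumes w: "weak_derivative A w \<omega>" "weak_derivative A w' \<omega>'" and eq: "chart_AE (\<lambda>x. w x = w' x)"
  shows "chart_AE (\<lambda>x. \<omega> x = \<omega>' x)"
  unfolding chart_AE_def
proof
  fix c assume c: "c \<in> A"
  have "AE z in lebesgue. \<forall>i. z \<in> chart_image c \<longrightarrow>
     \<omega> (chart_inv c z) (chart_frame A c (chart_inv c z) (axis i 1)) = \<omega>' (chart_inv c z) (chart_frame A c (chart_inv c z) (axis i 1))"
    unfolding AE_all_countable
  proof
    fix i
    show "AE z in lebesgue. z \<in> chart_image c \<longrightarrow>
     \<omega> (chart_inv c z) (chart_frame A c (chart_inv c z) (axis i 1)) = \<omega>' (chart_inv c z) (chart_frame A c (chart_inv c z) (axis i 1))"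
    proof (rule weak_dderiv_unique[OF open_chart_image[OF c]])
      show "weak_dderiv (chart_image c) (axis i 1) (\<lambda>z. w (chart_inv c z)) (\<lambda>z. \<omega> (chart_inv c z) (chart_frame A c (chart_inv c z) (axis i 1)))"
        "weak_dderiv (chart_image c) (axis i 1) (\<lambda>z. w' (chart_inv c z)) (\<lambda>z. \<omega>' (chart_inv c z) (chart_frame A c (chart_inv c z) (axis i 1)))"
        using w c by (simp_all add: weak_derivative_iff)
      show "AE z in lebesgue. z \<in> chart_image c \<longrightarrow> w (chart_inv c z) = w' (chart_inv c z)"
        using eq c by (simp add: chart_AE_def)
    qed
  qed
  then show "AE z in lebesgue. z \<in> chart_image c \<longrightarrow> \<omega> (chart_inv c z) = \<omega>' (chart_inv c z)"
    by eventually_elim (use frame_axis_eqI[OF c chart_inv_in_dom[OF c]] in blast)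
qed


end

context riemannian_pair
begin

text \<open>Countably many cutoff charts cover N. The derivatives of their components along the map
  are unique almost everywhere, and at each point one of these charts recovers the value of D from
  them.\<close>

lemma colocal_weak_derivative_unique:
  assumes D: "is_colocal_weak_derivative A B u D" "is_colocal_weak_derivative A B u' D'" and eq: "M.chart_AE (\<lambda>x. u x = u' x)"
  shows "M.chart_AE (\<lambda>x. D x = D' x)"
proof -
  obtain c V F where cut: "\<And>j::nat. N.cutoff_chart (c j) (V j) (F j)" and V: "(\<Union>j. V j) = UNIV"
    by (rule N.countable_cutoff_cover, rule that; assumption)
  have FC: "(\<lambda>y. F j y $ i) \<in> C1c B" for i j using cut[of j] by (simp add: N.cutoff_chart_def)
  have "M.chart_AE (\<lambda>x. mdiff B (\<lambda>y. F j y $ i) (u x) o\<^sub>L D x = mdiff B (\<lambda>y. F j y $ i) (u' x) o\<^sub>L D' x)" for i j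
  proof (rule M.weak_derivative_unique)
    show "weak_derivative A ((\<lambda>y. F j y $ i) \<circ> u) (\<lambda>x. mdiff B (\<lambda>y. F j y $ i) (u x) o\<^sub>L D x)"
      "weak_derivative A ((\<lambda>y. F j y $ i) \<circ> u') (\<lambda>x. mdiff B (\<lambda>y. F j y $ i) (u' x) o\<^sub>L D' x)"
      using D FC by (auto simp: is_colocal_weak_derivative_def)
    show "M.chart_AE (\<lambda>x. ((\<lambda>y. F j y $ i) \<circ> u) x = ((\<lambda>y. F j y $ i) \<circ> u') x)"
      using eq by (rule M.chart_AE_mono) simp
  qed
  then have "M.chart_AE (\<lambda>x. \<forall>j i. mdiff B (\<lambda>y. F j y $ i) (u x) o\<^sub>L D x = mdiff B (\<lambda>y. F j y $ i) (u' x) o\<^sub>L D' x)"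
    by (intro M.chart_AE_all_countable)
  from M.chart_AE_conj[OF eq this] show ?thesis
  proof (rule M.chart_AE_mono)
    fix x assume x: "u x = u' x \<and> (\<forall>j i. mdiff B (\<lambda>y. F j y $ i) (u x) o\<^sub>L D x = mdiff B (\<lambda>y. F j y $ i) (u' x) o\<^sub>L D' x)"
    obtain j where j: "u x \<in> V j" using V by blast
    have cj: "c j \<in> B" "u x \<in> dom_of (c j)" using cut[of j] j by (auto simp: N.cutoff_chart_def)
    show "D x = D' x"
    proof (intro blinfun_eqI)
      fix v
      have "chart_diff B (c j) (u x) (D x v) $ i = chart_diff B (c j) (u x) (D' x v) $ i" for i
      proof -
        have "mdiff B (\<lambda>y. F j y $ i) (u x) o\<^sub>L D x = mdiff B (\<lambda>y. F j y $ i) (u' x) o\<^sub>L D' x" using x by blast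
        then have "mdiff B (\<lambda>y. F j y $ i) (u x) o\<^sub>L D x = mdiff B (\<lambda>y. F j y $ i) (u x) o\<^sub>L D' x" by (simp only: conjunct1[OF x])
        then have "mdiff B (\<lambda>y. F j y $ i) (u x) (D x v) = mdiff B (\<lambda>y. F j y $ i) (u x) (D' x v)"
          by (metis blinfun_apply_blinfun_compose)
        then show ?thesis by (simp add: N.mdiff_cutoff[OF cut j])
      qed
      then have "chart_diff B (c j) (u x) (D x v) = chart_diff B (c j) (u x) (D' x v)" by (simp add: vec_eq_iff)
      then show "D x v = D' x v" by (metis N.chart_diff_frame_apply(2)[OF cj])
    qed
  qed
qed

text \<open>Where u lies in V_j the derivative is forced: it is the weak derivative of F_j o u,
  carried back by the frame. These are glued along the first index j with u(x) in V_j. It remains to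
  see that the result is measurable and gives the derivative of f o u for every test function f, not
  just for the components used.\<close>

theorem colocal_weak_derivative_exists:
  assumes u: "colocally_weakly_differentiable A B u"
  shows "\<exists>D. is_colocal_weak_derivative A B u D"
proof -
  have um: "u \<in> borel_measurable (manifold_sigma A)" and uw: "\<And>f. f \<in> C1c B \<Longrightarrow> \<exists>\<omega>. weak_derivative A (f \<circ> u) \<omega>"
    using u by (auto simp: colocally_weakly_differentiable_def weakly_differentiable_def)
  obtain c V F where cut: "\<And>j::nat. N.cutoff_chart (c j) (V j) (F j)" and V: "(\<Union>j. V j) = UNIV"
    by (rule N.countable_cutoff_cover, rule that; assumption)
  have FC: "(\<lambda>y. F j y $ i) \<in> C1c B" and cB: "c j \<in> B" and Vo: "open (V j)" and VD: "V j \<subseteq> dom_of (c j)" for i j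
    using cut[of j] by (auto simp: N.cutoff_chart_def)
  have "\<exists>\<omega>. weak_derivative A ((\<lambda>y. F j y $ i) \<circ> u) \<omega>" for j i by (rule uw[OF FC])
  then obtain \<omega> where \<omega>: "\<And>j i. weak_derivative A ((\<lambda>y. F j y $ i) \<circ> u) (\<omega> j i)" by metis
  \<comment> \<open>The covectors of the components of F_j o u, assembled into one vector-valued
    linear map.\<close>
  define \<Omega> where "\<Omega> j x = Blinfun (\<lambda>v. \<chi> i. \<omega> j i x v)" for j x
  have \<Omega>_apply: "\<Omega> j x v = (\<chi> i. \<omega> j i x v)" for j x v
    unfolding \<Omega>_def
    by (subst bounded_linear_Blinfun_apply)
      (auto simp: linear_conv_bounded_linear[symmetric] vec_eq_iff blinfun.add_right blinfun.scaleR_right intro!: linearI)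
  have wd: "weak_dderiv (chart_image k) v (\<lambda>z. F j (u (chart_inv k z))) (\<lambda>z. \<Omega> j (chart_inv k z) (chart_frame A k (chart_inv k z) v))"
    if k: "k \<in> A" for k v j
  proof -
    have "weak_dderiv (chart_image k) v (\<lambda>z. F j (u (chart_inv k z)) $ i *\<^sub>R axis i 1)
       (\<lambda>z. \<omega> j i (chart_inv k z) (chart_frame A k (chart_inv k z) v) *\<^sub>R axis i (1::real))" for i
    proof -
      have bl: "bounded_linear (\<lambda>t::real. t *\<^sub>R axis i (1::real) :: real^'n)" by (rule bounded_linear_scaleR_left)
      have "weak_dderiv (chart_image k) v (\<lambda>z. F j (u (chart_inv k z)) $ i) (\<lambda>z. \<omega> j i (chart_inv k z) (chart_frame A k (chart_inv k z) v))"
        using \<omega>[of j i] k by (simp add: M.weak_derivative_iff)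
      from weak_dderiv_bounded_linear[OF bl this] show ?thesis .
    qed
    then have "weak_dderiv (chart_image k) v (\<lambda>z. \<Sum>i\<in>UNIV. F j (u (chart_inv k z)) $ i *\<^sub>R axis i 1)
       (\<lambda>z. \<Sum>i\<in>UNIV. \<omega> j i (chart_inv k z) (chart_frame A k (chart_inv k z) v) *\<^sub>R axis i (1::real))"
      by (intro weak_dderiv_sum) auto
    moreover have "(\<Sum>i\<in>UNIV. t i *\<^sub>R axis i (1::real)) = (\<chi> i. t i)" for t :: "'n \<Rightarrow> real"
      by (simp add: vec_eq_iff axis_def if_distrib[of "\<lambda>t. _ * t"] sum.delta cong: if_cong)
    ultimately show ?thesis by (simp add: \<Omega>_apply)
  qed
  \<comment> \<open>The least index turns the cover of N into a partition of M into measurable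
    sets.\<close>
  define J where "J x = (LEAST j. u x \<in> V j)" for x
  have J: "u x \<in> V (J x)" for x
  proof -
    have "\<exists>j. u x \<in> V j" using V by blast
    then show ?thesis unfolding J_def by (rule LeastI_ex)
  qed
  have J_iff: "J x = j \<longleftrightarrow> u x \<in> V j - (\<Union>i<j. V i)" for x j
  proof
    assume j: "J x = j"
    have "u x \<notin> V i" if "i < j" for i
      by (rule not_less_Least) (use j that in \<open>simp add: J_def\<close>)
    then show "u x \<in> V j - (\<Union>i<j. V i)" using J[of x] j by blast
  next
    assume "u x \<in> V j - (\<Union>i<j. V i)"
    then have j: "u x \<in> V j" "\<And>i. i < j \<Longrightarrow> u x \<notin> V i" by blast+
    show "J x = j" unfolding J_def by (rule Least_equality[of "\<lambda>j. u x \<in> V j", OF j(1)]) (use j(2) not_le in blast)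
  qed
  define D where "D x = chart_frame B (c (J x)) (u x) o\<^sub>L \<Omega> (J x) x" for x
  have "(\<lambda>x. (x, u x, D x)) \<in> measurable (manifold_sigma A) bundle_borel"
  proof (rule measurable_bundleI)
    fix k k' W assume k: "k \<in> A" "k' \<in> B" and W: "open (W :: ((real ^ 'm) \<times> (real ^ 'n) \<times> ((real ^ 'm) \<Rightarrow>\<^sub>L (real ^ 'n))) set)"
    have ko: "open (chart_image k)" by (rule M.open_chart_image[OF k(1)])
    have km[measurable]: "chart_image k \<in> sets lebesgue" using ko by auto
    define ue where "ue z = u (M.chart_inv_ext k z)" for z
    have ue[measurable]: "ue \<in> borel_measurable lebesgue"
      unfolding ue_def by (rule measurable_compose[OF M.chart_inv_ext_measurable[OF k(1)] um])
    \<comment> \<open>The matrix of \<Omega> in the frame of the chart k, put to zero off the chart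
      image so as to be Lebesgue measurable on the whole space.\<close>
    define Q where "Q j z = (\<chi> i a. indicator (chart_image k) z *\<^sub>R \<omega> j i (chart_inv k z) (chart_frame A k (chart_inv k z) (axis a 1)))" for j z
    have Q: "Q j \<in> borel_measurable lebesgue" for j
    proof -
      have "(\<lambda>z. Q j z $ i $ a) \<in> borel_measurable lebesgue" for i a
      proof -
        have "weak_dderiv (chart_image k) (axis a 1) (\<lambda>z. F j (u (chart_inv k z)) $ i) (\<lambda>z. \<omega> j i (chart_inv k z) (chart_frame A k (chart_inv k z) (axis a 1)))"
          using \<omega>[of j i] k by (simp add: M.weak_derivative_iff)
        then have "loc_integrable (chart_image k) (\<lambda>z. \<omega> j i (chart_inv k z) (chart_frame A k (chart_inv k z) (axis a 1)))"
          by (simp add: weak_dderiv_def)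
        from loc_integrable_measurable_open[OF ko this] show ?thesis by (simp add: Q_def)
      qed
      then show ?thesis by (subst borel_measurable_euclidean_space) (auto simp: Basis_vec_def inner_axis)
    qed
    \<comment> \<open>The triples of coordinate, value of u and matrix that describe a bundle point
      with coordinates in W. Where \<open>J\<close> is j, membership of the glued section becomes an
      open condition on measurable data.\<close>
    define O' where "O' j = {p \<in> chart_image k \<times> (V j \<inter> dom_of k') \<times> UNIV.
       (fst p, map_of_chart k' (fst (snd p)), transition_deriv (c j) k' (fst (snd p)) o\<^sub>L blinfun_of_mat (snd (snd p))) \<in> W}" for j
    have O': "open (O' j)" for j
    proof -
      let ?D = "chart_image k \<times> (V j \<inter> dom_of k') \<times> (UNIV :: (real^'m^'n) set)"
      let ?f = "\<lambda>p. (fst p, map_of_chart k' (fst (snd p)), transition_deriv (c j) k' (fst (snd p)) o\<^sub>L blinfun_of_mat (snd (snd p)))"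
      have p2: "continuous_on ?D (\<lambda>p. fst (snd p))" by (intro continuous_intros)
      have 1: "continuous_on ?D (\<lambda>p. map_of_chart k' (fst (snd p)))"
        by (rule continuous_on_compose2[OF N.continuous_on_map[OF k(2)] p2]) auto
      have 2: "continuous_on ?D (\<lambda>p. transition_deriv (c j) k' (fst (snd p)))"
        by (rule continuous_on_compose2[OF N.continuous_on_transition_deriv[OF cB k(2)] p2]) (use VD[of j] in auto)
      have 3: "continuous_on ?D (\<lambda>p. blinfun_of_mat (snd (snd p)))"
        by (rule continuous_on_compose2[OF continuous_on_blinfun_of_mat[of UNIV]]) (auto intro!: continuous_intros)
      have "continuous_on ?D ?f" by (intro continuous_intros 1 2 3)
      moreover have "open ?D" by (intro open_Times open_Int open_UNIV ko Vo N.open_dom k)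
      ultimately have "open (?D \<inter> ?f -` W)" using W by (rule continuous_open_preimage)
      moreover have "?D \<inter> ?f -` W = O' j" by (auto simp: O'_def)
      ultimately show ?thesis by simp
    qed
    have "{z \<in> chart_image k. ue z \<in> V j - (\<Union>i<j. V i) \<and> (z, ue z, Q j z) \<in> O' j} \<in> sets lebesgue" for j
    proof -
      have z[measurable]: "(\<lambda>z::real^'m. z) \<in> borel_measurable lebesgue" by (intro measurable_completion) simp
      have "(\<lambda>z. (z, ue z, Q j z)) \<in> borel_measurable lebesgue"
        by (intro borel_measurable_Pair z ue Q)
      from measurable_sets[OF this borel_open[OF O'[of j]]]
      have a: "{z. (z, ue z, Q j z) \<in> O' j} \<in> sets lebesgue" by (simp add: vimage_def)
      have "V j - (\<Union>i<j. V i) \<in> sets borel" using Vo by auto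
      from measurable_sets[OF ue this] have b: "{z. ue z \<in> V j - (\<Union>i<j. V i)} \<in> sets lebesgue" by (simp add: vimage_def)
      have "chart_image k \<inter> {z. ue z \<in> V j - (\<Union>i<j. V i)} \<inter> {z. (z, ue z, Q j z) \<in> O' j} \<in> sets lebesgue"
        using a b km by (intro sets.Int)
      moreover have "{z \<in> chart_image k. ue z \<in> V j - (\<Union>i<j. V i) \<and> (z, ue z, Q j z) \<in> O' j} =
         chart_image k \<inter> {z. ue z \<in> V j - (\<Union>i<j. V i)} \<inter> {z. (z, ue z, Q j z) \<in> O' j}" by blast
      ultimately show ?thesis by (simp only:)
    qed
    then have "(\<Union>j. {z \<in> chart_image k. ue z \<in> V j - (\<Union>i<j. V i) \<and> (z, ue z, Q j z) \<in> O' j}) \<in> sets lebesgue" by blast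
    moreover have "{z \<in> chart_image k. (chart_inv k z, u (chart_inv k z), D (chart_inv k z)) \<in> over k k' \<and>
         triv k k' (chart_inv k z, u (chart_inv k z), D (chart_inv k z)) \<in> W} =
       (\<Union>j. {z \<in> chart_image k. ue z \<in> V j - (\<Union>i<j. V i) \<and> (z, ue z, Q j z) \<in> O' j})"
    proof -
      have key: "((chart_inv k z, u (chart_inv k z), D (chart_inv k z)) \<in> over k k' \<and> triv k k' (chart_inv k z, u (chart_inv k z), D (chart_inv k z)) \<in> W)
          \<longleftrightarrow> (z, ue z, Q j z) \<in> O' j" if z: "z \<in> chart_image k" and j: "ue z \<in> V j - (\<Union>i<j. V i)" for z j
      proof -
        let ?x = "chart_inv k z"
        have ue: "ue z = u ?x" using z by (simp add: ue_def M.chart_inv_ext_def)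
        have xk: "?x \<in> dom_of k" by (rule M.chart_inv_in_dom[OF k(1) z])
        have uj: "u ?x \<in> V j" "J ?x = j" using j ue J_iff by auto
        have mat: "blinfun_of_mat (Q j z) = \<Omega> j ?x o\<^sub>L chart_frame A k ?x"
        proof -
          have "Q j z = matrix (blinfun_apply (\<Omega> j ?x o\<^sub>L chart_frame A k ?x))"
            using z by (simp add: Q_def matrix_def \<Omega>_apply)
          then show ?thesis by (simp only: blinfun_of_mat_matrix)
        qed
        have "chart_diff B k' (u ?x) o\<^sub>L D ?x o\<^sub>L chart_frame A k ?x = transition_deriv (c j) k' (u ?x) o\<^sub>L blinfun_of_mat (Q j z)"
          if uk: "u ?x \<in> dom_of k'"
        proof -
          have ujd: "u ?x \<in> dom_of (c j)" using uj VD by blast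
          have "chart_diff B k' (u ?x) = transition_deriv (c j) k' (u ?x) o\<^sub>L chart_diff B (c j) (u ?x)"
            by (rule N.chart_diff_change[OF cB k(2) ujd uk])
          then show ?thesis unfolding mat
            by (intro blinfun_eqI) (simp add: D_def uj N.chart_diff_frame_apply(1)[OF cB ujd])
        qed
        then show ?thesis using z xk uj by (auto simp: O'_def ue M.map_chart_inv[OF k(1)])
      qed
      show ?thesis
      proof (intro set_eqI iffI)
        fix z assume a: "z \<in> {z \<in> chart_image k. (chart_inv k z, u (chart_inv k z), D (chart_inv k z)) \<in> over k k' \<and>
         triv k k' (chart_inv k z, u (chart_inv k z), D (chart_inv k z)) \<in> W}"
        then have z: "z \<in> chart_image k" by blast
        have j: "ue z \<in> V (J (chart_inv k z)) - (\<Union>i<J (chart_inv k z). V i)"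
          using J_iff[of "chart_inv k z" "J (chart_inv k z)"] z by (simp add: ue_def M.chart_inv_ext_def)
        show "z \<in> (\<Union>j. {z \<in> chart_image k. ue z \<in> V j - (\<Union>i<j. V i) \<and> (z, ue z, Q j z) \<in> O' j})"
          using a key[OF z j] z j by blast
      next
        fix z assume "z \<in> (\<Union>j. {z \<in> chart_image k. ue z \<in> V j - (\<Union>i<j. V i) \<and> (z, ue z, Q j z) \<in> O' j})"
        then obtain j where z: "z \<in> chart_image k" and j: "ue z \<in> V j - (\<Union>i<j. V i)" and o: "(z, ue z, Q j z) \<in> O' j" by blast
        then show "z \<in> {z \<in> chart_image k. (chart_inv k z, u (chart_inv k z), D (chart_inv k z)) \<in> over k k' \<and>
         triv k k' (chart_inv k z, u (chart_inv k z), D (chart_inv k z)) \<in> W}"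
          using key[OF z j] by blast
      qed
    qed
    ultimately show "{z \<in> chart_image k. (chart_inv k z, u (chart_inv k z), D (chart_inv k z)) \<in> over k k' \<and>
         triv k k' (chart_inv k z, u (chart_inv k z), D (chart_inv k z)) \<in> W} \<in> sets lebesgue" by (simp only:)
  qed simp
  moreover have "weak_derivative A (f \<circ> u) (\<lambda>x. mdiff B f (u x) o\<^sub>L D x)" if f: "f \<in> C1c B" for f
    unfolding M.weak_derivative_iff
  proof (intro ballI allI)
    fix k v assume k: "k \<in> A"
    obtain \<alpha> where \<alpha>: "weak_derivative A (f \<circ> u) \<alpha>" using uw[OF f] by blast
    have wf: "weak_dderiv (chart_image k) v (\<lambda>z. f (u (chart_inv k z))) (\<lambda>z. \<alpha> (chart_inv k z) (chart_frame A k (chart_inv k z) v))"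
      using \<alpha> k by (simp add: M.weak_derivative_iff)
    \<comment> \<open>The level set theorem is applied to f o u - h o F_j o u, which vanishes where
      u lies in V_j. Both terms are weakly differentiable on the whole chart image, one by
      assumption and one by the chain rule.\<close>
    have "AE z in lebesgue. z \<in> chart_image k \<longrightarrow> u (chart_inv k z) \<in> V j \<longrightarrow>
      \<alpha> (chart_inv k z) (chart_frame A k (chart_inv k z) v) =
      mdiff B f (u (chart_inv k z)) (chart_frame B (c j) (u (chart_inv k z)) (\<Omega> j (chart_inv k z) (chart_frame A k (chart_inv k z) v)))" for j
    proof -
      obtain h h' L where h: "\<And>z. (h has_derivative blinfun_apply (h' z)) (at z)" "continuous_on UNIV h'" "\<And>z. norm (h' z) \<le> L"
        "\<And>y. y \<in> V j \<Longrightarrow> h (F j y) = f y"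
        using cut[of j] f unfolding N.cutoff_chart_def by blast
      \<comment> \<open>On the open image of V_j the function h coincides with f in coordinates,
        which identifies its derivative.\<close>
      have h'eq: "h' (F j y) = mdiff B f y o\<^sub>L chart_frame B (c j) y" if y: "y \<in> V j" for y
      proof -
        have yd: "y \<in> dom_of (c j)" using y VD by blast
        have Fy: "F j y = map_of_chart (c j) y" if "y \<in> V j" for y using cut[of j] that by (simp add: N.cutoff_chart_def)
        have "((f \<circ> chart_inv (c j)) has_derivative blinfun_apply (h' (F j y))) (at (map_of_chart (c j) y))"
        proof (rule has_derivative_transform_within_open)
          show "(h has_derivative blinfun_apply (h' (F j y))) (at (map_of_chart (c j) y))" using h(1)[of "F j y"] by (simp add: Fy[OF y])
          show "open (map_of_chart (c j) ` (V j \<inter> dom_of (c j)))" by (rule N.open_map_image[OF cB Vo])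
          show "map_of_chart (c j) y \<in> map_of_chart (c j) ` (V j \<inter> dom_of (c j))" using y yd by blast
          show "h z = (f \<circ> chart_inv (c j)) z" if "z \<in> map_of_chart (c j) ` (V j \<inter> dom_of (c j))" for z
            using that h(4) Fy by (auto simp: N.chart_inv_map[OF cB]) 
        qed
        from has_derivative_unique[OF this N.C1c_chart_derivative[OF f cB yd]] show ?thesis
          by (simp add: blinfun_apply_inject)
      qed
      have "weak_dderiv (chart_image k) v (\<lambda>z. h (F j (u (chart_inv k z)))) (\<lambda>z. h' (F j (u (chart_inv k z))) (\<Omega> j (chart_inv k z) (chart_frame A k (chart_inv k z) v)))"
        by (rule weak_dderiv_chain[OF M.open_chart_image[OF k] wd[OF k] h(1,2,3)])
      from weak_dderiv_zero_set[OF M.open_chart_image[OF k] weak_dderiv_diff[OF wf this]]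
      show ?thesis
      proof eventually_elim
        case (elim z)
        show ?case
        proof (intro impI)
          assume z: "z \<in> chart_image k" "u (chart_inv k z) \<in> V j"
          show "\<alpha> (chart_inv k z) (chart_frame A k (chart_inv k z) v) =
            mdiff B f (u (chart_inv k z)) (chart_frame B (c j) (u (chart_inv k z)) (\<Omega> j (chart_inv k z) (chart_frame A k (chart_inv k z) v)))"
            using elim z h(4)[OF z(2)] h'eq[OF z(2)] by simp
        qed
      qed
    qed
    then have ae: "AE z in lebesgue. \<forall>j. z \<in> chart_image k \<longrightarrow> u (chart_inv k z) \<in> V j \<longrightarrow>
      \<alpha> (chart_inv k z) (chart_frame A k (chart_inv k z) v) =
      mdiff B f (u (chart_inv k z)) (chart_frame B (c j) (u (chart_inv k z)) (\<Omega> j (chart_inv k z) (chart_frame A k (chart_inv k z) v)))"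
      by (simp only: AE_all_countable) blast
    show "weak_dderiv (chart_image k) v (\<lambda>z. (f \<circ> u) (chart_inv k z))
      (\<lambda>z. (mdiff B f (u (chart_inv k z)) o\<^sub>L D (chart_inv k z)) (chart_frame A k (chart_inv k z) v))"
    proof (rule weak_dderiv_cong_AE[OF wf])
      show "AE z in lebesgue. z \<in> chart_image k \<longrightarrow> \<alpha> (chart_inv k z) (chart_frame A k (chart_inv k z) v) =
        (mdiff B f (u (chart_inv k z)) o\<^sub>L D (chart_inv k z)) (chart_frame A k (chart_inv k z) v)"
        using ae
      proof eventually_elim
        case (elim z)
        then show ?case using J[of "chart_inv k z"] by (auto simp: D_def)
      qed
    qed simp
  qed
  ultimately have "is_colocal_weak_derivative A B u D" by (simp add: is_colocal_weak_derivative_def)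
  then show ?thesis by blast
qed

lemma colocal_weak_derivative_works:
  "colocally_weakly_differentiable A B u \<Longrightarrow> is_colocal_weak_derivative A B u (colocal_weak_derivative A B u)"
  unfolding colocal_weak_derivative_def by (rule someI_ex[OF colocal_weak_derivative_exists])

end

section \<open>Concordant distances\<close>

locale concordant_distance = riemannian_pair A gM B gN
  for A :: "('a::{t2_space,second_countable_topology}, 'm::finite) mchart set"
    and gM :: "('a, 'm) mmetric"
    and B :: "('b::{t2_space,second_countable_topology}, 'n::finite) mchart set"
    and gN :: "('b, 'n) mmetric" +
  fixes d :: "('a, 'm, 'b, 'n) hom_bundle \<Rightarrow> ('a, 'm, 'b, 'n) hom_bundle \<Rightarrow> real"
  assumes metric_d: "Metric_space UNIV d" and concordant: "concordant A gM B gN d"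
begin

sublocale E: Metric_space UNIV d by (rule metric_d)

lemma mtopology_eq: "E.mtopology = bundle_topology"
  and d_base_proj: "d (base_proj e1) (base_proj e2) \<le> d e1 e2"
  using concordant unfolding concordant_def by blast+

lemma concordant_constant:
  obtains \<kappa> where "0 < \<kappa>" "\<And>e. hom_norm gM gN e \<le> \<kappa> * d e (base_proj e)" "\<And>e. d e (base_proj e) \<le> \<kappa> * hom_norm gM gN e"
proof -
  obtain \<kappa> where \<kappa>: "0 < \<kappa>" "\<And>e. inverse \<kappa> * hom_norm gM gN e \<le> d e (base_proj e)" "\<And>e. d e (base_proj e) \<le> \<kappa> * hom_norm gM gN e"
    using concordant unfolding concordant_def by blast
  have "hom_norm gM gN e \<le> \<kappa> * d e (base_proj e)" for e
    using \<kappa>(1) \<kappa>(2)[of e] by (simp add: field_simps)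
  then show thesis using \<kappa> by (intro that) auto
qed

lemma limitin_bundle_dist: "limitin bundle_topology s e F \<longleftrightarrow> (\<forall>\<epsilon>>0. \<forall>\<^sub>F k in F. d (s k) e < \<epsilon>)"
  unfolding mtopology_eq[symmetric] E.limitin_metric by simp

lemma openin_bundle_ball: "openin bundle_topology {e'. d e' e < r}"
proof -
  have "openin E.mtopology (E.mball e r)" by (rule E.openin_mball)
  moreover have "E.mball e r = {e'. d e' e < r}" by (auto simp: E.commute)
  ultimately show ?thesis by (simp add: mtopology_eq)
qed

lemma openin_bundle_dist: "openin bundle_topology V \<longleftrightarrow> (\<forall>e\<in>V. \<exists>r>0. \<forall>e'. d e' e < r \<longrightarrow> e' \<in> V)"
  unfolding mtopology_eq[symmetric] E.openin_mtopology by (auto simp: subset_iff E.commute Ball_def)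

lemma tendsto_dist:
  assumes "limitin bundle_topology s e F"
  shows "((\<lambda>k. d e' (s k)) \<longlongrightarrow> d e' e) F"
proof (rule tendstoI)
  fix \<epsilon> :: real assume "0 < \<epsilon>"
  then have "\<forall>\<^sub>F k in F. d (s k) e < \<epsilon>" using assms by (simp add: limitin_bundle_dist)
  then show "\<forall>\<^sub>F k in F. dist (d e' (s k)) (d e' e) < \<epsilon>"
  proof eventually_elim
    case (elim k)
    have "d e' (s k) \<le> d e' e + d e (s k)" "d e' e \<le> d e' (s k) + d (s k) e" by (rule E.triangle; simp)+
    then show ?case using elim E.commute[of e "s k"] by (simp add: dist_real_def)
  qed
qed

text \<open>A countable dense set of coordinates is carried to the bundle by the inverse
  trivialisations of countable covers. Separability is what makes d measurable along two sections at
  once.\<close>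

lemma bundle_countable_dense: "\<exists>S. countable S \<and> (\<forall>e. \<forall>\<epsilon>>0. \<exists>s\<in>S. d s e < \<epsilon>)"
proof -
  obtain T :: "((real ^ 'm) \<times> (real ^ 'n) \<times> (real ^ 'm ^ 'n)) set" where
    T: "countable T" "\<And>X. open X \<Longrightarrow> X \<noteq> {} \<Longrightarrow> \<exists>t\<in>T. t \<in> X"
    using countable_dense_exists by blast
  define q where "q i j p = (chart_inv (M.cover i) (fst p), chart_inv (N.cover j) (fst (snd p)),
     chart_frame B (N.cover j) (chart_inv (N.cover j) (fst (snd p))) o\<^sub>L blinfun_of_mat (snd (snd p)) o\<^sub>L chart_diff A (M.cover i) (chart_inv (M.cover i) (fst p)))"
    for i j and p :: "(real ^ 'm) \<times> (real ^ 'n) \<times> (real ^ 'm ^ 'n)"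
  let ?S = "\<Union>i j. q i j ` T"
  have "countable ?S" using T(1) by (intro countable_UN countableI_type countable_image)
  moreover have "\<exists>s\<in>?S. d s e < \<epsilon>" if \<epsilon>: "0 < \<epsilon>" for e \<epsilon>
  proof -
    obtain x y \<xi> where e: "e = (x, y, \<xi>)" by (cases e)
    obtain i where i: "x \<in> dom_of (M.cover i)" using M.countable_chart_cover_works(2) by blast
    obtain j where j: "y \<in> dom_of (N.cover j)" using N.countable_chart_cover_works(2) by blast
    note ci = M.cover_in[of i] and cj = N.cover_in[of j]
    obtain W where W: "open W" "\<And>e'. e' \<in> over (M.cover i) (N.cover j) \<Longrightarrow> d e' e < \<epsilon> \<longleftrightarrow> triv (M.cover i) (N.cover j) e' \<in> W"
      using bspec[OF bspec[OF openin_bundle_local[OF openin_bundle_ball[of e \<epsilon>]] ci] cj] by auto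
    let ?D = "chart_image (M.cover i) \<times> chart_image (N.cover j) \<times> (UNIV :: (real ^ 'm ^ 'n) set)"
    let ?f = "\<lambda>p. (fst p, fst (snd p), blinfun_of_mat (snd (snd p)))"
    have D: "open ?D" by (intro open_Times open_UNIV M.open_chart_image N.open_chart_image ci cj)
    have bm: "continuous_on ?D (\<lambda>p. blinfun_of_mat (snd (snd p)))"
      by (rule continuous_on_compose2[OF continuous_on_blinfun_of_mat[of UNIV]]) (auto intro!: continuous_intros)
    have "continuous_on ?D ?f" by (intro continuous_intros bm)
    then have X: "open (?D \<inter> ?f -` W)" by (rule continuous_open_preimage[OF _ D W(1)])
    have eov: "e \<in> over (M.cover i) (N.cover j)" using i j by (simp add: e)
    have "triv (M.cover i) (N.cover j) e \<in> W" using W(2)[OF eov] \<epsilon> by simp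
    then have "(map_of_chart (M.cover i) x, map_of_chart (N.cover j) y,
        matrix (blinfun_apply (chart_diff B (N.cover j) y o\<^sub>L \<xi> o\<^sub>L chart_frame A (M.cover i) x))) \<in> ?D \<inter> ?f -` W"
      using M.map_in_image[OF ci i] N.map_in_image[OF cj j] by (simp only: e) (simp only: hom_trivialization.simps blinfun_of_mat_matrix Int_iff vimage_eq mem_Times_iff fst_conv snd_conv UNIV_I simp_thms)
    then obtain p where p: "p \<in> T" "p \<in> ?D \<inter> ?f -` W" using T(2)[OF X] by blast
    have im: "fst p \<in> chart_image (M.cover i)" "fst (snd p) \<in> chart_image (N.cover j)" and pW: "?f p \<in> W" using p(2) by auto
    let ?x = "chart_inv (M.cover i) (fst p)" and ?y = "chart_inv (N.cover j) (fst (snd p))"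
    have xy: "?x \<in> dom_of (M.cover i)" "?y \<in> dom_of (N.cover j)" using M.chart_inv_in_dom[OF ci im(1)] N.chart_inv_in_dom[OF cj im(2)] .
    have "chart_diff B (N.cover j) ?y o\<^sub>L snd (snd (q i j p)) o\<^sub>L chart_frame A (M.cover i) ?x = blinfun_of_mat (snd (snd p))"
      by (intro blinfun_eqI) (simp add: q_def M.chart_diff_frame_apply[OF ci xy(1)] N.chart_diff_frame_apply[OF cj xy(2)])
    then have "triv (M.cover i) (N.cover j) (q i j p) = ?f p"
      by (simp add: q_def M.map_chart_inv[OF ci im(1)] N.map_chart_inv[OF cj im(2)])
    moreover have "q i j p \<in> over (M.cover i) (N.cover j)" using xy by (simp add: q_def)
    ultimately have "d (q i j p) e < \<epsilon>" using W(2) pW by simp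
    then show ?thesis using p(1) by blast
  qed
  ultimately show ?thesis by blast
qed

text \<open>The distance is below r exactly when a point q of a countable dense set and a rational
  \<rho> split it into d(s x, q) < \<rho> and d(t x, q) < r - \<rho>; each condition involves one
  section only.\<close>

lemma measurable_dist:
  assumes s: "s \<in> measurable (manifold_sigma A) bundle_borel" and t: "t \<in> measurable (manifold_sigma A) bundle_borel"
  shows "(\<lambda>x. d (s x) (t x)) \<in> borel_measurable (manifold_sigma A)"
  unfolding borel_measurable_iff_less
proof
  fix r :: real
  obtain S where S: "countable S" "\<And>e \<epsilon>. 0 < \<epsilon> \<Longrightarrow> \<exists>s\<in>S. d s e < \<epsilon>" using bundle_countable_dense by blast
  have m: "{x. d (s x) q < \<rho>} \<in> lebesgue_sets A" "{x. d (t x) q < \<rho>} \<in> lebesgue_sets A" for q \<rho>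
    using measurable_bundleD[OF s openin_bundle_ball[of q \<rho>]] measurable_bundleD[OF t openin_bundle_ball[of q \<rho>]] by (simp_all add: vimage_def)
  have "{x. d (s x) (t x) < r} = (\<Union>q\<in>S. \<Union>\<rho>\<in>\<rat>. {x. d (s x) q < \<rho>} \<inter> {x. d (t x) q < r - \<rho>})"
  proof (intro set_eqI iffI)
    fix x assume x: "x \<in> {x. d (s x) (t x) < r}"
    \<comment> \<open>A third of the slack is enough: d(t x, q) < r - 3\<delta> + \<rho>, and
      2\<rho> < 3\<delta>.\<close>
    let ?\<delta> = "(r - d (s x) (t x)) / 3"
    have \<delta>: "0 < ?\<delta>" using x by simp
    obtain q where q: "q \<in> S" "d q (s x) < ?\<delta>" using S(2)[OF \<delta>] by blast
    obtain \<rho> where \<rho>: "\<rho> \<in> \<rat>" "d (s x) q < \<rho>" "\<rho> < ?\<delta>"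
      using Rats_dense_in_real[of "d (s x) q" ?\<delta>] q(2) by (auto simp: E.commute)
    have "d (t x) q \<le> d (t x) (s x) + d (s x) q" by (rule E.triangle) auto
    then have "d (t x) q < r - \<rho>" using \<rho> \<delta> by (simp add: E.commute[of "t x" "s x"] field_simps)
    then show "x \<in> (\<Union>q\<in>S. \<Union>\<rho>\<in>\<rat>. {x. d (s x) q < \<rho>} \<inter> {x. d (t x) q < r - \<rho>})" using q \<rho> by blast
  next
    fix x assume "x \<in> (\<Union>q\<in>S. \<Union>\<rho>\<in>\<rat>. {x. d (s x) q < \<rho>} \<inter> {x. d (t x) q < r - \<rho>})"
    then obtain q \<rho> where q: "d (s x) q < \<rho>" "d (t x) q < r - \<rho>" by blast
    have "d (s x) (t x) \<le> d (s x) q + d q (t x)" by (rule E.triangle) auto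
    then show "x \<in> {x. d (s x) (t x) < r}" using q by (simp add: E.commute[of q])
  qed
  also have "\<dots> \<in> lebesgue_sets A"
    by (intro M.lebesgue_sets_countable_UN S(1) countable_rat M.lebesgue_sets_Int m)
  finally show "{x \<in> space (manifold_sigma A). d (s x) (t x) < r} \<in> sets (manifold_sigma A)" by simp
qed

text \<open>The limit lies in an open V exactly when, for some j, all late terms keep a distance of
  at least 1/(j+1) from the complement of V. This is a countable combination of preimages of closed
  sets.\<close>

lemma measurable_bundle_limit:
  assumes s: "\<And>k::nat. s k \<in> measurable (manifold_sigma A) bundle_borel"
    and lim: "\<And>x. limitin bundle_topology (\<lambda>k. s k x) (t x) sequentially"
  shows "t \<in> measurable (manifold_sigma A) bundle_borel"
proof (rule measurable_measure_of)
  fix V assume "V \<in> {W. openin bundle_topology W}"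
  then have V: "openin bundle_topology V" by simp
  define C where "C j = {e. \<forall>a. a \<notin> V \<longrightarrow> 1 / real (Suc j) \<le> d e a}" for j
  have Cm: "s k -` C j \<in> lebesgue_sets A" for k j
  proof -
    have "openin bundle_topology (\<Union>a\<in>-V. {e. d e a < 1 / real (Suc j)})"
      by (intro openin_Union) (auto intro: openin_bundle_ball)
    from M.lebesgue_sets_Diff[OF M.open_in_lebesgue_sets[OF open_UNIV] measurable_bundleD[OF s this]]
    have "UNIV - s k -` (\<Union>a\<in>-V. {e. d e a < 1 / real (Suc j)}) \<in> lebesgue_sets A" .
    moreover have "UNIV - s k -` (\<Union>a\<in>-V. {e. d e a < 1 / real (Suc j)}) = s k -` C j"
      by (auto simp: C_def not_less simp del: split_paired_All split_paired_Ex)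
    ultimately show ?thesis by simp
  qed
  have lim': "\<forall>\<^sub>F k in sequentially. d (s k x) (t x) < \<epsilon>" if "0 < \<epsilon>" for x \<epsilon>
    using lim[of x] that by (simp add: limitin_bundle_dist)
  have "t -` V = (\<Union>j. \<Union>K. \<Inter>k\<in>{K..}. s k -` C j)"
  proof (intro set_eqI iffI)
    fix x assume "x \<in> t -` V"
    then obtain r where r: "r > 0" "\<And>e. d e (t x) < r \<Longrightarrow> e \<in> V" using V by (auto simp: openin_bundle_dist)
    obtain j where j: "inverse (real (Suc j)) < r / 2" using reals_Archimedean[of "r/2"] r(1) by auto
    obtain K where K: "\<And>k. K \<le> k \<Longrightarrow> d (s k x) (t x) < r / 2"
      using lim'[of "r/2" x] r(1) by (auto simp: eventually_sequentially)
    have "s k x \<in> C j" if "K \<le> k" for k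
      unfolding C_def
    proof (intro CollectI allI impI)
      fix a assume "a \<notin> V"
      then have "r \<le> d a (t x)" using r(2)[of a] by (meson not_le)
      also have "\<dots> \<le> d a (s k x) + d (s k x) (t x)" by (rule E.triangle) auto
      finally show "1 / real (Suc j) \<le> d (s k x) a" using K[OF that] j by (simp add: E.commute[of a] inverse_eq_divide)
    qed
    then show "x \<in> (\<Union>j. \<Union>K. \<Inter>k\<in>{K..}. s k -` C j)" by (intro UN_I[of j] UN_I[of K] INT_I) auto
  next
    fix x assume "x \<in> (\<Union>j. \<Union>K. \<Inter>k\<in>{K..}. s k -` C j)"
    then obtain j K where jK: "\<And>k. K \<le> k \<Longrightarrow> s k x \<in> C j" by auto
    show "x \<in> t -` V"
    proof (rule ccontr)
      assume n: "x \<notin> t -` V"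
      obtain K' where K': "\<And>k. K' \<le> k \<Longrightarrow> d (s k x) (t x) < 1 / real (Suc j)"
        using lim'[of "1 / real (Suc j)" x] by (auto simp: eventually_sequentially)
      have "1 / real (Suc j) \<le> d (s (max K K') x) (t x)" using jK[of "max K K'"] n by (simp add: C_def del: split_paired_All)
      then show False using K'[of "max K K'"] by simp
    qed
  qed
  also have "\<dots> \<in> sets (manifold_sigma A)"
    by (intro sets.countable_UN'' sets.countable_INT'' countableI_type) (simp_all add: Cm M.open_in_lebesgue_sets)
  finally show "t -` V \<inter> space (manifold_sigma A) \<in> sets (manifold_sigma A)" by simp
qed auto

text \<open>Completeness is given for the zero section over x as a subspace, which is why base
  points are handled in that subspace. Compactness of bounded sets in the fibres only yields a
  subsequential limit; the Cauchy property makes it a limit of the whole sequence.\<close>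

lemma bundle_fibre_complete:
  fixes y :: "nat \<Rightarrow> 'b"
  assumes compl: "Metric_space.mcomplete (range (\<lambda>y. (x, y, 0))) d"
    and Cauchy: "\<And>\<epsilon>. 0 < \<epsilon> \<Longrightarrow> \<exists>K. \<forall>k\<ge>K. \<forall>l\<ge>K. d (x, y k, \<xi> k) (x, y l, \<xi> l) < \<epsilon>"
  shows "\<exists>y' \<xi>'. limitin bundle_topology (\<lambda>k. (x, y k, \<xi> k)) (x, y', \<xi>') sequentially"
proof -
  let ?R = "range (\<lambda>y::'b. (x, y, 0 :: (real ^ 'm) \<Rightarrow>\<^sub>L (real ^ 'n)))"
  let ?e = "\<lambda>k. (x, y k, \<xi> k)"
  interpret S: Metric_space ?R d by (rule E.subspace) simp
  have bp: "base_proj (?e k) = (x, y k, 0)" for k by simp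
  have "S.MCauchy (\<lambda>k. (x, y k, 0))"
    unfolding S.MCauchy_def
  proof (intro conjI allI impI)
    fix \<epsilon> :: real assume "0 < \<epsilon>"
    from Cauchy[OF this] obtain K where K: "\<And>k l. K \<le> k \<Longrightarrow> K \<le> l \<Longrightarrow> d (?e k) (?e l) < \<epsilon>" by blast
    show "\<exists>N. \<forall>n n'. N \<le> n \<longrightarrow> N \<le> n' \<longrightarrow> d (x, y n, 0) (x, y n', 0) < \<epsilon>"
    proof (intro exI[of _ K] allI impI)
      fix n n' assume "K \<le> n" "K \<le> n'"
      then show "d (x, y n, 0) (x, y n', 0) < \<epsilon>"
        using K[of n n'] d_base_proj[of "?e n" "?e n'"] unfolding bp by linarith
    qed
  qed auto
  then obtain z where "limitin S.mtopology (\<lambda>k. (x, y k, 0)) z sequentially"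
    using compl unfolding S.mcomplete_def by blast
  then obtain y' where "z = (x, y', 0)" and "\<forall>\<epsilon>>0. \<forall>\<^sub>F k in sequentially. d (x, y k, 0) z < \<epsilon>"
    unfolding S.limitin_metric by (auto elim!: eventually_mono)
  then have "limitin bundle_topology (\<lambda>k. (x, y k, 0)) (x, y', 0) sequentially" by (simp add: limitin_bundle_dist)
  then have yy: "y \<longlonglongrightarrow> y'" by (rule limitin_bundle_base)
  obtain \<kappa> where \<kappa>: "0 < \<kappa>" "\<And>e. hom_norm gM gN e \<le> \<kappa> * d e (base_proj e)" by (rule concordant_constant) blast
  obtain K where K: "\<And>k l. K \<le> k \<Longrightarrow> K \<le> l \<Longrightarrow> d (?e k) (?e l) < 1" using Cauchy[of 1] by auto
  \<comment> \<open>From the term at \<open>k + K\<close> to the one at K, on to its projection and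
    then to the projection of the term at \<open>k + K\<close>: the outer steps cost at most 1 each,
    as projecting does not increase d. Concordance contributes \<kappa>.\<close>
  let ?R = "\<kappa> * (2 + d (?e K) (base_proj (?e K)))"
  have bd: "hom_norm gM gN (x, y (k + K), \<xi> (k + K)) \<le> ?R" for k
  proof -
    have 1: "d (?e (k + K)) (?e K) < 1" by (rule K) auto
    have "d (?e (k + K)) (base_proj (?e (k + K))) \<le> d (?e (k + K)) (?e K) + d (?e K) (base_proj (?e (k + K)))"
      by (rule E.triangle) auto
    moreover have "d (?e K) (base_proj (?e (k + K))) \<le> d (?e K) (base_proj (?e K)) + d (base_proj (?e K)) (base_proj (?e (k + K)))"
      by (rule E.triangle) auto
    moreover have "d (base_proj (?e K)) (base_proj (?e (k + K))) \<le> d (?e (k + K)) (?e K)"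
      using d_base_proj[of "?e K" "?e (k + K)"] by (simp only: E.commute)
    ultimately have "d (?e (k + K)) (base_proj (?e (k + K))) \<le> 2 + d (?e K) (base_proj (?e K))" using 1 by linarith
    then have "\<kappa> * d (?e (k + K)) (base_proj (?e (k + K))) \<le> ?R" by (rule mult_left_mono) (use \<kappa>(1) in simp)
    then show ?thesis using \<kappa>(2)[of "?e (k + K)"] by linarith
  qed
  have "(\<lambda>k. y (k + K)) \<longlonglongrightarrow> y'" using yy by (rule LIMSEQ_ignore_initial_segment)
  from bundle_fibre_compactness[OF this bd] obtain r \<xi>' where r: "strict_mono r"
    "limitin bundle_topology (\<lambda>k. (x, y (r k + K), \<xi> (r k + K))) (x, y', \<xi>') sequentially" by blast
  have "limitin bundle_topology ?e (x, y', \<xi>') sequentially"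
    unfolding limitin_bundle_dist
  proof (intro allI impI)
    fix \<epsilon> :: real assume \<epsilon>: "0 < \<epsilon>"
    obtain K1 where K1: "\<And>k l. K1 \<le> k \<Longrightarrow> K1 \<le> l \<Longrightarrow> d (?e k) (?e l) < \<epsilon> / 2" using Cauchy[of "\<epsilon>/2"] \<epsilon> by auto
    have "\<forall>\<^sub>F k in sequentially. d (?e (r k + K)) (x, y', \<xi>') < \<epsilon> / 2"
      using half_gt_zero[OF \<epsilon>] r(2) unfolding limitin_bundle_dist by blast
    then obtain K2 where K2: "\<And>k. K2 \<le> k \<Longrightarrow> d (?e (r k + K)) (x, y', \<xi>') < \<epsilon> / 2" by (auto simp: eventually_sequentially)
    define m where "m = max K1 K2"
    have m: "K1 \<le> r m + K" "K2 \<le> m" using strict_mono_imp_increasing[OF r(1), of m] by (auto simp: m_def)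
    have "d (?e k) (x, y', \<xi>') < \<epsilon>" if "K1 \<le> k" for k
      using E.triangle[of "?e k" "?e (r m + K)" "(x, y', \<xi>')"] K1[OF that m(1)] K2[OF m(2)] by simp
    then show "\<forall>\<^sub>F k in sequentially. d (?e k) (x, y', \<xi>') < \<epsilon>" by (auto simp: eventually_sequentially)
  qed
  then show ?thesis by blast
qed

end

section \<open>Completeness of the Sobolev space\<close>

text \<open>It trades smallness of the distance for smallness of the integral, so that roots need
  not be handled further.\<close>

lemma ennreal_root_less_iff:
  assumes "1 \<le> p" "0 < \<epsilon>"
  shows "ennreal_root p t < ennreal \<epsilon> \<longleftrightarrow> t < ennreal (\<epsilon> powr p)"
proof (cases t)
  case (real r)
  have "r powr (1 / p) < \<epsilon> \<longleftrightarrow> r < \<epsilon> powr p"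
  proof
    assume "r powr (1 / p) < \<epsilon>"
    then have "(r powr (1 / p)) powr p < \<epsilon> powr p" using assms by (intro powr_less_mono2) auto
    then show "r < \<epsilon> powr p" using real assms by (simp add: powr_powr)
  next
    assume "r < \<epsilon> powr p"
    then have "r powr (1 / p) < (\<epsilon> powr p) powr (1 / p)" using real assms by (intro powr_less_mono2) auto
    then show "r powr (1 / p) < \<epsilon>" using assms by (simp add: powr_powr)
  qed
  then show ?thesis using real by (simp add: ennreal_root_def ennreal_less_iff)
qed (simp add: ennreal_root_def)

lemma tendsto_0_ennrealI:
  fixes f :: "'i \<Rightarrow> ennreal"
  assumes "\<And>\<epsilon>. 0 < \<epsilon> \<Longrightarrow> \<forall>\<^sub>F k in F. f k < ennreal \<epsilon>"
  shows "(f \<longlongrightarrow> 0) F"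
proof (rule order_tendstoI)
  fix a :: ennreal assume a: "0 < a"
  show "\<forall>\<^sub>F k in F. f k < a"
  proof (cases a)
    case (real r)
    then show ?thesis using assms[of r] a by simp
  next
    case top
    show ?thesis using assms[of 1] by (rule eventually_mono) (auto simp: top less_top[symmetric] intro: less_trans[of _ 1])
  qed
qed simp

text \<open>It makes L^p functions locally integrable: the p-th power and the constant one are. This
  takes the place of Hoelder's inequality.\<close>

lemma le_one_add_powr: "0 \<le> t \<Longrightarrow> 1 \<le> p \<Longrightarrow> t \<le> 1 + t powr p" for t p :: real
  using powr_mono[of 1 p t] by (cases "t \<le> 1") (auto intro: order_trans)

lemma add_powr_le:
  fixes a b p :: real
  assumes "0 \<le> a" "0 \<le> b" "0 \<le> p"
  shows "(a + b) powr p \<le> 2 powr p * (a powr p + b powr p)"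
proof -
  have "(a + b) powr p \<le> (2 * max a b) powr p" using assms by (intro powr_mono2) auto
  also have "\<dots> = 2 powr p * max a b powr p" using assms by (simp add: powr_mult)
  also have "\<dots> \<le> 2 powr p * (a powr p + b powr p)" by (intro mult_left_mono) (auto simp: max_def)
  finally show ?thesis .
qed

text \<open>A continuous factor is bounded on compact sets. It is applied to the length of a frame
  vector, which may be unbounded on the chart image.\<close>

lemma loc_integrable_cont_mult:
  fixes \<phi> w :: "'v::euclidean_space \<Rightarrow> real"
  assumes \<phi>: "continuous_on V \<phi>" and w: "loc_integrable V w"
  shows "loc_integrable V (\<lambda>z. \<phi> z * w z)"
  unfolding loc_integrable_def set_integrable_def
proof (intro allI impI, elim conjE)
  fix K assume K: "compact K" "K \<subseteq> V"
  have cK: "continuous_on K \<phi>" using \<phi> K(2) by (rule continuous_on_subset)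
  obtain C where C: "\<And>z. z \<in> K \<Longrightarrow> \<bar>\<phi> z\<bar> \<le> C"
    using compact_imp_bounded[OF compact_continuous_image[OF cK K(1)]] by (auto simp: bounded_iff)
  have "(\<lambda>z. indicator K z *\<^sub>R \<phi> z) \<in> borel_measurable borel"
    using borel_measurable_continuous_on_indicator[OF borel_compact[OF K(1)] cK] .
  then have m: "(\<lambda>z. indicator K z * \<phi> z) \<in> borel_measurable lebesgue"
    by (intro measurable_completion) simp
  have "integrable lebesgue (\<lambda>z. (indicator K z * \<phi> z) *\<^sub>R (indicator K z *\<^sub>R w z))"
  proof (rule integrable_bounded_scaleR[OF loc_integrableD[OF w K] m])
    show "\<bar>indicator K z * \<phi> z\<bar> \<le> \<bar>C\<bar>" for z using C[of z] by (auto simp: indicator_def)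
  qed
  also have "(\<lambda>z. (indicator K z * \<phi> z) *\<^sub>R (indicator K z *\<^sub>R w z)) = (\<lambda>z. indicator K z *\<^sub>R (\<phi> z * w z))"
    by (auto simp: indicator_def)
  finally show "integrable lebesgue (\<lambda>z. indicator K z *\<^sub>R (\<phi> z * w z))" .
qed

text \<open>The induction needs the sharper bound R (2^-k - 2^-(k+m)), which telescopes; the
  subtracted term is dropped at the end.\<close>

lemma (in Metric_space) dist_geometric_le:
  fixes e :: "nat \<Rightarrow> 'a"
  assumes e: "\<And>k. e k \<in> M" and le: "\<And>k. d (e k) (e (Suc k)) \<le> R * (1/2) ^ Suc k" and R: "0 \<le> R" and "k \<le> l"
  shows "d (e k) (e l) \<le> R * (1/2) ^ k"
proof -
  have "d (e k) (e (k + m)) \<le> R * ((1/2) ^ k - (1/2) ^ (k + m))" for m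
  proof (induction m)
    case 0
    then show ?case using e by simp
  next
    case (Suc m)
    have "d (e k) (e (Suc (k + m))) \<le> d (e k) (e (k + m)) + d (e (k + m)) (e (Suc (k + m)))" by (intro triangle e)
    moreover have "R * ((1/2) ^ k - (1/2) ^ (k + m)) + R * (1/2) ^ Suc (k + m) = R * ((1/2) ^ k - (1/2) ^ Suc (k + m))"
      by (simp add: algebra_simps)
    ultimately show ?case using Suc le[of "k + m"] unfolding add_Suc_right by linarith
  qed
  from this[of "l - k"] have "d (e k) (e l) \<le> R * ((1/2) ^ k - (1/2) ^ l)" using \<open>k \<le> l\<close> by simp
  also have "\<dots> \<le> R * (1/2) ^ k" using R by (intro mult_left_mono) auto
  finally show ?thesis .
qed

text \<open>h is the sum of the p-th powers of \<delta>_k after multiplication by 2^(k+1). The k-th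
  integral is then at most 2^-(k+1), so h is integrable, and comparing a single term with the whole
  sum gives the pointwise bound.\<close>

lemma summable_rescaled_powers:
  fixes \<delta> :: "nat \<Rightarrow> 'a \<Rightarrow> real"
  assumes p: "1 \<le> p" and m: "\<And>k. \<delta> k \<in> borel_measurable \<mu>" and nn: "\<And>k x. 0 \<le> \<delta> k x"
    and le: "\<And>k. (\<integral>\<^sup>+x. ennreal (\<delta> k x powr p) \<partial>\<mu>) < ennreal (((1/4) ^ Suc k) powr p)"
  obtains h where "h \<in> borel_measurable \<mu>" "\<And>x. 0 \<le> h x" "(\<integral>\<^sup>+x. ennreal (h x) \<partial>\<mu>) < \<infinity>"
    "AE x in \<mu>. \<forall>k. \<delta> k x \<le> h x powr (1 / p) * (1/2) ^ Suc k"
proof -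
  define q where "q k x = (2 ^ Suc k * \<delta> k x) powr p" for k x
  have [measurable]: "q k \<in> borel_measurable \<mu>" for k using m[of k] unfolding q_def by measurable
  have qI: "(\<integral>\<^sup>+x. ennreal (q k x) \<partial>\<mu>) \<le> ennreal ((1/2) ^ Suc k)" for k
  proof -
    have [measurable]: "\<delta> k \<in> borel_measurable \<mu>" by (rule m)
    have "(\<integral>\<^sup>+x. ennreal (q k x) \<partial>\<mu>) = ennreal ((2 ^ Suc k) powr p) * (\<integral>\<^sup>+x. ennreal (\<delta> k x powr p) \<partial>\<mu>)"
      by (subst nn_integral_cmult[symmetric]) (auto simp: q_def powr_mult nn ennreal_mult simp del: power_Suc)
    also have "\<dots> \<le> ennreal ((2 ^ Suc k) powr p) * ennreal (((1/4) ^ Suc k) powr p)"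
      by (rule mult_left_mono[OF less_imp_le[OF le]]) simp
    also have "\<dots> = ennreal ((2 ^ Suc k * (1/4) ^ Suc k) powr p)" by (simp add: powr_mult ennreal_mult del: power_Suc)
    also have "2 ^ Suc k * (1/4) ^ Suc k = (1/2 :: real) ^ Suc k" by (simp add: power_mult_distrib[symmetric] del: power_Suc)
    \<comment> \<open>Powers of a number at most one decrease with the exponent, and p is at least
      one.\<close>
    also have "ennreal (((1/2) ^ Suc k) powr p) \<le> ennreal (((1/2) ^ Suc k) powr 1)"
      using p by (intro ennreal_leI powr_mono') (auto intro: power_le_one simp del: power_Suc)
    finally show ?thesis by simp
  qed
  define H where "H x = (\<Sum>k. ennreal (q k x))" for x
  have [measurable]: "H \<in> borel_measurable \<mu>" unfolding H_def by measurable
  have "(\<integral>\<^sup>+x. H x \<partial>\<mu>) = (\<Sum>k. \<integral>\<^sup>+x. ennreal (q k x) \<partial>\<mu>)" unfolding H_def by (rule nn_integral_suminf) measurable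
  also have "\<dots> \<le> (\<Sum>k. ennreal ((1/2) ^ Suc k))" by (intro suminf_le qI summableI)
  also have "\<dots> = ennreal 1" by (rule suminf_ennreal_eq[OF _ power_half_series]) simp
  finally have HI: "(\<integral>\<^sup>+x. H x \<partial>\<mu>) < \<infinity>" by (rule le_less_trans) simp
  have Hfin: "AE x in \<mu>. H x \<noteq> \<infinity>" by (rule nn_integral_PInf_AE) (use HI in auto)
  show thesis
  \<comment> \<open>\<open>enn2real\<close> sends infinity to zero; this affects a null set only,
    because the sum is integrable.\<close>
  proof (rule that[of "\<lambda>x. enn2real (H x)"])
    have "(\<integral>\<^sup>+x. ennreal (enn2real (H x)) \<partial>\<mu>) \<le> (\<integral>\<^sup>+x. H x \<partial>\<mu>)"
      by (intro nn_integral_mono) (simp add: ennreal_enn2real_if)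
    then show "(\<integral>\<^sup>+x. ennreal (enn2real (H x)) \<partial>\<mu>) < \<infinity>" using HI by (rule le_less_trans)
    show "AE x in \<mu>. \<forall>k. \<delta> k x \<le> enn2real (H x) powr (1 / p) * (1/2) ^ Suc k"
      using Hfin
    proof (eventually_elim, intro allI)
      fix x k assume fin: "H x \<noteq> \<infinity>"
      have "ennreal (q k x) \<le> H x"
        using sum_le_suminf[OF summableI, of "{k}" "\<lambda>k. ennreal (q k x)"] by (simp add: H_def)
      then have "enn2real (ennreal (q k x)) \<le> enn2real (H x)" using fin by (intro enn2real_mono) (auto simp: less_top)
      then have "q k x \<le> enn2real (H x)" by (simp add: q_def)
      then have "q k x powr (1 / p) \<le> enn2real (H x) powr (1 / p)" using p by (intro powr_mono2) (auto simp: q_def)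
      moreover have "q k x powr (1 / p) = 2 ^ Suc k * \<delta> k x" using p nn[of k x] by (simp add: q_def powr_powr del: power_Suc)
      ultimately show "\<delta> k x \<le> enn2real (H x) powr (1 / p) * (1/2) ^ Suc k"
        by (simp add: field_simps power_divide)
    qed
  qed auto
qed

section \<open>Limits of fast Cauchy sequences\<close>

context concordant_distance
begin

text \<open>Go from e to e', on to the projection of e' and then to the projection of e. The outer
  steps cost at most d(e, e') each, and concordance bounds the middle one by \<kappa> times the norm
  of e'. Concordance once more for e gives the coefficients 2\<kappa> and \<kappa>^2, both below the
  constant taken.\<close>

lemma hom_norm_le_dist:
  obtains \<kappa> where "0 < \<kappa>" "\<And>e e'. hom_norm gM gN e \<le> \<kappa> * (d e e' + hom_norm gM gN e')"
proof -
  obtain \<kappa> where \<kappa>: "0 < \<kappa>" "\<And>e. hom_norm gM gN e \<le> \<kappa> * d e (base_proj e)" "\<And>e. d e (base_proj e) \<le> \<kappa> * hom_norm gM gN e"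
    by (rule concordant_constant) blast
  let ?C = "2 * \<kappa> + \<kappa> * \<kappa>"
  have "hom_norm gM gN e \<le> ?C * (d e e' + hom_norm gM gN e')" for e e'
  proof -
    have "d e (base_proj e) \<le> d e e' + d e' (base_proj e)" "d e' (base_proj e) \<le> d e' (base_proj e') + d (base_proj e') (base_proj e)"
      by (rule E.triangle; simp)+
    moreover have "d (base_proj e') (base_proj e) \<le> d e e'" using d_base_proj[of e e'] by (simp only: E.commute)
    ultimately have "d e (base_proj e) \<le> 2 * d e e' + \<kappa> * hom_norm gM gN e'" using \<kappa>(3)[of e'] by linarith
    then have "\<kappa> * d e (base_proj e) \<le> \<kappa> * (2 * d e e' + \<kappa> * hom_norm gM gN e')" using \<kappa>(1) by (intro mult_left_mono) auto
    also have "\<dots> \<le> ?C * (d e e' + hom_norm gM gN e')"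
      using \<kappa>(1) E.nonneg[of e e'] hom_norm_nonneg[of e'] by (simp add: algebra_simps)
    finally show ?thesis using \<kappa>(2)[of e] by linarith
  qed
  moreover have "0 < ?C" using \<kappa>(1) by (simp add: add_pos_pos)
  ultimately show thesis by (rule that[rotated])
qed

lemma measurable_weak_tangent:
  "colocally_weakly_differentiable A B u \<Longrightarrow> weak_tangent A B u \<in> measurable (manifold_sigma A) bundle_borel"
  using colocal_weak_derivative_works[of u] unfolding is_colocal_weak_derivative_def weak_tangent_def[abs_def] by blast

lemma weak_tangent_cong_AE:
  assumes "is_colocal_weak_derivative A B v D" "colocally_weakly_differentiable A B u" "M.chart_AE (\<lambda>x. u x = v x)"
  shows "M.chart_AE (\<lambda>x. weak_tangent A B u x = (x, v x, D x))"
  using M.chart_AE_conj[OF assms(3) colocal_weak_derivative_unique[OF colocal_weak_derivative_works[OF assms(2)] assms(1,3)]]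
  by (rule M.chart_AE_mono) (simp add: weak_tangent_def)

lemma nn_integral_sobolev_finite:
  assumes "u \<in> sobolev_maps A gM B gN p"
  shows "(\<integral>\<^sup>+x. ennreal (hom_norm gM gN (weak_tangent A B u x) powr p) \<partial>riemannian_measure A gM) < \<infinity>"
proof -
  have "integrable (riemannian_measure A gM) (\<lambda>x. hom_norm gM gN (weak_tangent A B u x) powr p)"
    using assms unfolding sobolev_maps_def by blast
  then have "(\<integral>\<^sup>+x. ennreal (norm (hom_norm gM gN (weak_tangent A B u x) powr p)) \<partial>riemannian_measure A gM) < \<infinity>"
    unfolding integrable_iff_bounded by blast
  also have "(\<lambda>x. norm (hom_norm gM gN (weak_tangent A B u x) powr p)) = (\<lambda>x. hom_norm gM gN (weak_tangent A B u x) powr p)"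
    by (intro ext) (simp only: real_norm_def abs_of_nonneg powr_ge_zero)
  finally show ?thesis .
qed

text \<open>For a test function f the compositions are uniformly bounded and their derivatives are
  at most a continuous factor times F, so the limit theorem applies in each chart. Convergence in
  the bundle is used in the base for f o u_k and in the fibre for the derivative.\<close>

lemma weak_derivative_dominated_limit:
  fixes u :: "nat \<Rightarrow> 'a \<Rightarrow> 'b"
  assumes D: "\<And>k. is_colocal_weak_derivative A B (u k) (D k)"
    and lim: "M.chart_AE (\<lambda>x. limitin bundle_topology (\<lambda>k. (x, u k x, D k x)) (x, Y x, \<Xi> x) sequentially)"
    and le: "M.chart_AE (\<lambda>x. \<forall>k. hom_norm gM gN (x, u k x, D k x) \<le> F x)"
    and F: "\<And>c. c \<in> A \<Longrightarrow> loc_integrable (chart_image c) (\<lambda>z. F (chart_inv c z))"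
    and f: "f \<in> C1c B"
  shows "weak_derivative A (f \<circ> Y) (\<lambda>x. mdiff B f (Y x) o\<^sub>L \<Xi> x)"
  unfolding M.weak_derivative_iff
proof (intro ballI allI)
  fix c v assume c: "c \<in> A"
  obtain C0 where C0: "\<And>y. \<bar>f y\<bar> \<le> C0" by (rule N.C1c_bounded[OF f]) blast
  obtain C where C: "0 \<le> C" "\<And>y \<eta>. \<bar>mdiff B f y \<eta>\<bar> \<le> C * sqrt (gN y \<eta> \<eta>)" by (rule N.mdiff_bound[OF f]) blast
  let ?v = "\<lambda>x. chart_frame A c x v"
  let ?\<phi> = "\<lambda>x. C * real CARD('m) * sqrt (gM x (?v x) (?v x))"
  have "continuous_on (chart_image c) (\<lambda>z. gM (chart_inv c z) (?v (chart_inv c z)) (?v (chart_inv c z)))"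
    by (rule continuous_on_compose2[OF M.continuous_on_metric[OF c, of v v] M.continuous_on_inv[OF c]]) (auto simp: M.chart_inv_in_dom[OF c])
  then have cont: "continuous_on (chart_image c) (\<lambda>z. ?\<phi> (chart_inv c z))"
    by (intro continuous_intros continuous_on_real_sqrt)
  have wd: "weak_dderiv (chart_image c) v (\<lambda>z. f (u k (chart_inv c z)))
      (\<lambda>z. mdiff B f (u k (chart_inv c z)) (D k (chart_inv c z) (?v (chart_inv c z))))" for k
  proof -
    have "weak_derivative A (f \<circ> u k) (\<lambda>x. mdiff B f (u k x) o\<^sub>L D k x)"
      using D[of k] f unfolding is_colocal_weak_derivative_def by blast
    then show ?thesis using c unfolding M.weak_derivative_iff by simp
  qed
  have "weak_dderiv (chart_image c) v (\<lambda>z. f (Y (chart_inv c z)))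
      (\<lambda>z. mdiff B f (Y (chart_inv c z)) (\<Xi> (chart_inv c z) (?v (chart_inv c z))))"
  proof (rule weak_dderiv_limit[OF wd loc_integrable_const[of _ C0] loc_integrable_cont_mult[OF cont F[OF c]]])
    have l: "AE z in lebesgue. z \<in> chart_image c \<longrightarrow> limitin bundle_topology (\<lambda>k. (chart_inv c z, u k (chart_inv c z), D k (chart_inv c z)))
        (chart_inv c z, Y (chart_inv c z), \<Xi> (chart_inv c z)) sequentially"
      using lim c unfolding M.chart_AE_def by blast
    show "AE z in lebesgue. z \<in> chart_image c \<longrightarrow> (\<lambda>k. f (u k (chart_inv c z))) \<longlonglongrightarrow> f (Y (chart_inv c z))"
      using l
    proof (eventually_elim, intro impI)
      fix z assume 1: "z \<in> chart_image c \<longrightarrow> limitin bundle_topology (\<lambda>k. (chart_inv c z, u k (chart_inv c z), D k (chart_inv c z)))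
        (chart_inv c z, Y (chart_inv c z), \<Xi> (chart_inv c z)) sequentially" and 2: "z \<in> chart_image c"
      from limitin_bundle_base[OF mp[OF 1 2]] show "(\<lambda>k. f (u k (chart_inv c z))) \<longlonglongrightarrow> f (Y (chart_inv c z))"
        by (rule continuous_on_tendsto_compose[OF N.C1c_continuous[OF f]]) auto
    qed
    show "AE z in lebesgue. z \<in> chart_image c \<longrightarrow> (\<lambda>k. mdiff B f (u k (chart_inv c z)) (D k (chart_inv c z) (?v (chart_inv c z))))
        \<longlonglongrightarrow> mdiff B f (Y (chart_inv c z)) (\<Xi> (chart_inv c z) (?v (chart_inv c z)))"
      using l by eventually_elim (intro impI limitin_bundle_fibre[OF _ f], blast)
    show "AE z in lebesgue. z \<in> chart_image c \<longrightarrow> norm (f (u k (chart_inv c z))) \<le> C0" for k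
      by (intro AE_I2 impI) (simp only: real_norm_def C0)
    have "AE z in lebesgue. z \<in> chart_image c \<longrightarrow> (\<forall>k. hom_norm gM gN (chart_inv c z, u k (chart_inv c z), D k (chart_inv c z)) \<le> F (chart_inv c z))"
      using le c unfolding M.chart_AE_def by blast
    then show "AE z in lebesgue. z \<in> chart_image c \<longrightarrow> norm (mdiff B f (u k (chart_inv c z)) (D k (chart_inv c z) (?v (chart_inv c z))))
        \<le> ?\<phi> (chart_inv c z) * F (chart_inv c z)" for k
    proof (eventually_elim, intro impI)
      fix z assume "z \<in> chart_image c \<longrightarrow> (\<forall>k. hom_norm gM gN (chart_inv c z, u k (chart_inv c z), D k (chart_inv c z)) \<le> F (chart_inv c z))" "z \<in> chart_image c"
      then have F: "hom_norm gM gN (chart_inv c z, u k (chart_inv c z), D k (chart_inv c z)) \<le> F (chart_inv c z)" by blast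
      interpret m: scalar_product "gM (chart_inv c z)" by (rule M.scalar_product)
      have lin: "linear (blinfun_apply (mdiff B f (u k (chart_inv c z))))" by (rule bounded_linear.linear[OF blinfun.bounded_linear_right])
      have "norm (mdiff B f (u k (chart_inv c z)) (D k (chart_inv c z) (?v (chart_inv c z)))) \<le>
          ?\<phi> (chart_inv c z) * hom_norm gM gN (chart_inv c z, u k (chart_inv c z), D k (chart_inv c z))"
        by (rule hom_norm_apply_le[OF lin C(1)]) (simp only: real_norm_def C(2))
      also have "\<dots> \<le> ?\<phi> (chart_inv c z) * F (chart_inv c z)"
        by (rule mult_left_mono[OF F]) (intro mult_nonneg_nonneg C(1) of_nat_0_le_iff real_sqrt_ge_zero m.h_nonneg)
      finally show "norm (mdiff B f (u k (chart_inv c z)) (D k (chart_inv c z) (?v (chart_inv c z))))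
        \<le> ?\<phi> (chart_inv c z) * F (chart_inv c z)" .
    qed
  qed
  then show "weak_dderiv (chart_image c) v (\<lambda>z. (f \<circ> Y) (chart_inv c z))
      (\<lambda>z. (mdiff B f (Y (chart_inv c z)) o\<^sub>L \<Xi> (chart_inv c z)) (?v (chart_inv c z)))" by simp
qed

text \<open>The limit is taken first as a bare measurable section of the bundle; afterwards its
  fibre component is recognised as the weak derivative of its base component.\<close>

lemma sobolev_fast_limit:
  fixes u :: "nat \<Rightarrow> 'a \<Rightarrow> 'b"
  assumes p: "1 \<le> p" and compl: "M.chart_AE (\<lambda>x. Metric_space.mcomplete (range (\<lambda>y. (x, y, 0))) d)"
    and u: "\<And>k. u k \<in> sobolev_maps A gM B gN p"
    and fast: "\<And>k. (\<integral>\<^sup>+x. ennreal (d (weak_tangent A B (u k) x) (weak_tangent A B (u (Suc k)) x) powr p) \<partial>riemannian_measure A gM)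
      < ennreal (((1/4) ^ Suc k) powr p)"
  obtains v where "v \<in> sobolev_maps A gM B gN p"
    "M.chart_AE (\<lambda>x. limitin bundle_topology (\<lambda>k. weak_tangent A B (u k) x) (weak_tangent A B v x) sequentially)"
proof -
  let ?\<mu> = "riemannian_measure A gM"
  define e where "e k = weak_tangent A B (u k)" for k
  define D where "D k = colocal_weak_derivative A B (u k)" for k
  have e_eq: "e k x = (x, u k x, D k x)" for k x by (simp add: e_def D_def weak_tangent_def)
  have cwd: "colocally_weakly_differentiable A B (u k)" for k using u[of k] unfolding sobolev_maps_def by blast
  have D: "is_colocal_weak_derivative A B (u k) (D k)" for k unfolding D_def by (rule colocal_weak_derivative_works[OF cwd])
  have em: "e k \<in> measurable (manifold_sigma A) bundle_borel" for k unfolding e_def by (rule measurable_weak_tangent[OF cwd])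
  have dm: "(\<lambda>x. d (e k x) (e (Suc k) x)) \<in> borel_measurable ?\<mu>" for k
    unfolding M.measurable_riemannian_measure by (rule measurable_dist[OF em em])
  obtain h where h: "h \<in> borel_measurable ?\<mu>" "\<And>x. 0 \<le> h x" "(\<integral>\<^sup>+x. ennreal (h x) \<partial>?\<mu>) < \<infinity>"
    and h_le: "AE x in ?\<mu>. \<forall>k. d (e k x) (e (Suc k) x) \<le> h x powr (1 / p) * (1/2) ^ Suc k"
    by (rule summable_rescaled_powers[where p=p and \<delta>="\<lambda>k x. d (e k x) (e (Suc k) x)", OF p dm E.nonneg fast[folded e_def]]) blast
  define R where "R x = h x powr (1 / p)" for x
  have R0: "0 \<le> R x" for x by (simp add: R_def)
  have Rp: "R x powr p = h x" for x using p h(2)[of x] by (simp add: R_def powr_powr)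
  define good where "good x \<longleftrightarrow> (\<forall>k. d (e k x) (e (Suc k) x) \<le> R x * (1/2) ^ Suc k) \<and>
     Metric_space.mcomplete (range (\<lambda>y. (x, y, 0))) d" for x
  have good_AE: "M.chart_AE good"
    using M.chart_AE_conj[OF h_le[unfolded M.AE_riemannian_measure] compl] unfolding good_def R_def .
  have geom: "d (e k x) (e l x) \<le> R x * (1/2) ^ k" if "good x" "k \<le> l" for k l x
    by (rule E.dist_geometric_le) (use that R0 in \<open>auto simp: good_def\<close>)
  have "\<exists>y \<xi>. limitin bundle_topology (\<lambda>k. e k x) (x, y, \<xi>) sequentially" if gx: "good x" for x
    unfolding e_eq
  proof (rule bundle_fibre_complete)
    show "Metric_space.mcomplete (range (\<lambda>y. (x, y, 0))) d" using gx by (simp add: good_def)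
    fix \<epsilon> :: real assume \<epsilon>: "0 < \<epsilon>"
    have "(\<lambda>k. R x * (1/2) ^ k) \<longlonglongrightarrow> R x * 0" by (intro tendsto_mult_left LIMSEQ_power_zero) simp
    then have "\<forall>\<^sub>F k in sequentially. R x * (1/2) ^ k < \<epsilon> / 2" using \<epsilon> by (intro order_tendstoD(2)) auto
    then obtain K where K: "R x * (1/2) ^ K < \<epsilon> / 2" by (auto simp: eventually_sequentially)
    show "\<exists>K. \<forall>k\<ge>K. \<forall>l\<ge>K. d (x, u k x, D k x) (x, u l x, D l x) < \<epsilon>"
      unfolding e_eq[symmetric]
    proof (intro exI[of _ K] allI impI)
      fix k l assume "K \<le> k" "K \<le> l"
      have "d (e k x) (e l x) \<le> d (e k x) (e K x) + d (e K x) (e l x)" by (rule E.triangle) auto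
      then show "d (e k x) (e l x) < \<epsilon>"
        using geom[OF gx \<open>K \<le> k\<close>] geom[OF gx \<open>K \<le> l\<close>] K E.commute[of "e k x" "e K x"] by linarith
    qed
  qed
  \<comment> \<open>Off the good points the limit is given the value of the first section. It is
    then an everywhere limit of sections altered on a null set, which yields its
    measurability.\<close>
  then have "\<forall>x. \<exists>y \<xi>. if good x then limitin bundle_topology (\<lambda>k. e k x) (x, y, \<xi>) sequentially else (y, \<xi>) = (u 0 x, D 0 x)"
    by (intro allI) (case_tac "good x"; simp)
  then obtain Y \<Xi> where Y\<Xi>: "\<And>x. if good x then limitin bundle_topology (\<lambda>k. e k x) (x, Y x, \<Xi> x) sequentially else (Y x, \<Xi> x) = (u 0 x, D 0 x)"
    by metis
  have lim: "limitin bundle_topology (\<lambda>k. e k x) (x, Y x, \<Xi> x) sequentially" if "good x" for x using Y\<Xi>[of x] that by simp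
  have bad: "(x, Y x, \<Xi> x) = e 0 x" if "\<not> good x" for x using Y\<Xi>[of x] that by (simp add: e_eq)
  have Ym: "(\<lambda>x. (x, Y x, \<Xi> x)) \<in> measurable (manifold_sigma A) bundle_borel"
  proof (rule measurable_bundle_limit)
    show "(\<lambda>x. if good x then e k x else e 0 x) \<in> measurable (manifold_sigma A) bundle_borel" for k
      by (rule M.chart_AE_measurable[OF em[of k]], rule M.chart_AE_mono[OF good_AE]) (simp_all add: space_measure_of)
    show "limitin bundle_topology (\<lambda>k. if good x then e k x else e 0 x) (x, Y x, \<Xi> x) sequentially" for x
      using lim[of x] bad[of x] by (cases "good x") (simp_all add: limitin_const)
  qed
  have Yb: "Y \<in> measurable (manifold_sigma A) borel"
  proof (rule borel_measurableI)
    fix V :: "'b set" assume "open V"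
    from measurable_bundleD[OF Ym openin_bundle_base[OF this]]
    show "Y -` V \<inter> space (manifold_sigma A) \<in> sets (manifold_sigma A)" by (simp add: vimage_def)
  qed
  define b where "b x = hom_norm gM gN (e 0 x)" for x
  have b0: "0 \<le> b x" for x by (simp only: b_def hom_norm_nonneg)
  have bI: "(\<integral>\<^sup>+x. ennreal (b x powr p) \<partial>?\<mu>) < \<infinity>" unfolding b_def e_def by (rule nn_integral_sobolev_finite[OF u])
  have hm: "h \<in> borel_measurable (manifold_sigma A)" using h(1) unfolding M.measurable_riemannian_measure .
  have bm: "b \<in> borel_measurable (manifold_sigma A)" unfolding b_def by (rule measurable_bundle_greater[OF em openin_hom_norm_greater])
  then have bpm: "(\<lambda>x. b x powr p) \<in> borel_measurable (manifold_sigma A)" by measurable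
  obtain \<kappa> where \<kappa>: "0 < \<kappa>" "\<And>e e'. hom_norm gM gN e \<le> \<kappa> * (d e e' + hom_norm gM gN e')" by (rule hom_norm_le_dist) blast
  have norm_le: "hom_norm gM gN e' \<le> \<kappa> * (R x + b x)" if "d (e 0 x) e' \<le> R x" for e' x
  proof -
    have "hom_norm gM gN e' \<le> \<kappa> * (d e' (e 0 x) + b x)" unfolding b_def by (rule \<kappa>(2))
    also have "\<dots> \<le> \<kappa> * (R x + b x)" using that \<kappa>(1) by (intro mult_left_mono) (auto simp: E.commute[of e'])
    finally show ?thesis .
  qed
  have lim_le: "d (e 0 x) (x, Y x, \<Xi> x) \<le> R x" if "good x" for x
    by (rule LIMSEQ_le_const2[OF tendsto_dist[OF lim[OF that]]]) (use geom[OF that, of 0] in auto)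
  \<comment> \<open>The norms are at most \<kappa> (R + b), and t \<le> 1 + t^p is used for both
    terms; since R^p = h, the result is locally integrable.\<close>
  define F where "F x = \<kappa> * (2 + h x + b x powr p)" for x
  have YD: "is_colocal_weak_derivative A B Y \<Xi>"
    unfolding is_colocal_weak_derivative_def
  proof (intro conjI ballI Ym)
    fix f assume f: "f \<in> C1c B"
    show "weak_derivative A (f \<circ> Y) (\<lambda>x. mdiff B f (Y x) o\<^sub>L \<Xi> x)"
    proof (rule weak_derivative_dominated_limit[where u=u and D=D and F=F])
      show "M.chart_AE (\<lambda>x. limitin bundle_topology (\<lambda>k. (x, u k x, D k x)) (x, Y x, \<Xi> x) sequentially)"
        using good_AE by (rule M.chart_AE_mono) (use lim in \<open>simp only: e_eq[symmetric]\<close>)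
      show "M.chart_AE (\<lambda>x. \<forall>k. hom_norm gM gN (x, u k x, D k x) \<le> F x)"
        using good_AE
      proof (rule M.chart_AE_mono, intro allI)
        fix x k assume gx: "good x"
        have "hom_norm gM gN (e k x) \<le> \<kappa> * (R x + b x)" by (rule norm_le) (use geom[OF gx, of 0 k] in simp)
        also have "\<dots> \<le> F x"
          using le_one_add_powr[OF R0[of x] p] le_one_add_powr[OF b0[of x] p] \<kappa>(1) unfolding F_def Rp by (intro mult_left_mono) auto
        finally show "hom_norm gM gN (x, u k x, D k x) \<le> F x" unfolding e_eq .
      qed
      fix c assume c: "c \<in> A"
      have "loc_integrable (chart_image c) (\<lambda>z. 2 + h (chart_inv c z) + b (chart_inv c z) powr p)"
        by (intro loc_integrable_add loc_integrable_const M.loc_integrable_chart[OF c hm h(2,3)] M.loc_integrable_chart[OF c bpm _ bI]) simp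
      from loc_integrable_cont_mult[OF continuous_on_const this] show "loc_integrable (chart_image c) (\<lambda>z. F (chart_inv c z))"
        unfolding F_def .
    qed (rule D f)+
  qed
  have Yc: "colocally_weakly_differentiable A B Y"
    unfolding colocally_weakly_differentiable_def weakly_differentiable_def using YD Yb unfolding is_colocal_weak_derivative_def by blast
  have YT: "M.chart_AE (\<lambda>x. weak_tangent A B Y x = (x, Y x, \<Xi> x))"
    by (rule weak_tangent_cong_AE[OF YD Yc]) (simp add: M.chart_AE_def)
  show thesis
  proof (rule that[of Y])
    have gT: "M.chart_AE (\<lambda>x. good x \<and> weak_tangent A B Y x = (x, Y x, \<Xi> x))" by (rule M.chart_AE_conj[OF good_AE YT])
    then show "M.chart_AE (\<lambda>x. limitin bundle_topology (\<lambda>k. weak_tangent A B (u k) x) (weak_tangent A B Y x) sequentially)"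
      by (rule M.chart_AE_mono) (use lim in \<open>simp add: e_def\<close>)
    have "integrable ?\<mu> (\<lambda>x. hom_norm gM gN (weak_tangent A B Y x) powr p)"
    proof (rule Bochner_Integration.integrable_bound)
      have "integrable ?\<mu> h" "integrable ?\<mu> (\<lambda>x. b x powr p)"
        by (rule integrableI_nonneg; use h bI bpm in \<open>simp add: M.measurable_riemannian_measure\<close>)+
      then show "integrable ?\<mu> (\<lambda>x. \<kappa> powr p * 2 powr p * (h x + b x powr p))" by simp
      have "(\<lambda>x. hom_norm gM gN (weak_tangent A B Y x)) \<in> borel_measurable ?\<mu>"
        unfolding M.measurable_riemannian_measure by (rule measurable_bundle_greater[OF measurable_weak_tangent[OF Yc] openin_hom_norm_greater])
      then show "(\<lambda>x. hom_norm gM gN (weak_tangent A B Y x) powr p) \<in> borel_measurable ?\<mu>" by measurable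
      show "AE x in ?\<mu>. norm (hom_norm gM gN (weak_tangent A B Y x) powr p) \<le> norm (\<kappa> powr p * 2 powr p * (h x + b x powr p))"
        unfolding M.AE_riemannian_measure using gT
      proof (rule M.chart_AE_mono, elim conjE)
        fix x assume gx: "good x" and T: "weak_tangent A B Y x = (x, Y x, \<Xi> x)"
        have "hom_norm gM gN (weak_tangent A B Y x) \<le> \<kappa> * (R x + b x)" unfolding T by (rule norm_le[OF lim_le[OF gx]])
        then have "hom_norm gM gN (weak_tangent A B Y x) powr p \<le> (\<kappa> * (R x + b x)) powr p"
          using p by (intro powr_mono2 hom_norm_nonneg) auto
        also have "\<dots> = \<kappa> powr p * (R x + b x) powr p" using \<kappa>(1) R0[of x] b0[of x] by (simp add: powr_mult)
        also have "\<dots> \<le> \<kappa> powr p * (2 powr p * (R x powr p + b x powr p))"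
          using p by (intro mult_left_mono add_powr_le R0 b0) auto
        also have "\<dots> = \<kappa> powr p * 2 powr p * (h x + b x powr p)" unfolding Rp by (simp only: mult.assoc)
        finally show "norm (hom_norm gM gN (weak_tangent A B Y x) powr p) \<le> norm (\<kappa> powr p * 2 powr p * (h x + b x powr p))"
          using h(2)[of x] by (simp only: real_norm_def abs_of_nonneg powr_ge_zero)
      qed
    qed
    then show "Y \<in> sobolev_maps A gM B gN p" using Yc unfolding sobolev_maps_def by blast
  qed
qed

section \<open>Almost everywhere classes and completeness\<close>

lemma sobolev_representative:
  assumes "X \<in> sobolev_space A gM B gN p"
  shows "(SOME u. u \<in> X) \<in> sobolev_maps A gM B gN p"
proof -
  let ?S = "sobolev_maps A gM B gN p"
  obtain a where a: "a \<in> ?S" "X = ae_eq_rel A gM ?S `` {a}"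
    using assms unfolding sobolev_space_def by (elim quotientE)
  then have "a \<in> X" by (simp add: ae_eq_rel_def)
  then have "(SOME u. u \<in> X) \<in> X" by (rule someI[of "\<lambda>u. u \<in> X"])
  moreover have "X \<subseteq> ?S" unfolding a(2) ae_eq_rel_def by blast
  ultimately show ?thesis by (rule rev_subsetD)
qed

text \<open>The distance is evaluated at a representative picked from the class, which may differ
  from v. Uniqueness of the colocal weak derivative makes their tangent maps agree almost
  everywhere.\<close>

lemma sobolev_class:
  assumes v: "v \<in> sobolev_maps A gM B gN p"
  obtains X where "X \<in> sobolev_space A gM B gN p" "M.chart_AE (\<lambda>x. weak_tangent A B (SOME w. w \<in> X) x = weak_tangent A B v x)"
proof -
  let ?S = "sobolev_maps A gM B gN p"
  let ?X = "ae_eq_rel A gM ?S `` {v}"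
  let ?w = "SOME w. w \<in> ?X"
  have "v \<in> ?X" using v by (simp add: ae_eq_rel_def)
  then have "?w \<in> ?X" by (rule someI[of "\<lambda>w. w \<in> ?X"])
  then have w: "?w \<in> ?S" "AE x in riemannian_measure A gM. v x = ?w x" by (auto simp: ae_eq_rel_def)
  have eq: "M.chart_AE (\<lambda>x. ?w x = v x)" using w(2) unfolding M.AE_riemannian_measure by (rule M.chart_AE_mono) simp
  have c: "colocally_weakly_differentiable A B v" "colocally_weakly_differentiable A B ?w" using v w(1) unfolding sobolev_maps_def by blast+
  show thesis
  proof (rule that)
    show "?X \<in> sobolev_space A gM B gN p" unfolding sobolev_space_def by (rule quotientI[OF v])
    show "M.chart_AE (\<lambda>x. weak_tangent A B ?w x = weak_tangent A B v x)"
      using weak_tangent_cong_AE[OF colocal_weak_derivative_works[OF c(1)] c(2) eq] by (simp add: weak_tangent_def)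
  qed
qed

text \<open>Lower semicontinuity of the distance in one argument under almost everywhere
  convergence: d is continuous for the bundle topology, so the integrand equals the lower limit to
  which Fatou's lemma applies.\<close>

lemma nn_integral_dist_limit_le:
  assumes meas: "s \<in> measurable (manifold_sigma A) bundle_borel" "\<And>j::nat. t j \<in> measurable (manifold_sigma A) bundle_borel"
    and lim: "M.chart_AE (\<lambda>x. limitin bundle_topology (\<lambda>j. t j x) (t' x) sequentially)"
    and le: "\<forall>\<^sub>F j in sequentially. (\<integral>\<^sup>+x. ennreal (d (s x) (t j x) powr p) \<partial>riemannian_measure A gM) \<le> C"
    and p: "1 \<le> p"
  shows "(\<integral>\<^sup>+x. ennreal (d (s x) (t' x) powr p) \<partial>riemannian_measure A gM) \<le> C"
proof -
  let ?\<mu> = "riemannian_measure A gM"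
  have "(\<integral>\<^sup>+x. ennreal (d (s x) (t' x) powr p) \<partial>?\<mu>) = (\<integral>\<^sup>+x. liminf (\<lambda>j. ennreal (d (s x) (t j x) powr p)) \<partial>?\<mu>)"
  proof (rule nn_integral_cong_AE, unfold M.AE_riemannian_measure, rule M.chart_AE_mono[OF lim])
    fix x assume "limitin bundle_topology (\<lambda>j. t j x) (t' x) sequentially"
    then have "(\<lambda>j. d (s x) (t j x)) \<longlonglongrightarrow> d (s x) (t' x)" by (rule tendsto_dist)
    then have "(\<lambda>j. ennreal (d (s x) (t j x) powr p)) \<longlonglongrightarrow> ennreal (d (s x) (t' x) powr p)"
      using p by (intro tendsto_ennrealI tendsto_powr' tendsto_const) auto
    from lim_imp_Liminf[OF _ this] show "ennreal (d (s x) (t' x) powr p) = liminf (\<lambda>j. ennreal (d (s x) (t j x) powr p))" by simp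
  qed
  also have "\<dots> \<le> liminf (\<lambda>j. \<integral>\<^sup>+x. ennreal (d (s x) (t j x) powr p) \<partial>?\<mu>)"
  proof (rule nn_integral_liminf)
    fix j
    have "(\<lambda>x. d (s x) (t j x)) \<in> borel_measurable ?\<mu>"
      unfolding M.measurable_riemannian_measure by (rule measurable_dist[OF meas])
    then show "(\<lambda>x. ennreal (d (s x) (t j x) powr p)) \<in> borel_measurable ?\<mu>" by measurable
  qed
  also have "\<dots> \<le> limsup (\<lambda>j. \<integral>\<^sup>+x. ennreal (d (s x) (t j x) powr p) \<partial>?\<mu>)" by (rule Liminf_le_Limsup) simp
  also have "\<dots> \<le> C" by (rule Limsup_bounded[OF le])
  finally show ?thesis .
qed

theorem complete_sobolev_space:
  assumes p: "1 \<le> p" and compl: "M.chart_AE (\<lambda>x. Metric_space.mcomplete (range (\<lambda>y. (x, y, 0))) d)"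
  shows "complete_extended (sobolev_space A gM B gN p) (sobolev_dist A gM B p d)"
  unfolding complete_extended_def
proof (intro allI impI, elim conjE)
  fix \<sigma> :: "nat \<Rightarrow> ('a \<Rightarrow> 'b) set"
  assume \<sigma>: "\<forall>k. \<sigma> k \<in> sobolev_space A gM B gN p"
    and Cauchy: "\<forall>\<epsilon>>0. \<exists>K. \<forall>k\<ge>K. \<forall>l\<ge>K. sobolev_dist A gM B p d (\<sigma> k) (\<sigma> l) < \<epsilon>"
  define u where "u k = (SOME u. u \<in> \<sigma> k)" for k
  define I where "I u v = (\<integral>\<^sup>+x. ennreal (d (weak_tangent A B u x) (weak_tangent A B v x) powr p) \<partial>riemannian_measure A gM)" for u v
  have u: "u k \<in> sobolev_maps A gM B gN p" for k unfolding u_def by (rule sobolev_representative) (use \<sigma> in blast)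
  have um: "weak_tangent A B (u k) \<in> measurable (manifold_sigma A) bundle_borel" for k
    by (rule measurable_weak_tangent) (use u[of k] in \<open>unfold sobolev_maps_def, blast\<close>)
  have Cauchy': "\<exists>K. \<forall>k\<ge>K. \<forall>l\<ge>K. I (u k) (u l) < ennreal (\<epsilon> powr p)" if "0 < \<epsilon>" for \<epsilon>
  proof -
    have "0 < ennreal \<epsilon>" using that by simp
    then obtain K where "\<forall>k\<ge>K. \<forall>l\<ge>K. sobolev_dist A gM B p d (\<sigma> k) (\<sigma> l) < ennreal \<epsilon>" using Cauchy by blast
    then show ?thesis
      unfolding sobolev_dist_def Let_def u_def[symmetric] I_def[symmetric] ennreal_root_less_iff[OF p that] by blast
  qed
  have "\<exists>K. \<forall>k\<ge>K. \<forall>l\<ge>K. I (u k) (u l) < ennreal (((1/4) ^ Suc j) powr p)" for j by (rule Cauchy') simp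
  then obtain K where K: "\<And>j k l. K j \<le> k \<Longrightarrow> K j \<le> l \<Longrightarrow> I (u k) (u l) < ennreal (((1/4) ^ Suc j) powr p)" by metis
  \<comment> \<open>The sum makes the indices monotone and at least \<open>K j\<close>; adding
    \<open>j\<close> makes them unbounded.\<close>
  define n where "n j = (\<Sum>i\<le>j. K i) + j" for j
  have n: "K j \<le> n j" "j \<le> n j" "n j \<le> n (Suc j)" for j
    using member_le_sum[of j "{..j}" K] by (auto simp: n_def)
  have "I (u (n k)) (u (n (Suc k))) < ennreal (((1/4) ^ Suc k) powr p)" for k
    by (rule K[OF n(1) order_trans[OF n(1) n(3)]])
  from sobolev_fast_limit[where u="\<lambda>k. u (n k)", OF p compl u this[unfolded I_def]] obtain v where v: "v \<in> sobolev_maps A gM B gN p"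
    and lim: "M.chart_AE (\<lambda>x. limitin bundle_topology (\<lambda>k. weak_tangent A B (u (n k)) x) (weak_tangent A B v x) sequentially)" by blast
  obtain X where X: "X \<in> sobolev_space A gM B gN p" "M.chart_AE (\<lambda>x. weak_tangent A B (SOME w. w \<in> X) x = weak_tangent A B v x)"
    by (rule sobolev_class[OF v])
  define w where "w = (SOME w. w \<in> X)"
  have limw: "M.chart_AE (\<lambda>x. limitin bundle_topology (\<lambda>k. weak_tangent A B (u (n k)) x) (weak_tangent A B w x) sequentially)"
    using M.chart_AE_conj[OF lim X(2)[folded w_def]] by (rule M.chart_AE_mono) (elim conjE, simp only:)
  have "(\<lambda>k. sobolev_dist A gM B p d (\<sigma> k) X) \<longlonglongrightarrow> 0"
  proof (rule tendsto_0_ennrealI)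
    fix \<epsilon> :: real assume \<epsilon>: "0 < \<epsilon>"
    \<comment> \<open>The limit preserves only a weak inequality, hence half of \<epsilon>.\<close>
    obtain K where K: "\<And>k l. K \<le> k \<Longrightarrow> K \<le> l \<Longrightarrow> I (u k) (u l) < ennreal ((\<epsilon> / 2) powr p)" using Cauchy'[OF half_gt_zero[OF \<epsilon>]] by blast
    have "sobolev_dist A gM B p d (\<sigma> k) X < ennreal \<epsilon>" if "K \<le> k" for k
    proof -
      have "\<forall>\<^sub>F j in sequentially. I (u k) (u (n j)) \<le> ennreal ((\<epsilon> / 2) powr p)"
        using eventually_ge_at_top[of K] by eventually_elim (rule less_imp_le[OF K[OF that order_trans[OF _ n(2)]]])
      then have "I (u k) w \<le> ennreal ((\<epsilon> / 2) powr p)" unfolding I_def by (rule nn_integral_dist_limit_le[OF um um limw _ p])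
      also have "\<dots> < ennreal (\<epsilon> powr p)" using \<epsilon> p by (intro ennreal_lessI powr_less_mono2) auto
      finally have "ennreal_root p (I (u k) w) < ennreal \<epsilon>" unfolding ennreal_root_less_iff[OF p \<epsilon>] .
      then show ?thesis unfolding sobolev_dist_def Let_def u_def[symmetric] w_def[symmetric] I_def[symmetric] .
    qed
    then show "\<forall>\<^sub>F k in sequentially. sobolev_dist A gM B p d (\<sigma> k) X < ennreal \<epsilon>" unfolding eventually_sequentially by blast
  qed
  then show "\<exists>s\<in>sobolev_space A gM B gN p. (\<lambda>k. sobolev_dist A gM B p d (\<sigma> k) s) \<longlonglongrightarrow> 0" using X(1) by blast
qed

end

theorem proposition4p20:
  fixes A :: "('a::{t2_space,second_countable_topology}, 'm::finite) mchart set"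
    and gM :: "('a, 'm) mmetric"
    and B :: "('b::{t2_space,second_countable_topology}, 'n::finite) mchart set"
    and gN :: "('b, 'n) mmetric"
    and p :: real
    and d :: "('a, 'm, 'b, 'n) hom_bundle \<Rightarrow> ('a, 'm, 'b, 'n) hom_bundle \<Rightarrow> real"
  assumes "riemannian_manifold A gM"
    and "riemannian_manifold B gN"
    and "1 \<le> p"
    and "Metric_space UNIV d"
    and "AE x in riemannian_measure A gM. Metric_space.mcomplete (range (\<lambda>y. (x, y, 0))) d"
    and "concordant A gM B gN d"
  shows "complete_extended (sobolev_space A gM B gN p) (sobolev_dist A gM B p d)"
proof -
  interpret M: riemannian A gM using assms(1) by unfold_locales (auto simp: riemannian_manifold_def)
  interpret N: riemannian B gN using assms(2) by unfold_locales (auto simp: riemannian_manifold_def)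
  interpret concordant_distance A gM B gN d 
    by (intro concordant_distance.intro concordant_distance_axioms.intro riemannian_pair.intro assms M.riemannian_axioms N.riemannian_axioms)
  show ?thesis using complete_sobolev_space[OF assms(3)] assms(5) unfolding M.AE_riemannian_measure by blast
qed

end
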